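(* Let $\mathcal T_n$ be a conditioned Galton--Watson tree of order $n$ with offspring distribution $\xi$, where $\mathbb E\xi=1$ and $0<\sigma^2:=\operatorname{Var}\xi<\infty$, and let $\mathcal T$ be the corresponding unconditioned Galton--Watson tree. Suppose that $f:\mathfrak T\to\mathbb R$ is a bounded and local functional, and let $\mu:=\mathbb E f(\mathcal T)$. Then, for some finite $\gamma^2\ge0$, as $n\to\infty$, $$\mathbb E F(\mathcal T_n)=n\mu+o(\sqrt n),\qquad \operatorname{Var}F(\mathcal T_n)=n\gamma^2+o(n),\qquad \frac{F(\mathcal T_n)-n\mu}{\sqrt n}\overset{d}{\longrightarrow}N(0,\gamma^2).$$ More generally, the same holds if $f$ is a bounded and weakly local functional such that $\mathbb E f(\mathcal T_n)\to0$ as $n\to\infty$ and $\sum_n|\mathbb E f(\mathcal T_n)|/n<\infty$.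
   Context: All trees are finite, rooted and ordered (plane). $\mathfrak T$ is the countable set of all such trees (up to isomorphism preserving the root and the orderings of children), and $|T|$ is the number of nodes of $T$. For a node $v$ of $T$, $T_v$ denotes the fringe subtree of $T$ consisting of $v$ and all its descendants. For a functional $f:\mathfrak T\to\mathbb R$, define $F(T):=\sum_{v\in T}f(T_v)$. For an integer $M$, $T^{(M)}$ denotes $T$ truncated at height $M$ (only nodes at depth at most $M$ are kept, where the depth of a node is its distance to the root). A functional $f$ is local (with cut-off $M$) if $f(T)=f(T^{(M)})$ for all $T$, for some $M<\infty$; it is weakly local (with cut-off $M$) if $f(T)$ depends only on $|T|$ and $T^{(M)}$, for some $M<\infty$. Given a nonnegative integer-valued random variable $\xi$, the Galton--Watson tree $\mathcal T$ with offspring distribution $\xi$ is the random tree obtained by starting with a root and giving each node a number of children that is an independent copy of $\xi$ (here a.s. finite). The conditioned Galton--Watson tree $\mathcal T_n$ is $\mathcal T$ conditioned on $|\mathcal T|=n$; only $n$ with $\mathbb P(|\mathcal T|=n)>0$ are considered, so limits as $n\to\infty$ and sums over $n$ are restricted to such $n$. $N(0,0)$ is the point mass at $0$. *)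

theory Defs
  imports "HOL-Probability.Probability"
begin

section \<open>Plane trees\<close>

datatype ptree = Node (children: "ptree list")

instance ptree :: countable
  by countable_datatype

text \<open>
  Nodes are addressed by Ulam--Harris words: the root is \<open>[]\<close>, and \<open>i # v\<close> is the node \<open>v\<close> of
  the \<open>i\<close>-th subtree of the root.  Hence the depth of a node is the length of its address, and
  appending \<open>[i]\<close> to the address of a node gives its \<open>i\<close>-th child.
\<close>

primrec is_node :: "ptree \<Rightarrow> nat list \<Rightarrow> bool" where
  "is_node T [] \<longleftrightarrow> True"
| "is_node T (i # v) \<longleftrightarrow> i < length (children T) \<and> is_node (children T ! i) v"

definition nodes :: "ptree \<Rightarrow> nat list set" where
  "nodes T = {v. is_node T v}"

definition tree_order :: "ptree \<Rightarrow> nat" where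
  "tree_order T = card (nodes T)"

text \<open>The fringe subtree \<open>T\<^sub>v\<close>; meaningful only for \<open>v \<in> nodes T\<close>.\<close>

primrec fringe :: "ptree \<Rightarrow> nat list \<Rightarrow> ptree" where
  "fringe T [] = T"
| "fringe T (i # v) = fringe (children T ! i) v"

definition outdeg :: "ptree \<Rightarrow> nat list \<Rightarrow> nat" where
  "outdeg T v = length (children (fringe T v))"

primrec truncate :: "nat \<Rightarrow> ptree \<Rightarrow> ptree" where
  "truncate 0 T = Node []"
| "truncate (Suc M) T = Node (map (truncate M) (children T))"

lemma nodes_Node: "nodes (Node ts) = insert [] (\<Union>i<length ts. (#) i ` nodes (ts ! i))"
proof (rule set_eqI)
  fix v show "v \<in> nodes (Node ts) \<longleftrightarrow> v \<in> insert [] (\<Union>i<length ts. (#) i ` nodes (ts ! i))"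
    by (cases v) (auto simp: nodes_def)
qed

lemma finite_nodes [simp, intro]: "finite (nodes T)"
  by (induction T) (auto simp: nodes_Node)

lemma Nil_in_nodes [simp, intro]: "[] \<in> nodes T"
  by (simp add: nodes_def)

lemma tree_order_pos: "tree_order T > 0"
  unfolding tree_order_def by (subst card_gt_0_iff) auto

lemma nodes_truncate: "nodes (truncate M T) = {v \<in> nodes T. length v \<le> M}"
proof -
  have "is_node (truncate M T) v \<longleftrightarrow> is_node T v \<and> length v \<le> M" for v
  proof (induction M arbitrary: T v)
    case 0 show ?case by (cases v) auto
  next
    case (Suc M) show ?case by (cases v) (auto simp: Suc)
  qed
  thus ?thesis by (auto simp: nodes_def)
qed

section \<open>Functionals of plane trees\<close>

definition additive_functional :: "(ptree \<Rightarrow> real) \<Rightarrow> ptree \<Rightarrow> real" where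
  "additive_functional f T = (\<Sum>v\<in>nodes T. f (fringe T v))"

definition local_functional :: "(ptree \<Rightarrow> real) \<Rightarrow> bool" where
  "local_functional f \<longleftrightarrow> (\<exists>M. \<forall>T. f T = f (truncate M T))"

definition weakly_local_functional :: "(ptree \<Rightarrow> real) \<Rightarrow> bool" where
  "weakly_local_functional f \<longleftrightarrow>
     (\<exists>M. \<forall>T T'. tree_order T = tree_order T' \<and> truncate M T = truncate M T' \<longrightarrow> f T = f T')"

section \<open>Galton--Watson trees\<close>

text \<open>
  \<open>c v\<close> is the number of children prescribed for the (potential) node \<open>v\<close>.  At most one finite tree
  is compatible with \<open>c\<close>.
\<close>

definition has_offspring :: "ptree \<Rightarrow> (nat list \<Rightarrow> nat) \<Rightarrow> bool" where
  "has_offspring T c \<longleftrightarrow> (\<forall>v\<in>nodes T. outdeg T v = c v)"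

lemma has_offspring_unique:
  assumes "has_offspring T c" "has_offspring T' c"
  shows "T = T'"
  using assms
proof (induction T arbitrary: T' c)
  case (Node ts)
  obtain us where T': "T' = Node us" by (cases T')
  have c: "length ts = c []"
    using bspec[OF Node.prems(1)[unfolded has_offspring_def] Nil_in_nodes] by (simp add: outdeg_def)
  have c': "length us = c []"
    using bspec[OF Node.prems(2)[unfolded has_offspring_def] Nil_in_nodes]
    by (simp add: outdeg_def T')
  have sub: "has_offspring (xs ! i) (\<lambda>v. c (i # v))"
    if "has_offspring (Node xs) c" "i < length xs" for xs i
    using that by (auto simp: has_offspring_def nodes_Node outdeg_def)
  have "ts = us"
  proof (rule nth_equalityI)
    show "length ts = length us" using c c' by simp
    fix i assume i: "i < length ts"
    hence "i < length us" using c c' by simp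
    from sub[OF Node.prems(2)[unfolded T'] this] show "ts ! i = us ! i"
      by (rule Node.IH[OF nth_mem[OF i] sub[OF Node.prems(1) i]])
  qed
  thus ?case by (simp add: T')
qed

text \<open>
  If the process prescribed by \<open>c\<close> does not die out, no finite tree is compatible with \<open>c\<close> and the
  value of \<open>tree_of\<close> is a fixed unspecified tree; for a critical offspring distribution with positive
  variance this is a null event.
\<close>

definition tree_of :: "(nat list \<Rightarrow> nat) \<Rightarrow> ptree" where
  "tree_of c = (THE T. has_offspring T c)"

lemma tree_of_eq: "has_offspring T c \<Longrightarrow> tree_of c = T"
  unfolding tree_of_def by (blast intro: has_offspring_unique)

text \<open>The law of the Galton--Watson tree whose offspring variable has distribution \<open>\<xi>\<close>.\<close>

definition GW :: "nat pmf \<Rightarrow> ptree measure" where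
  "GW \<xi> = distr (\<Pi>\<^sub>M v\<in>(UNIV :: nat list set). measure_pmf \<xi>) (count_space UNIV) tree_of"

lemma measurable_tree_of:
  "tree_of \<in> measurable (\<Pi>\<^sub>M v\<in>(UNIV :: nat list set). measure_pmf \<xi>) (count_space UNIV)"
proof -
  let ?P = "\<Pi>\<^sub>M v\<in>(UNIV :: nat list set). measure_pmf \<xi>"
  have comp: "(\<lambda>c. c v) \<in> measurable ?P (count_space UNIV)" for v
    using measurable_component_singleton[of v UNIV "\<lambda>_. measure_pmf \<xi>"]
    by (simp cong: measurable_cong_sets)
  have off: "{c \<in> space ?P. has_offspring T c} \<in> sets ?P" for T
    unfolding has_offspring_def
  proof (rule sets.sets_Collect_finite_All[OF _ finite_nodes])
    fix v
    have "(\<lambda>c. c v) -` {outdeg T v} \<inter> space ?P \<in> sets ?P"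
      by (rule measurable_sets[OF comp]) simp
    also have "(\<lambda>c. c v) -` {outdeg T v} \<inter> space ?P = {c \<in> space ?P. outdeg T v = c v}"
      by auto
    finally show "{c \<in> space ?P. outdeg T v = c v} \<in> sets ?P" .
  qed
  define junk where "junk = (THE T :: ptree. False)"
  have val: "tree_of c = junk" if "\<nexists>T. has_offspring T c" for c
    using that by (simp add: tree_of_def junk_def)
  have "tree_of -` {T} \<inter> space ?P \<in> sets ?P" for T
  proof -
    have "tree_of -` {T} \<inter> space ?P = {c \<in> space ?P. has_offspring T c} \<union>
            (if T = junk then space ?P - (\<Union>T. {c \<in> space ?P. has_offspring T c}) else {})"
      using val tree_of_eq by auto
    also have "\<dots> \<in> sets ?P"
      using off by auto
    finally show ?thesis .
  qed
  thus ?thesis by (intro measurable_count_space_eq2_countable[THEN iffD2]) auto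
qed

lemma prob_space_GW: "prob_space (GW \<xi>)"
proof -
  interpret P: prob_space "\<Pi>\<^sub>M v\<in>(UNIV :: nat list set). measure_pmf \<xi>"
    by (intro prob_space_PiM measure_pmf.prob_space_axioms)
  show ?thesis unfolding GW_def by (rule P.prob_space_distr[OF measurable_tree_of])
qed

text \<open>The orders \<open>n\<close> for which the conditioned Galton--Watson tree exists, and the filter of the
  limit \<open>n \<rightarrow> \<infinity>\<close> along these orders.\<close>

definition admissible :: "nat pmf \<Rightarrow> nat set" where
  "admissible \<xi> = {n. measure (GW \<xi>) {T. tree_order T = n} > 0}"

definition adm_seq :: "nat pmf \<Rightarrow> nat filter" where
  "adm_seq \<xi> = inf sequentially (principal (admissible \<xi>))"

text \<open>The law of the Galton--Watson tree conditioned on having order \<open>n\<close>; meaningful only for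
  \<open>n \<in> admissible \<xi>\<close>.\<close>

definition cond_GW :: "nat pmf \<Rightarrow> nat \<Rightarrow> ptree measure" where
  "cond_GW \<xi> n = uniform_measure (GW \<xi>) {T. tree_order T = n}"

lemma prob_space_cond_GW:
  assumes "n \<in> admissible \<xi>"
  shows "prob_space (cond_GW \<xi> n)"
proof -
  interpret G: prob_space "GW \<xi>" by (rule prob_space_GW)
  show ?thesis
    using assms unfolding cond_GW_def admissible_def
    by (intro prob_space_uniform_measure) (auto simp: G.emeasure_eq_measure)
qed

section \<open>Convergence in distribution\<close>

text \<open>\<open>weak_conv_m\<close> with an arbitrary filter in place of \<open>sequentially\<close>.\<close>

definition weak_conv_m_along :: "nat filter \<Rightarrow> (nat \<Rightarrow> real measure) \<Rightarrow> real measure \<Rightarrow> bool" where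
  "weak_conv_m_along F \<mu>s \<mu> \<longleftrightarrow>
     (\<forall>x. isCont (cdf \<mu>) x \<longrightarrow> ((\<lambda>n. cdf (\<mu>s n) x) \<longlongrightarrow> cdf \<mu> x) F)"

lemma weak_conv_m_along_sequentially: "weak_conv_m_along sequentially = weak_conv_m"
  by (simp add: fun_eq_iff weak_conv_m_along_def weak_conv_m_def weak_conv_def)

text \<open>The second parameter is the variance.\<close>

definition normal_law :: "real \<Rightarrow> real \<Rightarrow> real measure" where
  "normal_law m v =
     (if v = 0 then return borel m else density lborel (\<lambda>x. ennreal (normal_density m (sqrt v) x)))"

end

theory Submission
  imports Defs "HOL-Computational_Algebra.Formal_Power_Series" "HOL-Real_Asymp.Real_Asymp"
begin

text \<open>
  The functional is reduced to a limit theorem for independent outdegrees. Subtracting \<open>\<mu>\<close> times a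
  centred functional \<open>\<omega>\<close> of the outdegree, which is uncorrelated with the outdegree, leaves a functional
  \<open>f'\<close> with \<open>E f'(T) = 0\<close>. It is split into a part \<open>f\<^sub>K\<close> on trees of order at most \<open>K\<close> and a part
  \<open>g\<^sub>K\<close> on larger trees, both corrected on the one-node tree so as to have mean zero. In depth-first
  order, \<open>f\<^sub>K\<close> depends only on the next \<open>K\<close> outdegrees; by the cycle lemma the conditioned tree
  is a cyclic word of \<open>n\<close> independent outdegrees with sum \<open>n - 1\<close>, and Fourier inversion gives the
  first two moments and the characteristic function of sums of such a window functional. Generating
  functions of the trees together with bounds on \<open>P(S\<^sub>n = m)\<close> show that the sum of \<open>g\<^sub>K\<close> has second
  moment at most \<open>\<epsilon>\<^sub>K n\<close> with \<open>\<epsilon>\<^sub>K \<rightarrow> 0\<close>, so the limits carry over to the functional itself. A bounded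
  local functional is weakly local after subtraction of a constant \<open>L\<close> with
  \<open>E f(T\<^sub>n) - L = O(1 / sqrt n)\<close>.
\<close>

section \<open>Trees, codes and weights\<close>

text \<open>Conditioning on the order fixes the sum of the letters, and this correlates all windows
  of the cyclic word, however far apart. A pair of disjoint windows contributes through the square
  of a twisted mean \<open>ghat\<close>; the order of n^2 such pairs is negligible once
  \<open>ghat\<close> is o(t) at 0, that is, once the window functional has mean zero and is
  uncorrelated with the letter sum. For a functional of trees the second property follows from the
  first: a code of length k has letter sum k - 1, so the correlation is minus the mean. Only the
  centring by n \<mu> lacks this property; this is why it is traded for leaves and
  \<open>\<omega>\<close>. For large trees absolute bounds would lose too much, because the kernel
  P(S_n = n) decays only like n^(-1/2). Mean zero is used through increments of this kernel, of
  order n^(-3/2). On a lattice of span above 1 the probabilities themselves jump to 0, so the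
  increments are taken of the Fourier integral that agrees with them on the lattice.\<close>

lemma sum_nodes_Node:
  fixes h :: "nat list \<Rightarrow> 'b :: comm_monoid_add"
  shows "(\<Sum>v\<in>nodes (Node ts). h v) = h [] + (\<Sum>i<length ts. \<Sum>v\<in>nodes (ts ! i). h (i # v))"
proof -
  have "(\<Sum>v\<in>nodes (Node ts). h v) = h [] + (\<Sum>v\<in>(\<Union>i<length ts. (#) i ` nodes (ts ! i)). h v)"
    unfolding nodes_Node by (subst sum.insert) auto
  also have "(\<Sum>v\<in>(\<Union>i<length ts. (#) i ` nodes (ts ! i)). h v)
      = (\<Sum>i<length ts. \<Sum>v\<in>(#) i ` nodes (ts ! i). h v)"
    by (rule sum.UNION_disjoint) auto
  also have "\<dots> = (\<Sum>i<length ts. \<Sum>v\<in>nodes (ts ! i). h (i # v))"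
    by (rule sum.cong[OF refl]) (simp add: sum.reindex)
  finally show ?thesis .
qed

lemma sum_list_map_nth: "(\<Sum>t\<leftarrow>ts. h t) = (\<Sum>i<length ts. h (ts ! i))"
  by (simp add: sum_list_sum_nth atLeast0LessThan)

lemma tree_order_Node: "tree_order (Node ts) = Suc (\<Sum>t\<leftarrow>ts. tree_order t)"
  using sum_nodes_Node[of "\<lambda>_. 1::nat" ts] by (simp add: tree_order_def sum_list_map_nth)

lemma additive_functional_Node:
  "additive_functional f (Node ts) = f (Node ts) + (\<Sum>t\<leftarrow>ts. additive_functional f t)"
  unfolding additive_functional_def sum_nodes_Node by (simp add: sum_list_map_nth)

text \<open>The preorder word of outdegrees (Lukasiewicz word). With 1 subtracted from each letter
  it is the step sequence of a walk that first hits -1 at its last step.\<close>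

primrec code :: "ptree \<Rightarrow> nat list" where
  "code (Node ts) = length ts # concat (map code ts)"

text \<open>The sum of \<open>\<phi>\<close> over the fringe subtrees rooted at depth
  \<open>M\<close>. Apart from the total order, a functional with cut-off \<open>M\<close> does not
  see the inside of these subtrees, so sums over the nodes are cut at this level.\<close>

primrec level_sum :: "nat \<Rightarrow> (ptree \<Rightarrow> real) \<Rightarrow> ptree \<Rightarrow> real" where
  "level_sum 0 \<phi> T = \<phi> T"
| "level_sum (Suc M) \<phi> T = (\<Sum>t\<leftarrow>children T. level_sum M \<phi> t)"

lemma level_sum_add: "level_sum M (\<lambda>T. \<phi> T + \<psi> T) T = level_sum M \<phi> T + level_sum M \<psi> T"
  by (induction M arbitrary: T) (simp_all add: sum_list_addf)

lemma level_sum_Suc: "level_sum (Suc M) \<phi> T = level_sum M (level_sum 1 \<phi>) T"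
  by (induction M arbitrary: T) simp_all

lemma level_sum_bound:
  assumes "\<And>T. \<bar>\<phi> T\<bar> \<le> B * \<psi> T"
  shows "\<bar>level_sum M \<phi> T\<bar> \<le> B * level_sum M \<psi> T"
proof (induction M arbitrary: T)
  case (Suc M)
  have "\<bar>\<Sum>t\<leftarrow>children T. level_sum M \<phi> t\<bar> \<le> (\<Sum>t\<leftarrow>children T. \<bar>level_sum M \<phi> t\<bar>)"
    by (simp add: sum_list_map_nth sum_abs)
  also have "\<dots> \<le> (\<Sum>t\<leftarrow>children T. B * level_sum M \<psi> t)"
    by (intro sum_list_mono Suc)
  finally show ?case by (simp add: sum_list_const_mult)
qed (use assms in simp)

lemma additive_functional_level1:
  "additive_functional f T = f T + level_sum 1 (additive_functional f) T"
  by (cases T) (simp add: additive_functional_Node)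

lemma additive_functional_levels:
  "additive_functional f T = (\<Sum>i<M. level_sum i f T) + level_sum M (additive_functional f) T"
proof (induction M)
  case (Suc M)
  have "level_sum M (additive_functional f) T = level_sum M f T + level_sum (Suc M) (additive_functional f) T"
    by (subst additive_functional_level1[abs_def], subst level_sum_add, subst level_sum_Suc) simp
  with Suc show ?case by simp
qed simp

lemma tree_order_level1: "real (tree_order T) = 1 + level_sum 1 (\<lambda>t. real (tree_order t)) T"
  by (cases T) (simp add: tree_order_Node sum_list_map_nth)

lemma tree_order_levels:
  "real (tree_order T) = (\<Sum>i<M. level_sum i (\<lambda>_. 1) T) + level_sum M (\<lambda>t. real (tree_order t)) T"
proof (induction M)
  case (Suc M)
  have "level_sum M (\<lambda>t. real (tree_order t)) T
      = level_sum M (\<lambda>_. 1) T + level_sum (Suc M) (\<lambda>t. real (tree_order t)) T"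
    by (subst tree_order_level1[abs_def], subst level_sum_add, subst level_sum_Suc) simp
  with Suc show ?case by simp
qed simp

lemma length_code: "length (code T) = tree_order T"
proof (induction T)
  case (Node ts)
  then have "map (\<lambda>x. length (code x)) ts = map tree_order ts" by simp
  then show ?case by (simp add: tree_order_Node length_concat o_def cong: map_cong)
qed

text \<open>Every node except the root is a child of exactly one node.\<close>

lemma sum_code: "Suc (sum_list (code T)) = tree_order T"
proof (induction T)
  case (Node ts)
  have "length ts + sum_list (concat (map code ts)) = (\<Sum>t\<leftarrow>ts. tree_order t)"
    using Node
  proof (induction ts)
    case (Cons t ts)
    have "Suc (sum_list (code t)) = tree_order t" by (rule Cons.prems) simp
    moreover have "length ts + sum_list (concat (map code ts)) = (\<Sum>t\<leftarrow>ts. tree_order t)"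
      by (rule Cons.IH) (use Cons.prems in auto)
    ultimately show ?case by simp
  qed simp
  then show ?case by (simp add: tree_order_Node)
qed

text \<open>Decoding reads from left to right without look-ahead: the first letter tells how many
  codes follow. The free tails \<open>a\<close> and \<open>b\<close> carry the induction through the
  concatenated codes of the children.\<close>

lemma code_prefix_free: "code T @ a = code T' @ b \<Longrightarrow> T = T' \<and> a = b"
proof (induction T arbitrary: T' a b)
  case (Node ts)
  obtain us where T': "T' = Node us" by (cases T')
  have len: "length ts = length us" and cc: "concat (map code ts) @ a = concat (map code us) @ b"
    using Node.prems by (simp_all add: T')
  have "ts = us \<and> a = b" using Node.IH len cc
  proof (induction ts arbitrary: us)
    case (Cons t ts)
    obtain u us' where us: "us = u # us'" using Cons.prems(2) by (cases us) auto
    have "code t @ (concat (map code ts) @ a) = code u @ (concat (map code us') @ b)"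
      using Cons.prems(3) by (simp add: us)
    from Cons.prems(1)[OF _ this] have tu: "t = u" "concat (map code ts) @ a = concat (map code us') @ b"
      by auto
    have "ts = us' \<and> a = b"
      by (rule Cons.IH) (use Cons.prems tu us in auto)
    then show ?case using tu us by simp
  qed simp
  then show ?case by (simp add: T')
qed

lemma inj_code: "inj code"
  by (rule injI) (metis append_Nil2 code_prefix_free)

section \<open>Finite sets of trees, forests and words\<close>

definition trees :: "nat \<Rightarrow> ptree set" where
  "trees n = {T. tree_order T = n}"

definition forests :: "nat \<Rightarrow> nat \<Rightarrow> ptree list set" where
  "forests r n = {ts. length ts = r \<and> (\<Sum>t\<leftarrow>ts. tree_order t) = n}"

definition words :: "nat \<Rightarrow> nat \<Rightarrow> nat list set" where
  "words n s = {w. length w = n \<and> sum_list w = s}"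

lemma finite_words [simp]: "finite (words n s)"
proof (rule finite_subset)
  show "words n s \<subseteq> {w. set w \<subseteq> {..s} \<and> length w = n}"
    by (auto simp: words_def member_le_sum_list)
  show "finite {w. set w \<subseteq> {..s} \<and> length w = n}"
    by (rule finite_lists_length_eq) simp
qed

lemma code_trees: "T \<in> trees n \<Longrightarrow> code T \<in> words n (n - 1)"
  using sum_code[of T] by (auto simp: trees_def words_def length_code)

lemma finite_trees [simp]: "finite (trees n)"
proof (rule finite_imageD)
  show "finite (code ` trees n)"
    by (rule finite_subset[OF _ finite_words[of n "n - 1"]]) (use code_trees in auto)
qed (use inj_code in \<open>auto intro: inj_on_subset\<close>)

lemma trees_0 [simp]: "trees 0 = {}"
  using tree_order_pos by (auto simp: trees_def)

lemma forests_empty: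
  assumes "n < r"
  shows "forests r n = {}"
proof -
  have "length ts \<le> (\<Sum>t\<leftarrow>ts. tree_order t)" for ts
  proof (induction ts)
    case (Cons t ts)
    then show ?case using tree_order_pos[of t] by simp
  qed simp
  then show ?thesis using assms by (fastforce simp: forests_def not_less[symmetric])
qed

lemma finite_forests [simp]: "finite (forests r n)"
proof (rule finite_subset)
  have "tree_order t \<le> (\<Sum>t\<leftarrow>ts. tree_order t)" if "t \<in> set ts" for t ts
    using that by (simp add: member_le_sum_list)
  then show "forests r n \<subseteq> {ts. set ts \<subseteq> (\<Union>k\<le>n. trees k) \<and> length ts = r}"
    by (auto simp: forests_def trees_def)
  show "finite {ts. set ts \<subseteq> (\<Union>k\<le>n. trees k) \<and> length ts = r}"
    by (rule finite_lists_length_eq) simp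
qed

text \<open>Inverse of removing the entry at position \<open>i\<close>. For each fixed position,
  forests of length r + 1 correspond to pairs of a tree and a forest of length r; this is how one
  child is singled out.\<close>

definition ins :: "nat \<Rightarrow> 'a \<Rightarrow> 'a list \<Rightarrow> 'a list" where
  "ins i x us = take i us @ x # drop i us"

lemma length_ins [simp]: "length (ins i x us) = Suc (length us)"
  by (simp add: ins_def)

lemma nth_ins [simp]: "i \<le> length us \<Longrightarrow> ins i x us ! i = x"
  by (simp add: ins_def nth_append)

lemma sum_list_ins: "(\<Sum>t\<leftarrow>ins i x us. h t) = h x + (\<Sum>t\<leftarrow>us. h t :: 'b :: comm_monoid_add)"
proof -
  have "(\<Sum>t\<leftarrow>us. h t) = (\<Sum>t\<leftarrow>take i us. h t) + (\<Sum>t\<leftarrow>drop i us. h t)"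
    by (metis append_take_drop_id map_append sum_list_append)
  then show ?thesis by (simp add: ins_def ac_simps)
qed

lemma prod_list_ins: "(\<Prod>t\<leftarrow>ins i x us. h t) = h x * (\<Prod>t\<leftarrow>us. h t :: 'b :: comm_monoid_mult)"
proof -
  have "(\<Prod>t\<leftarrow>us. h t) = (\<Prod>t\<leftarrow>take i us. h t) * (\<Prod>t\<leftarrow>drop i us. h t)"
    by (metis append_take_drop_id map_append prod_list.append)
  then show ?thesis by (simp add: ins_def ac_simps)
qed

lemma ins_remove: "i < length ts \<Longrightarrow> ins i (ts ! i) (take i ts @ drop (Suc i) ts) = ts"
  by (simp add: ins_def id_take_nth_drop[symmetric])

lemma remove_ins: "i \<le> length us \<Longrightarrow> take i (ins i x us) @ drop (Suc i) (ins i x us) = us"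
  by (simp add: ins_def)

section \<open>Weighted sums over trees\<close>

locale offspring =
  fixes \<xi> :: "nat pmf"
begin

abbreviation p :: "nat \<Rightarrow> real" where "p \<equiv> pmf \<xi>"

text \<open>The probability that the Galton-Watson tree is the given one
  (\<open>measure_GW\<close>). The analysis works with these finite products alone; the measure
  enters at the end.\<close>

primrec wt :: "ptree \<Rightarrow> real" where
  "wt (Node ts) = p (length ts) * prod_list (map wt ts)"

definition fwt :: "ptree list \<Rightarrow> real" where
  "fwt ts = (\<Prod>t\<leftarrow>ts. wt t)"

lemma wt_Node: "wt (Node ts) = p (length ts) * fwt ts"
  by (simp add: fwt_def)

lemma wt_nonneg [simp]: "0 \<le> wt T"
proof (induction T)
  case (Node ts)
  then have "0 \<le> prod_list (map wt ts)" by (induction ts) auto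
  then show ?case by simp
qed

lemma fwt_nonneg [simp]: "0 \<le> fwt ts"
  unfolding fwt_def by (induction ts) auto

text \<open>The expectation of \<open>\<phi>\<close> on the event that the order is
  \<open>n\<close>, not divided by the probability \<open>mass n\<close> of this event. Without the
  division, generating functions stay multiplicative.\<close>

definition treesum :: "(ptree \<Rightarrow> real) \<Rightarrow> nat \<Rightarrow> real" where
  "treesum \<phi> n = (\<Sum>T\<in>trees n. wt T * \<phi> T)"

definition fsum :: "nat \<Rightarrow> nat \<Rightarrow> (ptree list \<Rightarrow> real) \<Rightarrow> real" where
  "fsum r n \<psi> = (\<Sum>ts\<in>forests r n. fwt ts * \<psi> ts)"

definition gf :: "(ptree \<Rightarrow> real) \<Rightarrow> real fps" where
  "gf \<phi> = Abs_fps (treesum \<phi>)"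

abbreviation mass :: "nat \<Rightarrow> real" where "mass \<equiv> treesum (\<lambda>_. 1)"

abbreviation TT :: "real fps" where "TT \<equiv> gf (\<lambda>_. 1)"

lemma gf_nth [simp]: "fps_nth (gf \<phi>) n = treesum \<phi> n"
  by (simp add: gf_def)

lemma treesum_0 [simp]: "treesum \<phi> 0 = 0"
  by (simp add: treesum_def)

lemma treesum_cmult: "treesum (\<lambda>T. c * \<phi> T) n = c * treesum \<phi> n"
  by (simp add: treesum_def sum_distrib_left mult_ac)

lemma treesum_add: "treesum (\<lambda>T. \<phi> T + \<psi> T) n = treesum \<phi> n + treesum \<psi> n"
  by (simp add: treesum_def sum.distrib algebra_simps)

lemma treesum_diff: "treesum (\<lambda>T. \<phi> T - \<psi> T) n = treesum \<phi> n - treesum \<psi> n"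
  by (simp add: treesum_def sum_subtractf algebra_simps)

lemma treesum_sum: "treesum (\<lambda>T. \<Sum>i\<in>I. \<phi> i T) n = (\<Sum>i\<in>I. treesum (\<phi> i) n)"
  unfolding treesum_def sum_distrib_left by (rule sum.swap)

lemma treesum_cong: "(\<And>T. tree_order T = n \<Longrightarrow> \<phi> T = \<psi> T) \<Longrightarrow> treesum \<phi> n = treesum \<psi> n"
  unfolding treesum_def by (intro sum.cong) (auto simp: trees_def)

lemma treesum_mono:
  "(\<And>T. tree_order T = n \<Longrightarrow> \<phi> T \<le> \<psi> T) \<Longrightarrow> treesum \<phi> n \<le> treesum \<psi> n"
  unfolding treesum_def by (intro sum_mono mult_left_mono) (auto simp: trees_def)

lemma treesum_nonneg: "(\<And>T. tree_order T = n \<Longrightarrow> 0 \<le> \<phi> T) \<Longrightarrow> 0 \<le> treesum \<phi> n"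
  unfolding treesum_def by (intro sum_nonneg mult_nonneg_nonneg) (auto simp: trees_def)

lemma abs_treesum_le: "\<bar>treesum \<phi> n\<bar> \<le> treesum (\<lambda>T. \<bar>\<phi> T\<bar>) n"
  unfolding treesum_def by (rule order_trans[OF sum_abs]) (simp add: abs_mult)

lemma fsum_sum: "fsum r n (\<lambda>ts. \<Sum>i\<in>I. \<psi> i ts) = (\<Sum>i\<in>I. fsum r n (\<psi> i))"
  unfolding fsum_def sum_distrib_left by (rule sum.swap)

lemma fsum_add: "fsum r n (\<lambda>ts. \<phi> ts + \<psi> ts) = fsum r n \<phi> + fsum r n \<psi>"
  by (simp add: fsum_def sum.distrib algebra_simps)

lemma fsum_cong: "(\<And>ts. length ts = r \<Longrightarrow> \<phi> ts = \<psi> ts) \<Longrightarrow> fsum r n \<phi> = fsum r n \<psi>"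
  unfolding fsum_def by (intro sum.cong) (auto simp: forests_def)

lemma fsum_empty: "n < r \<Longrightarrow> fsum r n \<psi> = 0"
  by (simp add: fsum_def forests_empty)

text \<open>Decomposition at the root. The cut-off \<open>N\<close> is free above \<open>n\<close>
  because more than \<open>n\<close> trees cannot have \<open>n\<close> nodes in total; a common
  \<open>N\<close> allows the degree sums for different orders to be exchanged.\<close>

lemma treesum_Suc:
  assumes "n \<le> N"
  shows "treesum \<phi> (Suc n) = (\<Sum>d\<le>N. p d * fsum d n (\<lambda>ts. \<phi> (Node ts)))"
proof -
  have "trees (Suc n) = Node ` (\<Union>d\<le>n. forests d n)"
  proof (intro set_eqI iffI)
    fix T assume "T \<in> trees (Suc n)"
    then obtain ts where T: "T = Node ts" "(\<Sum>t\<leftarrow>ts. tree_order t) = n"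
      by (cases T) (auto simp: trees_def tree_order_Node)
    then have "ts \<in> forests (length ts) n" by (simp add: forests_def)
    moreover have "length ts \<le> n" using forests_empty[of n "length ts"] calculation by force
    ultimately show "T \<in> Node ` (\<Union>d\<le>n. forests d n)" using T by auto
  qed (auto simp: trees_def forests_def tree_order_Node)
  then have "treesum \<phi> (Suc n) = (\<Sum>ts\<in>(\<Union>d\<le>n. forests d n). wt (Node ts) * \<phi> (Node ts))"
    unfolding treesum_def by (simp add: sum.reindex inj_on_def del: wt.simps)
  also have "\<dots> = (\<Sum>d\<le>n. \<Sum>ts\<in>forests d n. wt (Node ts) * \<phi> (Node ts))"
    by (subst sum.UNION_disjoint, simp, simp, auto simp: forests_def)
  also have "\<dots> = (\<Sum>d\<le>n. p d * fsum d n (\<lambda>ts. \<phi> (Node ts)))"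
    unfolding fsum_def sum_distrib_left
    by (intro sum.cong refl) (auto simp: wt_Node forests_def simp del: wt.simps)
  also have "\<dots> = (\<Sum>d\<le>N. p d * fsum d n (\<lambda>ts. \<phi> (Node ts)))"
    using assms by (intro sum.mono_neutral_left) (auto simp: fsum_empty)
  finally show ?thesis .
qed

text \<open>Separates the tree at position \<open>i\<close> from its siblings \<open>us\<close>, of
  total order \<open>m\<close>. The sum over \<open>us\<close> stays outside \<open>treesum\<close>,
  so \<open>\<psi>\<close> may still depend on the siblings.\<close>

lemma fsum_ins:
  assumes "i \<le> r"
  shows "fsum (Suc r) n \<psi> = (\<Sum>m\<le>n. \<Sum>us\<in>forests r m. fwt us * treesum (\<lambda>T. \<psi> (ins i T us)) (n - m))"
proof -
  have "fsum (Suc r) n \<psi> = (\<Sum>(m, us, T)\<in>(SIGMA m:{..n}. SIGMA us:forests r m. trees (n - m)).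
      fwt us * (wt T * \<psi> (ins i T us)))"
    unfolding fsum_def
  proof (rule sum.reindex_bij_witness[where
      i = "\<lambda>(m, us, T). ins i T us" and
      j = "\<lambda>ts. (\<Sum>t\<leftarrow>take i ts @ drop (Suc i) ts. tree_order t, take i ts @ drop (Suc i) ts, ts ! i)"])
    fix ts assume ts: "ts \<in> forests (Suc r) n"
    then have l: "i < length ts" using assms by (simp add: forests_def)
    let ?us = "take i ts @ drop (Suc i) ts"
    have e: "ins i (ts ! i) ?us = ts" by (rule ins_remove[OF l])
    have s: "n = tree_order (ts ! i) + (\<Sum>t\<leftarrow>?us. tree_order t)"
      using ts sum_list_ins[of tree_order i "ts ! i" ?us] unfolding e by (simp add: forests_def)
    show "(case (\<Sum>t\<leftarrow>?us. tree_order t, ?us, ts ! i) of (m, us, T) \<Rightarrow> ins i T us) = ts"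
      using e by simp
    show "(\<Sum>t\<leftarrow>?us. tree_order t, ?us, ts ! i) \<in> (SIGMA m:{..n}. SIGMA us:forests r m. trees (n - m))"
      using ts l s by (auto simp: forests_def trees_def)
    show "(case (\<Sum>t\<leftarrow>?us. tree_order t, ?us, ts ! i) of (m, us, T) \<Rightarrow> fwt us * (wt T * \<psi> (ins i T us)))
        = fwt ts * \<psi> ts"
    proof -
      have "fwt ts = wt (ts ! i) * fwt ?us"
        using prod_list_ins[of wt i "ts ! i" ?us] unfolding e fwt_def .
      then show ?thesis by (simp only: e prod.case mult_ac)
    qed
  next
    fix x assume x: "x \<in> (SIGMA m:{..n}. SIGMA us:forests r m. trees (n - m))"
    then show "(\<lambda>ts. (\<Sum>t\<leftarrow>take i ts @ drop (Suc i) ts. tree_order t, take i ts @ drop (Suc i) ts, ts ! i))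
        (case x of (m, us, T) \<Rightarrow> ins i T us) = x"
      using assms by (auto simp: forests_def remove_ins simp del: map_append)
    show "(case x of (m, us, T) \<Rightarrow> ins i T us) \<in> forests (Suc r) n"
      using x by (auto simp: forests_def trees_def sum_list_ins)
  qed
  then show ?thesis
    by (simp add: sum.Sigma[symmetric] treesum_def sum_distrib_left)
qed

lemma fsum_one: "fsum r n (\<lambda>_. 1) = fps_nth (TT ^ r) n"
proof (induction r arbitrary: n)
  case 0
  have "forests 0 n = (if n = 0 then {[]} else {})" by (auto simp: forests_def)
  then show ?case by (simp add: fsum_def fwt_def)
next
  case (Suc r)
  have "fsum (Suc r) n (\<lambda>_. 1) = (\<Sum>m\<le>n. fsum r m (\<lambda>_. 1) * mass (n - m))"
    by (subst fsum_ins[of 0]) (simp_all add: fsum_def sum_distrib_right)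
  also have "\<dots> = fps_nth (TT ^ r * TT) n"
    by (simp add: fps_mult_nth Suc atLeast0AtMost)
  finally show ?case by (simp add: mult.commute)
qed

lemma fsum_level:
  "fsum d n (\<lambda>ts. \<Sum>t\<leftarrow>ts. \<phi> t) = real d * fps_nth (gf \<phi> * TT ^ (d - 1)) n"
proof (cases d)
  case 0 then show ?thesis by (simp add: fsum_def forests_def)
next
  case (Suc r)
  have "fsum d n (\<lambda>ts. \<Sum>t\<leftarrow>ts. \<phi> t) = (\<Sum>i<d. fsum d n (\<lambda>ts. \<phi> (ts ! i)))"
    unfolding fsum_sum[symmetric] by (rule fsum_cong) (simp add: sum_list_map_nth)
  also have "\<dots> = (\<Sum>i<d. fps_nth (gf \<phi> * TT ^ r) n)"
  proof (rule sum.cong[OF refl])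
    fix i assume "i \<in> {..<d}"
    then have i: "i \<le> r" by (simp add: Suc)
    have "fsum d n (\<lambda>ts. \<phi> (ts ! i)) = (\<Sum>m\<le>n. \<Sum>us\<in>forests r m. fwt us * treesum \<phi> (n - m))"
      unfolding Suc using i by (subst fsum_ins[OF i]) (intro sum.cong refl, simp add: forests_def)
    also have "\<dots> = (\<Sum>m\<le>n. fsum r m (\<lambda>_. 1) * treesum \<phi> (n - m))"
      by (simp add: fsum_def sum_distrib_right)
    also have "\<dots> = fps_nth (TT ^ r * gf \<phi>) n"
      by (simp add: fps_mult_nth fsum_one atLeast0AtMost)
    finally show "fsum d n (\<lambda>ts. \<phi> (ts ! i)) = fps_nth (gf \<phi> * TT ^ r) n" by (simp add: mult.commute)
  qed
  finally show ?thesis by (simp add: Suc)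
qed

text \<open>The d diagonal terms give the second moment of one tree, the d (d - 1) ordered pairs of
  positions the product of first moments.\<close>

lemma fsum_level_square:
  "fsum d n (\<lambda>ts. (\<Sum>t\<leftarrow>ts. \<phi> t)\<^sup>2)
    = real d * fps_nth (gf (\<lambda>T. (\<phi> T)\<^sup>2) * TT ^ (d - 1)) n
      + real d * (real d - 1) * fps_nth ((gf \<phi>)\<^sup>2 * TT ^ (d - 2)) n"
proof (cases d)
  case 0 then show ?thesis by (simp add: fsum_def forests_def)
next
  case (Suc r)
  have "fsum d n (\<lambda>ts. (\<Sum>t\<leftarrow>ts. \<phi> t)\<^sup>2)
      = fsum d n (\<lambda>ts. (\<Sum>t\<leftarrow>ts. (\<phi> t)\<^sup>2) + (\<Sum>i<d. \<phi> (ts ! i) * ((\<Sum>t\<leftarrow>ts. \<phi> t) - \<phi> (ts ! i))))"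
    by (rule fsum_cong)
      (simp add: sum_list_map_nth right_diff_distrib sum_subtractf power2_eq_square sum_distrib_right)
  also have "\<dots> = fsum d n (\<lambda>ts. \<Sum>t\<leftarrow>ts. (\<phi> t)\<^sup>2)
      + (\<Sum>i<d. fsum d n (\<lambda>ts. \<phi> (ts ! i) * ((\<Sum>t\<leftarrow>ts. \<phi> t) - \<phi> (ts ! i))))"
    by (simp add: fsum_add fsum_sum)
  also have "(\<Sum>i<d. fsum d n (\<lambda>ts. \<phi> (ts ! i) * ((\<Sum>t\<leftarrow>ts. \<phi> t) - \<phi> (ts ! i))))
      = (\<Sum>i<d. (real d - 1) * fps_nth ((gf \<phi>)\<^sup>2 * TT ^ (d - 2)) n)"
  proof (rule sum.cong[OF refl])
    fix i assume "i \<in> {..<d}"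
    then have i: "i \<le> r" by (simp add: Suc)
    have "fsum d n (\<lambda>ts. \<phi> (ts ! i) * ((\<Sum>t\<leftarrow>ts. \<phi> t) - \<phi> (ts ! i)))
        = (\<Sum>m\<le>n. \<Sum>us\<in>forests r m. fwt us * (\<Sum>t\<leftarrow>us. \<phi> t) * treesum \<phi> (n - m))"
      unfolding Suc using i
      by (subst fsum_ins[OF i]) (intro sum.cong refl, simp add: forests_def sum_list_ins
          mult.commute[of "\<phi> _"] treesum_cmult)
    also have "\<dots> = (\<Sum>m\<le>n. fsum r m (\<lambda>ts. \<Sum>t\<leftarrow>ts. \<phi> t) * treesum \<phi> (n - m))"
      by (simp add: fsum_def sum_distrib_right)
    also have "\<dots> = real r * (\<Sum>m\<le>n. fps_nth (gf \<phi> * TT ^ (r - 1)) m * treesum \<phi> (n - m))"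
      by (simp add: fsum_level sum_distrib_left mult_ac)
    also have "(\<Sum>m\<le>n. fps_nth (gf \<phi> * TT ^ (r - 1)) m * treesum \<phi> (n - m))
        = fps_nth (gf \<phi> * TT ^ (r - 1) * gf \<phi>) n"
      unfolding fps_mult_nth[of "gf \<phi> * TT ^ (r - 1)" "gf \<phi>"] atLeast0AtMost by simp
    also have "gf \<phi> * TT ^ (r - 1) * gf \<phi> = (gf \<phi>)\<^sup>2 * TT ^ (d - 2)"
      using Suc by (simp add: power2_eq_square mult_ac diff_diff_left numeral_2_eq_2)
    finally show "fsum d n (\<lambda>ts. \<phi> (ts ! i) * ((\<Sum>t\<leftarrow>ts. \<phi> t) - \<phi> (ts ! i)))
        = (real d - 1) * fps_nth ((gf \<phi>)\<^sup>2 * TT ^ (d - 2)) n" using Suc by simp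
  qed
  finally show ?thesis by (simp add: fsum_level)
qed

section \<open>Series of trees with marked children left out\<close>

lemma TT_0 [simp]: "fps_nth TT 0 = 0" by simp

lemma TT_power_eq_0: "n < r \<Longrightarrow> fps_nth (TT ^ r) n = 0"
  by (simp add: fsum_one[symmetric] fsum_empty)

text \<open>With G the generating function of the offspring law this is z G'(TT): a root with one
  marked child whose subtree is left out. The shift by one counts the root; the sum is finite since
  \<open>TT\<close> has no constant term.\<close>

definition Lam :: "real fps" where
  "Lam = Abs_fps (\<lambda>k. case k of 0 \<Rightarrow> 0 | Suc m \<Rightarrow> \<Sum>d\<le>Suc m. real d * p d * fps_nth (TT ^ (d - 1)) m)"

text \<open>The analogue z G''(TT), with an ordered pair of distinct children left out. The power d
  - 2 explains the range up to m + 2.\<close>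

definition Lam2 :: "real fps" where
  "Lam2 = Abs_fps (\<lambda>k. case k of 0 \<Rightarrow> 0
     | Suc m \<Rightarrow> \<Sum>d\<le>m + 2. real d * (real d - 1) * p d * fps_nth (TT ^ (d - 2)) m)"

lemma Lam_0 [simp]: "fps_nth Lam 0 = 0" by (simp add: Lam_def)
lemma Lam2_0 [simp]: "fps_nth Lam2 0 = 0" by (simp add: Lam2_def)

lemma Lam_Suc:
  assumes "Suc m \<le> N"
  shows "fps_nth Lam (Suc m) = (\<Sum>d\<le>N. real d * p d * fps_nth (TT ^ (d - 1)) m)"
  unfolding Lam_def using assms
  by (simp del: sum.atMost_Suc) (rule sum.mono_neutral_left, auto simp: TT_power_eq_0)

lemma Lam2_Suc:
  assumes "m + 2 \<le> N"
  shows "fps_nth Lam2 (Suc m) = (\<Sum>d\<le>N. real d * (real d - 1) * p d * fps_nth (TT ^ (d - 2)) m)"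
  unfolding Lam2_def using assms
  by (simp del: sum.atMost_Suc) (rule sum.mono_neutral_left, auto simp: TT_power_eq_0)

lemma Lam_nonneg: "0 \<le> fps_nth Lam k"
  by (cases k) (auto simp: Lam_Suc[OF order_refl] fsum_one[symmetric] fsum_def
      intro!: sum_nonneg mult_nonneg_nonneg simp del: sum.atMost_Suc)

lemma Lam2_nonneg: "0 \<le> fps_nth Lam2 k"
proof (cases k)
  case (Suc m)
  have c: "0 \<le> real d * (real d - 1)" for d by (cases d) auto
  show ?thesis unfolding Suc Lam2_Suc[OF order_refl]
    by (intro sum_nonneg mult_nonneg_nonneg[OF mult_nonneg_nonneg[OF c]])
      (auto simp: fsum_one[symmetric] fsum_def intro!: sum_nonneg)
qed simp

lemma mult_nth_Suc_0:
  "fps_nth X 0 = (0::real) \<Longrightarrow> fps_nth (X * Y) (Suc n) = (\<Sum>i\<le>n. fps_nth X (Suc i) * fps_nth Y (n - i))"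
  unfolding fps_mult_nth atLeast0AtMost by (subst sum.atMost_Suc_shift) simp

lemma Lam_mult_Suc:
  assumes "Suc n \<le> N"
  shows "fps_nth (Lam * X) (Suc n) = (\<Sum>d\<le>N. real d * p d * fps_nth (X * TT ^ (d - 1)) n)"
proof -
  have "fps_nth (Lam * X) (Suc n)
      = (\<Sum>i\<le>n. (\<Sum>d\<le>N. real d * p d * fps_nth (TT ^ (d - 1)) i) * fps_nth X (n - i))"
    unfolding mult_nth_Suc_0[OF Lam_0] using assms by (intro sum.cong refl) (simp add: Lam_Suc[of _ N])
  also have "\<dots> = (\<Sum>d\<le>N. \<Sum>i\<le>n. real d * p d * fps_nth (TT ^ (d - 1)) i * fps_nth X (n - i))"
    unfolding sum_distrib_right by (rule sum.swap)
  also have "\<dots> = (\<Sum>d\<le>N. real d * p d * fps_nth (TT ^ (d - 1) * X) n)"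
    by (simp only: fps_mult_nth[of "TT ^ _"] atLeast0AtMost sum_distrib_left mult.assoc)
  finally show ?thesis by (simp add: mult.commute)
qed

lemma Lam2_mult_Suc:
  assumes "n + 2 \<le> N"
  shows "fps_nth (Lam2 * X) (Suc n) = (\<Sum>d\<le>N. real d * (real d - 1) * p d * fps_nth (X * TT ^ (d - 2)) n)"
proof -
  have "fps_nth (Lam2 * X) (Suc n)
      = (\<Sum>i\<le>n. (\<Sum>d\<le>N. real d * (real d - 1) * p d * fps_nth (TT ^ (d - 2)) i) * fps_nth X (n - i))"
    unfolding mult_nth_Suc_0[OF Lam2_0] using assms by (intro sum.cong refl) (simp add: Lam2_Suc[of _ N])
  also have "\<dots> = (\<Sum>d\<le>N. \<Sum>i\<le>n. real d * (real d - 1) * p d * fps_nth (TT ^ (d - 2)) i * fps_nth X (n - i))"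
    unfolding sum_distrib_right by (rule sum.swap)
  also have "\<dots> = (\<Sum>d\<le>N. real d * (real d - 1) * p d * fps_nth (TT ^ (d - 2) * X) n)"
    by (simp only: fps_mult_nth[of "TT ^ _"] atLeast0AtMost sum_distrib_left mult.assoc)
  finally show ?thesis by (simp add: mult.commute)
qed

lemma gf_level1: "gf (level_sum 1 \<phi>) = Lam * gf \<phi>"
proof (rule fps_ext)
  fix n show "fps_nth (gf (level_sum 1 \<phi>)) n = fps_nth (Lam * gf \<phi>) n"
  proof (cases n)
    case (Suc m)
    show ?thesis unfolding Suc gf_nth Lam_mult_Suc[OF order_refl]
      by (subst treesum_Suc[of m "Suc m"]) (simp_all add: fsum_level mult_ac)
  qed simp
qed

lemma gf_level1_square:
  "gf (\<lambda>T. (level_sum 1 \<phi> T)\<^sup>2) = Lam * gf (\<lambda>T. (\<phi> T)\<^sup>2) + Lam2 * (gf \<phi>)\<^sup>2"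
proof (rule fps_ext)
  fix n
  show "fps_nth (gf (\<lambda>T. (level_sum 1 \<phi> T)\<^sup>2)) n
      = fps_nth (Lam * gf (\<lambda>T. (\<phi> T)\<^sup>2) + Lam2 * (gf \<phi>)\<^sup>2) n"
  proof (cases n)
    case (Suc m)
    have 1: "Suc m \<le> m + 2" by simp
    show ?thesis unfolding Suc gf_nth fps_add_nth Lam_mult_Suc[OF 1] Lam2_mult_Suc[OF order_refl]
      by (subst treesum_Suc[of m "m + 2"])
        (simp_all add: fsum_level_square sum.distrib[symmetric] algebra_simps del: sum.atMost_Suc)
  qed simp
qed

lemma gf_level: "gf (level_sum M \<phi>) = Lam ^ M * gf \<phi>"
proof (induction M arbitrary: \<phi>)
  case (Suc M)
  have "level_sum (Suc M) \<phi> = level_sum M (level_sum 1 \<phi>)" by (rule ext) (rule level_sum_Suc)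
  then show ?case using Suc[of "level_sum 1 \<phi>"] by (simp only: gf_level1) (simp add: mult_ac)
next
  case 0
  have "level_sum 0 \<phi> = \<phi>" by (rule ext) simp
  then show ?case by simp
qed

text \<open>Marking a node at depth \<open>M\<close> splits a tree into the fringe subtree of that node and a part
  whose contribution does not depend on the fringe subtree, because \<open>h\<close> does not see it.\<close>

lemma gf_marked_level:
  assumes "\<And>T. \<bar>h T\<bar> \<le> B" "\<And>T. h T = h (truncate M T)"
  shows "\<exists>R. (\<forall>j. \<bar>fps_nth R j\<bar> \<le> B * fps_nth (Lam ^ M) j) \<and>
             (\<forall>\<phi>. gf (\<lambda>T. h T * level_sum M \<phi> T) = R * gf \<phi>)"
  using assms
proof (induction M arbitrary: h)
  case 0
  have "h T = h (Node [])" for T using 0(2)[of T] by simp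
  then have "gf (\<lambda>T. h T * \<phi> T) = fps_const (h (Node [])) * gf \<phi>" for \<phi>
    by (intro fps_ext, simp only: gf_nth fps_mult_left_const_nth treesum_cmult[symmetric])
      (rule treesum_cong, metis)
  then show ?case using 0(1)[of "Node []"]
    by (intro exI[of _ "fps_const (h (Node []))"]) auto
next
  case (Suc M)
  have B: "0 \<le> B" using Suc.prems(1)[of "Node []"] by linarith
  \<comment> \<open>With the siblings of the marked child fixed, \<open>h\<close> becomes a
    functional of that child with cut-off \<open>M\<close>, to which the induction hypothesis
    applies.\<close>
  define g where "g i us = (\<lambda>T. h (Node (ins i T us)))" for i us
  have trunc: "g i us T = g i us (truncate M T)" for i us T
    unfolding g_def using Suc.prems(2)[of "Node (ins i T us)"] Suc.prems(2)[of "Node (ins i (truncate M T) us)"]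
  proof -
    have "truncate M (truncate M T) = truncate M T" for T
      by (induction M arbitrary: T) auto
    then have "truncate (Suc M) (Node (ins i T us)) = truncate (Suc M) (Node (ins i (truncate M T) us))"
      by (simp add: ins_def)
    then show "h (Node (ins i T us)) = h (Node (ins i (truncate M T) us))"
      by (metis Suc.prems(2))
  qed
  have "\<exists>R. (\<forall>j. \<bar>fps_nth R j\<bar> \<le> B * fps_nth (Lam ^ M) j) \<and>
             (\<forall>\<phi>. gf (\<lambda>T. g i us T * level_sum M \<phi> T) = R * gf \<phi>)" for i us
    by (rule Suc.IH) (use Suc.prems(1) trunc in \<open>auto simp: g_def\<close>)
  then obtain R where R: "\<And>i us j. \<bar>fps_nth (R i us) j\<bar> \<le> B * fps_nth (Lam ^ M) j"
      "\<And>i us \<phi>. gf (\<lambda>T. g i us T * level_sum M \<phi> T) = R i us * gf \<phi>"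
    by metis
  \<comment> \<open>A root of degree \<open>d\<close> whose \<open>i\<close>-th child leads to the
    marked node; \<open>n\<close> counts the nodes outside the marked fringe subtree, the root
    excepted.\<close>
  define Q where "Q d i n = (\<Sum>m\<le>n. \<Sum>us\<in>forests (d - 1) m. fwt us * fps_nth (R i us) (n - m))" for d i n
  have Q0: "Q d i n = 0" if "Suc n < d" for d i n
    using that unfolding Q_def by (intro sum.neutral ballI) (simp add: forests_empty)
  define RR where "RR = Abs_fps (\<lambda>k. case k of 0 \<Rightarrow> 0 | Suc n \<Rightarrow> \<Sum>d\<le>Suc n. p d * (\<Sum>i<d. Q d i n))"
  have RR_Suc: "fps_nth RR (Suc m) = (\<Sum>d\<le>N. p d * (\<Sum>i<d. Q d i m))" if "Suc m \<le> N" for m N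
    unfolding RR_def using that
    by (simp del: sum.atMost_Suc) (rule sum.mono_neutral_left, auto simp: Q0)
  have RR0: "fps_nth RR 0 = 0" by (simp add: RR_def)
  show ?case
  proof (intro exI[of _ RR] conjI allI)
    fix j
    show "\<bar>fps_nth RR j\<bar> \<le> B * fps_nth (Lam ^ Suc M) j"
    proof (cases j)
      case 0 then show ?thesis by (simp add: RR0)
    next
      case (Suc n)
      have QB: "\<bar>Q d i n\<bar> \<le> B * fps_nth (Lam ^ M * TT ^ (d - 1)) n" for d i
      proof -
        have "\<bar>Q d i n\<bar> \<le> (\<Sum>m\<le>n. \<Sum>us\<in>forests (d - 1) m. fwt us * (B * fps_nth (Lam ^ M) (n - m)))"
          unfolding Q_def
          by (intro order_trans[OF sum_abs] sum_mono) (auto simp: abs_mult intro!: mult_left_mono R(1))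
        also have "\<dots> = (\<Sum>m\<le>n. B * (fsum (d - 1) m (\<lambda>_. 1) * fps_nth (Lam ^ M) (n - m)))"
          by (intro sum.cong refl) (simp add: fsum_def sum_distrib_left mult_ac)
        also have "\<dots> = B * fps_nth (TT ^ (d - 1) * Lam ^ M) n"
          by (simp add: sum_distrib_left[symmetric] fsum_one fps_mult_nth atLeast0AtMost)
        finally show ?thesis by (simp add: mult.commute)
      qed
      have "\<bar>fps_nth RR j\<bar> \<le> (\<Sum>d\<le>Suc n. p d * (\<Sum>i<d. B * fps_nth (Lam ^ M * TT ^ (d - 1)) n))"
        unfolding Suc RR_Suc[OF order_refl]
      proof (intro order_trans[OF sum_abs] sum_mono)
        fix d
        have "\<bar>\<Sum>i<d. Q d i n\<bar> \<le> (\<Sum>i<d. B * fps_nth (Lam ^ M * TT ^ (d - 1)) n)"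
          by (intro order_trans[OF sum_abs] sum_mono QB)
        then show "\<bar>p d * (\<Sum>i<d. Q d i n)\<bar> \<le> p d * (\<Sum>i<d. B * fps_nth (Lam ^ M * TT ^ (d - 1)) n)"
          by (subst abs_mult) (simp add: mult_left_mono del: sum_constant)
      qed
      also have "\<dots> = B * (\<Sum>d\<le>Suc n. real d * p d * fps_nth (Lam ^ M * TT ^ (d - 1)) n)"
        by (simp add: sum_distrib_left mult_ac del: sum.atMost_Suc)
      finally show ?thesis unfolding Suc power_Suc Lam_mult_Suc[OF order_refl] .
    qed
  next
    fix \<phi>
    show "gf (\<lambda>T. h T * level_sum (Suc M) \<phi> T) = RR * gf \<phi>"
    proof (rule fps_ext)
      fix n show "fps_nth (gf (\<lambda>T. h T * level_sum (Suc M) \<phi> T)) n = fps_nth (RR * gf \<phi>) n"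
      proof (cases n)
        case 0 then show ?thesis by simp
      next
        case (Suc m)
        have Qc: "fsum d m (\<lambda>ts. h (Node ts) * level_sum M \<phi> (ts ! i))
            = (\<Sum>k\<le>m. Q d i k * treesum \<phi> (m - k))" if "i < d" for d i
        proof -
          define r where "r = d - 1"
          have d: "d = Suc r" and i: "i \<le> r" using that by (auto simp: r_def)
          have "fsum d m (\<lambda>ts. h (Node ts) * level_sum M \<phi> (ts ! i))
              = (\<Sum>k\<le>m. \<Sum>us\<in>forests r k. fwt us * fps_nth (R i us * gf \<phi>) (m - k))"
            unfolding d fsum_ins[OF i]
            by (intro sum.cong refl) (use i in \<open>auto simp: forests_def R(2)[symmetric] g_def\<close>)
          also have "\<dots> = (\<Sum>k\<le>m. \<Sum>us\<in>forests r k. \<Sum>l\<le>m - k. fwt us * fps_nth (R i us) l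
                * treesum \<phi> (m - k - l))"
            by (simp only: fps_mult_nth atLeast0AtMost sum_distrib_left mult.assoc gf_nth)
          also have "\<dots> = (\<Sum>k\<le>m. \<Sum>l\<le>m - k. (\<Sum>us\<in>forests r k. fwt us * fps_nth (R i us) l)
                * treesum \<phi> (m - k - l))"
            unfolding sum_distrib_right by (intro sum.cong refl sum.swap)
          also have "\<dots> = (\<Sum>(k, l)\<in>(SIGMA k:{..m}. {..m - k}).
                (\<Sum>us\<in>forests r k. fwt us * fps_nth (R i us) l) * treesum \<phi> (m - k - l))"
            by (simp add: sum.Sigma)
          \<comment> \<open>\<open>q\<close> collects the nodes of the siblings and those of the
            child outside the marked subtree.\<close>
          also have "\<dots> = (\<Sum>(q, k)\<in>(SIGMA q:{..m}. {..q}).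
                (\<Sum>us\<in>forests r k. fwt us * fps_nth (R i us) (q - k)) * treesum \<phi> (m - q))"
            by (rule sum.reindex_bij_witness[where i = "\<lambda>(q, k). (k, q - k)" and j = "\<lambda>(k, l). (k + l, k)"])
              auto
          also have "\<dots> = (\<Sum>q\<le>m. Q d i q * treesum \<phi> (m - q))"
            by (simp add: sum.Sigma[symmetric] Q_def d sum_distrib_right)
          finally show ?thesis .
        qed
        have "treesum (\<lambda>T. h T * level_sum (Suc M) \<phi> T) (Suc m)
            = (\<Sum>d\<le>Suc m. p d * fsum d m (\<lambda>ts. \<Sum>i<d. h (Node ts) * level_sum M \<phi> (ts ! i)))"
          by (subst treesum_Suc[of m "Suc m"], simp)
            (intro sum.cong arg_cong2[of _ _ _ _ "(*)"] refl fsum_cong,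
              simp add: sum_list_map_nth sum_distrib_left)
        also have "\<dots> = (\<Sum>d\<le>Suc m. p d * (\<Sum>i<d. \<Sum>k\<le>m. Q d i k * treesum \<phi> (m - k)))"
          unfolding fsum_sum by (intro sum.cong arg_cong2[of _ _ _ _ "(*)"] refl Qc) auto
        also have "\<dots> = (\<Sum>d\<le>Suc m. \<Sum>k\<le>m. p d * (\<Sum>i<d. Q d i k) * treesum \<phi> (m - k))"
        proof (rule sum.cong[OF refl])
          fix d
          have "(\<Sum>i<d. \<Sum>k\<le>m. Q d i k * treesum \<phi> (m - k)) = (\<Sum>k\<le>m. (\<Sum>i<d. Q d i k) * treesum \<phi> (m - k))"
            unfolding sum_distrib_right by (rule sum.swap)
          then show "p d * (\<Sum>i<d. \<Sum>k\<le>m. Q d i k * treesum \<phi> (m - k))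
              = (\<Sum>k\<le>m. p d * (\<Sum>i<d. Q d i k) * treesum \<phi> (m - k))"
            by (simp only: sum_distrib_left[of "p d" _ "{..m}"] mult.assoc)
        qed
        also have "\<dots> = (\<Sum>k\<le>m. (\<Sum>d\<le>Suc m. p d * (\<Sum>i<d. Q d i k)) * treesum \<phi> (m - k))"
          unfolding sum_distrib_right by (rule sum.swap)
        also have "\<dots> = (\<Sum>k\<le>m. fps_nth RR (Suc k) * treesum \<phi> (m - k))"
          by (intro sum.cong refl) (simp add: RR_Suc[of _ "Suc m"] del: sum.atMost_Suc)
        also have "\<dots> = fps_nth (RR * gf \<phi>) (Suc m)"
          by (simp add: mult_nth_Suc_0[OF RR0])
        finally show ?thesis by (simp add: Suc del: level_sum.simps)
      qed
    qed
  qed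
qed

subsection \<open>The hitting time theorem\<close>

definition Pf :: "real fps" where "Pf = Abs_fps p"

abbreviation PS :: "nat \<Rightarrow> nat \<Rightarrow> real" where "PS n s \<equiv> fps_nth (Pf ^ n) s"

lemma fps_nth_Pf: "fps_nth Pf k = p k" by (simp add: Pf_def)

text \<open>The return probabilities P(S_j = j), with S_j the sum of j letters: the renewal series
  of the centred walk. \<open>UU_eq\<close> shows that it inverts 1 - \<open>Lam\<close>.\<close>

definition UU :: "real fps" where "UU = Abs_fps (\<lambda>j. PS j j)"

lemma PS_Suc: "PS (Suc n) s = (\<Sum>d\<le>s. p d * PS n (s - d))"
  by (simp add: fps_mult_nth Pf_def atLeast0AtMost)

text \<open>By exchangeability the first of n + 1 letters has conditional mean s / (n + 1) given
  that the sum is s. Here this comes from differentiating a power of \<open>Pf\<close>.\<close>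

lemma PS_exchange: "real (Suc n) * (\<Sum>d\<le>s. real d * p d * PS n (s - d)) = real s * PS (Suc n) s"
proof (cases s)
  case (Suc k)
  have "real s * PS (Suc n) s = fps_nth (fps_deriv (Pf ^ Suc n)) k"
    unfolding Suc fps_deriv_nth by simp
  also have "fps_deriv (Pf ^ Suc n) = fps_const (real (Suc n)) * (fps_deriv Pf * Pf ^ n)"
    by (simp add: fps_deriv_power mult_ac del: power_Suc)
  also have "fps_nth \<dots> k = real (Suc n) * (\<Sum>i\<le>k. real (Suc i) * p (Suc i) * PS n (k - i))"
    unfolding fps_mult_left_const_nth fps_mult_nth[of "fps_deriv Pf"] atLeast0AtMost fps_deriv_nth
    by (simp add: fps_nth_Pf)
  also have "(\<Sum>i\<le>k. real (Suc i) * p (Suc i) * PS n (k - i)) = (\<Sum>d\<le>s. real d * p d * PS n (s - d))"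
    unfolding Suc by (subst sum.atMost_Suc_shift) (simp del: sum.atMost_Suc)
  finally show ?thesis by simp
qed simp

text \<open>Opens the first tree of a forest: its root is removed and its d subtrees join the other
  r trees.\<close>

lemma TT_power_Suc:
  assumes "n \<le> N"
  shows "fps_nth (TT ^ Suc r) (Suc n) = (\<Sum>d\<le>N. p d * fps_nth (TT ^ (d + r)) n)"
proof -
  have "fps_nth (TT ^ Suc r) (Suc n) = (\<Sum>i\<le>n. mass (Suc i) * fps_nth (TT ^ r) (n - i))"
    unfolding power_Suc mult_nth_Suc_0[OF TT_0] by simp
  also have "\<dots> = (\<Sum>i\<le>n. \<Sum>d\<le>N. p d * fps_nth (TT ^ d) i * fps_nth (TT ^ r) (n - i))"
    using assms by (intro sum.cong refl, subst treesum_Suc[of _ N]) (simp_all add: fsum_one sum_distrib_right)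
  also have "\<dots> = (\<Sum>d\<le>N. \<Sum>i\<le>n. p d * fps_nth (TT ^ d) i * fps_nth (TT ^ r) (n - i))"
    by (rule sum.swap)
  also have "\<dots> = (\<Sum>d\<le>N. p d * fps_nth (TT ^ d * TT ^ r) n)"
    by (simp only: fps_mult_nth[of "TT ^ _"] atLeast0AtMost sum_distrib_left mult.assoc)
  finally show ?thesis by (simp add: power_add)
qed

text \<open>Opening the first tree lowers n by one; the weights d + q that the induction hypothesis
  leaves are summed by \<open>PS_exchange\<close>. This is the Otter-Dwass formula for the total
  progeny of r ancestors.\<close>

lemma kemperman:
  "r \<le> n \<Longrightarrow> real n * fps_nth (TT ^ r) n = real r * PS n (n - r)"
proof (induction n arbitrary: r)
  case (Suc n)
  show ?case
  proof (cases r)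
    case (Suc q)
    then have q: "q \<le> n" using Suc.prems by simp
    let ?s = "n - q"
    have s: "Suc n - r = ?s" using Suc by simp
    have T: "fps_nth (TT ^ r) (Suc n) = (\<Sum>d\<le>?s. p d * fps_nth (TT ^ (d + q)) n)"
      unfolding Suc TT_power_Suc[OF order_refl]
      by (rule sum.mono_neutral_right) (auto simp: TT_power_eq_0)
    show ?thesis
    \<comment> \<open>The induction hypothesis carries the factor n, so it is void at n = 0.\<close>
    proof (cases "n = 0")
      case True
      then show ?thesis using T q Suc by (simp add: Pf_def)
    next
      case False
      have "real n * fps_nth (TT ^ r) (Suc n) = (\<Sum>d\<le>?s. p d * (real n * fps_nth (TT ^ (d + q)) n))"
        unfolding T by (simp add: sum_distrib_left mult_ac)
      also have "\<dots> = (\<Sum>d\<le>?s. p d * (real (d + q) * PS n (?s - d)))"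
        using q by (intro sum.cong refl) (subst Suc.IH, auto simp: algebra_simps)
      also have "\<dots> = (\<Sum>d\<le>?s. real d * p d * PS n (?s - d)) + real q * PS (Suc n) ?s"
        unfolding PS_Suc by (simp add: sum_distrib_left sum.distrib algebra_simps)
      finally have "real (Suc n) * (real n * fps_nth (TT ^ r) (Suc n))
          = real (Suc n) * (\<Sum>d\<le>?s. real d * p d * PS n (?s - d)) + real (Suc n) * (real q * PS (Suc n) ?s)"
        by (simp only: distrib_left)
      also have "\<dots> = real ?s * PS (Suc n) ?s + real (Suc n) * (real q * PS (Suc n) ?s)"
        by (simp only: PS_exchange)
      also have "\<dots> = real n * (real r * PS (Suc n) ?s)"
        using q by (simp only: Suc) (simp add: of_nat_diff algebra_simps del: power_Suc)
      finally have "real n * (real (Suc n) * fps_nth (TT ^ r) (Suc n)) = real n * (real r * PS (Suc n) ?s)"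
        by (simp only: mult_ac)
      then show ?thesis using False unfolding s by (simp del: of_nat_Suc power_Suc)
    qed
  qed simp
qed (simp)

text \<open>First passage: a centred walk that sits at -r after n letters first completes r trees
  (\<open>TT ^ r\<close>) and then returns to the level reached (\<open>UU\<close>). The induction
  removes one letter at a time.\<close>

lemma UU_TT:
  "fps_nth (UU * TT ^ r) n = (if r \<le> n then PS n (n - r) else 0)"
proof (induction n arbitrary: r)
  case 0
  show ?case by (cases r) (simp_all add: UU_def)
next
  case (Suc n)
  show ?case
  proof (cases r)
    case 0 then show ?thesis by (simp add: UU_def del: power_Suc)
  next
    case (Suc q)
    have "fps_nth (UU * TT ^ r) (Suc n) = fps_nth (TT ^ r * UU) (Suc n)" by (simp only: mult.commute)
    also have "\<dots> = (\<Sum>i\<le>n. fps_nth (TT ^ Suc q) (Suc i) * fps_nth UU (n - i))"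
      unfolding Suc by (rule mult_nth_Suc_0) simp
    also have "\<dots> = (\<Sum>i\<le>n. \<Sum>d\<le>n. p d * (fps_nth (TT ^ (d + q)) i * fps_nth UU (n - i)))"
      by (intro sum.cong refl, subst TT_power_Suc[of _ n]) (simp_all add: sum_distrib_left mult_ac del: power_Suc)
    also have "\<dots> = (\<Sum>d\<le>n. \<Sum>i\<le>n. p d * (fps_nth (TT ^ (d + q)) i * fps_nth UU (n - i)))"
      by (rule sum.swap)
    also have "\<dots> = (\<Sum>d\<le>n. p d * fps_nth (UU * TT ^ (d + q)) n)"
      by (simp only: mult.commute[of UU] fps_mult_nth[of "TT ^ _"] sum_distrib_left atLeast0AtMost)
    also have "\<dots> = (\<Sum>d\<le>n. p d * (if d + q \<le> n then PS n (n - (d + q)) else 0))"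
      by (simp only: Suc.IH)
    also have "\<dots> = (if q \<le> n then \<Sum>d\<le>n - q. p d * PS n (n - q - d) else 0)"
      by (auto intro!: sum.mono_neutral_cong_right simp: algebra_simps split: if_splits)
    also have "\<dots> = (if q \<le> n then PS (Suc n) (n - q) else 0)" by (simp only: PS_Suc)
    finally show ?thesis by (simp add: Suc)
  qed
qed

text \<open>After \<open>UU_TT\<close>, a coefficient of \<open>Lam * UU\<close> is the mean of the
  first letter on the event S_n = n; by \<open>PS_exchange\<close> this letter may be replaced by
  its conditional mean 1.\<close>

lemma UU_eq: "UU = 1 + Lam * UU"
proof (rule fps_ext)
  fix n show "fps_nth UU n = fps_nth (1 + Lam * UU) n"
  proof (cases n)
    case 0 then show ?thesis by (simp add: UU_def)
  next
    case (Suc m)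
    have "fps_nth (Lam * UU) (Suc m) = (\<Sum>d\<le>Suc m. real d * p d * fps_nth (UU * TT ^ (d - 1)) m)"
      by (rule Lam_mult_Suc) simp
    also have "\<dots> = (\<Sum>d\<le>Suc m. real d * p d * PS m (Suc m - d))"
      by (intro sum.cong refl) (auto simp: UU_TT)
    also have "\<dots> = PS (Suc m) (Suc m)"
      using PS_exchange[of m "Suc m"] by (simp del: sum.atMost_Suc power_Suc of_nat_Suc)
    finally show ?thesis by (simp add: Suc UU_def del: power_Suc)
  qed
qed

lemma solve_renewal:
  assumes "X = Y + Lam * X"
  shows "X = Y * UU"
proof -
  have "Y = X * (1 - Lam)" using assms by (simp add: algebra_simps)
  moreover have "UU * (1 - Lam) = 1" using UU_eq by (simp add: algebra_simps)
  ultimately show ?thesis by (metis mult.assoc mult.commute mult.right_neutral)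
qed

lemma gf_additive: "gf (additive_functional f) = gf f * UU"
proof (rule solve_renewal)
  have "gf (additive_functional f) = gf f + gf (level_sum 1 (additive_functional f))"
    by (rule fps_ext, simp only: gf_nth fps_add_nth treesum_add[symmetric])
      (intro treesum_cong additive_functional_level1)
  then show "gf (additive_functional f) = gf f + Lam * gf (additive_functional f)"
    by (simp only: gf_level1)
qed

text \<open>As the functional G is g plus the sum of G over the children, its square is g (2G - g)
  plus the square of the child sum. The latter returns G^2 with factor \<open>Lam\<close> and the
  squared first moments with factor \<open>Lam2\<close>, so second moments again solve the renewal
  equation.\<close>

lemma gf_additive_square:
  "gf (\<lambda>T. (additive_functional g T)\<^sup>2)
    = (gf (\<lambda>T. g T * (2 * additive_functional g T - g T)) + Lam2 * (gf (additive_functional g))\<^sup>2) * UU"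
proof (rule solve_renewal)
  let ?G = "additive_functional g"
  have "(?G T)\<^sup>2 = g T * (2 * ?G T - g T) + (level_sum 1 ?G T)\<^sup>2" for T
    by (subst (1 2) additive_functional_level1) (simp add: power2_eq_square algebra_simps)
  then have "gf (\<lambda>T. (?G T)\<^sup>2) = gf (\<lambda>T. g T * (2 * ?G T - g T)) + gf (\<lambda>T. (level_sum 1 ?G T)\<^sup>2)"
    by (intro fps_ext) (simp only: gf_nth fps_add_nth treesum_add[symmetric])
  then show "gf (\<lambda>T. (?G T)\<^sup>2) = gf (\<lambda>T. g T * (2 * ?G T - g T)) + Lam2 * (gf ?G)\<^sup>2 + Lam * gf (\<lambda>T. (?G T)\<^sup>2)"
    by (simp only: gf_level1_square ac_simps)
qed

end

section \<open>Convolution estimates\<close>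

text \<open>The weight (n + 1)^(3/2), reciprocal to the decay of \<open>mass\<close>.\<close>

definition w3 :: "nat \<Rightarrow> real" where
  "w3 n = (real n + 1) * sqrt (real n + 1)"

lemma w3_pos [simp]: "0 < w3 n" by (simp add: w3_def)

lemma w3_double: assumes "n + 1 \<le> 2 * (m + 1)" shows "w3 n \<le> 3 * w3 m"
proof -
  have r: "real n + 1 \<le> 2 * (real m + 1)" using of_nat_mono[OF assms, where 'a = real] by simp
  have "sqrt (real n + 1) \<le> sqrt 2 * sqrt (real m + 1)"
    unfolding real_sqrt_mult[symmetric] using r by simp
  moreover have "sqrt 2 \<le> (3 / 2 :: real)" by (rule real_le_lsqrt) (simp_all add: power2_eq_square)
  ultimately have "sqrt (real n + 1) \<le> 3 / 2 * sqrt (real m + 1)"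
    by (meson mult_right_mono order_trans real_sqrt_ge_zero of_nat_0_le_iff add_nonneg_nonneg zero_le_one)
  then have "(real n + 1) * sqrt (real n + 1) \<le> (2 * (real m + 1)) * (3 / 2 * sqrt (real m + 1))"
    using r by (intro mult_mono) auto
  also have "\<dots> = 3 * ((real m + 1) * sqrt (real m + 1))" by (simp add: algebra_simps)
  finally show ?thesis by (simp add: w3_def)
qed

text \<open>Subadditive up to a factor, because the larger summand is at least half of the
  total.\<close>

lemma w3_add: "w3 (l + m) \<le> 3 * (w3 l + w3 m)"
proof (cases "l \<le> m")
  case True
  then have "w3 (l + m) \<le> 3 * w3 m" by (intro w3_double) simp
  then show ?thesis using w3_pos[of l] by argo
next
  case False
  then have "w3 (l + m) \<le> 3 * w3 l" by (intro w3_double) simp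
  then show ?thesis using w3_pos[of m] by argo
qed

lemma sum_inverse_sqrt: "(\<Sum>i<n. 1 / sqrt (real i + 1)) \<le> 2 * sqrt (real n)"
proof (induction n)
  case (Suc n)
  let ?a = "sqrt (real n)" and ?b = "sqrt (real n + 1)"
  have ab: "?b * ?b = real n + 1" "?a * ?a = real n" "0 \<le> ?a" "0 < ?b" "?a \<le> ?b" by auto
  have "1 / ?b \<le> 2 * ?b - 2 * ?a"
  proof -
    have "1 = (?b - ?a) * (?b + ?a)" using ab by (simp add: algebra_simps)
    also have "\<dots> \<le> (?b - ?a) * (2 * ?b)" using ab by (intro mult_left_mono) auto
    finally show ?thesis using ab by (simp add: field_simps)
  qed
  then show ?case using Suc by (simp add: add.commute)
qed simp

text \<open>For square roots of consecutive integers b - a is at least 1 / (2b), which makes 2 / a -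
  2 / b a telescoping majorant of 1 / b^3.\<close>

lemma inverse_cube_le:
  fixes a b :: real
  assumes "0 < a" "a \<le> b" "b * b = a * a + 1"
  shows "1 / (b * b * b) \<le> 2 / a - 2 / b"
proof -
  have b: "0 < b" using assms by linarith
  have "1 = (b - a) * (b + a)" using assms(3) by (simp add: algebra_simps)
  also have "\<dots> \<le> (b - a) * (2 * b)" using assms by (intro mult_left_mono) auto
  finally have "1 / b \<le> 2 * (b - a)" using b by (simp add: field_simps)
  then have "1 / b / (a * b) \<le> 2 * (b - a) / (a * b)" using assms b by (intro divide_right_mono) auto
  moreover have "1 / (b * b * b) \<le> 1 / b / (a * b)"
  proof -
    have "b * (a * b) \<le> b * b * b" using mult_right_mono[OF assms(2), of "b * b"] b by (simp add: mult_ac)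
    then show ?thesis unfolding divide_divide_eq_left using assms(1) b by (intro divide_left_mono) auto
  qed
  moreover have "2 * (b - a) / (a * b) = 2 / a - 2 / b" using assms b by (simp add: field_simps)
  ultimately show ?thesis by linarith
qed

lemma sum_inverse_w3: assumes "0 < m" shows "(\<Sum>i\<in>{m..<m + n}. 1 / w3 i) \<le> 2 / sqrt (real m) - 2 / sqrt (real (m + n))"
proof (induction n)
  case (Suc n)
  let ?k = "real (m + n)"
  let ?a = "sqrt ?k" and ?b = "sqrt (?k + 1)"
  have ab: "?b * ?b = ?k + 1" "?a * ?a = ?k" "0 < ?a" "0 < ?b" "?a \<le> ?b" using assms by auto
  have "1 / w3 (m + n) = 1 / (?b * ?b * ?b)" using ab by (simp add: w3_def)
  also have "\<dots> \<le> 2 / ?a - 2 / ?b" using ab by (intro inverse_cube_le) auto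
  finally show ?case using Suc by (simp add: add.commute add.left_commute)
qed simp

lemma sum_inverse_w3': assumes "0 < m" shows "(\<Sum>i\<in>{m..<n}. 1 / w3 i) \<le> 2 / sqrt (real m)"
proof (cases "m \<le> n")
  case True
  then have "(\<Sum>i\<in>{m..<n}. 1 / w3 i) \<le> 2 / sqrt (real m) - 2 / sqrt (real n)"
    using sum_inverse_w3[OF assms, of "n - m"] by simp
  moreover have "0 \<le> 2 / sqrt (real n)" by simp
  ultimately show ?thesis by linarith
qed simp

lemma summable_inverse_w3: "summable (\<lambda>i. 1 / w3 i)"
proof (rule bounded_imp_summable)
  fix n
  have "(\<Sum>i\<le>n. 1 / w3 i) = 1 / w3 0 + (\<Sum>i\<in>{1..<Suc n}. 1 / w3 i)"
    by (simp add: lessThan_Suc_atMost[symmetric] lessThan_atLeast0 sum.atLeast_Suc_lessThan del: sum.op_ivl_Suc)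
  also have "\<dots> \<le> 1 + 2" using sum_inverse_w3'[of 1 "Suc n"] by (intro add_mono) (simp_all add: w3_def)
  finally show "(\<Sum>i\<le>n. 1 / w3 i) \<le> 3" by simp
qed (simp add: less_imp_le)

lemma suminf_tail_w3: "(\<Sum>i. 1 / w3 (i + Suc l)) \<le> 2 / sqrt (real l + 1)"
proof (rule suminf_le_const)
  show "summable (\<lambda>i. 1 / w3 (i + Suc l))" using summable_inverse_w3 by (rule summable_ignore_initial_segment)
  fix n
  have "(\<Sum>i<n. 1 / w3 (i + Suc l)) = (\<Sum>i\<in>{Suc l..<Suc l + n}. 1 / w3 i)"
    by (rule sum.reindex_bij_witness[of _ "\<lambda>i. i - Suc l" "\<lambda>i. i + Suc l"]) auto
  also have "\<dots> \<le> 2 / sqrt (real (Suc l))" by (rule sum_inverse_w3') simp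
  finally show "(\<Sum>i<n. 1 / w3 (i + Suc l)) \<le> 2 / sqrt (real l + 1)" by (simp add: add.commute)
qed

lemma sum_inverse_sqrt_reflect: "(\<Sum>j\<le>l. 1 / sqrt (real (l - j) + 1)) \<le> 2 * sqrt (real l + 1)"
proof -
  have "(\<Sum>j\<le>l. 1 / sqrt (real (l - j) + 1)) = (\<Sum>i<Suc l. 1 / sqrt (real i + 1))"
    by (rule sum.reindex_bij_witness[of _ "\<lambda>i. l - i" "\<lambda>i. l - i"]) auto
  then show ?thesis using sum_inverse_sqrt[of "Suc l"] by (simp add: add.commute)
qed

text \<open>The decay of local probabilities of a random walk in the number of steps, with one
  derivative: n^(-1/2) for the values and n^(-3/2) for the increments.\<close>

definition root_decay :: "real \<Rightarrow> (nat \<Rightarrow> real) \<Rightarrow> bool" where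
  "root_decay C u \<longleftrightarrow> (\<forall>i. \<bar>u i\<bar> \<le> C / sqrt (real i + 1)) \<and> (\<forall>i. \<bar>u (Suc i) - u i\<bar> \<le> C / w3 i)"

lemma root_decayD:
  assumes "root_decay C u"
  shows "\<bar>u i\<bar> \<le> C / sqrt (real i + 1)" "\<bar>u (Suc i) - u i\<bar> \<le> C / w3 i" "0 \<le> C"
proof -
  show *: "\<bar>u i\<bar> \<le> C / sqrt (real i + 1)" "\<bar>u (Suc i) - u i\<bar> \<le> C / w3 i" for i
    using assms by (auto simp: root_decay_def)
  show "0 \<le> C" using *(1)[of 0] by simp
qed

lemma root_decay_diff:
  assumes "root_decay C u" "2 * j \<le> l"
  shows "\<bar>u (l - j) - u l\<bar> \<le> 3 * C * real j / w3 l"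
proof -
  note u = root_decayD[OF assms(1)]
  have "\<bar>u (l - j) - u l\<bar> = \<bar>\<Sum>i\<in>{l - j..<l}. u (Suc i) - u i\<bar>"
    by (subst sum_Suc_diff'[of "l - j" l u]) (auto simp: abs_minus_commute)
  also have "\<dots> \<le> (\<Sum>i\<in>{l - j..<l}. 3 * C / w3 l)"
  proof (intro order_trans[OF sum_abs] sum_mono)
    fix i assume "i \<in> {l - j..<l}"
    then have "l + 1 \<le> 2 * (i + 1)" using assms(2) by auto
    then have "w3 l \<le> 3 * w3 i" by (rule w3_double)
    then have "C / (3 * w3 i) \<le> C / w3 l" using u(3) by (intro divide_left_mono) auto
    then show "\<bar>u (Suc i) - u i\<bar> \<le> 3 * C / w3 l" using u(2)[of i] by simp
  qed
  also have "\<dots> = 3 * C * real j / w3 l" using assms(2) by simp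
  finally show ?thesis .
qed

lemma root_decay_diff':
  assumes "root_decay C u" "j \<le> l"
  shows "\<bar>u (l - j) - u l\<bar> \<le> 2 * C / sqrt (real (l - j) + 1)"
proof -
  note u = root_decayD[OF assms(1)]
  have "C / sqrt (real l + 1) \<le> C / sqrt (real (l - j) + 1)"
    using u(3) by (intro divide_left_mono) auto
  then show ?thesis using u(1)[of l] u(1)[of "l - j"] by simp
qed

section \<open>Convolution with kernels of root decay\<close>

lemma summable_w3:
  assumes "\<And>j. \<bar>a j\<bar> \<le> N / w3 j"
  shows "summable (\<lambda>j. \<bar>a j\<bar>)"
  by (rule summable_comparison_test'[where g = "\<lambda>j. N * (1 / w3 j)" and N = 0])
    (use assms summable_mult[OF summable_inverse_w3, of N] in auto)

lemma convolution_expand: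
  fixes a u :: "nat \<Rightarrow> real"
  assumes "summable (\<lambda>j. \<bar>a j\<bar>)"
  shows "(\<Sum>j\<le>l. a j * u (l - j)) - (\<Sum>j. a j) * u l
      = (\<Sum>j\<le>l. a j * (u (l - j) - u l)) - u l * (\<Sum>j. a (j + Suc l))"
proof -
  have "(\<Sum>j. a j) = (\<Sum>j. a (j + Suc l)) + (\<Sum>j\<le>l. a j)"
    using suminf_split_initial_segment[OF summable_rabs_cancel[OF assms], of "Suc l"]
    by (simp add: lessThan_Suc_atMost)
  then show ?thesis by (simp add: algebra_simps sum_subtractf sum_distrib_right sum_distrib_left)
qed

text \<open>For j up to l / 2 the increments of \<open>u\<close> are small, for larger j the values
  of \<open>a\<close>. Either half is of order 1 / l, better than \<open>u l\<close> by a factor of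
  order sqrt l.\<close>

lemma convolution_root_decay:
  assumes u: "root_decay C u" and a: "\<And>j. \<bar>a j\<bar> \<le> N / w3 j"
  shows "\<bar>(\<Sum>j\<le>l. a j * u (l - j)) - (\<Sum>j. a j) * u l\<bar> \<le> 20 * C * N / (real l + 1)"
proof -
  note u' = root_decayD[OF u]
  have N: "0 \<le> N" using a[of 0] by (simp add: w3_def)
  note sa = summable_w3[OF a]
  let ?r = "sqrt (real l + 1)"
  have r: "?r * ?r = real l + 1" "0 < ?r" by auto
  have tail: "\<bar>u l * (\<Sum>j. a (j + Suc l))\<bar> \<le> 2 * C * N / (real l + 1)"
  proof -
    have "\<bar>\<Sum>j. a (j + Suc l)\<bar> \<le> (\<Sum>j. \<bar>a (j + Suc l)\<bar>)"
      by (rule summable_rabs[OF summable_ignore_initial_segment[OF sa]])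
    also have "\<dots> \<le> (\<Sum>j. N * (1 / w3 (j + Suc l)))"
      by (intro suminf_le summable_mult summable_ignore_initial_segment summable_inverse_w3
          summable_ignore_initial_segment[OF sa]) (use a in simp)
    also have "\<dots> = N * (\<Sum>j. 1 / w3 (j + Suc l))"
      by (intro suminf_mult summable_ignore_initial_segment summable_inverse_w3)
    also have "\<dots> \<le> N * (2 / ?r)" using suminf_tail_w3[of l] N by (intro mult_left_mono) auto
    finally have "\<bar>u l\<bar> * \<bar>\<Sum>j. a (j + Suc l)\<bar> \<le> (C / ?r) * (N * (2 / ?r))"
      using u'(1)[of l] u'(3) by (intro mult_mono) auto
    also have "\<dots> = 2 * C * N / (?r * ?r)" by (simp add: field_simps)
    finally show ?thesis by (simp only: r abs_mult)
  qed
  \<comment> \<open>The bounds for the two ranges are added in either case, so that one majorant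
    serves all j.\<close>
  have main: "\<bar>a j * (u (l - j) - u l)\<bar>
      \<le> 3 * C * N / w3 l * (1 / sqrt (real j + 1)) + 6 * C * N / w3 l * (1 / sqrt (real (l - j) + 1))"
    if j: "j \<le> l" for j
  proof (cases "2 * j \<le> l")
    case True
    have "\<bar>a j * (u (l - j) - u l)\<bar> \<le> (N / w3 j) * (3 * C * real j / w3 l)"
      unfolding abs_mult by (intro mult_mono root_decay_diff[OF u True] a) (use N u'(3) in \<open>auto intro!: divide_nonneg_pos\<close>)
    also have "\<dots> \<le> (N / w3 j) * (3 * C * (real j + 1) / w3 l)"
      using N u'(3) by (intro mult_left_mono divide_right_mono) (auto simp: less_imp_le)
    also have "\<dots> = 3 * C * N / w3 l * (1 / sqrt (real j + 1))"
    proof -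
      have "(N / ((x) * y)) * (3 * C * x / w) = 3 * C * N / w * (1 / y)" if "0 < x" for x y w :: real
        using that by (simp add: mult_ac)
      from this[of "real j + 1" "sqrt (real j + 1)" "w3 l"] show ?thesis unfolding w3_def[of j] by simp
    qed
    finally show ?thesis using N u'(3) w3_pos[of l]
      by (smt (verit, best) divide_nonneg_nonneg mult_nonneg_nonneg real_sqrt_ge_zero of_nat_0_le_iff)
  next
    case False
    then have "w3 l \<le> 3 * w3 j" by (intro w3_double) simp
    then have "N / (3 * w3 j) \<le> N / w3 l" using N by (intro divide_left_mono) auto
    then have "\<bar>a j\<bar> \<le> 3 * N / w3 l" using a[of j] by simp
    then have "\<bar>a j * (u (l - j) - u l)\<bar> \<le> (3 * N / w3 l) * (2 * C / sqrt (real (l - j) + 1))"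
      unfolding abs_mult by (intro mult_mono root_decay_diff'[OF u j]) (use N in auto)
    also have "\<dots> = 6 * C * N / w3 l * (1 / sqrt (real (l - j) + 1))" by simp
    finally show ?thesis using N u'(3) w3_pos[of l]
      by (smt (verit, best) divide_nonneg_nonneg mult_nonneg_nonneg real_sqrt_ge_zero of_nat_0_le_iff)
  qed
  have "\<bar>\<Sum>j\<le>l. a j * (u (l - j) - u l)\<bar>
      \<le> (\<Sum>j\<le>l. 3 * C * N / w3 l * (1 / sqrt (real j + 1)) + 6 * C * N / w3 l * (1 / sqrt (real (l - j) + 1)))"
    by (intro order_trans[OF sum_abs] sum_mono main) simp
  also have "\<dots> = 3 * C * N / w3 l * (\<Sum>j<Suc l. 1 / sqrt (real j + 1)) + 6 * C * N / w3 l * (\<Sum>j\<le>l. 1 / sqrt (real (l - j) + 1))"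
    by (simp only: sum.distrib sum_distrib_left lessThan_Suc_atMost)
  also have "\<dots> \<le> 3 * C * N / w3 l * (2 * ?r) + 6 * C * N / w3 l * (2 * ?r)"
    using N u'(3) sum_inverse_sqrt[of "Suc l"] sum_inverse_sqrt_reflect[of l]
    by (intro add_mono mult_left_mono) (auto simp: less_imp_le add.commute simp del: sum.lessThan_Suc)
  also have "\<dots> = 18 * C * N / (real l + 1)"
  proof -
    have "3 * z / (x * y) * (2 * y) + 6 * z / (x * y) * (2 * y) = 18 * z / x" if "0 < y" for x y z :: real
      using that by (simp add: add_divide_distrib[symmetric])
    from this[of ?r "C * N" "real l + 1"] show ?thesis unfolding w3_def by (simp add: mult.assoc)
  qed
  finally have m: "\<bar>\<Sum>j\<le>l. a j * (u (l - j) - u l)\<bar> \<le> 18 * C * N / (real l + 1)" .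
  show ?thesis unfolding convolution_expand[OF sa]
  proof -
    have "18 * C * N / (real l + 1) + 2 * C * N / (real l + 1) = 20 * C * N / (real l + 1)"
      by (simp add: add_divide_distrib[symmetric])
    then show "\<bar>(\<Sum>j\<le>l. a j * (u (l - j) - u l)) - u l * (\<Sum>j. a (j + Suc l))\<bar> \<le> 20 * C * N / (real l + 1)"
      using tail m by linarith
  qed
qed

text \<open>Total sum zero allows u (l - j) to be replaced by its difference to u l. Summed over l,
  these differences cost only sqrt j: between j and 2j the values of \<open>u\<close> are summed,
  beyond 2j its increments.\<close>

lemma convolution_root_decay_sum:
  assumes u: "root_decay C u" and sa: "summable (\<lambda>j. sqrt (real j + 1) * \<bar>a j\<bar>)"
    and a0: "(\<Sum>j. a j) = 0"
  shows "(\<Sum>l\<le>L. \<bar>\<Sum>j\<le>l. a j * u (l - j)\<bar>) \<le> 12 * C * (\<Sum>j. sqrt (real j + 1) * \<bar>a j\<bar>)"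
proof -
  note u' = root_decayD[OF u]
  have saa: "summable (\<lambda>j. \<bar>a j\<bar>)"
  proof (rule summable_comparison_test'[OF sa, of 0])
    fix n :: nat
    have "1 * \<bar>a n\<bar> \<le> sqrt (real n + 1) * \<bar>a n\<bar>" by (intro mult_right_mono) auto
    then show "norm \<bar>a n\<bar> \<le> sqrt (real n + 1) * \<bar>a n\<bar>" by simp
  qed
  let ?S = "\<Sum>j. sqrt (real j + 1) * \<bar>a j\<bar>"
  \<comment> \<open>The range up to 2j contributes 4 and the range beyond it 6 to the
    constant.\<close>
  have inner: "(\<Sum>l\<in>{j..L}. \<bar>u (l - j) - u l\<bar>) \<le> 10 * C * sqrt (real j + 1)" for j
  proof (cases "j = 0")
    case True then show ?thesis using u'(3) by simp
  next
    case False
    have "(\<Sum>l\<in>{j..L}. \<bar>u (l - j) - u l\<bar>) \<le> (\<Sum>l\<in>{j..<2*j} \<union> {2*j..<Suc L}. \<bar>u (l - j) - u l\<bar>)"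
      by (intro sum_mono2) auto
    also have "\<dots> \<le> (\<Sum>l\<in>{j..<2*j}. \<bar>u (l - j) - u l\<bar>) + (\<Sum>l\<in>{2*j..<Suc L}. \<bar>u (l - j) - u l\<bar>)"
      by (subst sum.union_disjoint) auto
    also have "(\<Sum>l\<in>{j..<2*j}. \<bar>u (l - j) - u l\<bar>) \<le> (\<Sum>l\<in>{j..<2*j}. 2 * C * (1 / sqrt (real (l - j) + 1)))"
      by (intro sum_mono) (use root_decay_diff'[OF u] in auto)
    also have "\<dots> = 2 * C * (\<Sum>i<j. 1 / sqrt (real i + 1))"
      unfolding sum_distrib_left by (rule sum.reindex_bij_witness[of _ "\<lambda>i. i + j" "\<lambda>i. i - j"]) auto
    also have "\<dots> \<le> 2 * C * (2 * sqrt (real j))" using u'(3) sum_inverse_sqrt by (intro mult_left_mono) auto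
    also have "(\<Sum>l\<in>{2*j..<Suc L}. \<bar>u (l - j) - u l\<bar>) \<le> (\<Sum>l\<in>{2*j..<Suc L}. 3 * C * real j * (1 / w3 l))"
      by (intro sum_mono) (use root_decay_diff[OF u] in auto)
    also have "\<dots> \<le> 3 * C * real j * (2 / sqrt (real (2 * j)))"
      unfolding sum_distrib_left[symmetric] using u'(3) False by (intro mult_left_mono sum_inverse_w3') auto
    also have "\<dots> \<le> 3 * C * real j * (2 / sqrt (real j))"
      using u'(3) False by (intro mult_left_mono divide_left_mono) auto
    also have "\<dots> = 6 * C * sqrt (real j)"
      using False by (simp add: field_simps)
    finally have "(\<Sum>l\<in>{j..L}. \<bar>u (l - j) - u l\<bar>) \<le> 10 * C * sqrt (real j)" by simp
    also have "\<dots> \<le> 10 * C * sqrt (real j + 1)" using u'(3) by (intro mult_left_mono) auto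
    finally show ?thesis .
  qed
  have first: "(\<Sum>l\<le>L. \<Sum>j\<le>l. \<bar>a j\<bar> * \<bar>u (l - j) - u l\<bar>) \<le> 10 * C * ?S"
  proof -
    have "(\<Sum>l\<le>L. \<Sum>j\<le>l. \<bar>a j\<bar> * \<bar>u (l - j) - u l\<bar>) = (\<Sum>j\<le>L. \<Sum>l\<in>{j..L}. \<bar>a j\<bar> * \<bar>u (l - j) - u l\<bar>)"
      unfolding sum.Sigma[OF finite_atMost ballI[OF finite_atMost]] sum.Sigma[OF finite_atMost ballI[OF finite_atLeastAtMost]]
      by (rule sum.reindex_bij_witness[of _ "\<lambda>(j, l). (l, j)" "\<lambda>(l, j). (j, l)"]) auto
    also have "\<dots> \<le> (\<Sum>j\<le>L. \<bar>a j\<bar> * (10 * C * sqrt (real j + 1)))"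
      unfolding sum_distrib_left[symmetric] by (intro sum_mono mult_left_mono inner) auto
    also have "\<dots> = 10 * C * (\<Sum>j\<le>L. sqrt (real j + 1) * \<bar>a j\<bar>)"
      by (simp add: sum_distrib_left mult_ac)
    also have "\<dots> \<le> 10 * C * ?S"
      using u'(3) by (intro mult_left_mono sum_le_suminf sa) auto
    finally show ?thesis .
  qed
  \<comment> \<open>The tail of \<open>a\<close> beyond l is weighted by u l; for each j the sum of
    \<open>u\<close> over l < j is at most 2 C sqrt j.\<close>
  have second: "(\<Sum>l\<le>L. \<bar>u l\<bar> * (\<Sum>j. \<bar>a (j + Suc l)\<bar>)) \<le> 2 * C * ?S"
  proof -
    have tl: "(\<Sum>j. \<bar>a (j + Suc l)\<bar>) = (\<Sum>j. if l < j then \<bar>a j\<bar> else 0)"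
      and stl: "summable (\<lambda>j. if l < j then \<bar>a j\<bar> else 0)" for l
    proof -
      show s: "summable (\<lambda>j. if l < j then \<bar>a j\<bar> else 0)"
        by (rule summable_comparison_test'[OF saa, of 0]) auto
      show "(\<Sum>j. \<bar>a (j + Suc l)\<bar>) = (\<Sum>j. if l < j then \<bar>a j\<bar> else 0)"
        using suminf_split_initial_segment[OF s, of "Suc l"] by simp
    qed
    have "(\<Sum>l\<le>L. \<bar>u l\<bar> * (\<Sum>j. \<bar>a (j + Suc l)\<bar>)) = (\<Sum>l\<le>L. \<Sum>j. \<bar>u l\<bar> * (if l < j then \<bar>a j\<bar> else 0))"
      unfolding tl by (intro sum.cong refl suminf_mult[symmetric] stl)
    also have "\<dots> = (\<Sum>j. \<Sum>l\<le>L. \<bar>u l\<bar> * (if l < j then \<bar>a j\<bar> else 0))"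
      by (intro suminf_sum[symmetric] summable_mult stl)
    also have "\<dots> \<le> (\<Sum>j. 2 * C * (sqrt (real j + 1) * \<bar>a j\<bar>))"
    proof (intro suminf_le summable_mult sa summable_sum stl)
      fix j
      have "(\<Sum>l\<le>L. \<bar>u l\<bar> * (if l < j then \<bar>a j\<bar> else 0)) = \<bar>a j\<bar> * (\<Sum>l\<in>{..L} \<inter> {..<j}. \<bar>u l\<bar>)"
        unfolding sum_distrib_left by (intro sum.mono_neutral_cong_right) auto
      then have e: "(\<Sum>l\<le>L. \<bar>u l\<bar> * (if l < j then \<bar>a j\<bar> else 0)) = \<bar>a j\<bar> * (\<Sum>l\<in>{..L} \<inter> {..<j}. \<bar>u l\<bar>)" .
      have "(\<Sum>l\<in>{..L} \<inter> {..<j}. \<bar>u l\<bar>) \<le> (\<Sum>l<j. \<bar>u l\<bar>)" by (intro sum_mono2) auto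
      also have "\<dots> \<le> (\<Sum>l<j. C * (1 / sqrt (real l + 1)))" by (intro sum_mono) (use u'(1) in simp)
      also have "\<dots> \<le> C * (2 * sqrt (real j))"
        unfolding sum_distrib_left[symmetric] using u'(3) by (intro mult_left_mono sum_inverse_sqrt) auto
      also have "\<dots> \<le> C * (2 * sqrt (real j + 1))" using u'(3) by (intro mult_left_mono) auto
      finally have "\<bar>a j\<bar> * (\<Sum>l\<in>{..L} \<inter> {..<j}. \<bar>u l\<bar>) \<le> \<bar>a j\<bar> * (C * (2 * sqrt (real j + 1)))"
        by (rule mult_left_mono) simp
      then show "(\<Sum>l\<le>L. \<bar>u l\<bar> * (if l < j then \<bar>a j\<bar> else 0)) \<le> 2 * C * (sqrt (real j + 1) * \<bar>a j\<bar>)"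
        unfolding e by (simp add: mult_ac)
    qed
    also have "\<dots> = 2 * C * ?S" by (intro suminf_mult sa)
    finally show ?thesis .
  qed
  have "(\<Sum>l\<le>L. \<bar>\<Sum>j\<le>l. a j * u (l - j)\<bar>)
      \<le> (\<Sum>l\<le>L. (\<Sum>j\<le>l. \<bar>a j\<bar> * \<bar>u (l - j) - u l\<bar>) + \<bar>u l\<bar> * (\<Sum>j. \<bar>a (j + Suc l)\<bar>))"
  proof (rule sum_mono)
    fix l
    have "\<bar>\<Sum>j\<le>l. a j * u (l - j)\<bar> = \<bar>(\<Sum>j\<le>l. a j * (u (l - j) - u l)) - u l * (\<Sum>j. a (j + Suc l))\<bar>"
      unfolding convolution_expand[OF saa, where l = l and u = u, symmetric] a0 by simp
    also have "\<dots> \<le> \<bar>\<Sum>j\<le>l. a j * (u (l - j) - u l)\<bar> + \<bar>u l * (\<Sum>j. a (j + Suc l))\<bar>"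
      by (rule abs_triangle_ineq4)
    also have "\<dots> \<le> (\<Sum>j\<le>l. \<bar>a j\<bar> * \<bar>u (l - j) - u l\<bar>) + \<bar>u l\<bar> * (\<Sum>j. \<bar>a (j + Suc l)\<bar>)"
    proof (rule add_mono)
      show "\<bar>\<Sum>j\<le>l. a j * (u (l - j) - u l)\<bar> \<le> (\<Sum>j\<le>l. \<bar>a j\<bar> * \<bar>u (l - j) - u l\<bar>)"
        by (rule order_trans[OF sum_abs]) (simp add: abs_mult)
      show "\<bar>u l * (\<Sum>j. a (j + Suc l))\<bar> \<le> \<bar>u l\<bar> * (\<Sum>j. \<bar>a (j + Suc l)\<bar>)"
        unfolding abs_mult by (intro mult_left_mono summable_rabs summable_ignore_initial_segment[OF saa]) simp
    qed
    finally show "\<bar>\<Sum>j\<le>l. a j * u (l - j)\<bar>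
        \<le> (\<Sum>j\<le>l. \<bar>a j\<bar> * \<bar>u (l - j) - u l\<bar>) + \<bar>u l\<bar> * (\<Sum>j. \<bar>a (j + Suc l)\<bar>)" .
  qed
  also have "\<dots> \<le> 10 * C * ?S + 2 * C * ?S" unfolding sum.distrib by (intro add_mono first second)
  finally show ?thesis by simp
qed

text \<open>For k up to n / 2 the factor u (n - k) is of order n^(-1/2) and the sums of \<tau>
  suffice; for larger k the harmonic bound on \<tau> is summed against \<open>u\<close>. In contrast
  to the estimates above, no cancellation takes place.\<close>

lemma convolution_harmonic_root:
  assumes u: "\<And>i. \<bar>u i\<bar> \<le> C / sqrt (real i + 1)"
    and s: "\<And>n. (\<Sum>k\<le>n. \<bar>\<tau> k\<bar>) \<le> \<delta>" and h: "\<And>k. (real k + 1) * \<bar>\<tau> k\<bar> \<le> \<delta>"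
  shows "\<bar>\<Sum>k\<le>n. \<tau> k * u (n - k)\<bar> \<le> 6 * C * \<delta> / sqrt (real n + 1)"
proof -
  let ?r = "sqrt (real n + 1)"
  have r: "?r * ?r = real n + 1" "0 < ?r" by auto
  have C: "0 \<le> C" using u[of 0] by simp
  have d: "0 \<le> \<delta>" using s[of 0] by simp
  have main: "\<bar>\<tau> k * u (n - k)\<bar> \<le> 2 * C / ?r * \<bar>\<tau> k\<bar> + 2 * \<delta> * C / (real n + 1) * (1 / sqrt (real (n - k) + 1))"
    if k: "k \<le> n" for k
  proof (cases "2 * k \<le> n")
    case True
    have "?r \<le> sqrt (4 * (real (n - k) + 1))" using True by simp
    also have "\<dots> = 2 * sqrt (real (n - k) + 1)" unfolding real_sqrt_mult by simp
    finally have "C / (2 * sqrt (real (n - k) + 1)) \<le> C / ?r" using C by (intro divide_left_mono) auto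
    then have "\<bar>u (n - k)\<bar> \<le> 2 * C / ?r" using u[of "n - k"] by simp
    then have "\<bar>\<tau> k * u (n - k)\<bar> \<le> \<bar>\<tau> k\<bar> * (2 * C / ?r)" unfolding abs_mult by (intro mult_left_mono) auto
    moreover have "0 \<le> 2 * \<delta> * C / (real n + 1) * (1 / sqrt (real (n - k) + 1))" using C d by simp
    ultimately show ?thesis by (simp add: mult_ac)
  next
    case False
    then have "(real n + 1) * \<bar>\<tau> k\<bar> \<le> (2 * (real k + 1)) * \<bar>\<tau> k\<bar>" by (intro mult_right_mono) auto
    with h[of k] have "(real n + 1) * \<bar>\<tau> k\<bar> \<le> 2 * \<delta>" by linarith
    then have "\<bar>\<tau> k\<bar> \<le> 2 * \<delta> / (real n + 1)" by (simp add: pos_le_divide_eq mult.commute)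
    then have "\<bar>\<tau> k * u (n - k)\<bar> \<le> (2 * \<delta> / (real n + 1)) * (C / sqrt (real (n - k) + 1))"
      unfolding abs_mult using d by (intro mult_mono u) auto
    also have "\<dots> = 2 * \<delta> * C / (real n + 1) * (1 / sqrt (real (n - k) + 1))" by simp
    moreover have "0 \<le> 2 * C / ?r * \<bar>\<tau> k\<bar>" using C by simp
    ultimately show ?thesis by linarith
  qed
  have "\<bar>\<Sum>k\<le>n. \<tau> k * u (n - k)\<bar>
      \<le> (\<Sum>k\<le>n. 2 * C / ?r * \<bar>\<tau> k\<bar> + 2 * \<delta> * C / (real n + 1) * (1 / sqrt (real (n - k) + 1)))"
    by (intro order_trans[OF sum_abs] sum_mono main) simp
  also have "\<dots> = 2 * C / ?r * (\<Sum>k\<le>n. \<bar>\<tau> k\<bar>) + 2 * \<delta> * C / (real n + 1) * (\<Sum>k\<le>n. 1 / sqrt (real (n - k) + 1))"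
    by (simp only: sum.distrib sum_distrib_left)
  also have "\<dots> \<le> 2 * C / ?r * \<delta> + 2 * \<delta> * C / (real n + 1) * (2 * ?r)"
    using C d s[of n] sum_inverse_sqrt_reflect[of n] by (intro add_mono mult_left_mono) auto
  also have "\<dots> = 6 * C * \<delta> / ?r"
  proof -
    have "2 * \<delta> * C / (real n + 1) * (2 * ?r) = 2 * \<delta> * C / (?r * ?r) * (2 * ?r)" by (simp only: r)
    also have "\<dots> = 4 * C * \<delta> / ?r" using r(2) by (simp add: field_simps)
    finally show ?thesis by (simp add: add_divide_distrib[symmetric])
  qed
  finally show ?thesis .
qed

subsection \<open>Power series with controlled coefficients\<close>

text \<open>A norm for nonnegative coefficients that bounds partial sums and weighted suprema at
  once; the product rule \<open>controlled_mult\<close> uses each part for one factor.\<close>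

definition controlled :: "(nat \<Rightarrow> real) \<Rightarrow> real fps \<Rightarrow> real \<Rightarrow> bool" where
  "controlled \<omega> X \<epsilon> \<longleftrightarrow> (\<forall>n. 0 \<le> fps_nth X n) \<and> (\<forall>n. (\<Sum>k\<le>n. fps_nth X k) \<le> \<epsilon>) \<and> (\<forall>n. \<omega> n * fps_nth X n \<le> \<epsilon>)"

lemma controlledD:
  assumes "controlled \<omega> X \<epsilon>"
  shows "0 \<le> fps_nth X n" "(\<Sum>k\<le>n. fps_nth X k) \<le> \<epsilon>" "\<omega> n * fps_nth X n \<le> \<epsilon>" "0 \<le> \<epsilon>"
proof -
  show *: "0 \<le> fps_nth X n" "(\<Sum>k\<le>n. fps_nth X k) \<le> \<epsilon>" "\<omega> n * fps_nth X n \<le> \<epsilon>" for n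
    using assms by (auto simp: controlled_def)
  show "0 \<le> \<epsilon>" using *(1,2)[of 0] by simp
qed

lemma controlled_mono: "controlled \<omega> X \<epsilon> \<Longrightarrow> \<epsilon> \<le> \<delta> \<Longrightarrow> controlled \<omega> X \<delta>"
  unfolding controlled_def by (meson order_trans)

lemma fps_mult_nonneg:
  "(\<And>n. 0 \<le> fps_nth X n) \<Longrightarrow> (\<And>n. 0 \<le> fps_nth Y n) \<Longrightarrow> 0 \<le> fps_nth (X * Y) n" for X Y :: "real fps"
  unfolding fps_mult_nth by (intro sum_nonneg) auto

lemma fps_mult_partial_sum:
  fixes X Y :: "real fps"
  assumes X: "\<And>n. 0 \<le> fps_nth X n" and Y: "\<And>n. 0 \<le> fps_nth Y n"
    and x: "(\<Sum>k\<le>n. fps_nth X k) \<le> x" and y: "(\<Sum>k\<le>n. fps_nth Y k) \<le> y"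
  shows "(\<Sum>k\<le>n. fps_nth (X * Y) k) \<le> x * y"
proof -
  have yn: "(\<Sum>j\<le>n - i. fps_nth Y j) \<le> y" for i
    by (rule order_trans[OF _ y], rule sum_mono2) (auto intro: Y)
  have y0: "0 \<le> y" using y by (rule order_trans[rotated]) (auto intro: sum_nonneg Y)
  have "(\<Sum>k\<le>n. fps_nth (X * Y) k) = (\<Sum>(k, i)\<in>(SIGMA k:{..n}. {..k}). fps_nth X i * fps_nth Y (k - i))"
    by (simp add: fps_mult_nth atLeast0AtMost sum.Sigma)
  also have "\<dots> = (\<Sum>(i, j)\<in>(SIGMA i:{..n}. {..n - i}). fps_nth X i * fps_nth Y j)"
    by (rule sum.reindex_bij_witness[of _ "\<lambda>(i, j). (i + j, i)" "\<lambda>(k, i). (i, k - i)"]) auto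
  also have "\<dots> = (\<Sum>i\<le>n. fps_nth X i * (\<Sum>j\<le>n - i. fps_nth Y j))"
    by (simp add: sum.Sigma[symmetric] sum_distrib_left)
  also have "\<dots> \<le> (\<Sum>i\<le>n. fps_nth X i * y)" by (intro sum_mono mult_left_mono yn X)
  also have "\<dots> = (\<Sum>i\<le>n. fps_nth X i) * y" by (simp add: sum_distrib_right)
  also have "\<dots> \<le> x * y" using x y0 by (rule mult_right_mono)
  finally show ?thesis .
qed

text \<open>The weight of n passes to one of the two factors, whose weighted supremum is then
  multiplied by the partial sums of the other.\<close>

lemma controlled_mult:
  assumes \<omega>: "\<And>l m. \<omega> (l + m) \<le> A * (\<omega> l + \<omega> m)" and A: "1 \<le> A"
    and X: "controlled \<omega> X \<epsilon>" and Y: "controlled \<omega> Y \<delta>"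
  shows "controlled \<omega> (X * Y) (2 * A * (\<epsilon> * \<delta>))"
  unfolding controlled_def
proof (intro conjI allI)
  note x = controlledD[OF X] and y = controlledD[OF Y]
  fix n
  show "0 \<le> fps_nth (X * Y) n" by (intro fps_mult_nonneg x y)
  have "(\<Sum>k\<le>n. fps_nth (X * Y) k) \<le> \<epsilon> * \<delta>" by (intro fps_mult_partial_sum x y)
  also have "\<dots> \<le> (2 * A) * (\<epsilon> * \<delta>)"
    using mult_right_mono[of 1 "2 * A" "\<epsilon> * \<delta>"] A x(4) y(4) by simp
  finally show "(\<Sum>k\<le>n. fps_nth (X * Y) k) \<le> 2 * A * (\<epsilon> * \<delta>)" .
  have "\<omega> n * fps_nth (X * Y) n = (\<Sum>i\<le>n. \<omega> n * (fps_nth X i * fps_nth Y (n - i)))"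
    by (simp add: fps_mult_nth atLeast0AtMost sum_distrib_left)
  also have "\<dots> \<le> (\<Sum>i\<le>n. A * (\<omega> i + \<omega> (n - i)) * (fps_nth X i * fps_nth Y (n - i)))"
    by (intro sum_mono mult_right_mono mult_nonneg_nonneg x y) (metis \<omega> atMost_iff le_add_diff_inverse)
  also have "\<dots> = A * ((\<Sum>i\<le>n. (\<omega> i * fps_nth X i) * fps_nth Y (n - i)) + (\<Sum>i\<le>n. fps_nth X i * (\<omega> (n - i) * fps_nth Y (n - i))))"
    by (simp add: sum_distrib_left sum.distrib[symmetric] algebra_simps)
  also have "\<dots> \<le> A * ((\<Sum>i\<le>n. \<epsilon> * fps_nth Y (n - i)) + (\<Sum>i\<le>n. fps_nth X i * \<delta>))"
    using A by (intro mult_left_mono add_mono sum_mono mult_right_mono x y) auto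
  also have "(\<Sum>i\<le>n. \<epsilon> * fps_nth Y (n - i)) = \<epsilon> * (\<Sum>i\<le>n. fps_nth Y i)"
    unfolding sum_distrib_left by (rule sum.reindex_bij_witness[of _ "\<lambda>i. n - i" "\<lambda>i. n - i"]) auto
  also have "(\<Sum>i\<le>n. fps_nth X i * \<delta>) = (\<Sum>i\<le>n. fps_nth X i) * \<delta>" by (simp add: sum_distrib_right)
  also have "A * (\<epsilon> * (\<Sum>i\<le>n. fps_nth Y i) + (\<Sum>i\<le>n. fps_nth X i) * \<delta>) \<le> A * (\<epsilon> * \<delta> + \<epsilon> * \<delta>)"
    using A x(4) y(4) x(2) y(2) by (intro mult_left_mono add_mono mult_mono) (auto intro!: sum_nonneg x y)
  finally show "\<omega> n * fps_nth (X * Y) n \<le> 2 * A * (\<epsilon> * \<delta>)" by (simp add: mult_ac)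
qed

lemmas controlled_mult_w3 = controlled_mult[where \<omega> = w3 and A = 3, OF w3_add, simplified]
lemmas controlled_mult_lin = controlled_mult[where \<omega> = "\<lambda>n. real n + 1" and A = 1, simplified]

lemma controlled_add:
  "controlled \<omega> X \<epsilon> \<Longrightarrow> controlled \<omega> Y \<delta> \<Longrightarrow> controlled \<omega> (X + Y) (\<epsilon> + \<delta>)"
  unfolding controlled_def by (auto simp: sum.distrib distrib_left intro!: add_mono)

lemma controlled_cmult:
  "controlled \<omega> X \<epsilon> \<Longrightarrow> 0 \<le> c \<Longrightarrow> controlled \<omega> (fps_const c * X) (c * \<epsilon>)"
  unfolding controlled_def
  by (auto simp: sum_distrib_left[symmetric] mult.left_commute[of _ c] intro: mult_left_mono)

lemma controlled_w3_imp_lin: "controlled w3 X \<epsilon> \<Longrightarrow> controlled (\<lambda>n. real n + 1) X \<epsilon>"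
  unfolding controlled_def
proof (intro conjI allI; (elim conjE)?)
  fix n assume *: "\<forall>n. 0 \<le> fps_nth X n" "\<forall>n. w3 n * fps_nth X n \<le> \<epsilon>"
  have "(real n + 1) * 1 \<le> w3 n" unfolding w3_def by (intro mult_left_mono) auto
  then have "(real n + 1) * fps_nth X n \<le> w3 n * fps_nth X n" using * by (intro mult_right_mono) auto
  also have "\<dots> \<le> \<epsilon>" using * by blast
  finally show "(real n + 1) * fps_nth X n \<le> \<epsilon>" .
qed auto

lemma controlled_power_w3:
  assumes "controlled w3 X \<epsilon>" shows "\<exists>\<delta>. controlled w3 (X ^ k) \<delta>"
proof (induction k)
  case 0
  have "(\<Sum>k\<le>n. fps_nth (1 :: real fps) k) \<le> 1" for n by simp
  then have "controlled w3 (1 :: real fps) 1" by (auto simp: controlled_def w3_def)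
  then show ?case by auto
next
  case (Suc k)
  then show ?case using controlled_mult_w3[OF assms] by auto
qed

text \<open>Relaxing the weight n^(3/2) to n gains K^(-1/2) on the coefficients beyond K. This is
  one source of smallness of the remainder as K grows.\<close>

lemma controlled_w3_tail:
  assumes X: "controlled w3 X \<epsilon>"
  shows "controlled (\<lambda>n. real n + 1) (Abs_fps (\<lambda>k. if K < k then fps_nth X k else 0)) (2 * \<epsilon> / sqrt (real K + 1))"
  unfolding controlled_def
proof (intro conjI allI)
  note x = controlledD[OF X]
  have b: "fps_nth X k \<le> \<epsilon> * (1 / w3 k)" for k using x(3)[of k] by (simp add: pos_le_divide_eq mult.commute)
  fix n
  show "0 \<le> fps_nth (Abs_fps (\<lambda>k. if K < k then fps_nth X k else 0)) n" using x(1) by simp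
  have "(\<Sum>k\<le>n. fps_nth (Abs_fps (\<lambda>k. if K < k then fps_nth X k else 0)) k) = (\<Sum>k\<in>{Suc K..<Suc n}. fps_nth X k)"
    by (rule sum.mono_neutral_cong_right) auto
  also have "\<dots> \<le> (\<Sum>k\<in>{Suc K..<Suc n}. \<epsilon> * (1 / w3 k))" by (intro sum_mono b)
  also have "\<dots> \<le> \<epsilon> * (2 / sqrt (real (Suc K)))"
    unfolding sum_distrib_left[symmetric] using x(4) by (intro mult_left_mono sum_inverse_w3') auto
  finally show "(\<Sum>k\<le>n. fps_nth (Abs_fps (\<lambda>k. if K < k then fps_nth X k else 0)) k) \<le> 2 * \<epsilon> / sqrt (real K + 1)"
    by (simp add: add.commute mult.commute)
  show "(real n + 1) * fps_nth (Abs_fps (\<lambda>k. if K < k then fps_nth X k else 0)) n \<le> 2 * \<epsilon> / sqrt (real K + 1)"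
  proof (cases "K < n")
    case True
    have "(real n + 1) * fps_nth X n \<le> (real n + 1) * (\<epsilon> * (1 / w3 n))" using b by (intro mult_left_mono) auto
    also have "\<dots> = \<epsilon> / sqrt (real n + 1)" by (simp add: w3_def)
    also have "\<dots> \<le> \<epsilon> / sqrt (real K + 1)" using x(4) True by (intro divide_left_mono) auto
    also have "\<dots> \<le> 2 * \<epsilon> / sqrt (real K + 1)" using x(4) by (intro divide_right_mono) auto
    finally show ?thesis using True by simp
  qed (use x(4) in simp)
qed

section \<open>Products and characteristic functions of discrete laws\<close>

text \<open>For countable types the product sigma-algebra contains all sets, so Fubini for product
  measures speaks about \<open>pair_pmf\<close>.\<close>

lemma pair_measure_pmf:
  fixes A :: "'a :: countable pmf" and B :: "'b :: countable pmf"
  shows "measure_pmf A \<Otimes>\<^sub>M measure_pmf B = measure_pmf (pair_pmf A B)"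
proof (rule pair_measure_eqI)
  have "sets (measure_pmf A \<Otimes>\<^sub>M measure_pmf B)
      = sets (count_space (UNIV :: 'a set) \<Otimes>\<^sub>M count_space (UNIV :: 'b set))"
    by (intro sets_pair_measure_cong) auto
  also have "\<dots> = UNIV" by (subst pair_measure_countable) auto
  finally show "sets (measure_pmf A \<Otimes>\<^sub>M measure_pmf B) = sets (measure_pmf (pair_pmf A B))"
    by simp
  fix X Y
  show "emeasure (measure_pmf A) X * emeasure (measure_pmf B) Y = emeasure (measure_pmf (pair_pmf A B)) (X \<times> Y)"
    by (simp add: measure_pmf.emeasure_eq_measure measure_pmf_prob_product ennreal_mult)
qed (auto intro: prob_space_imp_sigma_finite measure_pmf.prob_space_axioms)

lemma pair_sigma_finite_pmf: "pair_sigma_finite (measure_pmf A) (measure_pmf B)"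
  by (intro pair_sigma_finite.intro prob_space_imp_sigma_finite measure_pmf.prob_space_axioms)

lemma expectation_pair_pmf:
  fixes A :: "'a :: countable pmf" and B :: "'b :: countable pmf"
    and f :: "'a \<times> 'b \<Rightarrow> 'c :: {banach, second_countable_topology}"
  assumes "integrable (measure_pmf (pair_pmf A B)) f"
  shows "measure_pmf.expectation (pair_pmf A B) f
      = measure_pmf.expectation A (\<lambda>x. measure_pmf.expectation B (\<lambda>y. f (x, y)))"
  using pair_sigma_finite.integral_fst'[OF pair_sigma_finite_pmf, of A B f] assms
  by (simp add: pair_measure_pmf)

lemma
  fixes A :: "'a :: countable pmf" and B :: "'b :: countable pmf"
    and u :: "'a \<Rightarrow> 'c :: {real_normed_field, banach, second_countable_topology}"
  assumes u: "integrable (measure_pmf A) u" and v: "integrable (measure_pmf B) v"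
  shows integrable_pair_pmf_mult: "integrable (measure_pmf (pair_pmf A B)) (\<lambda>z. u (fst z) * v (snd z))"
    and expectation_pair_pmf_mult: "measure_pmf.expectation (pair_pmf A B) (\<lambda>z. u (fst z) * v (snd z))
      = measure_pmf.expectation A u * measure_pmf.expectation B v"
proof -
  have "integrable (measure_pmf A \<Otimes>\<^sub>M measure_pmf B) (\<lambda>z. u (fst z) * v (snd z))"
    by (rule pair_sigma_finite.Fubini_integrable[OF pair_sigma_finite_pmf])
      (use u v in \<open>simp_all add: pair_measure_pmf norm_mult\<close>)
  then show *: "integrable (measure_pmf (pair_pmf A B)) (\<lambda>z. u (fst z) * v (snd z))"
    by (simp add: pair_measure_pmf)
  show "measure_pmf.expectation (pair_pmf A B) (\<lambda>z. u (fst z) * v (snd z))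
      = measure_pmf.expectation A u * measure_pmf.expectation B v"
    by (simp add: expectation_pair_pmf[OF *])
qed

lemma replicate_pmf_add:
  "replicate_pmf (a + b) q = map_pmf (\<lambda>z. fst z @ snd z) (pair_pmf (replicate_pmf a q) (replicate_pmf b q))"
  by (simp add: replicate_pmf_distrib pair_pmf_def map_pmf_def bind_assoc_pmf bind_return_pmf)

lemma length_replicate_pmf: "w \<in> set_pmf (replicate_pmf n q) \<Longrightarrow> length w = n"
  by (simp add: set_replicate_pmf)

lemma
  fixes q :: "'a :: countable pmf"
    and u :: "'a list \<Rightarrow> 'c :: {real_normed_field, banach, second_countable_topology}"
  assumes u: "integrable (measure_pmf (replicate_pmf a q)) u"
    and v: "integrable (measure_pmf (replicate_pmf b q)) v"
  shows integrable_replicate_mult: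
      "integrable (measure_pmf (replicate_pmf (a + b) q)) (\<lambda>w. u (take a w) * v (drop a w))"
    and expectation_replicate_mult:
      "measure_pmf.expectation (replicate_pmf (a + b) q) (\<lambda>w. u (take a w) * v (drop a w))
        = measure_pmf.expectation (replicate_pmf a q) u * measure_pmf.expectation (replicate_pmf b q) v"
proof -
  let ?P = "pair_pmf (replicate_pmf a q) (replicate_pmf b q)"
  have ae: "AE z in measure_pmf ?P. u (take a (fst z @ snd z)) * v (drop a (fst z @ snd z)) = u (fst z) * v (snd z)"
    by (rule AE_pmfI) (auto dest!: length_replicate_pmf)
  show "integrable (measure_pmf (replicate_pmf (a + b) q)) (\<lambda>w. u (take a w) * v (drop a w))"
    unfolding replicate_pmf_add integrable_map_pmf_eq
    using integrable_cong_AE[THEN iffD2, OF _ _ ae] integrable_pair_pmf_mult[OF u v] by (simp add: o_def)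
  show "measure_pmf.expectation (replicate_pmf (a + b) q) (\<lambda>w. u (take a w) * v (drop a w))
        = measure_pmf.expectation (replicate_pmf a q) u * measure_pmf.expectation (replicate_pmf b q) v"
    unfolding replicate_pmf_add integral_map_pmf
    by (subst integral_cong_AE[OF _ _ ae]) (simp_all add: expectation_pair_pmf_mult[OF u v])
qed

lemma char_quadratic_approx:
  fixes M :: "'a pmf" and X :: "'a \<Rightarrow> real"
  assumes sq: "integrable (measure_pmf M) (\<lambda>a. (X a)\<^sup>2)" and m0: "measure_pmf.expectation M X = 0"
  shows "norm (measure_pmf.expectation M (\<lambda>a. cis (t * X a)) - (1 - t\<^sup>2 * measure_pmf.expectation M (\<lambda>a. (X a)\<^sup>2) / 2))
    \<le> t\<^sup>2 / 6 * measure_pmf.expectation M (\<lambda>a. min (6 * (X a)\<^sup>2) (\<bar>t\<bar> * \<bar>X a\<bar> ^ 3))"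
proof -
  have i: "integrable (measure_pmf M) X"
    by (rule measure_pmf.square_integrable_imp_integrable[OF _ sq]) simp
  have "char (distr (measure_pmf M) borel X) t = measure_pmf.expectation M (\<lambda>a. cis (t * X a))"
    by (simp add: char_def integral_distr cis_conv_exp)
  then show ?thesis
    using prob_space.char_approx3'[OF measure_pmf.prob_space_axioms, of X M "measure_pmf.expectation M (\<lambda>a. (X a)\<^sup>2)" "distr (measure_pmf M) borel X" t]
      i sq m0 by simp
qed

text \<open>Only second moments are at hand. The cubic error is therefore cut at a multiple of X^2,
  which dominates while the cubic term tends to 0.\<close>

lemma min_cubic_tendsto_0:
  fixes M :: "'a pmf" and X :: "'a \<Rightarrow> real"
  assumes sq: "integrable (measure_pmf M) (\<lambda>a. (X a)\<^sup>2)"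
  shows "((\<lambda>t. measure_pmf.expectation M (\<lambda>a. min (6 * (X a)\<^sup>2) (\<bar>t\<bar> * \<bar>X a\<bar> ^ 3))) \<longlongrightarrow> 0) (at 0)"
  unfolding tendsto_at_iff_sequentially
proof (intro allI impI)
  fix T :: "nat \<Rightarrow> real" assume T: "T \<longlonglongrightarrow> 0"
  have "(\<lambda>n. measure_pmf.expectation M (\<lambda>a. min (6 * (X a)\<^sup>2) (\<bar>T n\<bar> * \<bar>X a\<bar> ^ 3))) \<longlonglongrightarrow> measure_pmf.expectation M (\<lambda>a. 0)"
  proof (rule integral_dominated_convergence[where w = "\<lambda>a. 6 * (X a)\<^sup>2"])
    have "(\<lambda>n. min (6 * (X a)\<^sup>2) (\<bar>T n\<bar> * \<bar>X a\<bar> ^ 3)) \<longlonglongrightarrow> min (6 * (X a)\<^sup>2) (\<bar>0\<bar> * \<bar>X a\<bar> ^ 3)" for a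
      by (intro tendsto_intros T)
    then show "AE a in measure_pmf M. (\<lambda>n. min (6 * (X a)\<^sup>2) (\<bar>T n\<bar> * \<bar>X a\<bar> ^ 3)) \<longlonglongrightarrow> 0" by simp
  qed (use sq in auto)
  then show "((\<lambda>t. measure_pmf.expectation M (\<lambda>a. min (6 * (X a)\<^sup>2) (\<bar>t\<bar> * \<bar>X a\<bar> ^ 3))) \<circ> T) \<longlonglongrightarrow> 0"
    by (simp add: o_def)
qed

lemma char_quadratic_little_o:
  fixes M :: "'a pmf" and X :: "'a \<Rightarrow> real"
  assumes sq: "integrable (measure_pmf M) (\<lambda>a. (X a)\<^sup>2)" and m0: "measure_pmf.expectation M X = 0"
  shows "((\<lambda>t. norm (measure_pmf.expectation M (\<lambda>a. cis (t * X a))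
      - (1 - t\<^sup>2 * measure_pmf.expectation M (\<lambda>a. (X a)\<^sup>2) / 2)) / t\<^sup>2) \<longlongrightarrow> 0) (at 0)"
proof (rule tendsto_sandwich[OF _ _ tendsto_const])
  let ?m = "\<lambda>t. measure_pmf.expectation M (\<lambda>a. min (6 * (X a)\<^sup>2) (\<bar>t\<bar> * \<bar>X a\<bar> ^ 3))"
  show "((\<lambda>t. ?m t / 6) \<longlongrightarrow> 0) (at 0)"
    using tendsto_divide[OF min_cubic_tendsto_0[OF sq] tendsto_const[of 6]] by simp
  show "\<forall>\<^sub>F t in at 0. norm (measure_pmf.expectation M (\<lambda>a. cis (t * X a))
      - (1 - t\<^sup>2 * measure_pmf.expectation M (\<lambda>a. (X a)\<^sup>2) / 2)) / t\<^sup>2 \<le> ?m t / 6"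
    unfolding eventually_at_filter
  proof (intro always_eventually allI impI)
    fix t :: real assume "t \<noteq> 0"
    then show "norm (measure_pmf.expectation M (\<lambda>a. cis (t * X a))
      - (1 - t\<^sup>2 * measure_pmf.expectation M (\<lambda>a. (X a)\<^sup>2) / 2)) / t\<^sup>2 \<le> ?m t / 6"
      using char_quadratic_approx[OF sq m0, of t] by (simp add: pos_divide_le_eq mult.commute)
  qed
qed simp

lemma inverse_sqrt_at_0: "filterlim (\<lambda>n. 1 / sqrt (real n)) (at 0) sequentially"
  unfolding filterlim_at by (auto intro!: eventually_sequentiallyI[of 1]) real_asymp

lemma norm_expectation_cis_le: "norm (measure_pmf.expectation M (\<lambda>a. cis (h a))) \<le> 1"
  by (rule order_trans[OF integral_norm_bound]) (simp add: measure_pmf.prob_space)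

text \<open>Powers of two numbers in the unit disc differ by at most the exponent times the
  difference of the bases, so it suffices to compare the bases up to o(1 / n).\<close>

lemma char_power_tendsto:
  fixes M :: "'a pmf" and X :: "'a \<Rightarrow> real" and N :: "nat \<Rightarrow> nat"
  assumes sq: "integrable (measure_pmf M) (\<lambda>a. (X a)\<^sup>2)" and m0: "measure_pmf.expectation M X = 0"
    and N: "(\<lambda>n. real (N n) / real n) \<longlonglongrightarrow> \<beta>"
  defines "v \<equiv> measure_pmf.expectation M (\<lambda>a. (X a)\<^sup>2)"
  shows "(\<lambda>n. measure_pmf.expectation M (\<lambda>a. cis (X a / sqrt (real n))) ^ N n)
    \<longlonglongrightarrow> complex_of_real (exp (- \<beta> * v / 2))"
proof -
  define z where "z n = measure_pmf.expectation M (\<lambda>a. cis (X a / sqrt (real n)))" for n :: nat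
  \<comment> \<open>The comparison base is chosen so that its powers are explicit
    exponentials.\<close>
  define w where "w n = exp (- v / (2 * real n))" for n :: nat
  have v0: "0 \<le> v" unfolding v_def by (intro integral_nonneg_AE) simp
  have nz: "norm (z n) \<le> 1" for n unfolding z_def by (rule norm_expectation_cis_le)
  have nw: "norm (complex_of_real (w n)) \<le> 1" for n
    using v0 by (simp add: w_def norm_mult)
  have "(\<lambda>n. norm (z n - (1 - v / (2 * real n))) * real n) \<longlonglongrightarrow> 0"
  proof (rule Lim_transform_eventually)
    show "(\<lambda>n. norm (measure_pmf.expectation M (\<lambda>a. cis (1 / sqrt (real n) * X a))
      - (1 - (1 / sqrt (real n))\<^sup>2 * measure_pmf.expectation M (\<lambda>a. (X a)\<^sup>2) / 2)) / (1 / sqrt (real n))\<^sup>2) \<longlonglongrightarrow> 0"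
      by (rule filterlim_compose[OF char_quadratic_little_o[OF sq m0] inverse_sqrt_at_0])
    show "\<forall>\<^sub>F n in sequentially. norm (measure_pmf.expectation M (\<lambda>a. cis (1 / sqrt (real n) * X a))
      - (1 - (1 / sqrt (real n))\<^sup>2 * measure_pmf.expectation M (\<lambda>a. (X a)\<^sup>2) / 2)) / (1 / sqrt (real n))\<^sup>2
      = norm (z n - (1 - v / (2 * real n))) * real n"
      by (intro always_eventually allI) (simp add: z_def v_def power_divide mult.commute)
  qed
  moreover have "(\<lambda>n. \<bar>1 - v / (2 * real n) - w n\<bar> * real n) \<longlonglongrightarrow> 0"
  proof (cases "v = 0")
    case False
    with v0 have "0 < v" by simp
    then show ?thesis unfolding w_def by real_asymp
  qed (simp add: w_def)
  ultimately have "(\<lambda>n. norm (z n - (1 - v / (2 * real n))) * real n + \<bar>1 - v / (2 * real n) - w n\<bar> * real n) \<longlonglongrightarrow> 0 + 0"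
    by (rule tendsto_add)
  from tendsto_mult[OF N this]
  have lim0: "(\<lambda>n. real (N n) / real n * (norm (z n - (1 - v / (2 * real n))) * real n + \<bar>1 - v / (2 * real n) - w n\<bar> * real n)) \<longlonglongrightarrow> 0"
    by simp
  have "(\<lambda>n. z n ^ N n - complex_of_real (w n) ^ N n) \<longlonglongrightarrow> 0"
  proof (rule Lim_null_comparison[OF _ lim0], rule eventually_sequentiallyI[of 1])
    fix n :: nat assume n: "1 \<le> n"
    have "norm (z n ^ N n - complex_of_real (w n) ^ N n) \<le> real (N n) * norm (z n - complex_of_real (w n))"
      by (rule norm_power_diff[OF nz nw])
    also have "norm (z n - complex_of_real (w n))
        \<le> norm (z n - (1 - v / (2 * real n))) + norm (complex_of_real (1 - v / (2 * real n) - w n))"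
      using norm_triangle_ineq[of "z n - (1 - v / (2 * real n))" "complex_of_real (1 - v / (2 * real n) - w n)"] by simp
    also have "norm (complex_of_real (1 - v / (2 * real n) - w n)) = \<bar>1 - v / (2 * real n) - w n\<bar>"
      by (rule norm_of_real)
    finally show "norm (z n ^ N n - complex_of_real (w n) ^ N n)
        \<le> real (N n) / real n * (norm (z n - (1 - v / (2 * real n))) * real n + \<bar>1 - v / (2 * real n) - w n\<bar> * real n)"
      using n by (simp add: mult_left_mono distrib_left[symmetric] distrib_right[symmetric])
  qed
  moreover have "(\<lambda>n. complex_of_real (w n) ^ N n) \<longlonglongrightarrow> complex_of_real (exp (- \<beta> * v / 2))"
  proof -
    have "w n ^ N n = exp (- (real (N n) / real n) * v / 2)" for n
      unfolding w_def exp_of_nat_mult[symmetric] by (simp add: field_simps)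
    moreover have "(\<lambda>n. exp (- (real (N n) / real n) * v / 2)) \<longlonglongrightarrow> exp (- \<beta> * v / 2)"
      by (intro tendsto_intros N) simp
    ultimately have "(\<lambda>n. w n ^ N n) \<longlonglongrightarrow> exp (- \<beta> * v / 2)" by simp
    then show ?thesis unfolding of_real_power[symmetric] by (rule tendsto_of_real)
  qed
  ultimately have "(\<lambda>n. (z n ^ N n - complex_of_real (w n) ^ N n) + complex_of_real (w n) ^ N n)
      \<longlonglongrightarrow> 0 + complex_of_real (exp (- \<beta> * v / 2))"
    by (rule tendsto_add)
  then show ?thesis by (simp add: z_def)
qed

section \<open>Fourier inversion on a lattice\<close>

lemma measurable_cis [measurable]: "cis \<in> borel_measurable borel"
  by (intro borel_measurable_continuous_onI continuous_intros)

lemma measurable_expectation_cis: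
  fixes X :: "'a \<Rightarrow> complex"
  shows "(\<lambda>t. measure_pmf.expectation M (\<lambda>a. X a * cis (t * z a))) \<in> borel_measurable borel"
proof -
  have [measurable]: "X \<in> borel_measurable (measure_pmf M)" "z \<in> borel_measurable (measure_pmf M)" by simp_all
  show ?thesis
    by (rule sigma_finite_measure.borel_measurable_lebesgue_integral[OF
          prob_space_imp_sigma_finite[OF measure_pmf.prob_space_axioms]]) measurable
qed

lemma integral_cis_period:
  assumes d: "0 < d" and z: "int d dvd z"
  shows "integral\<^sup>L lborel (\<lambda>t. indicator {- pi / real d..pi / real d} t *\<^sub>R cis (t * real_of_int z))
      = (if z = 0 then complex_of_real (2 * pi / real d) else 0)"
proof (cases "z = 0")
  case True
  have "- (pi / real d) \<le> pi / real d" using d by (simp add: minus_divide_left[symmetric] order_trans[of _ 0])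
  then show ?thesis using True d by (simp add: scaleR_conv_of_real)
next
  case False
  define F where "F = (\<lambda>t::real. cis (t * real_of_int z) / (\<i> * of_int z))"
  have "integral\<^sup>L lborel (\<lambda>t. indicator {- pi / real d..pi / real d} t *\<^sub>R cis (t * real_of_int z))
      = F (pi / real d) - F (- pi / real d)"
  proof (rule integral_FTC_atLeastAtMost)
    show "- pi / real d \<le> pi / real d" using d by (simp add: divide_right_mono)
    show "continuous_on {- pi / real d..pi / real d} (\<lambda>t. cis (t * real_of_int z))"
      by (intro continuous_intros)
    fix t
    have "((\<lambda>w. exp (\<i> * (w * of_int z)) / (\<i> * of_int z)) has_field_derivative exp (\<i> * (of_real t * of_int z))) (at (of_real t))"
      using False by (auto intro!: derivative_eq_intros simp: mult_ac)
    from has_vector_derivative_real_field[OF this]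
    show "(F has_vector_derivative cis (t * real_of_int z)) (at t within {- pi / real d..pi / real d})"
      by (simp add: F_def cis_conv_exp)
  qed
  also have "\<dots> = 0"
  proof -
    obtain m where m: "z = int d * m" using z by auto
    have "pi / real d * real_of_int z = pi * real_of_int m" using d by (simp add: m)
    then have "cis (pi / real d * real_of_int z) = cis (- pi / real d * real_of_int z)"
      by (simp add: complex_eq_iff sin_npi_int)
    then show ?thesis by (simp add: F_def)
  qed
  finally show ?thesis using False by simp
qed

text \<open>Since \<open>Z\<close> takes only multiples of d, an interval of length 2 pi / d
  suffices. For d > 1 the characteristic function returns to modulus 1 inside [-pi, pi], and no
  Gaussian bound could hold there.\<close>

lemma fourier_lattice:
  fixes M :: "'a pmf" and X :: "'a \<Rightarrow> complex" and Z :: "'a \<Rightarrow> int"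
  assumes d: "0 < d" and Z: "\<And>a. a \<in> set_pmf M \<Longrightarrow> int d dvd Z a" and X: "integrable (measure_pmf M) X"
  shows "measure_pmf.expectation M (\<lambda>a. X a * of_bool (Z a = 0))
    = of_real (real d / (2 * pi)) * (LINT t:{- pi / real d..pi / real d}|lborel.
        measure_pmf.expectation M (\<lambda>a. X a * cis (t * real_of_int (Z a))))"
proof -
  let ?I = "{- pi / real d..pi / real d}"
  define f where "f = (\<lambda>(t :: real) a. indicator ?I t *\<^sub>R (X a * cis (t * real_of_int (Z a))))"
  interpret P: pair_sigma_finite lborel "measure_pmf M"
    by (intro pair_sigma_finite.intro prob_space_imp_sigma_finite measure_pmf.prob_space_axioms sigma_finite_lborel)
  have [measurable]: "X \<in> borel_measurable (measure_pmf M)" "(\<lambda>a. real_of_int (Z a)) \<in> borel_measurable (measure_pmf M)"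
    by simp_all
  have int: "integrable (lborel \<Otimes>\<^sub>M measure_pmf M) (case_prod f)"
  proof (rule P.Fubini_integrable)
    show "case_prod f \<in> borel_measurable (lborel \<Otimes>\<^sub>M measure_pmf M)" unfolding f_def by measurable
    have "(\<lambda>t. \<integral>a. norm (case_prod f (t, a)) \<partial>measure_pmf M) = (\<lambda>t. indicator ?I t *\<^sub>R (\<integral>a. norm (X a) \<partial>measure_pmf M))"
      by (auto simp: f_def norm_mult fun_eq_iff)
    then show "integrable lborel (\<lambda>t. \<integral>a. norm (case_prod f (t, a)) \<partial>measure_pmf M)" by simp
    show "AE t in lborel. integrable (measure_pmf M) (\<lambda>a. case_prod f (t, a))"
    proof (rule AE_I2)
      fix t
      have "integrable (measure_pmf M) (\<lambda>a. X a * cis (t * real_of_int (Z a)))"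
        by (rule Bochner_Integration.integrable_bound[OF X]) (auto simp: norm_mult)
      then show "integrable (measure_pmf M) (\<lambda>a. case_prod f (t, a))" by (simp add: f_def)
    qed
  qed
  have "(LINT t:?I|lborel. measure_pmf.expectation M (\<lambda>a. X a * cis (t * real_of_int (Z a))))
      = (\<integral>t. (\<integral>a. f t a \<partial>measure_pmf M) \<partial>lborel)"
    by (simp add: set_lebesgue_integral_def f_def)
  also have "\<dots> = (\<integral>a. (\<integral>t. f t a \<partial>lborel) \<partial>measure_pmf M)"
    using P.integral_fst[OF int] P.integral_snd[OF int] by simp
  also have "\<dots> = (\<integral>a. X a * of_bool (Z a = 0) * of_real (2 * pi / real d) \<partial>measure_pmf M)"
  proof (intro integral_cong_AE AE_pmfI)
    fix a assume "a \<in> set_pmf M"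
    have "(\<integral>t. f t a \<partial>lborel) = X a * (\<integral>t. indicator ?I t *\<^sub>R cis (t * real_of_int (Z a)) \<partial>lborel)"
      by (subst integral_mult_right_zero[symmetric]) (simp add: f_def)
    then show "(\<integral>t. f t a \<partial>lborel) = X a * of_bool (Z a = 0) * of_real (2 * pi / real d)"
      using integral_cis_period[OF d Z[OF \<open>a \<in> set_pmf M\<close>]] by simp
  qed simp_all
  also have "\<dots> = measure_pmf.expectation M (\<lambda>a. X a * of_bool (Z a = 0)) * of_real (2 * pi / real d)"
    by (rule integral_mult_left_zero)
  finally show ?thesis using d by (simp add: field_simps)
qed

lemma gauss_integral:
  assumes b: "0 < b"
  shows "integrable lborel (\<lambda>x::real. exp (- b * x\<^sup>2))" "(\<integral>x. exp (- b * x\<^sup>2) \<partial>lborel) = sqrt (pi / b)"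
proof -
  define \<sigma> where "\<sigma> = sqrt (1 / (2 * b))"
  have s: "0 < \<sigma>" "2 * \<sigma>\<^sup>2 = 1 / b" using b by (simp_all add: \<sigma>_def)
  have e: "exp (- b * x\<^sup>2) = sqrt (pi / b) * normal_density 0 \<sigma> x" for x
  proof -
    have "2 * pi * \<sigma>\<^sup>2 = pi / b" using s(2) by (metis mult.assoc mult.commute mult.right_neutral times_divide_eq_right)
    moreover have "- (x\<^sup>2 / (2 * \<sigma>\<^sup>2)) = - b * x\<^sup>2" unfolding s(2) by simp
    ultimately show ?thesis unfolding normal_density_def using b by simp
  qed
  show "integrable lborel (\<lambda>x::real. exp (- b * x\<^sup>2))"
    unfolding e using s by (intro integrable_mult_right integrable_normal_density)
  show "(\<integral>x. exp (- b * x\<^sup>2) \<partial>lborel) = sqrt (pi / b)"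
    unfolding e using s by simp
qed

text \<open>Half of the Gaussian exponent absorbs the polynomial factor; each power of t gains a
  factor b^(-1/2).\<close>

lemma gauss_moments:
  fixes b t :: real
  assumes b: "0 < b"
  shows "\<bar>t\<bar> * exp (- b * t\<^sup>2) \<le> 1 / sqrt b * exp (- (b / 2) * t\<^sup>2)"
    "t\<^sup>2 * exp (- b * t\<^sup>2) \<le> 2 / b * exp (- (b / 2) * t\<^sup>2)"
proof -
  have e: "exp (- b * t\<^sup>2) = exp (- (b / 2) * t\<^sup>2) * exp (- (b / 2) * t\<^sup>2)" by (simp add: exp_add[symmetric])
  have y: "y * exp (- (y\<^sup>2 / 2)) \<le> 1" for y :: real
  proof -
    have "y \<le> 1 + y\<^sup>2 / 2" using sum_squares_bound[of 1 y] by (simp add: power2_eq_square)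
    also have "\<dots> \<le> exp (y\<^sup>2 / 2)" by (rule exp_ge_add_one_self)
    finally show ?thesis by (simp add: exp_minus field_simps)
  qed
  have "\<bar>t\<bar> * exp (- (b / 2) * t\<^sup>2) = (sqrt b * \<bar>t\<bar>) * exp (- ((sqrt b * \<bar>t\<bar>)\<^sup>2 / 2)) / sqrt b"
    using b by (simp add: power_mult_distrib)
  also have "\<dots> \<le> 1 / sqrt b" using b by (intro divide_right_mono y) auto
  finally show "\<bar>t\<bar> * exp (- b * t\<^sup>2) \<le> 1 / sqrt b * exp (- (b / 2) * t\<^sup>2)"
    unfolding e mult.assoc[symmetric] by (rule mult_right_mono) simp
  have y2: "y * exp (- y) \<le> 1" for y :: real
  proof -
    have "y \<le> exp y" using exp_ge_add_one_self[of y] by linarith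
    then show ?thesis by (simp add: exp_minus field_simps)
  qed
  have "t\<^sup>2 * exp (- (b / 2) * t\<^sup>2) = (b / 2 * t\<^sup>2) * exp (- (b / 2 * t\<^sup>2)) * (2 / b)" using b by simp
  also have "\<dots> \<le> 2 / b" using mult_right_mono[OF y2[of "b / 2 * t\<^sup>2"], of "2 / b"] b
    by (simp only: mult_1_left divide_nonneg_pos zero_le_numeral simp_thms)
  finally show "t\<^sup>2 * exp (- b * t\<^sup>2) \<le> 2 / b * exp (- (b / 2) * t\<^sup>2)"
    unfolding e mult.assoc[symmetric] by (rule mult_right_mono[OF _ exp_ge_zero])
qed

lemma norm_set_integral_gauss:
  fixes g :: "real \<Rightarrow> complex"
  assumes b: "0 < b" and K: "0 \<le> K" and g: "\<And>t. t \<in> I \<Longrightarrow> norm (g t) \<le> K * exp (- b * t\<^sup>2)"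
  shows "norm (LINT t:I|lborel. g t) \<le> K * sqrt (pi / b)"
proof (cases "integrable lborel (\<lambda>t. indicator I t *\<^sub>R g t)")
  case True
  have "norm (LINT t:I|lborel. g t) \<le> (\<integral>t. norm (indicator I t *\<^sub>R g t) \<partial>lborel)"
    unfolding set_lebesgue_integral_def by (rule integral_norm_bound)
  also have "\<dots> \<le> (\<integral>t. K * exp (- b * t\<^sup>2) \<partial>lborel)"
    by (intro integral_mono integrable_norm True integrable_mult_right gauss_integral b)
      (use g K in \<open>auto simp: indicator_def\<close>)
  also have "\<dots> = K * sqrt (pi / b)" using gauss_integral[OF b] by simp
  finally show ?thesis .
next
  \<comment> \<open>The integral of a non-integrable function is 0 by convention, which satisfies
    the bound.\<close>
  case False
  then show ?thesis using K b by (simp add: set_lebesgue_integral_def not_integrable_integral_eq)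
qed

section \<open>Critical offspring laws\<close>

text \<open>The least positive gcd of a finite part of \<open>A\<close> divides all of
  \<open>A\<close>, since adjoining an element cannot lower it further. As an integer combination of
  elements of \<open>A\<close> it inherits their common periods.\<close>

lemma lattice_span:
  fixes A :: "nat set"
  assumes "\<exists>a\<in>A. a \<noteq> 0"
  shows "\<exists>d>0. (\<forall>a\<in>A. d dvd a) \<and>
    (\<forall>t::real. (\<forall>a\<in>A. \<exists>m::int. t * real a = 2 * pi * of_int m) \<longrightarrow> (\<exists>m::int. t * real d = 2 * pi * of_int m))"
proof -
  define P where "P n \<longleftrightarrow> (\<exists>B. finite B \<and> B \<subseteq> A \<and> Gcd B = n \<and> 0 < n)" for n :: nat
  obtain a where a: "a \<in> A" "a \<noteq> 0" using assms by blast
  have "P a" unfolding P_def using a by (intro exI[of _ "{a}"]) auto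
  define d where "d = (LEAST n. P n)"
  have "P d" unfolding d_def using \<open>P a\<close> by (rule LeastI)
  then obtain B where B: "finite B" "B \<subseteq> A" "Gcd B = d" "0 < d" unfolding P_def by blast
  have dvd: "d dvd a" if "a \<in> A" for a
  proof -
    have g: "Gcd (insert a B) = gcd a d" using B(3) by simp
    have "0 < gcd a d" using B(4) by simp
    then have "P (gcd a d)" unfolding P_def using g B that by (intro exI[of _ "insert a B"]) auto
    then have "d \<le> gcd a d" unfolding d_def by (rule Least_le)
    moreover have "gcd a d \<le> d" using B(4) by (simp add: gcd_le2_nat)
    ultimately have "gcd a d = d" by simp
    moreover have "gcd a d dvd a" by (rule gcd_dvd1)
    ultimately show ?thesis by simp
  qed
  have per: "\<exists>m::int. t * real (Gcd B') = 2 * pi * of_int m"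
    if "finite B'" "B' \<subseteq> A" "\<forall>a\<in>A. \<exists>m::int. t * real a = 2 * pi * of_int m" for B' and t :: real
    using that
  proof (induction B' rule: finite_induct)
    case empty then show ?case by (intro exI[of _ 0]) simp
  next
    case (insert b B')
    obtain m1 :: int where m1: "t * real b = 2 * pi * of_int m1" using insert.prems by auto
    obtain m2 :: int where m2: "t * real (Gcd B') = 2 * pi * of_int m2"
      using insert.IH[OF _ insert.prems(2)] insert.prems(1) by auto
    note m = m1 m2
    define g where "g = Gcd B'"
    obtain u v where uv: "u * int b + v * int g = gcd (int b) (int g)"
      using bezout_int[of "int b" "int g"] by blast
    have "real (gcd b g) = of_int (gcd (int b) (int g))" by simp
    also have "\<dots> = of_int u * real b + of_int v * real g" unfolding uv[symmetric] by simp
    finally have g: "real (Gcd (insert b B')) = of_int u * real b + of_int v * real g"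
      by (simp add: g_def)
    have "t * real (Gcd (insert b B')) = of_int u * (t * real b) + of_int v * (t * real (Gcd B'))"
      unfolding g unfolding g_def by (simp add: algebra_simps)
    also have "\<dots> = 2 * pi * of_int (u * m1 + v * m2)" unfolding m by (simp add: algebra_simps)
    finally show ?case by blast
  qed
  show ?thesis
  proof (intro exI[of _ d] conjI allI impI ballI)
    fix t :: real assume "\<forall>a\<in>A. \<exists>m::int. t * real a = 2 * pi * of_int m"
    from per[OF B(1,2) this] show "\<exists>m::int. t * real d = 2 * pi * of_int m" unfolding B(3) .
  qed (use B(4) dvd in auto)
qed

lemma Re_norm_eq_1: "Re z = 1 \<Longrightarrow> norm z = 1 \<Longrightarrow> z = 1"
  using cmod_power2[of z] by (simp add: complex_eq_iff)

locale critical_offspring = offspring \<xi> for \<xi> :: "nat pmf" +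
  assumes int1: "integrable (measure_pmf \<xi>) real" and mean1: "measure_pmf.expectation \<xi> real = 1"
    and int2: "integrable (measure_pmf \<xi>) (\<lambda>k. (real k)\<^sup>2)"
    and var_pos: "0 < measure_pmf.variance \<xi> real"
begin

section \<open>Moments, support and characteristic function of the offspring law\<close>

abbreviation E :: "(nat \<Rightarrow> real) \<Rightarrow> real" where "E \<equiv> measure_pmf.expectation \<xi>"

definition s2 :: real where "s2 = measure_pmf.variance \<xi> real"

lemma s2_pos: "0 < s2" using var_pos by (simp add: s2_def)

lemma s2_eq: "s2 = E (\<lambda>k. (real k - 1)\<^sup>2)" by (simp add: s2_def mean1)

lemma int_centred: "integrable (measure_pmf \<xi>) (\<lambda>k. real k - 1)" "E (\<lambda>k. real k - 1) = 0"
  using int1 mean1 by (simp_all add: measure_pmf.prob_space)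

lemma int_centred_square: "integrable (measure_pmf \<xi>) (\<lambda>k. (real k - 1)\<^sup>2)"
  using int1 int2 by (simp add: power2_diff)

lemma E_factorial2: "integrable (measure_pmf \<xi>) (\<lambda>k. real k * (real k - 1))" "E (\<lambda>k. real k * (real k - 1)) = s2"
proof -
  have e: "real k * (real k - 1) = (real k - 1)\<^sup>2 + (real k - 1)" for k by (simp add: power2_eq_square algebra_simps)
  show "integrable (measure_pmf \<xi>) (\<lambda>k. real k * (real k - 1))"
    unfolding e by (intro Bochner_Integration.integrable_add int_centred int_centred_square)
  show "E (\<lambda>k. real k * (real k - 1)) = s2"
    unfolding e s2_eq using int_centred int_centred_square by (subst Bochner_Integration.integral_add) auto
qed

lemma partial_expectation_le:
  assumes "integrable (measure_pmf \<xi>) h" "\<And>k. 0 \<le> h k"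
  shows "(\<Sum>d\<le>N. h d * p d) \<le> E h"
proof -
  have "(\<Sum>d\<le>N. h d * p d) = E (\<lambda>k. h k * of_bool (k \<le> N))"
    by (subst integral_measure_pmf[of "{..N}"]) (auto simp: mult.commute intro!: sum.cong)
  also have "\<dots> \<le> E h"
    by (rule integral_mono[OF Bochner_Integration.integrable_bound[OF assms(1)] assms(1)]) (use assms(2) in auto)
  finally show ?thesis .
qed

lemma sum_first_moment_le: "(\<Sum>d\<le>N. real d * p d) \<le> 1"
  using partial_expectation_le[OF int1] mean1 by simp

lemma factorial2_nonneg: "0 \<le> real d * (real d - 1)"
  by (cases d) auto

lemma sum_factorial2_le: "(\<Sum>d\<le>N. real d * (real d - 1) * p d) \<le> s2"
  using partial_expectation_le[OF E_factorial2(1) factorial2_nonneg] E_factorial2(2) by simp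

lemma sum_p_le: "(\<Sum>d\<le>N. p d) \<le> 1"
  using partial_expectation_le[of "\<lambda>_. 1"] by (simp add: measure_pmf.prob_space)

text \<open>If all mass lay on one side of 1, then \<xi> - 1 would have a sign and mean zero, hence
  vanish almost surely, against the positive variance.\<close>

lemma support:
  shows zero_in_support: "0 < p 0" and large_in_support: "\<exists>k\<ge>2. 0 < p k"
proof -
  have not1: "\<exists>k. 0 < p k \<and> k \<noteq> 1"
  proof (rule ccontr)
    assume n: "\<not> ?thesis"
    have "k = 1" if "k \<in> set_pmf \<xi>" for k using n pmf_positive[OF that] by blast
    then have "AE k in measure_pmf \<xi>. (real k - 1)\<^sup>2 = 0" by (intro AE_pmfI) auto
    then have "s2 = 0" unfolding s2_eq by (rule integral_eq_zero_AE)
    then show False using s2_pos by simp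
  qed
  have zero: "k = 1" if "\<And>k. k \<in> set_pmf \<xi> \<Longrightarrow> 0 \<le> c * (real k - 1)" "c \<noteq> 0" "0 < p k" for k and c :: real
  proof -
    have "AE k in measure_pmf \<xi>. 0 \<le> c * (real k - 1)" by (rule AE_pmfI) (rule that)
    moreover have "E (\<lambda>k. c * (real k - 1)) = 0" using int_centred by simp
    ultimately have "AE k in measure_pmf \<xi>. c * (real k - 1) = 0"
      using integral_nonneg_eq_0_iff_AE[of "measure_pmf \<xi>" "\<lambda>k. c * (real k - 1)"] int_centred(1) by auto
    then have "c * (real k - 1) = 0" using that(3) by (auto simp: AE_measure_pmf_iff set_pmf_iff)
    then show "k = 1" using that(2) by simp
  qed
  show "0 < p 0"
  proof (rule ccontr)
    assume n: "\<not> 0 < p 0"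
    have "k \<noteq> 0" if "k \<in> set_pmf \<xi>" for k using n pmf_positive[OF that] by (cases k) auto
    then have "0 \<le> 1 * (real k - 1)" if "k \<in> set_pmf \<xi>" for k using that by (cases k) force+
    from zero[OF this] not1 show False by auto
  qed
  show "\<exists>k\<ge>2. 0 < p k"
  proof (rule ccontr)
    assume c: "\<not> ?thesis"
    have "k \<le> 1" if "k \<in> set_pmf \<xi>" for k
      using c pmf_positive[OF that] by (metis not_less_eq_eq numeral_2_eq_2 One_nat_def)
    then have "0 \<le> (-1) * (real k - 1)" if "k \<in> set_pmf \<xi>" for k using that by force
    from zero[OF this] not1 show False by auto
  qed
qed

text \<open>Together the clauses say that \<open>d\<close> is the gcd of the support. As 0 lies in
  the support, this is also the span of the walk; the last clause is the form in which
  characteristic functions use it.\<close>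

definition is_span :: "nat \<Rightarrow> bool" where
  "is_span d \<longleftrightarrow> 0 < d \<and> (\<forall>a\<in>set_pmf \<xi>. d dvd a) \<and>
    (\<forall>t::real. (\<forall>a\<in>set_pmf \<xi>. \<exists>m::int. t * real a = 2 * pi * of_int m) \<longrightarrow> (\<exists>m::int. t * real d = 2 * pi * of_int m))"

definition span :: nat where "span = (SOME d. is_span d)"

lemma is_span_span: "is_span span"
proof -
  obtain k where "2 \<le> k" "0 < p k" using large_in_support by blast
  then have "\<exists>a\<in>set_pmf \<xi>. a \<noteq> 0" by (intro bexI[of _ k]) (auto simp: set_pmf_iff)
  from lattice_span[OF this] have "\<exists>d. is_span d" unfolding is_span_def .
  then show ?thesis unfolding span_def by (rule someI_ex)
qed

lemma span_pos: "0 < span"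
  using is_span_span unfolding is_span_def by (elim conjE)

lemma span_dvd: "a \<in> set_pmf \<xi> \<Longrightarrow> span dvd a"
  using is_span_span unfolding is_span_def by (elim conjE) (rule bspec)

lemma span_period:
  fixes t :: real
  assumes "\<And>a. a \<in> set_pmf \<xi> \<Longrightarrow> \<exists>m::int. t * real a = 2 * pi * of_int m"
  shows "\<exists>m::int. t * real span = 2 * pi * of_int m"
  using is_span_span[unfolded is_span_def, THEN conjunct2, THEN conjunct2, THEN spec[of _ t], THEN mp] assms
  by blast

definition psi :: "real \<Rightarrow> complex" where
  "psi t = measure_pmf.expectation \<xi> (\<lambda>k. cis (t * (real k - 1)))"

lemma norm_psi_le: "norm (psi t) \<le> 1"
  unfolding psi_def by (rule norm_expectation_cis_le)

lemma psi_char: "psi = char (distr (measure_pmf \<xi>) borel (\<lambda>k. real k - 1))"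
  by (rule ext) (simp add: psi_def char_def integral_distr cis_conv_exp)

lemma isCont_psi: "isCont psi t"
  unfolding psi_char by (intro real_distribution.isCont_char prob_space.real_distribution_distr[OF measure_pmf.prob_space_axioms]) simp

lemma measurable_psi [measurable]: "psi \<in> borel_measurable borel"
  by (intro borel_measurable_continuous_onI continuous_at_imp_continuous_on ballI isCont_psi)

text \<open>Modulus 1 forces cis (t (k - 1)) to be constant on the support. Comparison with k = 0
  gives cis (t k) = 1 there, so t times the span is a multiple of 2 pi, which is impossible in the
  given range.\<close>

lemma norm_psi_less:
  assumes "t \<noteq> 0" "\<bar>t\<bar> \<le> pi / real span"
  shows "norm (psi t) < 1"
proof (rule ccontr)
  assume "\<not> norm (psi t) < 1"
  then have n: "norm (psi t) = 1" using norm_psi_le[of t] by simp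
  let ?f = "\<lambda>k. 1 - Re (cnj (psi t) * cis (t * (real k - 1)))"
  have ic: "integrable (measure_pmf \<xi>) (\<lambda>k. cnj (psi t) * cis (t * (real k - 1)))"
    by (rule measure_pmf.integrable_const_bound[of _ "1"]) (auto simp: norm_mult n)
  have nn: "0 \<le> ?f k" for k
    using complex_Re_le_cmod[of "cnj (psi t) * cis (t * (real k - 1))"] by (simp add: norm_mult n)
  have "measure_pmf.expectation \<xi> (\<lambda>k. cnj (psi t) * cis (t * (real k - 1))) = cnj (psi t) * psi t"
    unfolding psi_def by (rule integral_mult_right_zero)
  also have "\<dots> = 1" using n by (metis complex_norm_square mult.commute of_real_1 one_power2)
  finally have "E ?f = 0"
    using ic by (subst Bochner_Integration.integral_diff) (auto simp: measure_pmf.prob_space integral_Re simp del: Re_complex_of_real times_complex.sel)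
  then have "AE k in measure_pmf \<xi>. ?f k = 0"
    using integral_nonneg_eq_0_iff_AE[of "measure_pmf \<xi>" ?f] ic nn by (auto simp del: times_complex.sel)
  then have k1: "?f k = 0" if "k \<in> set_pmf \<xi>" for k using that by (simp add: AE_measure_pmf_iff)
  have eq: "cis (t * (real k - 1)) = psi t" if "k \<in> set_pmf \<xi>" for k
  proof -
    let ?z = "cnj (psi t) * cis (t * (real k - 1))"
    have "Re ?z = 1" "norm ?z = 1" using k1[OF that] by (auto simp: norm_mult n)
    then have "?z = 1" by (rule Re_norm_eq_1)
    then have "psi t * (cnj (psi t) * cis (t * (real k - 1))) = psi t" by simp
    moreover have "psi t * cnj (psi t) = 1" using n by (metis complex_norm_square of_real_1 one_power2)
    ultimately show ?thesis by (metis mult.assoc mult.left_neutral)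
  qed
  have z: "(0::nat) \<in> set_pmf \<xi>" using zero_in_support by (simp add: set_pmf_iff)
  have "\<exists>m::int. t * real k = 2 * pi * of_int m" if "k \<in> set_pmf \<xi>" for k
  proof -
    have "cis (t * real k) = cis (t * (real k - 1)) * cis t" by (simp add: cis_mult algebra_simps)
    also have "\<dots> = cis (t * (real 0 - 1)) * cis t" using eq[OF that] eq[OF z] by simp
    also have "\<dots> = 1" by (simp add: cis_mult)
    finally have "cos (t * real k) = 1" by (metis cis.sel(1) one_complex.sel(1))
    then show ?thesis by (auto simp: cos_one_2pi_int mult_ac)
  qed
  from span_period[OF this] obtain m :: int where m: "t * real span = 2 * pi * of_int m" by auto
  have "\<bar>t * real span\<bar> \<le> pi" using assms(2) span_pos by (simp add: abs_mult field_simps)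
  then have "2 * pi * \<bar>of_int m\<bar> \<le> pi" unfolding m by (simp add: abs_mult)
  then have "\<bar>real_of_int m\<bar> \<le> 1 / 2" using pi_gt_zero by (simp add: field_simps)
  then have "m = 0" by linarith
  then show False using m assms(1) span_pos by simp
qed

lemma psi_approx: "norm (psi t - 1) \<le> s2 / 2 * t\<^sup>2"
proof -
  have i1: "integrable (measure_pmf \<xi>) (\<lambda>k. cis (t * (real k - 1)))"
    by (rule measure_pmf.integrable_const_bound[of _ "1"]) auto
  have i2: "integrable (measure_pmf \<xi>) (\<lambda>k. 1 + \<i> * complex_of_real (t * (real k - 1)))"
    by (intro Bochner_Integration.integrable_add integrable_mult_right integrable_of_real int_centred) simp
  have "measure_pmf.expectation \<xi> (\<lambda>k. 1 + \<i> * complex_of_real (t * (real k - 1))) = 1"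
  proof -
    have "measure_pmf.expectation \<xi> (\<lambda>k. \<i> * complex_of_real (t * (real k - 1))) = \<i> * complex_of_real (E (\<lambda>k. t * (real k - 1)))"
      by (simp only: integral_mult_right_zero integral_complex_of_real)
    also have "E (\<lambda>k. t * (real k - 1)) = 0" using int_centred(2) by simp
    finally have z: "measure_pmf.expectation \<xi> (\<lambda>k. \<i> * complex_of_real (t * (real k - 1))) = 0" by simp
    show ?thesis
      by (subst Bochner_Integration.integral_add)
        (use int_centred(1) z in \<open>auto simp: measure_pmf.prob_space simp del: of_real_mult of_real_diff\<close>)
  qed
  then have "psi t - 1 = measure_pmf.expectation \<xi> (\<lambda>k. cis (t * (real k - 1)) - (1 + \<i> * complex_of_real (t * (real k - 1))))"
    using i1 i2 by (simp add: psi_def)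
  also have "norm \<dots> \<le> E (\<lambda>k. norm (cis (t * (real k - 1)) - (1 + \<i> * complex_of_real (t * (real k - 1)))))"
    by (rule integral_norm_bound)
  also have "\<dots> \<le> E (\<lambda>k. t\<^sup>2 / 2 * (real k - 1)\<^sup>2)"
  proof (rule integral_mono)
    show "integrable (measure_pmf \<xi>) (\<lambda>k. norm (cis (t * (real k - 1)) - (1 + \<i> * complex_of_real (t * (real k - 1)))))"
      by (intro integrable_norm Bochner_Integration.integrable_diff i1 i2)
    show "integrable (measure_pmf \<xi>) (\<lambda>k. t\<^sup>2 / 2 * (real k - 1)\<^sup>2)"
      by (intro integrable_mult_right int_centred_square)
    fix k
    show "norm (cis (t * (real k - 1)) - (1 + \<i> * complex_of_real (t * (real k - 1)))) \<le> t\<^sup>2 / 2 * (real k - 1)\<^sup>2"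
      using iexp_approx1[of "t * (real k - 1)" 1] by (simp add: cis_conv_exp power2_eq_square abs_mult mult_ac)
  qed
  also have "\<dots> = s2 / 2 * t\<^sup>2" by (simp add: s2_eq)
  finally show ?thesis .
qed

text \<open>Near 0 the second-order expansion gives the Gaussian bound; the rest of the interval is
  compact, and there the modulus stays below a constant less than 1.\<close>

lemma psi_decay: "\<exists>c>0. \<forall>t\<in>{- pi / real span..pi / real span}. norm (psi t) \<le> exp (- c * t\<^sup>2)"
proof -
  have "((\<lambda>t. norm (psi t - (1 - t\<^sup>2 * s2 / 2)) / t\<^sup>2) \<longlongrightarrow> 0) (at 0)"
    using char_quadratic_little_o[OF int_centred_square int_centred(2)] by (simp add: psi_def s2_eq)
  then have "\<forall>\<^sub>F t in at 0. norm (psi t - (1 - t\<^sup>2 * s2 / 2)) / t\<^sup>2 < s2 / 4"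
    using s2_pos by (intro order_tendstoD) auto
  moreover have "\<forall>\<^sub>F t in at (0::real). \<bar>t\<bar> < sqrt (2 / s2)"
    unfolding eventually_at using s2_pos by (intro exI[of _ "sqrt (2 / s2)"]) (auto simp: dist_real_def)
  ultimately have "\<forall>\<^sub>F t in at 0. norm (psi t) \<le> exp (- (s2 / 4) * t\<^sup>2)"
    using eventually_neq_at_within[of 0 0 UNIV]
  proof eventually_elim
    case (elim t)
    then have a: "norm (psi t - (1 - t\<^sup>2 * s2 / 2)) \<le> s2 / 4 * t\<^sup>2" by (simp add: pos_divide_less_eq)
    have "t\<^sup>2 \<le> 2 / s2" using elim(2) by (metis abs_le_square_iff abs_of_nonneg less_imp_le real_sqrt_ge_zero real_sqrt_pow2 s2_pos divide_nonneg_pos zero_le_numeral)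
    then have "t\<^sup>2 * s2 / 2 \<le> 1" using s2_pos by (simp add: field_simps)
    define q where "q = complex_of_real (1 - t\<^sup>2 * s2 / 2)"
    have "norm q = 1 - t\<^sup>2 * s2 / 2" unfolding q_def norm_of_real using \<open>t\<^sup>2 * s2 / 2 \<le> 1\<close> by simp
    moreover have "norm (psi t - q) \<le> s2 / 4 * t\<^sup>2" using a by (simp add: q_def)
    moreover have "norm (psi t) \<le> norm q + norm (psi t - q)" using norm_triangle_ineq[of q "psi t - q"] by simp
    ultimately have "norm (psi t) \<le> (1 - t\<^sup>2 * s2 / 2) + s2 / 4 * t\<^sup>2" by linarith
    also have "\<dots> = 1 + (- (s2 / 4) * t\<^sup>2)" by (simp add: field_simps)
    also have "\<dots> \<le> exp (- (s2 / 4) * t\<^sup>2)" by (rule exp_ge_add_one_self)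
    finally show ?case .
  qed
  then obtain \<delta> where \<delta>: "0 < \<delta>" "\<And>t. t \<noteq> 0 \<Longrightarrow> \<bar>t\<bar> < \<delta> \<Longrightarrow> norm (psi t) \<le> exp (- (s2 / 4) * t\<^sup>2)"
    unfolding eventually_at by (auto simp: dist_real_def)
  let ?K = "{- pi / real span..pi / real span} - {-\<delta><..<\<delta>}"
  have "\<exists>\<eta><1. 0 < \<eta> \<and> (\<forall>t\<in>?K. norm (psi t) \<le> \<eta>)"
  proof (cases "?K = {}")
    case True then show ?thesis by (intro exI[of _ "1/2"]) auto
  next
    case False
    have "compact ?K" by (intro compact_diff) auto
    moreover have "continuous_on ?K (\<lambda>t. norm (psi t))"
      by (intro continuous_intros continuous_at_imp_continuous_on ballI isCont_psi)
    ultimately obtain t0 where t0: "t0 \<in> ?K" "\<And>t. t \<in> ?K \<Longrightarrow> norm (psi t) \<le> norm (psi t0)"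
      using continuous_attains_sup[OF _ False] by blast
    have "norm (psi t0) < 1" using t0(1) \<delta>(1) by (intro norm_psi_less) auto
    then show ?thesis using t0(2) by (intro exI[of _ "max (1/2) (norm (psi t0))"]) (auto simp: le_max_iff_disj)
  qed
  then obtain \<eta> where \<eta>: "\<eta> < 1" "0 < \<eta>" "\<And>t. t \<in> ?K \<Longrightarrow> norm (psi t) \<le> \<eta>" by blast
  \<comment> \<open>On the compact part the modulus is at most \<eta> and t^2 at most pi^2, so the
    second rate turns the constant \<eta> into a Gaussian.\<close>
  define c where "c = min (s2 / 4) (- ln \<eta> / pi\<^sup>2)"
  have "0 < - ln \<eta>" using \<eta> by simp
  then have "0 < - ln \<eta> / pi\<^sup>2" by (intro divide_pos_pos) auto
  then have c: "0 < c" "c \<le> s2 / 4" "c \<le> - ln \<eta> / pi\<^sup>2"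
    unfolding c_def using s2_pos by (simp_all only: min_less_iff_conj min.cobounded1 min.cobounded2) simp_all
  show ?thesis
  proof (intro exI[of _ c] conjI ballI c(1))
    fix t assume t: "t \<in> {- pi / real span..pi / real span}"
    consider "t = 0" | "t \<noteq> 0" "\<bar>t\<bar> < \<delta>" | "t \<in> ?K" using t by fastforce
    then show "norm (psi t) \<le> exp (- c * t\<^sup>2)"
    proof cases
      case 1 then show ?thesis using norm_psi_le[of t] by simp
    next
      case 2
      have "exp (- (s2 / 4) * t\<^sup>2) \<le> exp (- c * t\<^sup>2)"
        using mult_right_mono[OF c(2), of "t\<^sup>2"] by simp
      then show ?thesis using \<delta>(2)[OF 2] by linarith
    next
      case 3
      have "pi / real span \<le> pi / 1" using span_pos by (intro divide_left_mono) auto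
      then have "\<bar>t\<bar> \<le> pi" using t by auto
      then have "t\<^sup>2 \<le> pi\<^sup>2" using abs_le_square_iff[of t pi] by simp
      then have "c * t\<^sup>2 \<le> (- ln \<eta> / pi\<^sup>2) * pi\<^sup>2" using c by (intro mult_mono) auto
      then have "c * t\<^sup>2 \<le> - ln \<eta>" by simp
      then have "exp (ln \<eta>) \<le> exp (- c * t\<^sup>2)" by simp
      then show ?thesis using \<eta>(2) \<eta>(3)[OF 3] by simp
    qed
  qed
qed

definition cdec :: real where
  "cdec = (SOME c. 0 < c \<and> (\<forall>t\<in>{- pi / real span..pi / real span}. norm (psi t) \<le> exp (- c * t\<^sup>2)))"

lemma cdec: shows cdec_pos: "0 < cdec"
  and norm_psi_cdec: "\<And>t. t \<in> {- pi / real span..pi / real span} \<Longrightarrow> norm (psi t) \<le> exp (- cdec * t\<^sup>2)"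
  using someI_ex[OF psi_decay[unfolded Bex_def]] unfolding cdec_def[symmetric] by auto

lemma norm_psi_power:
  assumes "t \<in> {- pi / real span..pi / real span}"
  shows "norm (psi t ^ j) \<le> exp (- (cdec * real j) * t\<^sup>2)"
proof -
  have "norm (psi t ^ j) \<le> exp (- cdec * t\<^sup>2) ^ j"
    unfolding norm_power using norm_psi_cdec[OF assms] by (intro power_mono) auto
  also have "\<dots> = exp (- (cdec * real j) * t\<^sup>2)" unfolding exp_of_nat_mult[symmetric] by (simp add: mult_ac)
  finally show ?thesis .
qed

text \<open>The price, for t^2 at most pi^2, of replacing the exponent j by j + 1. This keeps the
  bounds finite at j = 0.\<close>

definition Kdec :: real where "Kdec = exp (cdec * pi\<^sup>2)"

lemma norm_psi_power':
  assumes "t \<in> {- pi / real span..pi / real span}"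
  shows "norm (psi t ^ j) \<le> Kdec * exp (- (cdec * (real j + 1)) * t\<^sup>2)"
proof -
  have "pi / real span \<le> pi / 1" using span_pos by (intro divide_left_mono) auto
  then have "\<bar>t\<bar> \<le> pi" using assms by auto
  then have "t\<^sup>2 \<le> pi\<^sup>2" using abs_le_square_iff[of t pi] by simp
  then have "cdec * t\<^sup>2 \<le> cdec * pi\<^sup>2" using cdec_pos by simp
  then have "- (cdec * real j) * t\<^sup>2 \<le> cdec * pi\<^sup>2 + (- (cdec * (real j + 1)) * t\<^sup>2)" by (simp add: algebra_simps)
  then have "exp (- (cdec * real j) * t\<^sup>2) \<le> Kdec * exp (- (cdec * (real j + 1)) * t\<^sup>2)"
    unfolding Kdec_def exp_add[symmetric] by simp
  then show ?thesis using norm_psi_power[OF assms, of j] by linarith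
qed

definition FI :: "(real \<Rightarrow> complex) \<Rightarrow> complex" where
  "FI g = of_real (real span / (2 * pi)) * (LINT t:{- pi / real span..pi / real span}|lborel. g t)"

lemma norm_FI_le:
  assumes "0 < b" "0 \<le> K" "\<And>t. t \<in> {- pi / real span..pi / real span} \<Longrightarrow> norm (g t) \<le> K * exp (- b * t\<^sup>2)"
  shows "norm (FI g) \<le> real span * K / sqrt b"
proof -
  have "norm (FI g) \<le> real span / (2 * pi) * (K * sqrt (pi / b))"
  proof -
    let ?L = "LINT t:{- pi / real span..pi / real span}|lborel. g t"
    have "norm (FI g) = real span / (2 * pi) * norm ?L"
      unfolding FI_def norm_mult norm_of_real by (subst abs_of_nonneg) auto
    also have "\<dots> \<le> real span / (2 * pi) * (K * sqrt (pi / b))"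
      by (intro mult_left_mono norm_set_integral_gauss assms) auto
    finally show ?thesis .
  qed
  also have "\<dots> = real span * K / sqrt b * (sqrt pi / (2 * pi))" by (simp add: real_sqrt_divide mult_ac)
  also have "\<dots> \<le> real span * K / sqrt b * 1"
  proof (intro mult_left_mono)
    have "sqrt pi \<le> sqrt (pi * pi)" using pi_gt3 by (intro real_sqrt_le_mono) auto
    then have "sqrt pi \<le> pi" by simp
    then have "sqrt pi \<le> 2 * pi" using pi_gt_zero by linarith
    then show "sqrt pi / (2 * pi) \<le> 1" by simp
  qed (use assms in auto)
  finally show ?thesis by simp
qed

subsection \<open>Words with independent letters\<close>

abbreviation W :: "nat \<Rightarrow> nat list pmf" where "W n \<equiv> replicate_pmf n \<xi>"

abbreviation EW where "EW n \<equiv> measure_pmf.expectation (W n)"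

abbreviation integrable_W where "integrable_W n \<equiv> integrable (measure_pmf (W n))"

lemma span_dvd_word: "w \<in> set_pmf (W n) \<Longrightarrow> span dvd sum_list w"
  using span_dvd by (induction w arbitrary: n) (auto simp: set_replicate_pmf)

lemma expectation_word_Suc:
  fixes f :: "nat list \<Rightarrow> 'c :: {banach, second_countable_topology}"
  assumes "integrable_W (Suc n) f"
  shows "EW (Suc n) f
    = measure_pmf.expectation \<xi> (\<lambda>d. EW n (\<lambda>w. f (d # w)))"
proof -
  have "W (Suc n) = map_pmf (\<lambda>z. fst z # snd z) (pair_pmf \<xi> (W n))"
    by (simp add: pair_pmf_def map_pmf_def bind_assoc_pmf bind_return_pmf)
  then show ?thesis using assms
    by (simp add: expectation_pair_pmf[of \<xi> "W n" "\<lambda>z. f (fst z # snd z)"] o_def del: replicate_pmf.simps)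
qed

lemma expectation_cis_word:
  "EW n (\<lambda>w. cis (t * (real (sum_list w) - real n))) = psi t ^ n"
proof (induction n)
  case (Suc n)
  have "EW (Suc n) (\<lambda>w. cis (t * (real (sum_list w) - real (Suc n))))
    = measure_pmf.expectation \<xi> (\<lambda>d. EW n (\<lambda>w. cis (t * (real d - 1)) * cis (t * (real (sum_list w) - real n))))"
    by (subst expectation_word_Suc) (auto intro!: measure_pmf.integrable_const_bound[of _ 1] simp: cis_mult algebra_simps)
  then show ?case by (simp only: integral_mult_right_zero Suc) (simp add: psi_def)
qed simp

lemma PS_expectation: "PS n s = EW n (\<lambda>w. of_bool (sum_list w = s))"
proof (induction n arbitrary: s)
  case (Suc n)
  have "EW (Suc n) (\<lambda>w. of_bool (sum_list w = s) :: real)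
      = E (\<lambda>d. EW n (\<lambda>w. of_bool (d + sum_list w = s)))"
    by (subst expectation_word_Suc) (auto intro!: measure_pmf.integrable_const_bound[of _ 1])
  also have "\<dots> = (\<Sum>d\<le>s. p d *\<^sub>R EW n (\<lambda>w. of_bool (d + sum_list w = s)))"
  proof (rule integral_measure_pmf)
    fix d assume "EW n (\<lambda>w. of_bool (d + sum_list w = s)) \<noteq> (0::real)"
    then show "d \<in> {..s}" by (rule contrapos_np) (auto intro!: integral_eq_zero_AE)
  qed simp
  also have "\<dots> = (\<Sum>d\<le>s. p d * PS n (s - d))"
  proof (intro sum.cong refl)
    fix d assume "d \<in> {..s}"
    then have "(d + sum_list w = s) = (sum_list w = s - d)" for w by auto
    then show "p d *\<^sub>R EW n (\<lambda>w. of_bool (d + sum_list w = s)) = p d * PS n (s - d)"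
      by (simp add: Suc)
  qed
  finally show ?case by (simp only: PS_Suc)
qed simp

lemma PS_expectation_complex:
  "EW n (\<lambda>w. of_bool (sum_list w = s)) = complex_of_real (PS n s)"
proof -
  have "(of_bool b :: complex) = complex_of_real (of_bool b)" for b by (cases b) simp_all
  then show ?thesis unfolding PS_expectation by (simp only: integral_complex_of_real)
qed

lemma PS_nonneg: "0 \<le> PS n s"
  unfolding PS_expectation by (intro integral_nonneg_AE) auto

lemma PS_span: "PS n s \<noteq> 0 \<Longrightarrow> span dvd s"
proof (rule ccontr)
  assume "PS n s \<noteq> 0" "\<not> span dvd s"
  then have "AE w in measure_pmf (W n). of_bool (sum_list w = s) = (0::real)"
    by (intro AE_pmfI) (use span_dvd_word in auto)
  then show False using \<open>PS n s \<noteq> 0\<close> unfolding PS_expectation by (metis integral_eq_zero_AE)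
qed

section \<open>Local bounds for the letter sum\<close>

lemma expectation_word_sum:
  fixes X :: "nat list \<Rightarrow> complex"
  assumes X: "integrable_W n X" and s: "span dvd s"
  shows "EW n (\<lambda>w. X w * of_bool (sum_list w = s))
    = FI (\<lambda>t. EW n (\<lambda>w. X w * cis (t * (real (sum_list w) - real n))) * cis (t * (real n - real s)))"
proof -
  have "EW n (\<lambda>w. X w * of_bool (sum_list w = s))
      = EW n (\<lambda>w. X w * of_bool (int (sum_list w) - int s = 0))"
    by simp
  also have "\<dots> = of_real (real span / (2 * pi)) * (LINT t:{- pi / real span..pi / real span}|lborel.
        EW n (\<lambda>w. X w * cis (t * real_of_int (int (sum_list w) - int s))))"
    using span_dvd_word s by (intro fourier_lattice span_pos X) (auto intro!: dvd_diff)
  also have "(\<lambda>t. EW n (\<lambda>w. X w * cis (t * real_of_int (int (sum_list w) - int s))))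
      = (\<lambda>t. EW n (\<lambda>w. X w * cis (t * (real (sum_list w) - real n))) * cis (t * (real n - real s)))"
    unfolding integral_mult_left_zero[symmetric] mult.assoc cis_mult by (simp add: algebra_simps)
  finally show ?thesis by (simp add: FI_def)
qed

text \<open>The Fourier integral of P(S_j = j - x). It agrees with the probability on the lattice
  (\<open>PS_eq_pt\<close>) but does not jump to 0 off it, so that its increments in j are of order
  j^(-3/2).\<close>

definition pt :: "nat \<Rightarrow> real \<Rightarrow> real" where
  "pt j x = Re (FI (\<lambda>t. psi t ^ j * cis (t * x)))"

lemma PS_eq_FI: "span dvd s \<Longrightarrow> complex_of_real (PS n s) = FI (\<lambda>t. psi t ^ n * cis (t * (real n - real s)))"
proof -
  assume s: "span dvd s"
  show ?thesis using expectation_word_sum[of n "\<lambda>_. 1" s] s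
    by (simp add: expectation_cis_word PS_expectation_complex)
qed

lemma PS_eq_pt: "span dvd s \<Longrightarrow> PS n s = pt n (real n - real s)"
  using PS_eq_FI[of s n] unfolding pt_def by (metis Re_complex_of_real)

lemma set_integrable_bounded:
  fixes g :: "real \<Rightarrow> complex"
  assumes "g \<in> borel_measurable borel" "\<And>t. norm (g t) \<le> K"
  shows "set_integrable lborel {- pi / real span..pi / real span} g"
  unfolding set_integrable_def
  by (rule integrableI_bounded_set[where A = "{- pi / real span..pi / real span}" and B = K])
    (use assms in \<open>auto simp: indicator_def intro: order_trans[OF norm_ge_zero]\<close>)

lemma FI_diff:
  assumes "g \<in> borel_measurable borel" "h \<in> borel_measurable borel" "\<And>t. norm (g t) \<le> 1" "\<And>t. norm (h t) \<le> 1"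
  shows "FI g - FI h = FI (\<lambda>t. g t - h t)"
  unfolding FI_def using set_integrable_bounded[OF assms(1,3)] set_integrable_bounded[OF assms(2,4)]
  by (simp add: right_diff_distrib)

lemma norm_psi_cis_le: "norm (psi t ^ j * cis y) \<le> 1"
  using norm_psi_le[of t] by (simp add: norm_mult norm_power power_le_one)

text \<open>One more step multiplies the integrand by psi - 1, of order t^2, and t^2 integrated
  against the Gaussian gains a factor 1 / j.\<close>

lemma pt_root_decay: "\<exists>C>0. \<forall>x. root_decay C (\<lambda>j. pt j x)"
proof -
  define C1 where "C1 = real span * Kdec / sqrt cdec"
  define C2 where "C2 = real span * (s2 / 2 * Kdec * (2 / cdec)) / sqrt (cdec / 2)"
  have K: "0 < Kdec" by (simp add: Kdec_def)
  have C: "0 < C1" "0 < C2" using span_pos K cdec_pos s2_pos by (auto simp: C1_def C2_def)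
  have 1: "\<bar>pt j x\<bar> \<le> C1 / sqrt (real j + 1)" for j x
  proof -
    have "norm (FI (\<lambda>t. psi t ^ j * cis (t * x))) \<le> real span * Kdec / sqrt (cdec * (real j + 1))"
      by (rule norm_FI_le) (use norm_psi_power'[of _ j] K cdec_pos in \<open>auto simp: norm_mult\<close>)
    then have "\<bar>pt j x\<bar> \<le> real span * Kdec / sqrt (cdec * (real j + 1))"
      unfolding pt_def using abs_Re_le_cmod order_trans by blast
    then show ?thesis by (simp add: C1_def real_sqrt_mult)
  qed
  have 2: "\<bar>pt (Suc j) x - pt j x\<bar> \<le> C2 / w3 j" for j x
  proof -
    have b: "0 < cdec * (real j + 1)" using cdec_pos by simp
    have "FI (\<lambda>t. psi t ^ Suc j * cis (t * x)) - FI (\<lambda>t. psi t ^ j * cis (t * x))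
        = FI (\<lambda>t. psi t ^ Suc j * cis (t * x) - psi t ^ j * cis (t * x))"
      by (rule FI_diff) (measurable, auto simp: norm_psi_cis_le simp del: power_Suc)
    also have "norm \<dots> \<le> real span * (s2 / 2 * Kdec * (2 / (cdec * (real j + 1)))) / sqrt (cdec * (real j + 1) / 2)"
    proof (rule norm_FI_le)
      fix t assume t: "t \<in> {- pi / real span..pi / real span}"
      have "norm (psi t ^ Suc j * cis (t * x) - psi t ^ j * cis (t * x)) = norm (psi t ^ j) * norm (psi t - 1)"
      proof -
        have "psi t ^ Suc j * cis (t * x) - psi t ^ j * cis (t * x) = psi t ^ j * (psi t - 1) * cis (t * x)"
          by (simp add: algebra_simps)
        then show ?thesis by (simp only: norm_mult norm_cis mult_1_right)
      qed
      also have "\<dots> \<le> (Kdec * exp (- (cdec * (real j + 1)) * t\<^sup>2)) * (s2 / 2 * t\<^sup>2)"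
        by (intro mult_mono norm_psi_power' psi_approx t) (use K in auto)
      also have "\<dots> = s2 / 2 * Kdec * (t\<^sup>2 * exp (- (cdec * (real j + 1)) * t\<^sup>2))" by simp
      also have "\<dots> \<le> s2 / 2 * Kdec * (2 / (cdec * (real j + 1)) * exp (- (cdec * (real j + 1) / 2) * t\<^sup>2))"
        using s2_pos K by (intro mult_left_mono gauss_moments(2)[OF b]) auto
      finally show "norm (psi t ^ Suc j * cis (t * x) - psi t ^ j * cis (t * x))
          \<le> s2 / 2 * Kdec * (2 / (cdec * (real j + 1))) * exp (- (cdec * (real j + 1) / 2) * t\<^sup>2)" by simp
    qed (use b s2_pos K in auto)
    finally have "\<bar>pt (Suc j) x - pt j x\<bar> \<le> real span * (s2 / 2 * Kdec * (2 / (cdec * (real j + 1)))) / sqrt (cdec * (real j + 1) / 2)"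
      unfolding pt_def minus_complex.sel[symmetric] using abs_Re_le_cmod order_trans by blast
    also have "\<dots> = C2 / w3 j"
    proof -
      have "cdec * (real j + 1) / 2 = cdec / 2 * (real j + 1)" by simp
      then have "sqrt (cdec * (real j + 1) / 2) = sqrt (cdec / 2) * sqrt (real j + 1)" by (simp only: real_sqrt_mult)
      then show ?thesis using cdec_pos by (simp add: C2_def w3_def)
    qed
    finally show ?thesis .
  qed
  show ?thesis
  proof (intro exI[of _ "max C1 C2"] conjI allI)
    show "0 < max C1 C2" using C by simp
    fix x show "root_decay (max C1 C2) (\<lambda>j. pt j x)"
      unfolding root_decay_def
      by (intro conjI allI order_trans[OF 1] order_trans[OF 2] divide_right_mono) (auto simp: less_imp_le)
  qed
qed

lemma PS_le: "\<exists>C>0. \<forall>n s. PS n s \<le> C / sqrt (real n + 1)"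
proof -
  obtain C where C: "0 < C" "\<And>x. root_decay C (\<lambda>j. pt j x)" using pt_root_decay by blast
  have "PS n s \<le> C / sqrt (real n + 1)" for n s
  proof (cases "PS n s = 0")
    case True then show ?thesis using C by simp
  next
    case False
    then have "PS n s = pt n (real n - real s)" by (intro PS_eq_pt PS_span)
    then show ?thesis using root_decayD(1)[OF C(2), of n "real n - real s"] by linarith
  qed
  then show ?thesis using C(1) by blast
qed

lemma norm_centred_cis_le:
  "norm (measure_pmf.expectation \<xi> (\<lambda>k. complex_of_real (real k - 1) * cis (t * (real k - 1)))) \<le> s2 * \<bar>t\<bar>"
proof -
  have i0: "integrable (measure_pmf \<xi>) (\<lambda>k. complex_of_real (real k - 1))"
    by (intro integrable_of_real int_centred)
  have i1: "integrable (measure_pmf \<xi>) (\<lambda>k. complex_of_real (real k - 1) * cis (t * (real k - 1)))"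
    by (rule Bochner_Integration.integrable_bound[OF i0]) (auto simp: norm_mult simp del: of_real_diff)
  have "measure_pmf.expectation \<xi> (\<lambda>k. complex_of_real (real k - 1)) = 0"
    by (simp only: integral_complex_of_real int_centred of_real_0)
  then have "measure_pmf.expectation \<xi> (\<lambda>k. complex_of_real (real k - 1) * cis (t * (real k - 1)))
      = measure_pmf.expectation \<xi> (\<lambda>k. complex_of_real (real k - 1) * cis (t * (real k - 1)) - complex_of_real (real k - 1))"
    by (subst Bochner_Integration.integral_diff[OF i1 i0]) (simp del: of_real_diff)
  also have "norm \<dots> \<le> E (\<lambda>k. norm (complex_of_real (real k - 1) * cis (t * (real k - 1)) - complex_of_real (real k - 1)))"
    by (rule integral_norm_bound)
  also have "\<dots> \<le> E (\<lambda>k. \<bar>t\<bar> * (real k - 1)\<^sup>2)"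
  proof (rule integral_mono)
    show "integrable (measure_pmf \<xi>) (\<lambda>k. norm (complex_of_real (real k - 1) * cis (t * (real k - 1)) - complex_of_real (real k - 1)))"
      by (intro integrable_norm Bochner_Integration.integrable_diff i1 i0)
    show "integrable (measure_pmf \<xi>) (\<lambda>k. \<bar>t\<bar> * (real k - 1)\<^sup>2)" by (intro integrable_mult_right int_centred_square)
    fix k
    have "norm (complex_of_real (real k - 1) * cis (t * (real k - 1)) - complex_of_real (real k - 1))
        = norm (complex_of_real (real k - 1) * (cis (t * (real k - 1)) - 1))" by (simp only: right_diff_distrib mult_1_right)
    also have "\<dots> = \<bar>real k - 1\<bar> * norm (cis (t * (real k - 1)) - 1)" by (simp only: norm_mult norm_of_real)
    also have "\<dots> \<le> \<bar>real k - 1\<bar> * \<bar>t * (real k - 1)\<bar>"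
      using iexp_approx1[of "t * (real k - 1)" 0] by (intro mult_left_mono) (auto simp: cis_conv_exp)
    finally show "norm (complex_of_real (real k - 1) * cis (t * (real k - 1)) - complex_of_real (real k - 1)) \<le> \<bar>t\<bar> * (real k - 1)\<^sup>2"
      by (simp add: abs_mult power2_eq_square mult_ac del: of_real_diff)
  qed
  also have "\<dots> = s2 * \<bar>t\<bar>" by (simp add: s2_eq)
  finally show ?thesis .
qed

text \<open>By exchangeability the deviation s - n may be replaced by n times the deviation of the
  first letter. In the Fourier integral that letter contributes a factor of order t, which gains
  n^(-1/2) on top of the local bound n^(-1/2); together they offset the n.\<close>

lemma PS_first_moment_le: "\<exists>C>0. \<forall>n s. \<bar>real s - real n\<bar> * PS n s \<le> C"
proof -
  have K: "0 < Kdec" by (simp add: Kdec_def)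
  define C where "C = real span * (s2 * Kdec * (1 / sqrt cdec)) / sqrt (cdec / 2)"
  have C: "0 < C" using K s2_pos cdec_pos span_pos by (simp add: C_def)
  have "\<bar>real s - real n\<bar> * PS n s \<le> C" for n s
  proof (cases "n = 0 \<or> PS n s = 0")
    case True
    then show ?thesis using C by auto
  next
    case False
    then obtain m where n: "n = Suc m" by (cases n) auto
    have s: "span dvd s" using False PS_span by blast
    let ?X = "\<lambda>w. complex_of_real (real (hd w) - 1)"
    have "real (Suc m) * (\<Sum>d\<le>s. (real d - 1) * p d * PS m (s - d)) = real s * PS n s - real (Suc m) * PS n s"
      unfolding n PS_exchange[symmetric] by (simp only: PS_Suc[of m s] right_diff_distrib[symmetric] sum_subtractf[symmetric] left_diff_distrib) simp
    then have e1: "(real s - real n) * PS n s = real n * (\<Sum>d\<le>s. (real d - 1) * p d * PS m (s - d))"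
      by (simp add: n left_diff_distrib)
    \<comment> \<open>The centred first letter; it is split off from the other m letters, which
      contribute \<open>psi t ^ m\<close>.\<close>
    define u where "u = (\<lambda>w :: nat list. complex_of_real (real (hd w) - 1))"
    have W1: "W 1 = map_pmf (\<lambda>x. [x]) \<xi>" by (rule replicate_pmf_1)
    have iu: "integrable_W 1 u"
      unfolding W1 u_def using int_centred(1) by (simp add: o_def integrable_of_real del: of_real_diff)
    have X1: "integrable_W (1 + m) (\<lambda>w. u (take 1 w) * 1)"
      using integrable_replicate_mult[OF iu, of m "\<lambda>_. 1"] by simp
    have "EW (1 + m) (\<lambda>w. u (take 1 w) * 1 * of_bool (sum_list w = s))
        = measure_pmf.expectation \<xi> (\<lambda>d. EW m (\<lambda>w. complex_of_real (real d - 1) * of_bool (d + sum_list w = s)))"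
    proof -
      have "integrable_W (Suc m) (\<lambda>w. u (take 1 w) * 1 * of_bool (sum_list w = s))"
        by (rule Bochner_Integration.integrable_bound[OF X1[simplified plus_1_eq_Suc]]) (auto simp: norm_mult)
      from expectation_word_Suc[OF this] show ?thesis by (simp add: u_def)
    qed
    also have "\<dots> = (\<Sum>d\<le>s. p d *\<^sub>R EW m (\<lambda>w. complex_of_real (real d - 1) * of_bool (d + sum_list w = s)))"
    proof (rule integral_measure_pmf)
      fix d assume "EW m (\<lambda>w. complex_of_real (real d - 1) * of_bool (d + sum_list w = s)) \<noteq> 0"
      then show "d \<in> {..s}" by (rule contrapos_np) (auto intro!: integral_eq_zero_AE)
    qed simp
    also have "\<dots> = (\<Sum>d\<le>s. complex_of_real ((real d - 1) * p d * PS m (s - d)))"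
    proof (intro sum.cong refl)
      fix d assume "d \<in> {..s}"
      then have e: "(d + sum_list w = s) = (sum_list w = s - d)" for w by auto
      have "EW m (\<lambda>w. complex_of_real (real d - 1) * of_bool (d + sum_list w = s))
          = complex_of_real (real d - 1) * complex_of_real (PS m (s - d))"
        unfolding e integral_mult_right_zero PS_expectation_complex ..
      also have "\<dots> = complex_of_real ((real d - 1) * PS m (s - d))" by simp
      finally show "p d *\<^sub>R EW m (\<lambda>w. complex_of_real (real d - 1) * of_bool (d + sum_list w = s))
          = complex_of_real ((real d - 1) * p d * PS m (s - d))"
        by (simp add: scaleR_conv_of_real mult_ac del: of_real_diff)
    qed
    also have "\<dots> = complex_of_real (\<Sum>d\<le>s. (real d - 1) * p d * PS m (s - d))" by simp
    finally have e2: "complex_of_real (\<Sum>d\<le>s. (real d - 1) * p d * PS m (s - d))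
        = FI (\<lambda>t. EW (1 + m) (\<lambda>w. u (take 1 w) * 1 * cis (t * (real (sum_list w) - real (1 + m)))) * cis (t * (real (1 + m) - real s)))"
      using expectation_word_sum[OF X1 s] by simp
    have "norm (complex_of_real (\<Sum>d\<le>s. (real d - 1) * p d * PS m (s - d)))
        \<le> real span * (s2 * Kdec * (1 / sqrt (cdec * real n))) / sqrt (cdec * real n / 2)"
      unfolding e2
    proof (rule norm_FI_le)
      fix t assume t: "t \<in> {- pi / real span..pi / real span}"
      have b: "0 < cdec * real n" using cdec_pos n by simp
      have iu2: "integrable_W 1 (\<lambda>w. u w * cis (t * (real (sum_list w) - 1)))"
        by (rule Bochner_Integration.integrable_bound[OF iu]) (auto simp: norm_mult)
      have iv2: "integrable_W m (\<lambda>w. cis (t * (real (sum_list w) - real m)))"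
        by (rule measure_pmf.integrable_const_bound[of _ 1]) auto
      have sp: "u (take 1 w) * 1 * cis (t * (real (sum_list w) - real (1 + m)))
         = (u (take 1 w) * cis (t * (real (sum_list (take 1 w)) - 1))) * cis (t * (real (sum_list (drop 1 w)) - real m))" for w
      proof -
        have "sum_list w = sum_list (take 1 w) + sum_list (drop 1 w)"
          by (metis append_take_drop_id sum_list_append)
        then show ?thesis by (simp add: mult.assoc cis_mult algebra_simps)
      qed
      have "EW (1 + m) (\<lambda>w. u (take 1 w) * 1 * cis (t * (real (sum_list w) - real (1 + m))))
          = EW 1 (\<lambda>w. u w * cis (t * (real (sum_list w) - 1))) * psi t ^ m"
        unfolding sp expectation_cis_word[symmetric] by (rule expectation_replicate_mult[OF iu2 iv2])
      also have "EW 1 (\<lambda>w. u w * cis (t * (real (sum_list w) - 1)))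
          = measure_pmf.expectation \<xi> (\<lambda>k. complex_of_real (real k - 1) * cis (t * (real k - 1)))"
        unfolding W1 u_def by (simp del: of_real_diff)
      finally have "norm (EW (1 + m) (\<lambda>w. u (take 1 w) * 1 * cis (t * (real (sum_list w) - real (1 + m)))) * cis (t * (real (1 + m) - real s)))
          = norm (measure_pmf.expectation \<xi> (\<lambda>k. complex_of_real (real k - 1) * cis (t * (real k - 1)))) * norm (psi t ^ m)"
        by (simp add: norm_mult del: of_real_diff)
      also have "\<dots> \<le> (s2 * \<bar>t\<bar>) * (Kdec * exp (- (cdec * (real m + 1)) * t\<^sup>2))"
        by (intro mult_mono norm_centred_cis_le norm_psi_power' t) (use s2_pos in auto)
      also have "\<dots> = s2 * Kdec * (\<bar>t\<bar> * exp (- (cdec * real n) * t\<^sup>2))" by (simp add: n add.commute)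
      also have "\<dots> \<le> s2 * Kdec * (1 / sqrt (cdec * real n) * exp (- (cdec * real n / 2) * t\<^sup>2))"
        using s2_pos K by (intro mult_left_mono gauss_moments(1)[OF b]) auto
      finally show "norm (EW (1 + m) (\<lambda>w. u (take 1 w) * 1 * cis (t * (real (sum_list w) - real (1 + m)))) * cis (t * (real (1 + m) - real s)))
          \<le> s2 * Kdec * (1 / sqrt (cdec * real n)) * exp (- (cdec * real n / 2) * t\<^sup>2)" by simp
    qed (use cdec_pos n s2_pos K in auto)
    then have "real n * \<bar>\<Sum>d\<le>s. (real d - 1) * p d * PS m (s - d)\<bar>
        \<le> real n * (real span * (s2 * Kdec * (1 / sqrt (cdec * real n))) / sqrt (cdec * real n / 2))"
      by (intro mult_left_mono) (simp_all only: norm_of_real of_nat_0_le_iff)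
    also have "\<dots> = C"
    proof -
      have "sqrt (cdec * real n) = sqrt cdec * sqrt (real n)" "sqrt (cdec * real n / 2) = sqrt (cdec / 2) * sqrt (real n)"
        by (simp_all add: real_sqrt_mult real_sqrt_divide)
      note sq = this
      have key: "r * r * (a * (b * (1 / (x * r))) / (y * r)) = a * (b * (1 / x)) / y" if "0 < r" for r a b x y :: real
        using that by simp
      have rn: "real n = sqrt (real n) * sqrt (real n)" by simp
      show ?thesis unfolding sq C_def
        using key[of "sqrt (real n)" "real span" "s2 * Kdec" "sqrt cdec" "sqrt (cdec / 2)"] n
        by (subst rn) simp
    qed
    finally have "\<bar>(real s - real n) * PS n s\<bar> \<le> C" unfolding e1 by (simp add: abs_mult)
    then show ?thesis using PS_nonneg[of n s] by (simp add: abs_mult)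
  qed
  then show ?thesis using C by blast
qed

end

context critical_offspring
begin

section \<open>Second moments under conditioning\<close>

lemma treesum_one_nonneg: "0 \<le> mass n"
  by (rule treesum_nonneg) simp

lemma treesum_one: "1 \<le> n \<Longrightarrow> mass n = PS n (n - 1) / real n"
  using kemperman[of 1 n] by (simp add: field_simps)

lemma treesum_abs_le:
  assumes "\<And>T. tree_order T = n \<Longrightarrow> \<bar>\<phi> T\<bar> \<le> B"
  shows "\<bar>treesum \<phi> n\<bar> \<le> B * mass n"
proof -
  have "\<bar>treesum \<phi> n\<bar> \<le> treesum (\<lambda>T. B * 1) n"
    by (rule order_trans[OF abs_treesum_le]) (rule treesum_mono, use assms in simp)
  then show ?thesis by (simp only: treesum_cmult)
qed

lemma treesum_eq_0: "mass n = 0 \<Longrightarrow> treesum \<phi> n = 0"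
proof -
  assume a: "mass n = 0"
  define B where "B = (\<Sum>T\<in>trees n. \<bar>\<phi> T\<bar>)"
  have bd: "\<bar>\<phi> T\<bar> \<le> B" if "tree_order T = n" for T
    unfolding B_def using that by (intro member_le_sum) (auto simp: trees_def[symmetric], simp add: trees_def)
  from treesum_abs_le[of n \<phi> B, OF bd] a show ?thesis by simp
qed

lemma treesum_span: "treesum \<phi> n \<noteq> 0 \<Longrightarrow> 1 \<le> n \<and> span dvd (n - 1)"
proof -
  assume a: "treesum \<phi> n \<noteq> 0"
  then have n: "1 \<le> n" by (cases n) auto
  have "mass n \<noteq> 0" using a treesum_eq_0 by blast
  then have "PS n (n - 1) \<noteq> 0" using treesum_one[OF n] by auto
  then show ?thesis using n PS_span by blast
qed

lemma TT_power_bound: "1 \<le> m \<Longrightarrow> fps_nth (TT ^ r) m \<le> real r / real m * PS m (m - r)"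
proof (cases "r \<le> m")
  case True
  assume "1 \<le> m"
  then show ?thesis using kemperman[OF True] by (simp add: field_simps)
qed (simp add: TT_power_eq_0 PS_nonneg)

lemma TT_power_nonneg: "0 \<le> fps_nth (TT ^ r) m"
  unfolding fsum_one[symmetric] fsum_def by (intro sum_nonneg) auto

text \<open>Induction along the root decomposition: if the sum up to n is at most 1, so are the
  corresponding sums of all powers of \<open>TT\<close>, and hence their mixture with weights
  \<open>p d\<close>.\<close>

lemma TT_partial_sum: "(\<Sum>k\<le>n. fps_nth TT k) \<le> 1"
proof (induction n)
  case (Suc n)
  have pw: "(\<Sum>k\<le>n. fps_nth (TT ^ d) k) \<le> 1" for d
  proof (induction d)
    case (Suc d)
    have "(\<Sum>k\<le>n. fps_nth (TT * TT ^ d) k) \<le> 1 * 1"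
      using \<open>(\<Sum>k\<le>n. fps_nth TT k) \<le> 1\<close> Suc TT_power_nonneg[of 1]
      by (intro fps_mult_partial_sum TT_power_nonneg) auto
    then show ?case by simp
  qed simp
  have "(\<Sum>k\<le>Suc n. fps_nth TT k) = (\<Sum>m\<le>n. \<Sum>d\<le>n. p d * fps_nth (TT ^ d) m)"
    by (subst sum.atMost_Suc_shift) (simp add: treesum_Suc[of _ n] fsum_one)
  also have "\<dots> = (\<Sum>d\<le>n. p d * (\<Sum>m\<le>n. fps_nth (TT ^ d) m))"
    unfolding sum_distrib_left by (rule sum.swap)
  also have "\<dots> \<le> (\<Sum>d\<le>n. p d * 1)" by (intro sum_mono mult_left_mono pw) auto
  also have "\<dots> \<le> 1" using sum_p_le[of n] by simp
  finally show ?case .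
qed simp

lemma TT_power_partial_sum: "(\<Sum>k\<le>n. fps_nth (TT ^ d) k) \<le> 1"
proof (induction d)
  case (Suc d)
  have "(\<Sum>k\<le>n. fps_nth (TT * TT ^ d) k) \<le> 1 * 1"
    using TT_partial_sum Suc TT_power_nonneg[of 1] by (intro fps_mult_partial_sum TT_power_nonneg) auto
  then show ?case by simp
qed simp

lemma w3_Suc_le: "1 \<le> m \<Longrightarrow> w3 (Suc m) \<le> 6 * (real m * sqrt (real m + 1))"
proof -
  assume m: "1 \<le> m"
  have "w3 (Suc m) \<le> 3 * w3 m" by (rule w3_double) simp
  also have "w3 m \<le> 2 * (real m * sqrt (real m + 1))"
    unfolding w3_def mult.assoc[symmetric] using m by (intro mult_right_mono) auto
  finally show ?thesis by simp
qed

lemma TT_controlled: "\<exists>C. controlled w3 TT C"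
proof -
  obtain C where C: "0 < C" "\<And>n s. PS n s \<le> C / sqrt (real n + 1)" using PS_le by blast
  have "w3 n * fps_nth TT n \<le> 2 * C" for n
  proof (cases "n = 0")
    case False
    have "w3 n * fps_nth TT n = (real n + 1) / real n * (sqrt (real n + 1) * PS n (n - 1))"
      using False by (simp add: treesum_one w3_def)
    also have "\<dots> \<le> 2 * (sqrt (real n + 1) * (C / sqrt (real n + 1)))"
      using False C by (intro mult_mono) (auto simp: field_simps PS_nonneg)
    finally show ?thesis by simp
  qed (use C in simp)
  then have "controlled w3 TT (max 1 (2 * C))"
    unfolding controlled_def using TT_partial_sum by (auto simp: treesum_one_nonneg le_max_iff_disj)
  then show ?thesis ..
qed

lemma Lam_partial_sum: "(\<Sum>k\<le>n. fps_nth Lam k) \<le> 1"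
proof (cases n)
  case (Suc m)
  have "(\<Sum>k\<le>n. fps_nth Lam k) = (\<Sum>k\<le>m. \<Sum>d\<le>Suc m. real d * p d * fps_nth (TT ^ (d - 1)) k)"
    unfolding Suc by (subst sum.atMost_Suc_shift) (simp add: Lam_Suc[of _ "Suc m"] del: sum.atMost_Suc)
  also have "\<dots> = (\<Sum>d\<le>Suc m. real d * p d * (\<Sum>k\<le>m. fps_nth (TT ^ (d - 1)) k))"
    unfolding sum_distrib_left by (rule sum.swap)
  also have "\<dots> \<le> (\<Sum>d\<le>Suc m. real d * p d * 1)"
    by (intro sum_mono mult_left_mono TT_power_partial_sum) auto
  finally show ?thesis using sum_first_moment_le[of "Suc m"] by simp
qed simp

text \<open>\<open>TT_power_bound\<close> brings a factor d - 1, so the sum over d becomes the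
  second factorial moment of the offspring law. Finite variance thus gives the n^(-3/2)
  decay.\<close>

lemma Lam_controlled: "\<exists>C. controlled w3 Lam C"
proof -
  obtain C where C: "0 < C" "\<And>n s. PS n s \<le> C / sqrt (real n + 1)" using PS_le by blast
  have "w3 k * fps_nth Lam k \<le> max 3 (6 * C * s2)" for k
  proof (cases k)
    case (Suc m)
    show ?thesis
    proof (cases "m = 0")
      case True
      have "fps_nth Lam 1 \<le> (\<Sum>k\<le>1. fps_nth Lam k)" by (simp add: Lam_nonneg)
      then have "fps_nth Lam 1 \<le> 1" using Lam_partial_sum[of 1] by linarith
      moreover have "w3 1 \<le> 3 * w3 0" by (rule w3_double) simp
      then have "w3 1 \<le> 3" by (simp add: w3_def[of 0])
      ultimately have "w3 1 * fps_nth Lam 1 \<le> 3 * 1" by (intro mult_mono) (auto simp: Lam_nonneg)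
      then show ?thesis using Suc True by (simp add: le_max_iff_disj)
    next
      case False
      have "fps_nth Lam k \<le> (\<Sum>d\<le>Suc m. real d * p d * (real (d - 1) / real m * (C / sqrt (real m + 1))))"
        unfolding Suc Lam_Suc[OF order_refl]
        by (intro sum_mono mult_left_mono order_trans[OF TT_power_bound] C) (use False in auto)
      also have "\<dots> = (\<Sum>d\<le>Suc m. real d * (real d - 1) * p d) * (C / (real m * sqrt (real m + 1)))"
        unfolding sum_distrib_right
      proof (intro sum.cong refl)
        fix d :: nat
        show "real d * p d * (real (d - 1) / real m * (C / sqrt (real m + 1)))
            = real d * (real d - 1) * p d * (C / (real m * sqrt (real m + 1)))"
          by (cases d) (simp_all add: mult_ac)
      qed
      also have "\<dots> \<le> s2 * (C / (real m * sqrt (real m + 1)))"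
        using C(1) by (intro mult_right_mono sum_factorial2_le) auto
      finally have "w3 k * fps_nth Lam k \<le> (6 * (real m * sqrt (real m + 1))) * (s2 * (C / (real m * sqrt (real m + 1))))"
        unfolding Suc using False s2_pos C(1) by (intro mult_mono w3_Suc_le) (auto simp: Lam_nonneg)
      also have "\<dots> = 6 * C * s2" using False by simp
      finally show ?thesis by (simp add: le_max_iff_disj)
    qed
  qed (use s2_pos C in simp)
  then have "controlled w3 Lam (max 3 (6 * C * s2))"
    unfolding controlled_def using order_trans[OF Lam_partial_sum, of "max 3 (6 * C * s2)"]
    by (auto simp: Lam_nonneg)
  then show ?thesis ..
qed

lemma levels_controlled: "\<exists>C. controlled w3 (\<Sum>i<M. Lam ^ i * TT) C"
proof (induction M)
  case 0 show ?case by (intro exI[of _ 0]) (simp add: controlled_def)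
next
  case (Suc M)
  obtain C where C: "controlled w3 (\<Sum>i<M. Lam ^ i * TT) C" using Suc ..
  obtain CT where CT: "controlled w3 TT CT" using TT_controlled ..
  obtain CL where CL: "controlled w3 (Lam ^ M) CL" using Lam_controlled controlled_power_w3 by blast
  from controlled_add[OF C controlled_mult_w3[OF CL CT]] show ?case by auto
qed

text \<open>The same argument would call for third moments. Instead the factor r of
  \<open>TT_power_bound\<close> is absorbed by the first-moment local bound, uniformly in r, which
  leaves only the weight n.\<close>

lemma Lam2_controlled: "\<exists>C. controlled (\<lambda>n. real n + 1) Lam2 C"
proof -
  obtain C where C: "0 < C" "\<And>n s. \<bar>real s - real n\<bar> * PS n s \<le> C" using PS_first_moment_le by blast
  have ps: "(\<Sum>k\<le>n. fps_nth Lam2 k) \<le> s2" for n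
  proof (cases n)
    case (Suc m)
    have "(\<Sum>k\<le>n. fps_nth Lam2 k) = (\<Sum>k\<le>m. \<Sum>d\<le>m + 2. real d * (real d - 1) * p d * fps_nth (TT ^ (d - 2)) k)"
      unfolding Suc by (subst sum.atMost_Suc_shift) (simp add: Lam2_Suc[of _ "m + 2"] del: sum.atMost_Suc)
    also have "\<dots> = (\<Sum>d\<le>m + 2. real d * (real d - 1) * p d * (\<Sum>k\<le>m. fps_nth (TT ^ (d - 2)) k))"
      unfolding sum_distrib_left by (rule sum.swap)
    also have "\<dots> \<le> (\<Sum>d\<le>m + 2. real d * (real d - 1) * p d * 1)"
      by (intro sum_mono mult_left_mono TT_power_partial_sum mult_nonneg_nonneg[OF factorial2_nonneg]) auto
    finally show ?thesis using sum_factorial2_le[of "m + 2"] by simp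
  qed (use s2_pos in simp)
  have "(real k + 1) * fps_nth Lam2 k \<le> max (2 * s2) (3 * (s2 * C))" for k
  proof (cases k)
    case (Suc m)
    show ?thesis
    proof (cases "m = 0")
      case True
      have "fps_nth Lam2 1 \<le> (\<Sum>k\<le>1. fps_nth Lam2 k)" by (simp add: Lam2_nonneg)
      then have "fps_nth Lam2 1 \<le> s2" using ps[of 1] by linarith
      then show ?thesis using Suc True by (simp add: le_max_iff_disj)
    next
      case False
      have T: "fps_nth (TT ^ r) m \<le> C / real m" for r
      proof (cases "r \<le> m")
        case True
        have "fps_nth (TT ^ r) m \<le> real r / real m * PS m (m - r)" using False by (intro TT_power_bound) simp
        also have "\<dots> = \<bar>real (m - r) - real m\<bar> * PS m (m - r) / real m" using True by (simp add: of_nat_diff)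
        also have "\<dots> \<le> C / real m" by (intro divide_right_mono C) simp
        finally show ?thesis .
      qed (use C(1) in \<open>simp add: TT_power_eq_0\<close>)
      have "fps_nth Lam2 k \<le> (\<Sum>d\<le>m + 2. real d * (real d - 1) * p d * (C / real m))"
        unfolding Suc Lam2_Suc[OF order_refl]
        by (intro sum_mono mult_left_mono T mult_nonneg_nonneg[OF factorial2_nonneg]) auto
      also have "\<dots> \<le> s2 * (C / real m)"
        unfolding sum_distrib_right[symmetric] using C(1) by (intro mult_right_mono sum_factorial2_le) auto
      finally have "(real k + 1) * fps_nth Lam2 k \<le> (3 * real m) * (s2 * (C / real m))"
        using False s2_pos C(1) by (intro mult_mono) (auto simp: Lam2_nonneg Suc)
      also have "\<dots> = 3 * (s2 * C)" using False by simp
      finally show ?thesis by (simp add: le_max_iff_disj)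
    qed
  qed (use s2_pos in \<open>simp add: le_max_iff_disj\<close>)
  then have "controlled (\<lambda>n. real n + 1) Lam2 (max (2 * s2) (3 * (s2 * C)))"
    unfolding controlled_def using order_trans[OF ps, of "max (2 * s2) (3 * (s2 * C))"] s2_pos
    by (auto simp: Lam2_nonneg)
  then show ?thesis ..
qed

lemma Lam_span: "fps_nth Lam k \<noteq> 0 \<Longrightarrow> span dvd k"
proof (cases k)
  case (Suc m)
  assume "fps_nth Lam k \<noteq> 0"
  then obtain d where d: "real d * p d * fps_nth (TT ^ (d - 1)) m \<noteq> 0"
    unfolding Suc Lam_Suc[OF order_refl] by (metis (mono_tags, lifting) sum.not_neutral_contains_not_neutral)
  then have "p d \<noteq> 0" and d0: "d \<noteq> 0" and T: "fps_nth (TT ^ (d - 1)) m \<noteq> 0" by auto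
  then have sd: "span dvd d" by (intro span_dvd) (simp add: set_pmf_iff)
  have le: "d - 1 \<le> m" using T TT_power_eq_0[of m "d - 1"] by force
  show ?thesis
  proof (cases "m = 0")
    case True
    then show ?thesis using sd d0 le Suc by (cases d) auto
  next
    case False
    then have "PS m (m - (d - 1)) \<noteq> 0" using kemperman[OF le] T by auto
    then have "span dvd (m - (d - 1)) + d" using sd PS_span by (intro dvd_add) auto
    then show ?thesis using le d0 Suc by simp
  qed
qed simp

lemma Lam_power_span: "fps_nth (Lam ^ M) k \<noteq> 0 \<Longrightarrow> span dvd k"
proof (induction M arbitrary: k)
  case (Suc M)
  then obtain i where "i \<le> k" "fps_nth Lam i * fps_nth (Lam ^ M) (k - i) \<noteq> 0"
    unfolding power_Suc fps_mult_nth by (metis (mono_tags, lifting) atLeastAtMost_iff sum.not_neutral_contains_not_neutral)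
  then have "span dvd i" "span dvd (k - i)" using Lam_span Suc.IH by auto
  then have "span dvd i + (k - i)" by (rule dvd_add)
  then show ?case using \<open>i \<le> k\<close> by simp
qed (auto split: if_splits)

text \<open>The first moments of the additive functional are those of \<open>g\<close> convolved
  with P(S_j = j). Mean zero of \<open>g\<close> makes them summable in spite of the n^(-1/2) decay
  of the kernel.\<close>

lemma gf_additive_controlled:
  "\<exists>C>0. \<forall>g \<epsilon>. (\<Sum>n. treesum g n) = 0 \<longrightarrow> summable (\<lambda>n. sqrt (real n + 1) * \<bar>treesum g n\<bar>)
    \<longrightarrow> (\<Sum>n. sqrt (real n + 1) * \<bar>treesum g n\<bar>) \<le> \<epsilon> \<longrightarrow> (\<forall>n. w3 n * \<bar>treesum g n\<bar> \<le> \<epsilon>)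
    \<longrightarrow> controlled (\<lambda>n. real n + 1) (Abs_fps (\<lambda>n. \<bar>treesum (additive_functional g) n\<bar>)) (C * \<epsilon>)"
proof -
  obtain C where C: "0 < C" "\<And>x. root_decay C (\<lambda>j. pt j x)" using pt_root_decay by blast
  show ?thesis
  proof (intro exI[of _ "20 * C"] conjI allI impI)
    show "0 < 20 * C" using C by simp
    fix g \<epsilon>
    assume z: "(\<Sum>n. treesum g n) = 0" and s: "summable (\<lambda>n. sqrt (real n + 1) * \<bar>treesum g n\<bar>)"
      and N1: "(\<Sum>n. sqrt (real n + 1) * \<bar>treesum g n\<bar>) \<le> \<epsilon>" and N2: "\<forall>n. w3 n * \<bar>treesum g n\<bar> \<le> \<epsilon>"
    have e0: "0 \<le> \<epsilon>" using N2[rule_format, of 0] by (simp add: w3_def)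
    \<comment> \<open>The kernel \<open>pt\<close> replaces P(S_j = j), which has no small
      increments when the span exceeds 1. At orders off the lattice the first moment of the
      functional vanishes, so an inequality remains.\<close>
    define b where "b l = (\<Sum>j\<le>l. treesum g j * pt (l - j) 0)" for l
    have le: "\<bar>treesum (additive_functional g) l\<bar> \<le> \<bar>b l\<bar>" for l
    proof (cases "treesum (additive_functional g) l = 0")
      case False
      then have l: "1 \<le> l" "span dvd (l - 1)" using treesum_span by blast+
      have "treesum (additive_functional g) l = fps_nth (gf g * UU) l"
        using gf_additive[of g] by (metis gf_nth)
      also have "\<dots> = (\<Sum>j\<le>l. treesum g j * PS (l - j) (l - j))"
        by (simp add: fps_mult_nth atLeast0AtMost UU_def)
      also have "\<dots> = b l" unfolding b_def
      proof (intro sum.cong refl)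
        fix j assume j: "j \<in> {..l}"
        show "treesum g j * PS (l - j) (l - j) = treesum g j * pt (l - j) 0"
        proof (cases "treesum g j = 0")
          case False
          then have "1 \<le> j" "span dvd (j - 1)" using treesum_span by blast+
          then have "span dvd (l - 1) - (j - 1)" using l(2) by (metis dvd_diff_nat)
          then have "span dvd (l - j)" using \<open>1 \<le> j\<close> by simp
          from PS_eq_pt[OF this, of "l - j"] show ?thesis by simp
        qed simp
      qed
      finally show ?thesis by simp
    qed simp
    show "controlled (\<lambda>n. real n + 1) (Abs_fps (\<lambda>n. \<bar>treesum (additive_functional g) n\<bar>)) (20 * C * \<epsilon>)"
      unfolding controlled_def fps_nth_Abs_fps
    proof (intro conjI allI)
      fix n
      have "(\<Sum>k\<le>n. \<bar>treesum (additive_functional g) k\<bar>) \<le> (\<Sum>k\<le>n. \<bar>b k\<bar>)" by (intro sum_mono le)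
      also have "\<dots> \<le> 12 * C * (\<Sum>j. sqrt (real j + 1) * \<bar>treesum g j\<bar>)"
        unfolding b_def by (rule convolution_root_decay_sum[OF C(2) s z])
      also have "\<dots> \<le> 12 * C * \<epsilon>" using C(1) by (intro mult_left_mono N1) auto
      also have "\<dots> \<le> 20 * C * \<epsilon>" using C(1) e0 by (intro mult_right_mono) auto
      finally show "(\<Sum>k\<le>n. \<bar>treesum (additive_functional g) k\<bar>) \<le> 20 * C * \<epsilon>" .
      have "\<bar>treesum g j\<bar> \<le> \<epsilon> / w3 j" for j using N2 by (simp add: pos_le_divide_eq mult.commute)
      from convolution_root_decay[OF C(2)[of 0] this, of n]
      have "\<bar>b n\<bar> \<le> 20 * C * \<epsilon> / (real n + 1)" unfolding z b_def by simp
      then have "\<bar>treesum (additive_functional g) n\<bar> \<le> 20 * C * \<epsilon> / (real n + 1)" using le[of n] by linarith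
      then show "(real n + 1) * \<bar>treesum (additive_functional g) n\<bar> \<le> 20 * C * \<epsilon>"
        by (simp add: pos_le_divide_eq mult.commute)
    qed simp
  qed
qed

definition weakly_local_at :: "nat \<Rightarrow> (ptree \<Rightarrow> real) \<Rightarrow> bool" where
  "weakly_local_at M g \<longleftrightarrow> (\<forall>T T'. tree_order T = tree_order T' \<and> truncate M T = truncate M T' \<longrightarrow> g T = g T')"

lemma truncate_idem: "truncate M (truncate M T) = truncate M T"
  by (induction M arbitrary: T) auto

text \<open>On the trees of one fixed order n a weakly local functional is local: its value can be
  read off any tree of order n with the same truncation. The factor that
  \<open>gf_marked_level\<close> then provides depends on n, but its bound does not.\<close>

lemma weakly_local_marked:
  assumes g: "weakly_local_at M g" and B: "\<And>T. \<bar>g T\<bar> \<le> B"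
  shows "\<bar>treesum (\<lambda>T. g T * level_sum M \<phi> T) n\<bar> \<le> B * fps_nth (Lam ^ M * Abs_fps (\<lambda>l. \<bar>treesum \<phi> l\<bar>)) n"
proof -
  have B0: "0 \<le> B" using B[of "Node []"] by linarith
  define P where "P T T' \<longleftrightarrow> tree_order T' = n \<and> truncate M T' = truncate M T" for T T'
  \<comment> \<open>The value 0 is taken where no tree of order n has the given truncation, so that
    \<open>h\<close> is local on all trees.\<close>
  define h where "h T = (if \<exists>T'. P T T' then g (SOME T'. P T T') else 0)" for T
  have hg: "h T = g T" if "tree_order T = n" for T
  proof -
    have "\<exists>T'. P T T'" using that by (auto simp: P_def)
    then have "P T (SOME T'. P T T')" by (rule someI_ex)
    then have "g (SOME T'. P T T') = g T" using g that unfolding weakly_local_at_def P_def by metis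
    then show ?thesis using \<open>\<exists>T'. P T T'\<close> by (simp add: h_def)
  qed
  have "P (truncate M T) = P T" for T by (simp add: P_def truncate_idem fun_eq_iff)
  then have ht: "h T = h (truncate M T)" for T by (simp add: h_def)
  have hB: "\<bar>h T\<bar> \<le> B" for T using B B0 by (auto simp: h_def)
  obtain R where R: "\<And>j. \<bar>fps_nth R j\<bar> \<le> B * fps_nth (Lam ^ M) j" "\<And>\<phi>. gf (\<lambda>T. h T * level_sum M \<phi> T) = R * gf \<phi>"
    using gf_marked_level[of h B M, OF hB ht] by blast
  have "treesum (\<lambda>T. g T * level_sum M \<phi> T) n = treesum (\<lambda>T. h T * level_sum M \<phi> T) n"
    by (intro treesum_cong) (simp add: hg)
  also have "\<dots> = fps_nth (R * gf \<phi>) n" using R(2)[of \<phi>] by (metis gf_nth)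
  also have "\<bar>\<dots>\<bar> \<le> (\<Sum>i\<le>n. (B * fps_nth (Lam ^ M) i) * \<bar>treesum \<phi> (n - i)\<bar>)"
    unfolding fps_mult_nth atLeast0AtMost
    by (intro order_trans[OF sum_abs] sum_mono) (auto simp: abs_mult intro!: mult_right_mono R(1))
  also have "\<dots> = B * fps_nth (Lam ^ M * Abs_fps (\<lambda>l. \<bar>treesum \<phi> l\<bar>)) n"
    by (simp add: fps_mult_nth atLeast0AtMost sum_distrib_left mult_ac)
  finally show ?thesis .
qed

lemma trees_1: "tree_order T = 1 \<longleftrightarrow> T = Node []"
proof
  assume "tree_order T = 1"
  then obtain ts where T: "T = Node ts" "(\<Sum>t\<leftarrow>ts. tree_order t) = 0" by (cases T) (auto simp: tree_order_Node)
  then show "T = Node []" using tree_order_pos[of "hd ts"] by (cases ts) auto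
qed (simp add: tree_order_Node)

lemma treesum_1: "treesum \<phi> 1 = p 0 * \<phi> (Node [])"
proof -
  have "trees 1 = {Node []}" using trees_1 by (auto simp: trees_def)
  then show ?thesis by (simp add: treesum_def)
qed

text \<open>The bound for the large-tree part. In \<open>gf_additive_square\<close> the term g (2G -
  g) is expanded by levels: levels below M are at most a constant times the number of nodes there,
  and level M is reached by marking. As \<open>g\<close> vanishes on the orders from 2 to K, only
  the tail beyond K of the former survives; the marked term and the \<open>Lam2\<close> term carry
  the small first moments of G. Division by \<open>mass n\<close>, of order n^(-3/2), will leave a
  bound linear in n.\<close>

lemma additive_functional_second_moment:
  assumes "0 \<le> B"
  shows "\<exists>C>0. \<forall>g K \<epsilon>. (\<forall>T. \<bar>g T\<bar> \<le> B) \<longrightarrow> weakly_local_at M g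
    \<longrightarrow> (\<forall>T. tree_order T \<noteq> 1 \<longrightarrow> tree_order T \<le> K \<longrightarrow> g T = 0)
    \<longrightarrow> (\<Sum>n. treesum g n) = 0 \<longrightarrow> summable (\<lambda>n. sqrt (real n + 1) * \<bar>treesum g n\<bar>)
    \<longrightarrow> (\<Sum>n. sqrt (real n + 1) * \<bar>treesum g n\<bar>) \<le> \<epsilon> \<longrightarrow> (\<forall>n. w3 n * \<bar>treesum g n\<bar> \<le> \<epsilon>)
    \<longrightarrow> \<bar>g (Node [])\<bar> \<le> \<epsilon> \<longrightarrow> \<epsilon> \<le> 1
    \<longrightarrow> (\<forall>n. \<bar>treesum (\<lambda>T. (additive_functional g T)\<^sup>2) n\<bar> \<le> C * (\<epsilon> + 1 / sqrt (real K + 1)) / sqrt (real n + 1))"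
proof -
  obtain C1 where C1: "0 < C1" "\<And>g \<epsilon>. (\<Sum>n. treesum g n) = 0 \<Longrightarrow> summable (\<lambda>n. sqrt (real n + 1) * \<bar>treesum g n\<bar>)
    \<Longrightarrow> (\<Sum>n. sqrt (real n + 1) * \<bar>treesum g n\<bar>) \<le> \<epsilon> \<Longrightarrow> (\<forall>n. w3 n * \<bar>treesum g n\<bar> \<le> \<epsilon>)
    \<Longrightarrow> controlled (\<lambda>n. real n + 1) (Abs_fps (\<lambda>n. \<bar>treesum (additive_functional g) n\<bar>)) (C1 * \<epsilon>)"
    using gf_additive_controlled by blast
  obtain CT where CT: "controlled w3 TT CT" using TT_controlled ..
  have "\<exists>C. controlled w3 (Lam ^ i) C" for i using Lam_controlled controlled_power_w3 by blast
  then obtain CL where CL: "\<And>i. controlled w3 (Lam ^ i) (CL i)" by metis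
  obtain C2 where C2: "controlled (\<lambda>n. real n + 1) Lam2 C2" using Lam2_controlled ..
  obtain CU where CU: "0 < CU" "\<And>n s. PS n s \<le> CU / sqrt (real n + 1)" using PS_le by blast
  \<comment> \<open>Majorant of the levels below M: the factor 2 B^2 belongs to 2 g G, the further
    B^2 to g^2.\<close>
  define X where "X = fps_const (B * B) * TT + fps_const (2 * B * B) * (\<Sum>i<M. Lam ^ i * TT)"
  obtain CS where "controlled w3 (\<Sum>i<M. Lam ^ i * TT) CS" using levels_controlled ..
  then have "controlled w3 X (B * B * CT + 2 * B * B * CS)"
    unfolding X_def using assms by (intro controlled_add controlled_cmult CT) auto
  then have "\<exists>C. controlled w3 X C" ..
  then obtain CX where CX: "controlled w3 X CX" ..
  have nn: "0 \<le> CX" "0 \<le> CL M" "0 \<le> C2" using controlledD(4)[OF CX] controlledD(4)[OF CL[of M]] controlledD(4)[OF C2] by auto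
  define C0 where "C0 = 2 * CX + 2 * B * (2 * (CL M * C1)) + 2 + 2 * (C2 * (2 * (C1 * C1)))"
  have "0 \<le> 2 * B * (2 * (CL M * C1))" "0 \<le> 2 * (C2 * (2 * (C1 * C1)))" using nn assms C1(1) by auto
  then have C0: "0 < C0" using nn unfolding C0_def by linarith
  show ?thesis
  proof (intro exI[of _ "6 * CU * C0"] conjI allI impI)
    show "0 < 6 * CU * C0" using CU C0 by simp
    fix g K \<epsilon> n
    assume gB: "\<forall>T. \<bar>g T\<bar> \<le> B" and wl: "weakly_local_at M g"
      and small: "\<forall>T. tree_order T \<noteq> 1 \<longrightarrow> tree_order T \<le> K \<longrightarrow> g T = 0"
      and z: "(\<Sum>n. treesum g n) = 0" and s: "summable (\<lambda>n. sqrt (real n + 1) * \<bar>treesum g n\<bar>)"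
      and N1: "(\<Sum>n. sqrt (real n + 1) * \<bar>treesum g n\<bar>) \<le> \<epsilon>" and N2: "\<forall>n. w3 n * \<bar>treesum g n\<bar> \<le> \<epsilon>"
      and leaf: "\<bar>g (Node [])\<bar> \<le> \<epsilon>" and e1: "\<epsilon> \<le> 1"
    let ?G = "additive_functional g"
    let ?lin = "\<lambda>n. real n + 1"
    have e0: "0 \<le> \<epsilon>" using leaf by linarith
    define \<beta> where "\<beta> = Abs_fps (\<lambda>n. \<bar>treesum ?G n\<bar>)"
    have \<beta>: "controlled ?lin \<beta> (C1 * \<epsilon>)" unfolding \<beta>_def by (rule C1(2)[OF z s N1 N2])
    define e where "e k = treesum (\<lambda>T. g T * (2 * ?G T - g T)) k" for k
    \<comment> \<open>The one-node tree is exempt from the vanishing of \<open>g\<close> and is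
      recorded separately.\<close>
    define \<delta> where "\<delta> = Abs_fps (\<lambda>k. if k = 1 then \<epsilon> else 0)"
    \<comment> \<open>Majorant of \<open>e\<close> at all orders: low levels beyond K, the marked
      level, and the leaf.\<close>
    define Y where "Y = Abs_fps (\<lambda>k. if K < k then fps_nth X k else 0) + fps_const (2 * B) * (Lam ^ M * \<beta>) + \<delta>"
    have X0: "0 \<le> fps_nth X k" for k using controlledD(1)[OF CX] .
    have LB0: "0 \<le> fps_nth (Lam ^ M * \<beta>) k" for k
      by (intro fps_mult_nonneg controlledD(1)[OF CL] controlledD(1)[OF \<beta>])
    have levels: "\<bar>e k\<bar> \<le> fps_nth X k + 2 * B * fps_nth (Lam ^ M * \<beta>) k" for k
    proof -
      have lev: "\<bar>treesum (\<lambda>T. g T * level_sum i g T) k\<bar> \<le> B * B * fps_nth (Lam ^ i * TT) k" for i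
      proof -
        have "\<bar>g T * level_sum i g T\<bar> \<le> B * B * level_sum i (\<lambda>_. 1) T" for T
        proof -
          have "\<bar>level_sum i g T\<bar> \<le> B * level_sum i (\<lambda>_. 1) T" using gB by (intro level_sum_bound) simp
          then have "\<bar>g T\<bar> * \<bar>level_sum i g T\<bar> \<le> B * (B * level_sum i (\<lambda>_. 1) T)"
            using gB assms by (intro mult_mono) auto
          then show ?thesis by (simp add: abs_mult mult_ac)
        qed
        then have "\<bar>treesum (\<lambda>T. g T * level_sum i g T) k\<bar> \<le> treesum (\<lambda>T. B * B * level_sum i (\<lambda>_. 1) T) k"
          by (intro order_trans[OF abs_treesum_le] treesum_mono) simp
        also have "\<dots> = B * B * fps_nth (gf (level_sum i (\<lambda>_. 1))) k" by (simp only: treesum_cmult gf_nth)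
        finally show ?thesis by (simp only: gf_level)
      qed
      have "e k = treesum (\<lambda>T. 2 * (\<Sum>i<M. g T * level_sum i g T) + 2 * (g T * level_sum M ?G T) - g T * level_sum 0 g T) k"
        unfolding e_def
        by (intro treesum_cong, subst additive_functional_levels[of g _ M]) (simp add: algebra_simps sum_distrib_left)
      also have "\<dots> = 2 * (\<Sum>i<M. treesum (\<lambda>T. g T * level_sum i g T) k) + 2 * treesum (\<lambda>T. g T * level_sum M ?G T) k
          - treesum (\<lambda>T. g T * level_sum 0 g T) k"
        by (simp only: treesum_add treesum_diff treesum_cmult treesum_sum)
      also have "\<bar>\<dots>\<bar> \<le> 2 * (\<Sum>i<M. B * B * fps_nth (Lam ^ i * TT) k) + 2 * (B * fps_nth (Lam ^ M * \<beta>) k) + B * B * fps_nth TT k"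
      proof -
        have "\<bar>\<Sum>i<M. treesum (\<lambda>T. g T * level_sum i g T) k\<bar> \<le> (\<Sum>i<M. B * B * fps_nth (Lam ^ i * TT) k)"
          by (intro order_trans[OF sum_abs] sum_mono lev)
        moreover have "\<bar>treesum (\<lambda>T. g T * level_sum M ?G T) k\<bar> \<le> B * fps_nth (Lam ^ M * \<beta>) k"
          unfolding \<beta>_def using gB by (intro weakly_local_marked wl) auto
        moreover have "\<bar>treesum (\<lambda>T. g T * level_sum 0 g T) k\<bar> \<le> B * B * fps_nth TT k" using lev[of 0] by simp
        ultimately show ?thesis by linarith
      qed
      also have "\<dots> = fps_nth X k + 2 * B * fps_nth (Lam ^ M * \<beta>) k"
        unfolding X_def fps_add_nth fps_mult_left_const_nth fps_sum_nth
        by (simp add: sum_distrib_left mult.assoc)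
      finally show ?thesis .
    qed
    have eY: "\<bar>e k\<bar> \<le> fps_nth Y k" for k
    proof (cases "K < k")
      case True
      have "fps_nth Y k = fps_nth X k + 2 * B * fps_nth (Lam ^ M * \<beta>) k + fps_nth \<delta> k"
        unfolding Y_def fps_add_nth fps_mult_left_const_nth using True by simp
      moreover have "0 \<le> fps_nth \<delta> k" using e0 by (simp add: \<delta>_def)
      ultimately show ?thesis using levels[of k] by linarith
    next
      case False
      have "\<bar>e k\<bar> \<le> fps_nth \<delta> k"
      proof (cases "k = 1")
        case True
        have "\<bar>e k\<bar> = p 0 * \<bar>g (Node [])\<bar> * \<bar>g (Node [])\<bar>"
          unfolding e_def True treesum_1 by (simp add: additive_functional_Node abs_mult)
        also have "\<dots> \<le> 1 * \<epsilon> * 1"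
          using leaf e1 e0 by (intro mult_mono) (auto simp: pmf_le_1)
        finally show ?thesis using True by (simp add: \<delta>_def)
      next
        case k: False
        have "e k = treesum (\<lambda>T. 0 * 1) k" unfolding e_def
          by (rule treesum_cong) (use small False k in auto)
        then have "e k = 0" by (simp add: treesum_def)
        then show ?thesis using e0 by (simp add: \<delta>_def)
      qed
      moreover have "fps_nth Y k = 2 * B * fps_nth (Lam ^ M * \<beta>) k + fps_nth \<delta> k"
        unfolding Y_def fps_add_nth fps_mult_left_const_nth using False by simp
      moreover have "0 \<le> 2 * B * fps_nth (Lam ^ M * \<beta>) k" using assms LB0[of k] by simp
      ultimately show ?thesis by linarith
    qed
    define \<tau> where "\<tau> = gf (\<lambda>T. g T * (2 * ?G T - g T)) + Lam2 * (gf ?G)\<^sup>2"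
    define Z where "Z = Y + Lam2 * (\<beta> * \<beta>)"
    have \<tau>Z: "\<bar>fps_nth \<tau> k\<bar> \<le> fps_nth Z k" for k
    proof -
      have sq: "\<bar>fps_nth ((gf ?G)\<^sup>2) i\<bar> \<le> fps_nth (\<beta> * \<beta>) i" for i
        unfolding power2_eq_square fps_mult_nth \<beta>_def
        by (rule order_trans[OF sum_abs]) (simp add: abs_mult)
      have "\<bar>fps_nth (Lam2 * (gf ?G)\<^sup>2) k\<bar> \<le> fps_nth (Lam2 * (\<beta> * \<beta>)) k"
        unfolding fps_mult_nth[of Lam2]
        by (intro order_trans[OF sum_abs] sum_mono)
          (simp add: abs_mult abs_of_nonneg[OF Lam2_nonneg] mult_left_mono[OF sq Lam2_nonneg])
      moreover have "fps_nth \<tau> k = e k + fps_nth (Lam2 * (gf ?G)\<^sup>2) k" by (simp add: \<tau>_def e_def)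
      ultimately show ?thesis using eY[of k] unfolding Z_def fps_add_nth by linarith
    qed
    let ?\<rho> = "\<epsilon> + 1 / sqrt (real K + 1)"
    have "controlled ?lin Z (2 * CX / sqrt (real K + 1) + 2 * B * (2 * (CL M * (C1 * \<epsilon>))) + 2 * \<epsilon>
        + 2 * (C2 * (2 * ((C1 * \<epsilon>) * (C1 * \<epsilon>)))))"
    proof -
      have \<delta>: "controlled ?lin \<delta> (2 * \<epsilon>)"
        unfolding controlled_def \<delta>_def using e0 by (auto simp: sum.If_cases)
      have B2: "0 \<le> 2 * B" using assms by simp
      note LB = controlled_cmult[OF controlled_mult_lin[OF controlled_w3_imp_lin[OF CL[of M]] \<beta>] B2]
      show ?thesis unfolding Z_def Y_def
        by (intro controlled_add[OF controlled_add[OF controlled_add[OF controlled_w3_tail[OF CX] LB] \<delta>]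
            controlled_mult_lin[OF C2 controlled_mult_lin[OF \<beta> \<beta>]]])
    qed
    then have Z: "controlled ?lin Z (C0 * ?\<rho>)"
    proof (rule controlled_mono)
      have r: "\<epsilon> \<le> ?\<rho>" "1 / sqrt (real K + 1) \<le> ?\<rho>" using e0 by auto
      have ee: "\<epsilon> * \<epsilon> \<le> \<epsilon>" using e0 e1 mult_left_mono[of \<epsilon> 1 \<epsilon>] by simp
      have "2 * CX / sqrt (real K + 1) \<le> 2 * CX * ?\<rho>" using nn mult_left_mono[OF r(2), of "2 * CX"] by simp
      moreover have "2 * B * (2 * (CL M * (C1 * \<epsilon>))) \<le> 2 * B * (2 * (CL M * C1)) * ?\<rho>"
        using mult_left_mono[OF r(1), of "2 * B * (2 * (CL M * C1))"] assms nn C1(1) by (simp add: mult.assoc)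
      moreover have "2 * \<epsilon> \<le> 2 * ?\<rho>" using r by simp
      moreover have "2 * (C2 * (2 * ((C1 * \<epsilon>) * (C1 * \<epsilon>)))) \<le> 2 * (C2 * (2 * (C1 * C1))) * ?\<rho>"
      proof -
        have "2 * (C2 * (2 * ((C1 * \<epsilon>) * (C1 * \<epsilon>)))) = 2 * (C2 * (2 * (C1 * C1))) * (\<epsilon> * \<epsilon>)" by (simp add: mult_ac)
        also have "\<dots> \<le> 2 * (C2 * (2 * (C1 * C1))) * ?\<rho>"
          using nn by (intro mult_left_mono order_trans[OF ee r(1)]) auto
        finally show ?thesis .
      qed
      ultimately show "2 * CX / sqrt (real K + 1) + 2 * B * (2 * (CL M * (C1 * \<epsilon>))) + 2 * \<epsilon>
        + 2 * (C2 * (2 * ((C1 * \<epsilon>) * (C1 * \<epsilon>)))) \<le> C0 * ?\<rho>"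
        unfolding C0_def distrib_right[of _ _ ?\<rho>] by linarith
    qed
    have "treesum (\<lambda>T. (?G T)\<^sup>2) n = fps_nth (\<tau> * UU) n"
      unfolding \<tau>_def gf_additive_square[symmetric] by simp
    also have "\<dots> = (\<Sum>k\<le>n. fps_nth \<tau> k * PS (n - k) (n - k))"
      by (simp add: fps_mult_nth atLeast0AtMost UU_def)
    also have "\<bar>\<dots>\<bar> \<le> 6 * CU * (C0 * ?\<rho>) / sqrt (real n + 1)"
    proof (rule convolution_harmonic_root)
      show "\<bar>PS i i\<bar> \<le> CU / sqrt (real i + 1)" for i using CU PS_nonneg by (simp add: abs_of_nonneg)
      show "(\<Sum>k\<le>m. \<bar>fps_nth \<tau> k\<bar>) \<le> C0 * ?\<rho>" for m
        by (rule order_trans[OF sum_mono[OF \<tau>Z] controlledD(2)[OF Z]])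
      show "(real k + 1) * \<bar>fps_nth \<tau> k\<bar> \<le> C0 * ?\<rho>" for k
        by (rule order_trans[OF mult_left_mono[OF \<tau>Z] controlledD(3)[OF Z]]) simp
    qed
    finally show "\<bar>treesum (\<lambda>T. (?G T)\<^sup>2) n\<bar> \<le> 6 * CU * C0 * ?\<rho> / sqrt (real n + 1)" by (simp add: mult.assoc)
  qed
qed

section \<open>Local functionals of the conditioned tree\<close>

text \<open>The factor n counts nodes. There are few nodes at depth below M; any other node is
  counted through its ancestor at depth M, and marking decouples the fringe subtree of that ancestor
  from \<open>f\<close>. The total mass L of the resulting factor is the limit of the conditional
  means.\<close>

lemma local_functional_rate:
  assumes f: "\<And>T. f T = f (truncate M T)" and B: "\<And>T. \<bar>f T\<bar> \<le> B"
  shows "\<exists>L C. \<forall>n. real n * \<bar>treesum f n - L * mass n\<bar> \<le> C / (real n + 1)"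
proof -
  have B0: "0 \<le> B" using B[of "Node []"] by linarith
  obtain R where R: "\<And>j. \<bar>fps_nth R j\<bar> \<le> B * fps_nth (Lam ^ M) j" "\<And>\<phi>. gf (\<lambda>T. f T * level_sum M \<phi> T) = R * gf \<phi>"
    using gf_marked_level[of f B M, OF B f] by blast
  obtain CT where CT: "controlled w3 TT CT" using TT_controlled ..
  have "\<exists>C. controlled w3 (Lam ^ i) C" for i using Lam_controlled controlled_power_w3 by blast
  then obtain CL where CL: "\<And>i. controlled w3 (Lam ^ i) (CL i)" by metis
  obtain C where C: "0 < C" "\<And>x. root_decay C (\<lambda>j. pt j x)" using pt_root_decay by blast
  \<comment> \<open>On the lattice this is l times \<open>mass l\<close>; at 0, where there is no
    tree, it has to be 0. The jump between 0 and 1 is covered by the factor 3 in the next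
    bound.\<close>
  define u where "u l = (if l = 0 then 0 else pt l 1)" for l
  have u: "root_decay (3 * C) u"
    unfolding root_decay_def
  proof (intro conjI allI)
    fix i
    have d: "\<bar>pt i 1\<bar> \<le> C / sqrt (real i + 1)" "\<bar>pt (Suc i) 1 - pt i 1\<bar> \<le> C / w3 i" for i
      using root_decayD[OF C(2)[of 1]] by auto
    have "C / sqrt (real i + 1) \<le> 3 * C / sqrt (real i + 1)" using C(1) by (intro divide_right_mono) auto
    then show "\<bar>u i\<bar> \<le> 3 * C / sqrt (real i + 1)" using d(1)[of i] C(1) by (simp add: u_def)
    show "\<bar>u (Suc i) - u i\<bar> \<le> 3 * C / w3 i"
    proof (cases "i = 0")
      case True
      have "\<bar>pt 1 1\<bar> \<le> \<bar>pt (Suc 0) 1 - pt 0 1\<bar> + \<bar>pt 0 1\<bar>" by simp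
      also have "\<dots> \<le> C / w3 0 + C / sqrt (real 0 + 1)" by (intro add_mono d)
      finally show ?thesis using True C(1) by (simp add: u_def w3_def)
    next
      case False
      have "C / w3 i \<le> 3 * C / w3 i" using C(1) by (intro divide_right_mono) (auto simp: less_imp_le)
      then show ?thesis using d(2)[of i] False by (simp add: u_def)
    qed
  qed
  have ord: "treesum (\<lambda>t. real (tree_order t)) l = real l * mass l" for l
  proof -
    have "treesum (\<lambda>t. real (tree_order t)) l = treesum (\<lambda>t. real l * 1) l" by (rule treesum_cong) simp
    then show ?thesis by (simp only: treesum_cmult)
  qed
  have ordu: "real l * mass l = u l" if "span dvd (l - 1)" "1 \<le> l" for l
  proof -
    have "real l * mass l = PS l (l - 1)" using that(2) by (simp add: treesum_one)
    also have "\<dots> = pt l 1" using PS_eq_pt[OF that(1), of l] that(2) by (simp add: of_nat_diff)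
    finally show ?thesis using that(2) by (simp add: u_def)
  qed
  define N where "N = B * CL M"
  have RN: "\<bar>fps_nth R j\<bar> \<le> N / w3 j" for j
  proof -
    have "\<bar>fps_nth R j\<bar> * w3 j \<le> B * (w3 j * fps_nth (Lam ^ M) j)"
      using mult_right_mono[OF R(1)[of j], of "w3 j"] by (simp add: mult_ac less_imp_le)
    also have "\<dots> \<le> B * CL M" by (intro mult_left_mono controlledD(3)[OF CL] B0)
    finally show ?thesis by (simp add: N_def pos_le_divide_eq)
  qed
  obtain CS where CS: "controlled w3 (\<Sum>i<M. Lam ^ i * TT) CS" using levels_controlled ..
  note CSl = controlledD[OF controlled_w3_imp_lin[OF CS]]
  define L where "L = (\<Sum>j. fps_nth R j)"
  show ?thesis
  proof (rule exI[of _ L], rule exI[of _ "B * CS + 20 * (3 * C) * N"], rule allI)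
    fix n
    show "real n * \<bar>treesum f n - L * mass n\<bar> \<le> (B * CS + 20 * (3 * C) * N) / (real n + 1)"
    proof (cases "mass n = 0")
      case True
      have "0 \<le> N" using RN[of 0] by (simp add: w3_def)
      then show ?thesis using True treesum_eq_0[OF True, of f] B0 CSl(4) C(1) by simp
    next
      case False
      then have n: "1 \<le> n" "span dvd (n - 1)" using treesum_span by blast+
      have "real n * treesum f n = treesum (\<lambda>T. f T * real (tree_order T)) n"
        unfolding treesum_cmult[symmetric] by (rule treesum_cong) simp
      also have "\<dots> = treesum (\<lambda>T. (\<Sum>i<M. f T * level_sum i (\<lambda>_. 1) T) + f T * level_sum M (\<lambda>t. real (tree_order t)) T) n"
        by (intro treesum_cong, subst tree_order_levels[of _ M]) (simp add: algebra_simps sum_distrib_left)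
      also have "\<dots> = (\<Sum>i<M. treesum (\<lambda>T. f T * level_sum i (\<lambda>_. 1) T) n) + fps_nth (R * gf (\<lambda>t. real (tree_order t))) n"
        unfolding R(2)[symmetric] by (simp only: treesum_add treesum_sum gf_nth)
      finally have e1: "real n * treesum f n
          = (\<Sum>i<M. treesum (\<lambda>T. f T * level_sum i (\<lambda>_. 1) T) n) + fps_nth (R * gf (\<lambda>t. real (tree_order t))) n" .
      have "fps_nth (R * gf (\<lambda>t. real (tree_order t))) n = (\<Sum>j\<le>n. fps_nth R j * u (n - j))"
        unfolding fps_mult_nth atLeast0AtMost
      proof (intro sum.cong refl)
        fix j assume j: "j \<in> {..n}"
        show "fps_nth R j * fps_nth (gf (\<lambda>t. real (tree_order t))) (n - j) = fps_nth R j * u (n - j)"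
        proof (cases "fps_nth R j = 0 \<or> n - j = 0")
          case True then show ?thesis by (auto simp: u_def)
        next
          case False
          then have "fps_nth (Lam ^ M) j \<noteq> 0" using R(1)[of j] by auto
          then have "span dvd j" by (rule Lam_power_span)
          then have "span dvd (n - 1) - j" using n(2) by (metis dvd_diff_nat)
          moreover have "(n - 1) - j = (n - j) - 1" by simp
          ultimately have "span dvd (n - j) - 1" by simp
          moreover have "1 \<le> n - j" using False by linarith
          ultimately show ?thesis using ordu[of "n - j"] by (simp only: ord gf_nth)
        qed
      qed
      then have "\<bar>fps_nth (R * gf (\<lambda>t. real (tree_order t))) n - L * u n\<bar> \<le> 20 * (3 * C) * N / (real n + 1)"
        unfolding L_def using convolution_root_decay[OF u RN, of n] by simp
      moreover have "\<bar>\<Sum>i<M. treesum (\<lambda>T. f T * level_sum i (\<lambda>_. 1) T) n\<bar> \<le> B * CS / (real n + 1)"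
      proof -
        have "\<bar>treesum (\<lambda>T. f T * level_sum i (\<lambda>_. 1) T) n\<bar> \<le> B * fps_nth (Lam ^ i * TT) n" for i
        proof -
          have l0: "\<bar>level_sum i (\<lambda>_. 1) T\<bar> \<le> 1 * level_sum i (\<lambda>_. 1) T" for T by (rule level_sum_bound) simp
          have "\<bar>f T * level_sum i (\<lambda>_. 1) T\<bar> \<le> B * level_sum i (\<lambda>_. 1) T" for T
            unfolding abs_mult using l0[of T] B[of T] by (intro mult_mono B B0) auto
          then have "\<bar>treesum (\<lambda>T. f T * level_sum i (\<lambda>_. 1) T) n\<bar> \<le> treesum (\<lambda>T. B * level_sum i (\<lambda>_. 1) T) n"
            by (intro order_trans[OF abs_treesum_le] treesum_mono) simp
          also have "\<dots> = B * fps_nth (gf (level_sum i (\<lambda>_. 1))) n" by (simp only: treesum_cmult gf_nth)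
          finally show ?thesis by (simp only: gf_level)
        qed
        then have "\<bar>\<Sum>i<M. treesum (\<lambda>T. f T * level_sum i (\<lambda>_. 1) T) n\<bar> \<le> (\<Sum>i<M. B * fps_nth (Lam ^ i * TT) n)"
          by (intro order_trans[OF sum_abs] sum_mono)
        also have "\<dots> = B * fps_nth (\<Sum>i<M. Lam ^ i * TT) n" by (simp add: fps_sum_nth sum_distrib_left)
        also have "\<dots> \<le> B * (CS / (real n + 1))"
          using CSl(3)[of n] by (intro mult_left_mono B0) (simp add: pos_le_divide_eq mult.commute)
        finally show ?thesis by simp
      qed
      ultimately have "\<bar>real n * treesum f n - L * u n\<bar> \<le> (B * CS + 20 * (3 * C) * N) / (real n + 1)"
        unfolding e1 add_divide_distrib by linarith
      moreover have "real n * treesum f n - L * u n = real n * (treesum f n - L * mass n)"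
        unfolding ordu[OF n(2,1), symmetric] by (simp add: algebra_simps)
      ultimately show ?thesis by (simp add: abs_mult)
    qed
  qed
qed

end

section \<open>Conditioned sums of window functionals\<close>

lemma rotate_replicate_pmf: "map_pmf (rotate a) (replicate_pmf (a + b) q) = replicate_pmf (a + b) q"
proof -
  let ?A = "replicate_pmf a q" and ?B = "replicate_pmf b q"
  have "map_pmf (rotate a) (replicate_pmf (a + b) q) = map_pmf (\<lambda>z. rotate a (fst z @ snd z)) (pair_pmf ?A ?B)"
    unfolding replicate_pmf_add by (simp add: map_pmf_comp)
  also have "\<dots> = map_pmf (\<lambda>z. snd z @ fst z) (pair_pmf ?A ?B)"
  proof (rule map_pmf_cong[OF refl])
    fix z assume "z \<in> set_pmf (pair_pmf ?A ?B)"
    then have "length (fst z) = a" by (auto dest: length_replicate_pmf)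
    then show "rotate a (fst z @ snd z) = snd z @ fst z" using rotate_append[of "fst z" "snd z"] by simp
  qed
  also have "\<dots> = map_pmf (\<lambda>z. fst z @ snd z) (pair_pmf ?B ?A)"
    by (subst pair_commute_pmf) (simp add: map_pmf_comp case_prod_unfold)
  also have "\<dots> = replicate_pmf (b + a) q" by (rule replicate_pmf_add[symmetric])
  finally show ?thesis by (simp add: add.commute)
qed

lemma rotate_replicate_pmf': "i \<le> n \<Longrightarrow> map_pmf (rotate i) (replicate_pmf n q) = replicate_pmf n q"
  using rotate_replicate_pmf[of i "n - i" q] by simp

lemma sum_list_rotate: "sum_list (rotate i w) = sum_list (w :: nat list)"
proof -
  have "sum_list (drop k w @ take k w) = sum_list (take k w @ drop k w)" for k
    unfolding sum_list_append by (rule add.commute)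
  then show ?thesis unfolding rotate_drop_take by simp
qed

lemma
  fixes q :: "'a :: countable pmf"
    and v :: "'a list \<Rightarrow> 'c :: {real_normed_field, banach, second_countable_topology}"
  shows expectation_replicate_take: "integrable (measure_pmf (replicate_pmf a q)) v \<Longrightarrow>
      integrable (measure_pmf (replicate_pmf (a + b) q)) (\<lambda>w. v (take a w)) \<and>
      measure_pmf.expectation (replicate_pmf (a + b) q) (\<lambda>w. v (take a w)) = measure_pmf.expectation (replicate_pmf a q) v"
    and expectation_replicate_drop: "integrable (measure_pmf (replicate_pmf b q)) v \<Longrightarrow>
      integrable (measure_pmf (replicate_pmf (a + b) q)) (\<lambda>w. v (drop a w)) \<and>
      measure_pmf.expectation (replicate_pmf (a + b) q) (\<lambda>w. v (drop a w)) = measure_pmf.expectation (replicate_pmf b q) v"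
  using integrable_replicate_mult[of a q v b "\<lambda>_. 1"] expectation_replicate_mult[of a q v b "\<lambda>_. 1"]
    integrable_replicate_mult[of a q "\<lambda>_. 1" b v] expectation_replicate_mult[of a q "\<lambda>_. 1" b v]
  by (simp_all add: measure_pmf.prob_space)

context critical_offspring
begin

text \<open>The limit of sqrt n P(S_n = n - 1), see \<open>PS_tendsto\<close>. It cancels in
  conditional expectations, so that only its positivity is of interest.\<close>

definition \<kappa> :: real where "\<kappa> = real span / (2 * pi) * (LINT s|lborel. exp (- (s2 / 2) * s\<^sup>2))"

lemma \<kappa>_pos: "0 < \<kappa>"
  using span_pos s2_pos gauss_integral(2)[of "s2 / 2"] by (simp add: \<kappa>_def)

lemma psi_power_tendsto:
  assumes "(\<lambda>n. real (k n) / real n) \<longlonglongrightarrow> \<beta>"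
  shows "(\<lambda>n. psi (s / sqrt (real n)) ^ k n) \<longlonglongrightarrow> complex_of_real (exp (- \<beta> * s2 * s\<^sup>2 / 2))"
proof -
  have "integrable (measure_pmf \<xi>) (\<lambda>j. (s * (real j - 1))\<^sup>2)"
    unfolding power_mult_distrib by (intro integrable_mult_right int_centred_square)
  moreover have "E (\<lambda>j. s * (real j - 1)) = 0" using int_centred by simp
  ultimately have "(\<lambda>n. measure_pmf.expectation \<xi> (\<lambda>j. cis (s * (real j - 1) / sqrt (real n))) ^ k n)
      \<longlonglongrightarrow> complex_of_real (exp (- \<beta> * E (\<lambda>j. (s * (real j - 1))\<^sup>2) / 2))"
    using assms by (rule char_power_tendsto)
  moreover have "E (\<lambda>j. (s * (real j - 1))\<^sup>2) = s2 * s\<^sup>2" by (simp add: power_mult_distrib s2_eq)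
  ultimately show ?thesis by (simp add: psi_def mult.assoc)
qed

text \<open>Substitution of t = s / sqrt n and dominated convergence. A positive proportion of the
  letters has to be left to \<open>psi\<close>, whose Gaussian bound dominates and also absorbs a
  factor n t^2 in \<open>A n\<close>.\<close>

lemma FI_limit:
  assumes meas: "\<And>n. A n \<in> borel_measurable borel" and meas': "A' \<in> borel_measurable borel"
    and bound: "\<And>n t. 1 \<le> n \<Longrightarrow> norm (A n t) \<le> K * (1 + real n * t\<^sup>2)"
    and lim: "\<And>s. (\<lambda>n. A n (s / sqrt (real n))) \<longlonglongrightarrow> A' s"
    and k: "(\<lambda>n. real (k n) / real n) \<longlonglongrightarrow> \<beta>" and \<beta>: "0 < \<beta>"
  shows "(\<lambda>n. sqrt (real n) * FI (\<lambda>t. A n t * psi t ^ k n))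
    \<longlonglongrightarrow> of_real (real span / (2 * pi)) * (LINT s|lborel. A' s * of_real (exp (- \<beta> * s2 * s\<^sup>2 / 2)))"
proof -
  let ?I = "{- pi / real span..pi / real span}"
  have K: "0 \<le> K" using bound[of 1 0] by (simp, meson norm_ge_zero order_trans)
  define F where "F n s = indicator ?I (s / sqrt (real n)) *\<^sub>R (A n (s / sqrt (real n)) * psi (s / sqrt (real n)) ^ k n)" for n s
  define b where "b = cdec * (\<beta> / 2)"
  have b: "0 < b" using cdec_pos \<beta> by (simp add: b_def)
  have "\<forall>\<^sub>F n in sequentially. \<beta> / 2 < real (k n) / real n" using \<beta> by (intro order_tendstoD(1)[OF k]) auto
  then obtain N0 where N0: "\<And>n. N0 \<le> n \<Longrightarrow> \<beta> / 2 < real (k n) / real n" by (auto simp: eventually_sequentially)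
  \<comment> \<open>From here on the exponent \<open>k n\<close> exceeds \<beta> n / 2, so that one
    Gaussian dominates for all n.\<close>
  define N where "N = Suc N0"
  have eq: "of_real (real span / (2 * pi)) * (LINT s|lborel. F n s) = sqrt (real n) * FI (\<lambda>t. A n t * psi t ^ k n)"
    if "1 \<le> n" for n
  proof -
    have r: "0 < sqrt (real n)" using that by simp
    have "(LINT t:?I|lborel. A n t * psi t ^ k n) = \<bar>1 / sqrt (real n)\<bar> *\<^sub>R (LINT s|lborel. F n s)"
      unfolding set_lebesgue_integral_def F_def
      using r by (subst lborel_integral_real_affine[of "1 / sqrt (real n)" _ 0]) auto
    then have "sqrt (real n) * (LINT t:?I|lborel. A n t * psi t ^ k n) = (LINT s|lborel. F n s)"
      using r by (simp add: scaleR_conv_of_real)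
    then show ?thesis unfolding FI_def by (metis mult.left_commute)
  qed
  have w: "integrable lborel (\<lambda>s. K * (1 + 2 / b) * exp (- (b / 2) * s\<^sup>2))"
    by (intro integrable_mult_right gauss_integral) (use b in simp)
  have "(\<lambda>n. LINT s|lborel. F (n + N) s) \<longlonglongrightarrow> (LINT s|lborel. A' s * of_real (exp (- \<beta> * s2 * s\<^sup>2 / 2)))"
  proof (rule integral_dominated_convergence[OF _ _ w])
    show "(\<lambda>s. A' s * of_real (exp (- \<beta> * s2 * s\<^sup>2 / 2))) \<in> borel_measurable lborel" using meas' by measurable
    show "F (n + N) \<in> borel_measurable lborel" for n unfolding F_def using meas[of "n + N"] by measurable
    show "AE s in lborel. (\<lambda>n. F (n + N) s) \<longlonglongrightarrow> A' s * of_real (exp (- \<beta> * s2 * s\<^sup>2 / 2))"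
    proof (rule AE_I2)
      fix s
      have s0: "(\<lambda>n. s / sqrt (real n)) \<longlonglongrightarrow> 0" by real_asymp
      have "0 < pi / real span" using span_pos by simp
      then have "\<forall>\<^sub>F n in sequentially. s / sqrt (real n) < pi / real span" "\<forall>\<^sub>F n in sequentially. - (pi / real span) < s / sqrt (real n)"
        by (intro order_tendstoD[OF s0]; simp)+
      then have "\<forall>\<^sub>F n in sequentially. A n (s / sqrt (real n)) * psi (s / sqrt (real n)) ^ k n = F n s"
        by eventually_elim (simp add: F_def)
      moreover have "(\<lambda>n. A n (s / sqrt (real n)) * psi (s / sqrt (real n)) ^ k n) \<longlonglongrightarrow> A' s * of_real (exp (- \<beta> * s2 * s\<^sup>2 / 2))"
        by (intro tendsto_mult lim psi_power_tendsto k)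
      ultimately have "(\<lambda>n. F n s) \<longlonglongrightarrow> A' s * of_real (exp (- \<beta> * s2 * s\<^sup>2 / 2))"
        by (rule Lim_transform_eventually[rotated])
      then show "(\<lambda>n. F (n + N) s) \<longlonglongrightarrow> A' s * of_real (exp (- \<beta> * s2 * s\<^sup>2 / 2))" by (rule LIMSEQ_ignore_initial_segment)
    qed
    show "AE s in lborel. norm (F (n + N) s) \<le> K * (1 + 2 / b) * exp (- (b / 2) * s\<^sup>2)" for n
    proof (rule AE_I2)
      fix s
      define m where "m = n + N"
      have m: "1 \<le> m" "N0 \<le> m" by (auto simp: m_def N_def)
      let ?t = "s / sqrt (real m)"
      have t2: "real m * ?t\<^sup>2 = s\<^sup>2" using m by (simp add: power_divide)
      show "norm (F (n + N) s) \<le> K * (1 + 2 / b) * exp (- (b / 2) * s\<^sup>2)"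
      proof (cases "?t \<in> ?I")
        case True
        have "norm (F m s) = norm (A m ?t) * norm (psi ?t ^ k m)" using True by (simp add: F_def norm_mult)
        also have "\<dots> \<le> (K * (1 + real m * ?t\<^sup>2)) * exp (- (cdec * real (k m)) * ?t\<^sup>2)"
          using K by (intro mult_mono bound m norm_psi_power True) auto
        also have "\<dots> \<le> (K * (1 + s\<^sup>2)) * exp (- b * s\<^sup>2)"
        proof -
          have "\<beta> / 2 * real m \<le> real (k m)" using N0[OF m(2)] m by (simp add: field_simps)
          then have "cdec * (\<beta> / 2 * real m) * ?t\<^sup>2 \<le> cdec * real (k m) * ?t\<^sup>2"
            using cdec_pos by (intro mult_right_mono mult_left_mono) auto
          moreover have "cdec * (\<beta> / 2 * real m) * ?t\<^sup>2 = b * s\<^sup>2" unfolding t2[symmetric] b_def by (simp only: mult_ac)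
          ultimately have "exp (- (cdec * real (k m)) * ?t\<^sup>2) \<le> exp (- b * s\<^sup>2)" by simp
          then show ?thesis unfolding t2 using K by (intro mult_left_mono) auto
        qed
        also have "\<dots> = K * (exp (- b * s\<^sup>2) + s\<^sup>2 * exp (- b * s\<^sup>2))" by (simp add: algebra_simps)
        also have "\<dots> \<le> K * (exp (- (b / 2) * s\<^sup>2) + 2 / b * exp (- (b / 2) * s\<^sup>2))"
          using K b gauss_moments(2)[OF b, of s] by (intro mult_left_mono add_mono) (auto simp: mult_right_mono)
        also have "\<dots> = K * (1 + 2 / b) * exp (- (b / 2) * s\<^sup>2)" by (simp add: algebra_simps)
        finally show ?thesis by (simp add: m_def)
      next
        case False
        then have "F m s = 0" by (simp add: F_def)
        then show ?thesis using K b by (simp add: m_def)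
      qed
    qed
  qed
  then have "(\<lambda>n. LINT s|lborel. F n s) \<longlonglongrightarrow> (LINT s|lborel. A' s * of_real (exp (- \<beta> * s2 * s\<^sup>2 / 2)))"
    by (rule LIMSEQ_offset)
  then have "(\<lambda>n. of_real (real span / (2 * pi)) * (LINT s|lborel. F n s))
      \<longlonglongrightarrow> of_real (real span / (2 * pi)) * (LINT s|lborel. A' s * of_real (exp (- \<beta> * s2 * s\<^sup>2 / 2)))"
    by (rule tendsto_mult_left)
  then show ?thesis
    by (rule Lim_transform_eventually) (use eq in \<open>auto intro!: eventually_sequentiallyI[of 1]\<close>)
qed

lemma gauss_complex:
  "of_real (real span / (2 * pi)) * (LINT s|lborel. c * of_real (exp (- 1 * s2 * s\<^sup>2 / 2))) = c * complex_of_real \<kappa>"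
proof -
  have "(LINT s|lborel. c * complex_of_real (exp (- 1 * s2 * s\<^sup>2 / 2))) = c * of_real (LINT s|lborel. exp (- (s2 / 2) * s\<^sup>2))"
    unfolding integral_mult_right_zero integral_complex_of_real by simp
  then show ?thesis by (simp add: \<kappa>_def)
qed

text \<open>Expectation on the event that the n letters add up to n - 1, not divided by the
  probability \<open>PS n (n - 1)\<close> of this event.\<close>

definition CE :: "nat \<Rightarrow> (nat list \<Rightarrow> real) \<Rightarrow> real" where
  "CE n H = (\<Sum>w\<in>words n (n - 1). pmf (W n) w * H w)"

definition CEc :: "nat \<Rightarrow> (nat list \<Rightarrow> complex) \<Rightarrow> complex" where
  "CEc n H = (\<Sum>w\<in>words n (n - 1). of_real (pmf (W n) w) * H w)"

lemma CEc_of_real: "CEc n (\<lambda>w. of_real (H w)) = of_real (CE n H)"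
  by (simp add: CEc_def CE_def)

lemma CEc_expectation: "CEc n H = EW n (\<lambda>w. H w * of_bool (sum_list w = n - 1))"
proof -
  have "EW n (\<lambda>w. H w * of_bool (sum_list w = n - 1))
      = (\<Sum>w\<in>words n (n - 1). pmf (W n) w *\<^sub>R (H w * of_bool (sum_list w = n - 1)))"
    by (rule integral_measure_pmf[OF finite_words]) (auto simp: words_def dest: length_replicate_pmf split: if_splits)
  also have "\<dots> = CEc n H" unfolding CEc_def
    by (intro sum.cong) (auto simp: words_def scaleR_conv_of_real)
  finally show ?thesis by simp
qed

lemma CE_expectation: "CE n H = EW n (\<lambda>w. H w * of_bool (sum_list w = n - 1))"
proof -
  have "EW n (\<lambda>w. H w * of_bool (sum_list w = n - 1))
      = (\<Sum>w\<in>words n (n - 1). pmf (W n) w *\<^sub>R (H w * of_bool (sum_list w = n - 1)))"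
    by (rule integral_measure_pmf[OF finite_words]) (auto simp: words_def dest: length_replicate_pmf split: if_splits)
  also have "\<dots> = CE n H" unfolding CE_def
    by (intro sum.cong) (auto simp: words_def)
  finally show ?thesis by simp
qed

lemma CE_one: "CE n (\<lambda>_. 1) = PS n (n - 1)"
  unfolding CE_expectation PS_expectation by simp

lemma CE_add: "CE n (\<lambda>w. H w + H' w) = CE n H + CE n H'"
  by (simp add: CE_def sum.distrib algebra_simps)

lemma CE_sum: "CE n (\<lambda>w. \<Sum>i\<in>I. H i w) = (\<Sum>i\<in>I. CE n (H i))"
  unfolding CE_def sum_distrib_left by (rule sum.swap)

lemma CE_mono: "(\<And>w. length w = n \<Longrightarrow> H w \<le> H' w) \<Longrightarrow> CE n H \<le> CE n H'"
  unfolding CE_def by (intro sum_mono mult_left_mono) (auto simp: words_def)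

lemma CE_cong: "(\<And>w. length w = n \<Longrightarrow> H w = H' w) \<Longrightarrow> CE n H = CE n H'"
  unfolding CE_def by (intro sum.cong) (auto simp: words_def)

lemma CEc_cong: "(\<And>w. length w = n \<Longrightarrow> H w = H' w) \<Longrightarrow> CEc n H = CEc n H'"
  unfolding CEc_def by (intro sum.cong) (auto simp: words_def)

lemma CE_cmult: "CE n (\<lambda>w. c * H w) = c * CE n H"
  by (simp add: CE_def sum_distrib_left mult_ac)

lemma CE_rotate: assumes "i \<le> n" shows "CE n (\<lambda>w. H (rotate i w)) = CE n H"
proof -
  have "CE n H = measure_pmf.expectation (map_pmf (rotate i) (W n)) (\<lambda>w. H w * of_bool (sum_list w = n - 1))"
    unfolding rotate_replicate_pmf'[OF assms] by (rule CE_expectation)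
  then show ?thesis by (simp add: CE_expectation sum_list_rotate)
qed

text \<open>The orders permitted by the lattice. Limits are first taken along this explicit set and
  then passed to the admissible orders by \<open>adm_seq_le\<close>.\<close>

definition good :: "nat set" where "good = {n. 1 \<le> n \<and> span dvd (n - 1)}"

definition gseq :: "nat filter" where "gseq = inf sequentially (principal good)"

lemma eventually_gseq: "eventually P gseq \<longleftrightarrow> (\<exists>N. \<forall>n\<ge>N. n \<in> good \<longrightarrow> P n)"
  unfolding gseq_def eventually_inf_principal eventually_sequentially ..

lemma gseq_le: "gseq \<le> sequentially" by (simp add: gseq_def)

lemma CEc_FI:
  assumes "n \<in> good" "integrable_W n X"
  shows "CEc n X = FI (\<lambda>t. EW n (\<lambda>w. X w * cis (t * (real (sum_list w) - real n))) * cis t)"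
  unfolding CEc_expectation using assms
  by (subst expectation_word_sum) (auto simp: good_def of_nat_diff)

lemma PS_tendsto: "((\<lambda>n. sqrt (real n) * PS n (n - 1)) \<longlongrightarrow> \<kappa>) gseq"
proof -
  have "(\<lambda>n. sqrt (real n) * FI (\<lambda>t. cis t * psi t ^ n)) \<longlonglongrightarrow>
     of_real (real span / (2 * pi)) * (LINT s|lborel. 1 * complex_of_real (exp (- 1 * s2 * s\<^sup>2 / 2)))"
  proof (rule FI_limit)
    show "norm (cis t) \<le> 1 * (1 + real n * t\<^sup>2)" for n t by simp
    show "(\<lambda>n. cis (s / sqrt (real n))) \<longlonglongrightarrow> 1" for s
    proof -
      have "(\<lambda>n. s / sqrt (real n)) \<longlonglongrightarrow> 0" by real_asymp
      then have "(\<lambda>n. cis (s / sqrt (real n))) \<longlonglongrightarrow> cis 0" by (intro tendsto_intros)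
      then show ?thesis by simp
    qed
    show "(\<lambda>n. real n / real n) \<longlonglongrightarrow> 1" by real_asymp
  qed (auto intro: measurable_cis)
  then have "((\<lambda>n. sqrt (real n) * FI (\<lambda>t. cis t * psi t ^ n)) \<longlongrightarrow> of_real \<kappa>) gseq"
    unfolding gauss_complex using tendsto_mono[OF gseq_le] by simp
  then have "((\<lambda>n. complex_of_real (sqrt (real n) * PS n (n - 1))) \<longlongrightarrow> of_real \<kappa>) gseq"
  proof (rule Lim_transform_eventually)
    show "\<forall>\<^sub>F n in gseq. sqrt (real n) * FI (\<lambda>t. cis t * psi t ^ n) = complex_of_real (sqrt (real n) * PS n (n - 1))"
      unfolding eventually_gseq
      by (auto intro!: exI[of _ 1] simp: good_def PS_eq_FI of_nat_diff mult.commute[of "cis _"])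
  qed
  then show ?thesis by (simp only: tendsto_of_real_iff)
qed

lemma PS_good_lower: "\<exists>c>0. \<forall>\<^sub>F n in gseq. c / sqrt (real n) \<le> PS n (n - 1)"
proof (intro exI[of _ "\<kappa> / 2"] conjI)
  show "0 < \<kappa> / 2" using \<kappa>_pos by simp
  have "\<forall>\<^sub>F n in gseq. \<kappa> / 2 < sqrt (real n) * PS n (n - 1)"
    using \<kappa>_pos by (intro order_tendstoD(1)[OF PS_tendsto]) auto
  moreover have "\<forall>\<^sub>F n in gseq. 1 \<le> n" unfolding eventually_gseq by auto
  ultimately show "\<forall>\<^sub>F n in gseq. \<kappa> / 2 / sqrt (real n) \<le> PS n (n - 1)"
    by eventually_elim (simp add: field_simps)
qed

section \<open>Moments of the letter sum\<close>

lemma word_sum_square_integrable: "integrable_W n (\<lambda>w. (real (sum_list w) - real n)\<^sup>2)"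
proof (induction n)
  case (Suc n)
  let ?u = "\<lambda>w. (real (sum_list w) - 1)\<^sup>2" and ?v = "\<lambda>w. (real (sum_list w) - real n)\<^sup>2"
  have 1: "integrable_W 1 ?u"
    unfolding replicate_pmf_1 using int_centred_square by (simp add: o_def)
  have "integrable_W (1 + n) (\<lambda>w. 2 * ?u (take 1 w) + 2 * ?v (drop 1 w))"
    using expectation_replicate_take[OF 1, of n] expectation_replicate_drop[OF Suc, of 1] by auto
  then show ?case unfolding plus_1_eq_Suc
  proof (rule Bochner_Integration.integrable_bound, simp, intro AE_pmfI)
    fix w assume "w \<in> set_pmf (W (Suc n))"
    have e: "sum_list w = sum_list (take 1 w) + sum_list (drop 1 w)" by (metis append_take_drop_id sum_list_append)
    have "(a + b)\<^sup>2 \<le> 2 * a\<^sup>2 + 2 * b\<^sup>2" for a b :: real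
      using zero_le_power2[of "a - b"] by (simp add: power2_eq_square algebra_simps)
    from this[of "real (sum_list (take 1 w)) - 1" "real (sum_list (drop 1 w)) - real n"]
    show "norm ((real (sum_list w) - real (Suc n))\<^sup>2) \<le> norm (2 * ?u (take 1 w) + 2 * ?v (drop 1 w))"
      by (simp add: e algebra_simps)
  qed
qed (simp add: integrable_measure_pmf_finite)

lemma word_sum_integrable: "integrable_W n (\<lambda>w. real (sum_list w) - real n)"
  by (rule measure_pmf.square_integrable_imp_integrable[OF _ word_sum_square_integrable]) simp

lemma word_sum_moments:
  "EW n (\<lambda>w. real (sum_list w) - real n) = 0"
  "EW n (\<lambda>w. (real (sum_list w) - real n)\<^sup>2) = real n * s2"
proof (induction n)
  case (Suc n)
  let ?u = "\<lambda>w. real (sum_list w) - 1" and ?v = "\<lambda>w. real (sum_list w) - real n"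
  have W1: "W 1 = map_pmf (\<lambda>x. [x]) \<xi>" by (rule replicate_pmf_1)
  have e: "real (sum_list w) - real (1 + n) = ?u (take 1 w) + ?v (drop 1 w)" for w :: "nat list"
  proof -
    have "sum_list w = sum_list (take 1 w) + sum_list (drop 1 w)" by (metis append_take_drop_id sum_list_append)
    then show ?thesis by simp
  qed
  have iu: "integrable_W 1 ?u" "integrable_W 1 (\<lambda>w. (?u w)\<^sup>2)"
    using word_sum_integrable[of 1] word_sum_square_integrable[of 1] by simp_all
  have Eu: "EW 1 ?u = 0" "EW 1 (\<lambda>w. (?u w)\<^sup>2) = s2"
    unfolding W1 using int_centred(2) s2_eq by simp_all
  note T = expectation_replicate_take[OF iu(1), of n] expectation_replicate_take[OF iu(2), of n]
    expectation_replicate_drop[OF word_sum_integrable[of n], of 1] expectation_replicate_drop[OF word_sum_square_integrable[of n], of 1]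
  note M = integrable_replicate_mult[OF iu(1) word_sum_integrable[of n]] expectation_replicate_mult[OF iu(1) word_sum_integrable[of n]]
  have "EW (1 + n) (\<lambda>w. real (sum_list w) - real (1 + n)) = 0"
    unfolding e using T Eu Suc by (subst Bochner_Integration.integral_add) auto
  then show "EW (Suc n) (\<lambda>w. real (sum_list w) - real (Suc n)) = 0" by simp
  have sq: "(real (sum_list w) - real (1 + n))\<^sup>2 = (?u (take 1 w))\<^sup>2 + (?v (drop 1 w))\<^sup>2 + 2 * (?u (take 1 w) * ?v (drop 1 w))" for w :: "nat list"
    unfolding e by (simp add: power2_sum)
  have "EW (1 + n) (\<lambda>w. (real (sum_list w) - real (1 + n))\<^sup>2) = s2 + real n * s2 + 2 * (0 * 0)"
    unfolding sq using T M Eu Suc by (subst Bochner_Integration.integral_add | subst integral_mult_right_zero | simp)+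
  then show "EW (Suc n) (\<lambda>w. (real (sum_list w) - real (Suc n))\<^sup>2) = real (Suc n) * s2"
    by (simp add: algebra_simps)
qed simp_all

end

lemma tendsto_approx_family:
  fixes a :: "'a \<Rightarrow> 'b :: real_normed_vector"
  assumes ab: "\<And>B. B0 \<le> B \<Longrightarrow> \<forall>\<^sub>F n in F. norm (a n - b B n) \<le> e B"
    and bl: "\<And>B. B0 \<le> B \<Longrightarrow> (b B \<longlongrightarrow> l B) F"
    and e: "e \<longlonglongrightarrow> (0::real)" and l: "l \<longlonglongrightarrow> L"
  shows "(a \<longlongrightarrow> L) F"
proof (rule tendstoI)
  fix \<epsilon> :: real assume \<epsilon>: "0 < \<epsilon>"
  have "\<forall>\<^sub>F B in sequentially. e B < \<epsilon> / 3" using \<epsilon> by (intro order_tendstoD(2)[OF e]) auto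
  moreover have "\<forall>\<^sub>F B in sequentially. dist (l B) L < \<epsilon> / 3" using \<epsilon> by (intro tendstoD[OF l]) auto
  moreover have "\<forall>\<^sub>F B in sequentially. B0 \<le> B" by (rule eventually_ge_at_top)
  ultimately have "\<forall>\<^sub>F B in sequentially. e B < \<epsilon> / 3 \<and> dist (l B) L < \<epsilon> / 3 \<and> B0 \<le> B"
    by eventually_elim simp
  then obtain B where B: "e B < \<epsilon> / 3" "dist (l B) L < \<epsilon> / 3" "B0 \<le> B"
    using eventually_happens'[OF sequentially_bot] by blast
  have "\<forall>\<^sub>F n in F. dist (b B n) (l B) < \<epsilon> / 3" using \<epsilon> by (intro tendstoD[OF bl[OF B(3)]]) auto
  with ab[OF B(3)] show "\<forall>\<^sub>F n in F. dist (a n) L < \<epsilon>"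
  proof eventually_elim
    case (elim n)
    have "dist (a n) L \<le> dist (a n) (b B n) + dist (b B n) (l B) + dist (l B) L"
      using dist_triangle[of "a n" L "b B n"] dist_triangle[of "b B n" L "l B"] by linarith
    then show ?case using elim B by (simp add: dist_norm[of "a n" "b B n"])
  qed
qed

text \<open>Windows at cyclic distance D overlap only for D < K or D > n - K; the middle range
  belongs to disjoint windows.\<close>

lemma sum_split_ends:
  fixes F :: "nat \<Rightarrow> 'a :: comm_monoid_add"
  assumes "2 * K \<le> n" "1 \<le> K"
  shows "(\<Sum>D<n. F D) = (\<Sum>D<K. F D) + (\<Sum>D\<in>{K..n - K}. F D) + (\<Sum>D\<in>{1..<K}. F (n - D))"
proof -
  have e: "{..<n} = ({..<K} \<union> {K..n - K}) \<union> {n - K<..<n}"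
  proof (rule set_eqI)
    fix x
    have "x < n \<longleftrightarrow> (x < K \<or> K \<le> x \<and> x \<le> n - K) \<or> n - K < x \<and> x < n" using assms by arith
    then show "x \<in> {..<n} \<longleftrightarrow> x \<in> ({..<K} \<union> {K..n - K}) \<union> {n - K<..<n}" by simp
  qed
  have d: "({..<K} \<union> {K..n - K}) \<inter> {n - K<..<n} = {}" using assms by force
  have "(\<Sum>D<n. F D) = (\<Sum>D\<in>{..<K} \<union> {K..n - K}. F D) + (\<Sum>D\<in>{n - K<..<n}. F D)"
    unfolding e by (rule sum.union_disjoint) (simp_all add: d)
  also have "(\<Sum>D\<in>{..<K} \<union> {K..n - K}. F D) = (\<Sum>D<K. F D) + (\<Sum>D\<in>{K..n - K}. F D)"
    by (rule sum.union_disjoint) auto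
  also have "(\<Sum>D\<in>{n - K<..<n}. F D) = (\<Sum>D\<in>{1..<K}. F (n - D))"
    by (rule sum.reindex_bij_witness[of _ "\<lambda>D. n - D" "\<lambda>D. n - D"]) (use assms in auto)
  finally show ?thesis .
qed

definition nd :: "nat \<Rightarrow> nat \<Rightarrow> nat" where "nd i j = (if i \<le> j then j - i else i - j)"

lemma sum_nd_le:
  fixes F :: "nat \<Rightarrow> real"
  assumes "i < n" "\<And>D. 0 \<le> F D"
  shows "(\<Sum>j<n. F (nd i j)) \<le> 2 * (\<Sum>D<n. F D)"
proof -
  have "(\<Sum>j<n. F (nd i j)) = (\<Sum>j\<in>{..<i}. F (nd i j)) + (\<Sum>j\<in>{i..<n}. F (nd i j))"
    using assms(1) by (subst sum.union_disjoint[symmetric]) (auto intro!: sum.cong)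
  also have "(\<Sum>j\<in>{..<i}. F (nd i j)) = (\<Sum>D\<in>{1..i}. F D)"
    by (rule sum.reindex_bij_witness[of _ "\<lambda>D. i - D" "\<lambda>j. i - j"]) (auto simp: nd_def)
  also have "\<dots> \<le> (\<Sum>D<n. F D)" using assms by (intro sum_mono2) auto
  also have "(\<Sum>j\<in>{i..<n}. F (nd i j)) = (\<Sum>D<n - i. F D)"
    by (rule sum.reindex_bij_witness[of _ "\<lambda>D. i + D" "\<lambda>j. j - i"]) (auto simp: nd_def)
  also have "\<dots> \<le> (\<Sum>D<n. F D)" using assms by (intro sum_mono2) auto
  finally show ?thesis by simp
qed

lemma sum_nd_eq:
  fixes F :: "nat \<Rightarrow> real"
  assumes "i < n" "\<And>D. D \<le> n \<Longrightarrow> F (n - D) = F D"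
  shows "(\<Sum>j<n. F (nd i j)) = (\<Sum>D<n. F D)"
proof -
  have "(\<Sum>j<n. F (nd i j)) = (\<Sum>j\<in>{..<i}. F (nd i j)) + (\<Sum>j\<in>{i..<n}. F (nd i j))"
    using assms(1) by (subst sum.union_disjoint[symmetric]) (auto intro!: sum.cong)
  also have "(\<Sum>j\<in>{..<i}. F (nd i j)) = (\<Sum>j\<in>{..<i}. F (n - (i - j)))"
  proof (intro sum.cong refl)
    fix j assume "j \<in> {..<i}"
    then have "nd i j = i - j" by (simp add: nd_def)
    moreover have "F (n - (i - j)) = F (i - j)" using assms(1) by (intro assms(2)) simp
    ultimately show "F (nd i j) = F (n - (i - j))" by (simp only:)
  qed
  also have "\<dots> = (\<Sum>D\<in>{n - i..<n}. F D)"
    by (rule sum.reindex_bij_witness[of _ "\<lambda>D. D - (n - i)" "\<lambda>j. n - (i - j)"]) (use assms(1) in auto)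
  also have "(\<Sum>j\<in>{i..<n}. F (nd i j)) = (\<Sum>D\<in>{..<n - i}. F D)"
    by (rule sum.reindex_bij_witness[of _ "\<lambda>D. i + D" "\<lambda>j. j - i"]) (auto simp: nd_def)
  also have "(\<Sum>D\<in>{n - i..<n}. F D) + (\<Sum>D\<in>{..<n - i}. F D) = (\<Sum>D<n. F D)"
    by (subst sum.union_disjoint[symmetric]) (auto intro!: sum.cong)
  finally show ?thesis .
qed

lemma integrable_mult_squares:
  fixes f h :: "'a \<Rightarrow> real"
  assumes "integrable (measure_pmf M) (\<lambda>a. (f a)\<^sup>2)" "integrable (measure_pmf M) (\<lambda>a. (h a)\<^sup>2)"
  shows "integrable (measure_pmf M) (\<lambda>a. f a * h a)"
proof (rule Bochner_Integration.integrable_bound[OF Bochner_Integration.integrable_add[OF assms]], simp, intro AE_pmfI)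
  fix a
  have "2 * (\<bar>f a\<bar> * \<bar>h a\<bar>) \<le> (f a)\<^sup>2 + (h a)\<^sup>2"
    using zero_le_power2[of "\<bar>f a\<bar> - \<bar>h a\<bar>"] by (simp add: power2_diff)
  moreover have "0 \<le> \<bar>f a\<bar> * \<bar>h a\<bar>" by simp
  ultimately have "\<bar>f a\<bar> * \<bar>h a\<bar> \<le> (f a)\<^sup>2 + (h a)\<^sup>2" by linarith
  then show "norm (f a * h a) \<le> norm ((f a)\<^sup>2 + (h a)\<^sup>2)" by (simp add: abs_mult)
qed

text \<open>\<open>g\<close> reads the first K letters of a word. The conditions \<open>m0\<close>
  and \<open>m1\<close> remove the constant and the linear term of its twisted mean at 0, and with
  them the long-range dependence that conditioning on the letter sum creates.\<close>

locale window = critical_offspring \<xi> for \<xi> :: "nat pmf" +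
  fixes K :: nat and g :: "nat list \<Rightarrow> real"
  assumes K1: "1 \<le> K" and dep: "\<And>w. K \<le> length w \<Longrightarrow> g w = g (take K w)"
    and sq: "integrable_W K (\<lambda>w. (g w)\<^sup>2)"
    and m0: "EW K g = 0"
    and m1: "EW K (\<lambda>w. g w * (real (sum_list w) - real K)) = 0"
begin

section \<open>Windows of independent letters\<close>

lemma dep_append: "K \<le> length x \<Longrightarrow> g (x @ y) = g x"
  using dep[of "x @ y"] dep[of x] by simp

lemma dep_take: "K \<le> a \<Longrightarrow> K \<le> length w \<Longrightarrow> g (take a w) = g w"
  using dep[of "take a w"] dep[of w] by (simp add: min_def)

lemma marginal:
  fixes v :: "nat list \<Rightarrow> real"
  assumes v: "integrable_W K v" and vd: "\<And>w. K \<le> length w \<Longrightarrow> v w = v (take K w)" and le: "i + K \<le> n"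
  shows "integrable_W n (\<lambda>w. v (drop i w))" "EW n (\<lambda>w. v (drop i w)) = EW K v"
proof -
  define m where "m = n - i - K"
  have n: "n = i + (K + m)" using le by (simp add: m_def)
  note t = expectation_replicate_take[OF v, of m]
  have ae: "AE w in measure_pmf (W (K + m)). v w = v (take K w)"
    by (rule AE_pmfI) (auto dest!: length_replicate_pmf intro!: vd)
  have 1: "integrable_W (K + m) v" "EW (K + m) v = EW K v"
    using t integrable_cong_AE[OF _ _ ae] integral_cong_AE[OF _ _ ae] by auto
  show "integrable_W n (\<lambda>w. v (drop i w))" "EW n (\<lambda>w. v (drop i w)) = EW K v"
    using expectation_replicate_drop[OF 1(1), of i] 1(2) unfolding n by auto
qed

lemma g_square_integrable: "i + K \<le> n \<Longrightarrow> integrable_W n (\<lambda>w. (g (drop i w))\<^sup>2)"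
  by (rule marginal(1)[of "\<lambda>w. (g w)\<^sup>2" i n, OF sq]) (simp_all add: dep_take)

lemma g_integrable: "integrable_W K g"
  by (rule measure_pmf.square_integrable_imp_integrable[OF _ sq]) simp

lemma g_expectation: "i + K \<le> n \<Longrightarrow> EW n (\<lambda>w. g (drop i w)) = 0"
  using marginal(2)[of g i n, OF g_integrable] by (simp add: dep_take m0)

lemma gg_integrable:
  "i + K \<le> n \<Longrightarrow> j + K \<le> n \<Longrightarrow> integrable_W n (\<lambda>w. g (drop i w) * g (drop j w))"
  by (rule integrable_mult_squares[OF g_square_integrable g_square_integrable])

lemma cis_mult_split:
  fixes X Y :: "nat list \<Rightarrow> complex"
  assumes "integrable_W a X" "integrable_W b Y"
  shows "EW (a + b) (\<lambda>w. X (take a w) * Y (drop a w) * cis (t * (real (sum_list w) - real (a + b))))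
    = EW a (\<lambda>w. X w * cis (t * (real (sum_list w) - real a))) * EW b (\<lambda>w. Y w * cis (t * (real (sum_list w) - real b)))"
proof -
  have i: "integrable_W c (\<lambda>w. Z w * cis (h w))" if "integrable_W c Z" for Z h c
    by (rule Bochner_Integration.integrable_bound[OF that]) (auto simp: norm_mult)
  have e: "X (take a w) * Y (drop a w) * cis (t * (real (sum_list w) - real (a + b)))
      = (X (take a w) * cis (t * (real (sum_list (take a w)) - real a))) * (Y (drop a w) * cis (t * (real (sum_list (drop a w)) - real b)))" for w
  proof -
    have "sum_list w = sum_list (take a w) + sum_list (drop a w)" by (metis append_take_drop_id sum_list_append)
    then have "cis (t * (real (sum_list w) - real (a + b)))
        = cis (t * (real (sum_list (take a w)) - real a)) * cis (t * (real (sum_list (drop a w)) - real b))"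
      unfolding cis_mult by (simp add: algebra_simps)
    then show ?thesis by (simp only: mult_ac)
  qed
  show ?thesis unfolding e by (rule expectation_replicate_mult[OF i[OF assms(1)] i[OF assms(2)]])
qed

lemma cis_split_take:
  fixes X :: "nat list \<Rightarrow> complex"
  assumes "integrable_W a X"
  shows "EW (a + b) (\<lambda>w. X (take a w) * cis (t * (real (sum_list w) - real (a + b))))
    = EW a (\<lambda>w. X w * cis (t * (real (sum_list w) - real a))) * psi t ^ b"
  using cis_mult_split[OF assms, of b "\<lambda>_. 1" t] by (simp add: expectation_cis_word)

text \<open>The mean of \<open>g\<close> twisted by the character of the centred letter sum. Its
  value at 0 is the mean in \<open>m0\<close>; its derivative there is i times the correlation in
  \<open>m1\<close>.\<close>

definition ghat :: "real \<Rightarrow> complex" where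
  "ghat t = EW K (\<lambda>w. of_real (g w) * cis (t * (real (sum_list w) - real K)))"

lemma gz_integrable: "integrable_W K (\<lambda>w. g w * (real (sum_list w) - real K))"
  by (rule integrable_mult_squares[OF sq word_sum_square_integrable])

lemma gc_integrable: "integrable_W K (\<lambda>w. complex_of_real (g w) * cis (h w))"
  by (rule Bochner_Integration.integrable_bound[OF g_integrable]) (auto simp: norm_mult)

lemma ghat_bound: "norm (ghat t) \<le> EW K (\<lambda>w. \<bar>g w * (real (sum_list w) - real K)\<bar>) * \<bar>t\<bar>"
proof -
  let ?z = "\<lambda>w. real (sum_list w) - real K"
  have g1: "EW K (\<lambda>w. complex_of_real (g w)) = 0" by (simp only: integral_complex_of_real m0 of_real_0)
  have "ghat t = EW K (\<lambda>w. complex_of_real (g w) * cis (t * ?z w) - complex_of_real (g w))"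
    unfolding ghat_def using g1 by (subst Bochner_Integration.integral_diff[OF gc_integrable integrable_of_real[OF g_integrable]]) simp
  also have "norm \<dots> \<le> EW K (\<lambda>w. norm (complex_of_real (g w) * cis (t * ?z w) - complex_of_real (g w)))"
    by (rule integral_norm_bound)
  also have "\<dots> \<le> EW K (\<lambda>w. \<bar>g w * ?z w\<bar> * \<bar>t\<bar>)"
  proof (rule integral_mono)
    show "integrable_W K (\<lambda>w. norm (complex_of_real (g w) * cis (t * ?z w) - complex_of_real (g w)))"
      by (intro integrable_norm Bochner_Integration.integrable_diff gc_integrable integrable_of_real g_integrable)
    show "integrable_W K (\<lambda>w. \<bar>g w * ?z w\<bar> * \<bar>t\<bar>)"
      by (intro integrable_mult_left integrable_abs gz_integrable)
    fix w
    have "norm (complex_of_real (g w) * cis (t * ?z w) - complex_of_real (g w)) = \<bar>g w\<bar> * norm (cis (t * ?z w) - 1)"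
    proof -
      have "complex_of_real (g w) * cis (t * ?z w) - complex_of_real (g w) = complex_of_real (g w) * (cis (t * ?z w) - 1)"
        by (simp add: algebra_simps)
      then show ?thesis by (simp only: norm_mult norm_of_real)
    qed
    also have "\<dots> \<le> \<bar>g w\<bar> * \<bar>t * ?z w\<bar>"
      using iexp_approx1[of "t * ?z w" 0] by (intro mult_left_mono) (auto simp: cis_conv_exp)
    finally show "norm (complex_of_real (g w) * cis (t * ?z w) - complex_of_real (g w)) \<le> \<bar>g w * ?z w\<bar> * \<bar>t\<bar>"
      by (simp add: abs_mult mult_ac)
  qed
  also have "\<dots> = EW K (\<lambda>w. \<bar>g w * ?z w\<bar>) * \<bar>t\<bar>" by (rule integral_mult_left_zero)
  finally show ?thesis .
qed

text \<open>By \<open>m0\<close> and \<open>m1\<close> the first-order Taylor polynomial can be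
  subtracted at no cost. Since \<open>g\<close> times the squared letter sum need not be integrable,
  the quadratic error bound serves only for pointwise convergence, and the linear one for
  domination.\<close>

lemma ghat_little_o: "(\<lambda>n. sqrt (real n) * ghat (s / sqrt (real n))) \<longlonglongrightarrow> 0"
proof -
  let ?z = "\<lambda>w. real (sum_list w) - real K"
  define h where "h n w = complex_of_real (sqrt (real n)) * (complex_of_real (g w) *
      (cis (s / sqrt (real n) * ?z w) - (1 + \<i> * complex_of_real (s / sqrt (real n) * ?z w))))" for n w
  have eq: "sqrt (real n) * ghat (s / sqrt (real n)) = EW K (h n)" for n
  proof -
    let ?t = "s / sqrt (real n)"
    have i2: "integrable_W K (\<lambda>w. complex_of_real (g w) + \<i> * of_real ?t * complex_of_real (g w * ?z w))"
      by (intro Bochner_Integration.integrable_add integrable_mult_right integrable_of_real g_integrable gz_integrable)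
    have "EW K (\<lambda>w. complex_of_real (g w) + \<i> * of_real ?t * complex_of_real (g w * ?z w))
        = complex_of_real (EW K g) + \<i> * of_real ?t * complex_of_real (EW K (\<lambda>w. g w * ?z w))"
      by (subst Bochner_Integration.integral_add)
        (simp_all only: integral_mult_right_zero integral_complex_of_real integrable_mult_right integrable_of_real g_integrable gz_integrable)
    then have z: "EW K (\<lambda>w. complex_of_real (g w) + \<i> * of_real ?t * complex_of_real (g w * ?z w)) = 0"
      by (simp only: m0 m1) simp
    have "EW K (h n) = sqrt (real n) * EW K (\<lambda>w. complex_of_real (g w) * cis (?t * ?z w)
        - (complex_of_real (g w) + \<i> * of_real ?t * complex_of_real (g w * ?z w)))"
      unfolding h_def integral_mult_right_zero
      by (intro arg_cong2[of _ _ _ _ "(*)"] refl Bochner_Integration.integral_cong) (simp_all add: algebra_simps)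
    also have "\<dots> = sqrt (real n) * ghat ?t"
      unfolding ghat_def by (subst Bochner_Integration.integral_diff[OF gc_integrable i2]) (simp only: z diff_0_right)
    finally show ?thesis ..
  qed
  have "(\<lambda>n. EW K (h n)) \<longlonglongrightarrow> EW K (\<lambda>_. 0)"
  proof (rule integral_dominated_convergence[where w = "\<lambda>w. 2 * \<bar>s\<bar> * \<bar>g w * ?z w\<bar>"])
    show "integrable_W K (\<lambda>w. 2 * \<bar>s\<bar> * \<bar>g w * ?z w\<bar>)"
      by (intro integrable_mult_right integrable_abs gz_integrable)
    have nh: "norm (h n w) = sqrt (real n) * (\<bar>g w\<bar> * norm (cis (s / sqrt (real n) * ?z w) - (1 + \<i> * complex_of_real (s / sqrt (real n) * ?z w))))" for n w
      unfolding h_def norm_mult norm_of_real by simp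
    show "AE w in measure_pmf (W K). norm (h n w) \<le> 2 * \<bar>s\<bar> * \<bar>g w * ?z w\<bar>" for n
    proof (rule AE_pmfI)
      fix w
      have "norm (h n w) \<le> sqrt (real n) * (\<bar>g w\<bar> * (2 * \<bar>s / sqrt (real n) * ?z w\<bar>))"
        unfolding nh using iexp_approx2[of "s / sqrt (real n) * ?z w" 1]
        by (intro mult_left_mono) (auto simp: cis_conv_exp)
      also have "\<dots> \<le> 2 * \<bar>s\<bar> * \<bar>g w * ?z w\<bar>"
        by (cases "n = 0") (auto simp: abs_mult)
      finally show "norm (h n w) \<le> 2 * \<bar>s\<bar> * \<bar>g w * ?z w\<bar>" .
    qed
    show "AE w in measure_pmf (W K). (\<lambda>n. h n w) \<longlonglongrightarrow> 0"
    proof (rule AE_pmfI, rule Lim_null_comparison)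
      fix w
      define c where "c = \<bar>g w\<bar> * (s * ?z w)\<^sup>2 / 2"
      show "\<forall>\<^sub>F n in sequentially. norm (h n w) \<le> c / sqrt (real n)"
      proof (rule eventually_sequentiallyI[of 1])
        fix n :: nat assume n: "1 \<le> n"
        have "norm (h n w) \<le> sqrt (real n) * (\<bar>g w\<bar> * ((s / sqrt (real n) * ?z w)\<^sup>2 / 2))"
          unfolding nh using iexp_approx1[of "s / sqrt (real n) * ?z w" 1]
          by (intro mult_left_mono) (auto simp: cis_conv_exp numeral_2_eq_2)
        also have "(s / sqrt (real n) * ?z w)\<^sup>2 = (s * ?z w)\<^sup>2 / (sqrt (real n) * sqrt (real n))"
          by (simp add: power_mult_distrib power_divide)
        also have "sqrt (real n) * (\<bar>g w\<bar> * ((s * ?z w)\<^sup>2 / (sqrt (real n) * sqrt (real n)) / 2)) = c / sqrt (real n)"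
        proof -
          have "r * (a * (b / (r * r) / 2)) = a * b / 2 / r" if "0 < r" for r a b :: real
            using that by simp
          from this[of "sqrt (real n)" "\<bar>g w\<bar>" "(s * ?z w)\<^sup>2"] n show ?thesis
            unfolding c_def by (simp del: real_sqrt_mult_self)
        qed
        finally show "norm (h n w) \<le> c / sqrt (real n)" .
      qed
      show "(\<lambda>n. c / sqrt (real n)) \<longlonglongrightarrow> 0" by real_asymp
    qed
  qed (simp_all add: h_def)
  then show ?thesis unfolding eq by simp
qed

definition cov :: "nat \<Rightarrow> real" where
  "cov D = EW (K + D) (\<lambda>w. g w * g (drop D w))"

lemma g_integrable': "K \<le> n \<Longrightarrow> integrable_W n g"
  using marginal(1)[of g 0 n, OF g_integrable] by (simp add: dep_take)

lemma cov_far: assumes "K \<le> D" shows "cov D = 0"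
proof -
  have ae: "AE w in measure_pmf (W (D + K)). g w * g (drop D w) = g (take D w) * g (drop D w)"
    using assms by (intro AE_pmfI) (auto simp: dep_take dest!: length_replicate_pmf)
  have "cov D = EW (D + K) (\<lambda>w. g (take D w) * g (drop D w))"
    unfolding cov_def by (subst add.commute, rule integral_cong_AE[OF _ _ ae]) auto
  also have "\<dots> = EW D g * EW K g" by (rule expectation_replicate_mult[OF g_integrable'[OF assms] g_integrable])
  finally show ?thesis by (simp add: m0)
qed

lemma cov_shift:
  assumes "i \<le> j" "j + K \<le> n"
  shows "EW n (\<lambda>w. g (drop i w) * g (drop j w)) = cov (j - i)"
proof -
  define D m where "D = j - i" and "m = n - j - K"
  have n: "n = i + ((K + D) + m)" and j: "j = i + D" using assms by (auto simp: D_def m_def)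
  let ?v = "\<lambda>w. g w * g (drop D w)"
  have iv: "integrable_W (K + D) ?v" using gg_integrable[of 0 "K + D" D] by simp
  note t = expectation_replicate_take[OF iv, of m]
  have ae: "AE w in measure_pmf (W (K + D + m)). ?v w = ?v (take (K + D) w)"
    by (intro AE_pmfI) (auto simp: dep_take drop_take dest!: length_replicate_pmf)
  have iv': "integrable_W (K + D + m) ?v" "EW (K + D + m) ?v = cov D"
    using t integrable_cong_AE[OF _ _ ae] integral_cong_AE[OF _ _ ae] by (auto simp: cov_def)
  show ?thesis using expectation_replicate_drop[OF iv'(1), of i] iv'(2)
    unfolding n j by (simp add: drop_drop add.commute)
qed

text \<open>The undivided mixed moment of two windows at cyclic distance D, on the event that fixes
  the letter sum.\<close>

definition R :: "nat \<Rightarrow> nat \<Rightarrow> real" where "R n D = CE n (\<lambda>w. g w * g (rotate D w))"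

lemma g_rotate: "D + K \<le> length w \<Longrightarrow> g (rotate D w) = g (drop D w)"
proof -
  assume a: "D + K \<le> length w"
  then have "D < length w" using K1 by simp
  then show ?thesis using a by (simp add: rotate_drop_take dep_append)
qed

text \<open>Two windows at fixed distance occupy boundedly many letters, on which the conditioning
  has no effect in the limit.\<close>

lemma R_close: "((\<lambda>n. sqrt (real n) * R n D) \<longlongrightarrow> \<kappa> * cov D) gseq"
proof -
  define X where "X w = complex_of_real (g w * g (drop D w))" for w
  have iX: "integrable_W (K + D) X"
    unfolding X_def using gg_integrable[of 0 "K + D" D] by (intro integrable_of_real) simp
  define A where "A n t = EW (K + D) (\<lambda>w. X w * cis (t * (real (sum_list w) - real (K + D)))) * cis t" for n :: nat and t
  have "(\<lambda>n. sqrt (real n) * FI (\<lambda>t. A n t * psi t ^ (n - (K + D)))) \<longlonglongrightarrow>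
     of_real (real span / (2 * pi)) * (LINT s|lborel. complex_of_real (cov D) * complex_of_real (exp (- 1 * s2 * s\<^sup>2 / 2)))"
  proof (rule FI_limit)
    show "A n \<in> borel_measurable borel" for n
      unfolding A_def using measurable_expectation_cis[of "W (K + D)" X] by measurable
    show "norm (A n t) \<le> EW (K + D) (\<lambda>w. norm (X w)) * (1 + real n * t\<^sup>2)" for n t
    proof -
      have "norm (A n t) \<le> EW (K + D) (\<lambda>w. norm (X w * cis (t * (real (sum_list w) - real (K + D)))))"
        unfolding A_def norm_mult[of _ "cis t"] norm_cis mult_1_right by (rule integral_norm_bound)
      also have "\<dots> = EW (K + D) (\<lambda>w. norm (X w)) * 1" by (simp add: norm_mult)
      also have "\<dots> \<le> EW (K + D) (\<lambda>w. norm (X w)) * (1 + real n * t\<^sup>2)"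
        by (intro mult_left_mono integral_nonneg_AE) auto
      finally show ?thesis .
    qed
    show "(\<lambda>n. A n (s / sqrt (real n))) \<longlonglongrightarrow> complex_of_real (cov D)" for s
    proof -
      have s0: "(\<lambda>n. s / sqrt (real n)) \<longlonglongrightarrow> 0" by real_asymp
      have "(\<lambda>n. EW (K + D) (\<lambda>w. X w * cis (s / sqrt (real n) * (real (sum_list w) - real (K + D))))) \<longlonglongrightarrow> EW (K + D) X"
      proof (rule integral_dominated_convergence[where w = "\<lambda>w. norm (X w)"])
        show "AE w in measure_pmf (W (K + D)). (\<lambda>n. X w * cis (s / sqrt (real n) * (real (sum_list w) - real (K + D)))) \<longlonglongrightarrow> X w"
        proof (rule AE_pmfI)
          fix w
          have "(\<lambda>n. X w * cis (s / sqrt (real n) * (real (sum_list w) - real (K + D)))) \<longlonglongrightarrow> X w * cis (0 * (real (sum_list w) - real (K + D)))"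
            by (intro tendsto_intros s0)
          then show "(\<lambda>n. X w * cis (s / sqrt (real n) * (real (sum_list w) - real (K + D)))) \<longlonglongrightarrow> X w" by simp
        qed
      qed (use iX in \<open>auto simp: norm_mult\<close>)
      moreover have "(\<lambda>n. cis (s / sqrt (real n))) \<longlonglongrightarrow> cis 0" by (intro tendsto_intros s0)
      ultimately have "(\<lambda>n. A n (s / sqrt (real n))) \<longlonglongrightarrow> EW (K + D) X * cis 0" unfolding A_def by (rule tendsto_mult)
      moreover have "EW (K + D) X = complex_of_real (cov D)" unfolding X_def cov_def by (rule integral_complex_of_real)
      ultimately show ?thesis by simp
    qed
    show "(\<lambda>n. real (n - (K + D)) / real n) \<longlonglongrightarrow> 1" by real_asymp
  qed auto
  then have "((\<lambda>n. sqrt (real n) * FI (\<lambda>t. A n t * psi t ^ (n - (K + D)))) \<longlongrightarrow> of_real (\<kappa> * cov D)) gseq"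
    unfolding gauss_complex using tendsto_mono[OF gseq_le] by (simp add: mult.commute)
  then have "((\<lambda>n. complex_of_real (sqrt (real n) * R n D)) \<longlongrightarrow> of_real (\<kappa> * cov D)) gseq"
  proof (rule Lim_transform_eventually)
    show "\<forall>\<^sub>F n in gseq. sqrt (real n) * FI (\<lambda>t. A n t * psi t ^ (n - (K + D))) = complex_of_real (sqrt (real n) * R n D)"
      unfolding eventually_gseq
    proof (intro exI[of _ "K + D"] allI impI)
      fix n assume n: "K + D \<le> n" "n \<in> good"
      define m where "m = n - (K + D)"
      have nm: "n = (K + D) + m" using n by (simp add: m_def)
      have "complex_of_real (R n D) = CEc n (\<lambda>w. X (take (K + D) w))"
        unfolding R_def CEc_of_real[symmetric]
        by (rule CEc_cong) (use n in \<open>simp add: X_def g_rotate dep_take drop_take\<close>)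
      also have "\<dots> = FI (\<lambda>t. EW n (\<lambda>w. X (take (K + D) w) * cis (t * (real (sum_list w) - real n))) * cis t)"
        using expectation_replicate_take[OF iX, of m] by (intro CEc_FI n) (simp add: nm)
      also have "\<dots> = FI (\<lambda>t. A n t * psi t ^ m)"
        unfolding nm cis_split_take[OF iX] A_def by (simp add: mult_ac)
      finally show "sqrt (real n) * FI (\<lambda>t. A n t * psi t ^ (n - (K + D))) = complex_of_real (sqrt (real n) * R n D)"
        by (simp add: m_def)
    qed
  qed
  then show ?thesis by (simp only: tendsto_of_real_iff)
qed

text \<open>The common value of \<open>R n D\<close> over all disjoint pairs (\<open>R_far\<close>):
  each window gives a factor \<open>ghat\<close>, all other letters a factor \<open>psi\<close>, and
  the distance drops out.\<close>

definition Q :: "nat \<Rightarrow> complex" where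
  "Q n = FI (\<lambda>t. (ghat t)\<^sup>2 * cis t * psi t ^ (n - 2 * K))"

lemma R_far:
  assumes "n \<in> good" "K \<le> D" "D + K \<le> n"
  shows "complex_of_real (R n D) = Q n"
proof -
  define m where "m = n - D - K"
  have n: "n = D + (K + m)" using assms by (simp add: m_def)
  let ?g = "\<lambda>w. complex_of_real (g w)"
  have ig: "integrable_W a ?g" if "K \<le> a" for a using g_integrable'[OF that] by (rule integrable_of_real)
  have e: "CEc n (\<lambda>w. of_real (g w * g (rotate D w))) = CEc n (\<lambda>w. ?g (take D w) * ?g (drop D w))"
    by (rule CEc_cong) (use assms in \<open>simp add: g_rotate dep_take\<close>)
  have split: "EW a (\<lambda>w. ?g w * cis (t * (real (sum_list w) - real a))) = ghat t * psi t ^ (a - K)" if "K \<le> a" for a t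
  proof -
    define b where "b = a - K"
    have a: "a = K + b" using that by (simp add: b_def)
    have ae: "AE w in measure_pmf (W (K + b)). ?g w * cis (t * (real (sum_list w) - real (K + b))) = ?g (take K w) * cis (t * (real (sum_list w) - real (K + b)))"
      by (intro AE_pmfI) (auto simp: dep_take dest!: length_replicate_pmf)
    show ?thesis unfolding a integral_cong_AE[OF _ _ ae, simplified]
      using cis_split_take[OF ig[OF order_refl], of b t] integral_cong_AE[OF _ _ ae] by (simp add: ghat_def)
  qed
  have "complex_of_real (R n D) = CEc n (\<lambda>w. ?g (take D w) * ?g (drop D w))"
    unfolding R_def CEc_of_real[symmetric] e ..
  also have "\<dots> = FI (\<lambda>t. EW n (\<lambda>w. ?g (take D w) * ?g (drop D w) * cis (t * (real (sum_list w) - real n))) * cis t)"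
    using integrable_replicate_mult[OF ig[OF assms(2)] ig, of "K + m"] by (intro CEc_FI assms) (simp add: n)
  also have "\<dots> = FI (\<lambda>t. (ghat t * psi t ^ (D - K)) * (ghat t * psi t ^ m) * cis t)"
  proof -
    have "EW n (\<lambda>w. ?g (take D w) * ?g (drop D w) * cis (t * (real (sum_list w) - real n)))
        = (ghat t * psi t ^ (D - K)) * (ghat t * psi t ^ m)" for t
      unfolding n cis_mult_split[OF ig[OF assms(2)] ig[of "K + m", simplified]] using split[OF assms(2)] split[of "K + m"] by simp
    then show ?thesis by simp
  qed
  also have "\<dots> = Q n"
  proof -
    have "n - 2 * K = (D - K) + m" using assms by (simp add: m_def)
    then show ?thesis unfolding Q_def by (simp add: power_add power2_eq_square mult_ac)
  qed
  finally show ?thesis .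
qed

lemma measurable_ghat: "ghat \<in> borel_measurable borel"
  using measurable_expectation_cis[of "W K" "\<lambda>w. of_real (g w)"] by (simp add: ghat_def[abs_def])

text \<open>At the scale t = s / sqrt n each factor \<open>ghat\<close> is o(n^(-1/2)). The at most
  n far distances together therefore contribute o(n^(-1/2)), negligible against P(S_n = n -
  1).\<close>

lemma Q_limit: "((\<lambda>n. sqrt (real n) * (real n * Q n)) \<longlongrightarrow> 0) gseq"
proof -
  define C where "C = EW K (\<lambda>w. \<bar>g w * (real (sum_list w) - real K)\<bar>)"
  have C: "0 \<le> C" unfolding C_def by (intro integral_nonneg_AE) auto
  have "(\<lambda>n. sqrt (real n) * FI (\<lambda>t. (of_real (real n) * (ghat t)\<^sup>2 * cis t) * psi t ^ (n - 2 * K))) \<longlonglongrightarrow>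
     of_real (real span / (2 * pi)) * (LINT s|lborel. 0 * complex_of_real (exp (- 1 * s2 * s\<^sup>2 / 2)))"
  proof (rule FI_limit)
    show "(\<lambda>t. of_real (real n) * (ghat t)\<^sup>2 * cis t) \<in> borel_measurable borel" for n using measurable_ghat by measurable
    show "norm (of_real (real n) * (ghat t)\<^sup>2 * cis t) \<le> C\<^sup>2 * (1 + real n * t\<^sup>2)" for n t
    proof -
      have "norm (of_real (real n) * (ghat t)\<^sup>2 * cis t) = real n * (norm (ghat t))\<^sup>2" by (simp add: norm_mult norm_power)
      also have "\<dots> \<le> real n * (C * \<bar>t\<bar>)\<^sup>2" using ghat_bound[of t] by (intro mult_left_mono power_mono) (auto simp: C_def)
      also have "\<dots> = C\<^sup>2 * (real n * t\<^sup>2)" by (simp add: power_mult_distrib)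
      also have "\<dots> \<le> C\<^sup>2 * (1 + real n * t\<^sup>2)" by (intro mult_left_mono) auto
      finally show ?thesis .
    qed
    show "(\<lambda>n. of_real (real n) * (ghat (s / sqrt (real n)))\<^sup>2 * cis (s / sqrt (real n))) \<longlonglongrightarrow> 0" for s
    proof -
      have s0: "(\<lambda>n. s / sqrt (real n)) \<longlonglongrightarrow> 0" by real_asymp
      have "(\<lambda>n. (sqrt (real n) * ghat (s / sqrt (real n)))\<^sup>2 * cis (s / sqrt (real n))) \<longlonglongrightarrow> 0\<^sup>2 * cis 0"
        by (intro tendsto_intros ghat_little_o s0)
      moreover have "(sqrt (real n) * ghat (s / sqrt (real n)))\<^sup>2 = of_real (real n) * (ghat (s / sqrt (real n)))\<^sup>2" for n
        by (simp add: power_mult_distrib of_real_power[symmetric] del: of_real_power)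
      ultimately show ?thesis by simp
    qed
    show "(\<lambda>n. real (n - 2 * K) / real n) \<longlonglongrightarrow> 1" by real_asymp
  qed auto
  moreover have "FI (\<lambda>t. (of_real (real n) * (ghat t)\<^sup>2 * cis t) * psi t ^ (n - 2 * K)) = real n * Q n" for n
    unfolding Q_def FI_def mult.assoc by (simp only: set_integral_mult_right) (simp only: mult_ac)
  ultimately show ?thesis using tendsto_mono[OF gseq_le] by simp
qed

lemma R_sym: assumes "D \<le> n" shows "R n (n - D) = R n D"
proof -
  have "R n (n - D) = CE n (\<lambda>w. g (rotate D w) * g (rotate (n - D) (rotate D w)))"
    unfolding R_def using CE_rotate[OF assms, of "\<lambda>w. g w * g (rotate (n - D) w)"] by simp
  also have "\<dots> = R n D" unfolding R_def
    by (rule CE_cong) (use assms in \<open>simp add: rotate_rotate mult.commute\<close>)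
  finally show ?thesis .
qed

text \<open>The sum of the covariances over all integer distances, as those from K on vanish
  (\<open>cov_far\<close>): the variance constant of the stationary sequence of windows.\<close>

definition \<gamma> :: real where "\<gamma> = cov 0 + 2 * (\<Sum>D\<in>{1..<K}. cov D)"

lemma eventually_large: "\<forall>\<^sub>F n in gseq. N \<le> n \<and> n \<in> good"
  unfolding eventually_gseq by (intro exI[of _ N]) auto

lemma sum_R_split:
  assumes "n \<in> good" "2 * K \<le> n"
  shows "(\<Sum>D<n. R n D) = (\<Sum>D<K. R n D) + real (n - 2 * K + 1) * Re (Q n) + (\<Sum>D\<in>{1..<K}. R n D)"
    "(\<Sum>D<n. \<bar>R n D\<bar>) = (\<Sum>D<K. \<bar>R n D\<bar>) + real (n - 2 * K + 1) * \<bar>Re (Q n)\<bar> + (\<Sum>D\<in>{1..<K}. \<bar>R n D\<bar>)"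
proof -
  have q: "R n D = Re (Q n)" if "D \<in> {K..n - K}" for D
  proof -
    have "complex_of_real (R n D) = Q n" using that assms by (intro R_far) auto
    then have "Re (complex_of_real (R n D)) = Re (Q n)" by (rule arg_cong)
    then show ?thesis by simp
  qed
  have s: "R n (n - D) = R n D" if "D \<in> {1..<K}" for D using that assms(2) by (intro R_sym) auto
  have c: "card {K..n - K} = n - 2 * K + 1" using assms(2) by simp
  show "(\<Sum>D<n. R n D) = (\<Sum>D<K. R n D) + real (n - 2 * K + 1) * Re (Q n) + (\<Sum>D\<in>{1..<K}. R n D)"
    unfolding sum_split_ends[OF assms(2) K1] using c by (simp add: q s del: card_atLeastAtMost)
  show "(\<Sum>D<n. \<bar>R n D\<bar>) = (\<Sum>D<K. \<bar>R n D\<bar>) + real (n - 2 * K + 1) * \<bar>Re (Q n)\<bar> + (\<Sum>D\<in>{1..<K}. \<bar>R n D\<bar>)"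
    unfolding sum_split_ends[OF assms(2) K1] using c by (simp add: q s del: card_atLeastAtMost)
qed

lemma Q_count_limit: "((\<lambda>n. sqrt (real n) * (real (n - 2 * K + 1) * Re (Q n))) \<longlongrightarrow> 0) gseq"
proof -
  have "((\<lambda>n. Re (sqrt (real n) * (real n * Q n))) \<longlongrightarrow> 0) gseq" using tendsto_Re[OF Q_limit] by simp
  moreover have "((\<lambda>n. real (n - 2 * K + 1) / real n) \<longlongrightarrow> 1) gseq"
    by (rule tendsto_mono[OF gseq_le]) real_asymp
  ultimately have "((\<lambda>n. real (n - 2 * K + 1) / real n * Re (sqrt (real n) * (real n * Q n))) \<longlongrightarrow> 1 * 0) gseq"
    by (intro tendsto_mult)
  then have "((\<lambda>n. real (n - 2 * K + 1) / real n * Re (sqrt (real n) * (real n * Q n))) \<longlongrightarrow> 0) gseq" by simp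
  then show ?thesis
  proof (rule Lim_transform_eventually)
    show "\<forall>\<^sub>F n in gseq. real (n - 2 * K + 1) / real n * Re (sqrt (real n) * (real n * Q n)) = sqrt (real n) * (real (n - 2 * K + 1) * Re (Q n))"
      using eventually_large[of 1] by eventually_elim (simp add: mult.assoc[symmetric] del: of_nat_add)
  qed
qed

lemma sum_R_limit: "((\<lambda>n. sqrt (real n) * (\<Sum>D<n. R n D)) \<longlongrightarrow> \<kappa> * \<gamma>) gseq"
proof -
  have "((\<lambda>n. (\<Sum>D<K. sqrt (real n) * R n D) + sqrt (real n) * (real (n - 2 * K + 1) * Re (Q n)) + (\<Sum>D\<in>{1..<K}. sqrt (real n) * R n D))
      \<longlongrightarrow> (\<Sum>D<K. \<kappa> * cov D) + 0 + (\<Sum>D\<in>{1..<K}. \<kappa> * cov D)) gseq"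
    by (intro tendsto_add tendsto_sum R_close Q_count_limit)
  moreover have "(\<Sum>D<K. \<kappa> * cov D) + 0 + (\<Sum>D\<in>{1..<K}. \<kappa> * cov D) = \<kappa> * \<gamma>"
  proof -
    have "{..<K} = insert 0 {1..<K}" using K1 by auto
    then show ?thesis by (simp add: \<gamma>_def sum_distrib_left algebra_simps)
  qed
  ultimately have "((\<lambda>n. (\<Sum>D<K. sqrt (real n) * R n D) + sqrt (real n) * (real (n - 2 * K + 1) * Re (Q n)) + (\<Sum>D\<in>{1..<K}. sqrt (real n) * R n D))
      \<longlongrightarrow> \<kappa> * \<gamma>) gseq" by simp
  then show ?thesis
  proof (rule Lim_transform_eventually)
    show "\<forall>\<^sub>F n in gseq. (\<Sum>D<K. sqrt (real n) * R n D) + sqrt (real n) * (real (n - 2 * K + 1) * Re (Q n)) + (\<Sum>D\<in>{1..<K}. sqrt (real n) * R n D)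
        = sqrt (real n) * (\<Sum>D<n. R n D)"
      using eventually_large[of "2 * K"]
      by eventually_elim (simp only: sum_R_split(1) distrib_left sum_distrib_left)
  qed
qed

lemma sum_abs_R_bounded: "\<exists>C>0. \<forall>\<^sub>F n in gseq. sqrt (real n) * (\<Sum>D<n. \<bar>R n D\<bar>) \<le> C"
proof -
  have "((\<lambda>n. (\<Sum>D<K. \<bar>sqrt (real n) * R n D\<bar>) + \<bar>sqrt (real n) * (real (n - 2 * K + 1) * Re (Q n))\<bar> + (\<Sum>D\<in>{1..<K}. \<bar>sqrt (real n) * R n D\<bar>))
      \<longlongrightarrow> (\<Sum>D<K. \<bar>\<kappa> * cov D\<bar>) + \<bar>0\<bar> + (\<Sum>D\<in>{1..<K}. \<bar>\<kappa> * cov D\<bar>)) gseq" (is "(?f \<longlongrightarrow> ?l) _")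
    by (intro tendsto_add tendsto_sum tendsto_rabs R_close Q_count_limit)
  then have "\<forall>\<^sub>F n in gseq. ?f n < ?l + 1" by (rule order_tendstoD) simp
  then have "\<forall>\<^sub>F n in gseq. sqrt (real n) * (\<Sum>D<n. \<bar>R n D\<bar>) \<le> ?l + 1"
    using eventually_large[of "2 * K"]
    by eventually_elim (simp add: sum_R_split(2) distrib_left sum_distrib_left abs_mult)
  moreover have "0 < ?l + 1" by (intro add_nonneg_pos add_nonneg_nonneg sum_nonneg) auto
  ultimately show ?thesis by blast
qed

section \<open>Moments of sums of rotated windows\<close>

lemma CE_square:
  assumes "I \<subseteq> {..<n}"
  shows "CE n (\<lambda>w. (\<Sum>i\<in>I. g (rotate i w))\<^sup>2) = (\<Sum>i\<in>I. \<Sum>j\<in>I. R n (nd i j))"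
proof -
  have R': "CE n (\<lambda>w. g (rotate i w) * g (rotate j w)) = R n (nd i j)" if "i < n" "j < n" for i j
  proof -
    have *: "CE n (\<lambda>w. g (rotate i w) * g (rotate j w)) = R n (j - i)" if "i \<le> j" "j < n" for i j
    proof -
      have "R n (j - i) = CE n (\<lambda>w. g (rotate i w) * g (rotate (j - i) (rotate i w)))"
        unfolding R_def using CE_rotate[of i n "\<lambda>w. g w * g (rotate (j - i) w)"] that by simp
      then show ?thesis using that by (simp add: rotate_rotate)
    qed
    show ?thesis
    proof (cases "i \<le> j")
      case True then show ?thesis using *[of i j] that by (simp add: nd_def)
    next
      case False
      have "CE n (\<lambda>w. g (rotate i w) * g (rotate j w)) = CE n (\<lambda>w. g (rotate j w) * g (rotate i w))"
        by (rule CE_cong) (rule mult.commute)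
      then show ?thesis using *[of j i] that False by (simp add: nd_def)
    qed
  qed
  have "CE n (\<lambda>w. (\<Sum>i\<in>I. g (rotate i w))\<^sup>2) = CE n (\<lambda>w. \<Sum>i\<in>I. \<Sum>j\<in>I. g (rotate i w) * g (rotate j w))"
    by (simp add: power2_eq_square sum_product)
  also have "\<dots> = (\<Sum>i\<in>I. \<Sum>j\<in>I. CE n (\<lambda>w. g (rotate i w) * g (rotate j w)))" by (simp only: CE_sum)
  also have "\<dots> = (\<Sum>i\<in>I. \<Sum>j\<in>I. R n (nd i j))" using assms by (intro sum.cong refl R') auto
  finally show ?thesis .
qed

text \<open>The row sums of the absolute mixed moments are bounded relative to P(S_n = n - 1), so
  any set of positions has a second moment linear in its size. This serves for the positions outside
  the blocks.\<close>

lemma CE_square_le: "\<exists>C>0. \<forall>\<^sub>F n in gseq. \<forall>I\<subseteq>{..<n}. CE n (\<lambda>w. (\<Sum>i\<in>I. g (rotate i w))\<^sup>2) \<le> C * real (card I) * PS n (n - 1)"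
proof -
  obtain C where C: "0 < C" "\<forall>\<^sub>F n in gseq. sqrt (real n) * (\<Sum>D<n. \<bar>R n D\<bar>) \<le> C" using sum_abs_R_bounded by blast
  obtain c where c: "0 < c" "\<forall>\<^sub>F n in gseq. c / sqrt (real n) \<le> PS n (n - 1)" using PS_good_lower by blast
  show ?thesis
  proof (intro exI[of _ "2 * C / c"] conjI)
    show "0 < 2 * C / c" using C c by simp
    show "\<forall>\<^sub>F n in gseq. \<forall>I\<subseteq>{..<n}. CE n (\<lambda>w. (\<Sum>i\<in>I. g (rotate i w))\<^sup>2) \<le> 2 * C / c * real (card I) * PS n (n - 1)"
      using C(2) c(2) eventually_large[of 1]
    proof eventually_elim
      case (elim n)
      show ?case
      proof (intro allI impI)
        fix I assume I: "I \<subseteq> {..<n}"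
        have "CE n (\<lambda>w. (\<Sum>i\<in>I. g (rotate i w))\<^sup>2) \<le> (\<Sum>i\<in>I. \<Sum>j<n. \<bar>R n (nd i j)\<bar>)"
          unfolding CE_square[OF I]
        proof (rule sum_mono)
          fix i assume "i \<in> I"
          have "(\<Sum>j\<in>I. R n (nd i j)) \<le> (\<Sum>j\<in>I. \<bar>R n (nd i j)\<bar>)" by (intro sum_mono) simp
          also have "\<dots> \<le> (\<Sum>j<n. \<bar>R n (nd i j)\<bar>)" using I by (intro sum_mono2) auto
          finally show "(\<Sum>j\<in>I. R n (nd i j)) \<le> (\<Sum>j<n. \<bar>R n (nd i j)\<bar>)" .
        qed
        also have "\<dots> \<le> (\<Sum>i\<in>I. 2 * (\<Sum>D<n. \<bar>R n D\<bar>))"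
          using I by (intro sum_mono sum_nd_le) auto
        also have "\<dots> = real (card I) * (2 * (\<Sum>D<n. \<bar>R n D\<bar>))" by simp
        also have "\<dots> \<le> real (card I) * (2 * (C / c * PS n (n - 1)))"
        proof (intro mult_left_mono)
          have n: "0 < sqrt (real n)" using elim by simp
          have "(\<Sum>D<n. \<bar>R n D\<bar>) \<le> C / sqrt (real n)" using elim(1) n by (simp add: pos_le_divide_eq mult.commute)
          also have "\<dots> = C / c * (c / sqrt (real n))" using c(1) by simp
          also have "\<dots> \<le> C / c * PS n (n - 1)" using C(1) c(1) elim(2) by (intro mult_left_mono) auto
          finally show "(\<Sum>D<n. \<bar>R n D\<bar>) \<le> C / c * PS n (n - 1)" .
        qed auto
        finally show "CE n (\<lambda>w. (\<Sum>i\<in>I. g (rotate i w))\<^sup>2) \<le> 2 * C / c * real (card I) * PS n (n - 1)" by (simp add: mult_ac)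
      qed
    qed
  qed
qed

lemma second_moment_limit:
  "((\<lambda>n. CE n (\<lambda>w. (\<Sum>i<n. g (rotate i w))\<^sup>2) / (real n * PS n (n - 1))) \<longlongrightarrow> \<gamma>) gseq"
proof -
  have "((\<lambda>n. (sqrt (real n) * (\<Sum>D<n. R n D)) / (sqrt (real n) * PS n (n - 1))) \<longlongrightarrow> (\<kappa> * \<gamma>) / \<kappa>) gseq"
    using \<kappa>_pos by (intro tendsto_divide sum_R_limit PS_tendsto) auto
  then have "((\<lambda>n. (sqrt (real n) * (\<Sum>D<n. R n D)) / (sqrt (real n) * PS n (n - 1))) \<longlongrightarrow> \<gamma>) gseq" using \<kappa>_pos by simp
  then show ?thesis
  proof (rule Lim_transform_eventually)
    show "\<forall>\<^sub>F n in gseq. (sqrt (real n) * (\<Sum>D<n. R n D)) / (sqrt (real n) * PS n (n - 1))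
        = CE n (\<lambda>w. (\<Sum>i<n. g (rotate i w))\<^sup>2) / (real n * PS n (n - 1))"
      using eventually_large[of 1]
    proof eventually_elim
      case (elim n)
      have "CE n (\<lambda>w. (\<Sum>i<n. g (rotate i w))\<^sup>2) = (\<Sum>i<n. \<Sum>D<n. R n D)"
        unfolding CE_square[OF subset_refl] by (intro sum.cong refl sum_nd_eq R_sym) auto
      then show ?case using elim by simp
    qed
  qed
qed

text \<open>By rotation invariance all windows have the same mean. Since \<open>ghat\<close> is
  o(n^(-1/2)) at the relevant scale, n of them give o(sqrt n).\<close>

lemma first_moment_limit:
  "((\<lambda>n. CE n (\<lambda>w. \<Sum>i<n. g (rotate i w)) / (sqrt (real n) * PS n (n - 1))) \<longlongrightarrow> 0) gseq"
proof -
  define C where "C = EW K (\<lambda>w. \<bar>g w * (real (sum_list w) - real K)\<bar>)"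
  have C: "0 \<le> C" unfolding C_def by (intro integral_nonneg_AE) auto
  have "(\<lambda>n. sqrt (real n) * FI (\<lambda>t. (of_real (sqrt (real n)) * ghat t * cis t) * psi t ^ (n - K))) \<longlonglongrightarrow>
     of_real (real span / (2 * pi)) * (LINT s|lborel. 0 * complex_of_real (exp (- 1 * s2 * s\<^sup>2 / 2)))"
  proof (rule FI_limit)
    show "(\<lambda>t. of_real (sqrt (real n)) * ghat t * cis t) \<in> borel_measurable borel" for n using measurable_ghat by measurable
    show "norm (of_real (sqrt (real n)) * ghat t * cis t) \<le> C * (1 + real n * t\<^sup>2)" for n t
    proof -
      have "norm (of_real (sqrt (real n)) * ghat t * cis t) = sqrt (real n) * norm (ghat t)" by (simp add: norm_mult)
      also have "\<dots> \<le> sqrt (real n) * (C * \<bar>t\<bar>)" using ghat_bound[of t] by (intro mult_left_mono) (auto simp: C_def)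
      also have "\<dots> = C * (sqrt (real n) * \<bar>t\<bar>)" by simp
      also have "\<dots> \<le> C * (1 + real n * t\<^sup>2)"
      proof (intro mult_left_mono C)
        have "(sqrt (real n) * \<bar>t\<bar>)\<^sup>2 = real n * t\<^sup>2" by (simp add: power_mult_distrib)
        then show "sqrt (real n) * \<bar>t\<bar> \<le> 1 + real n * t\<^sup>2"
          using zero_le_power2[of "sqrt (real n) * \<bar>t\<bar> - 1"] zero_le_power2[of "sqrt (real n) * \<bar>t\<bar>"]
          unfolding power2_diff power_one by linarith
      qed
      finally show ?thesis .
    qed
    show "(\<lambda>n. of_real (sqrt (real n)) * ghat (s / sqrt (real n)) * cis (s / sqrt (real n))) \<longlonglongrightarrow> 0" for s
    proof -
      have s0: "(\<lambda>n. s / sqrt (real n)) \<longlonglongrightarrow> 0" by real_asymp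
      have "(\<lambda>n. (sqrt (real n) * ghat (s / sqrt (real n))) * cis (s / sqrt (real n))) \<longlonglongrightarrow> 0 * cis 0"
        by (intro tendsto_mult ghat_little_o tendsto_intros s0)
      then show ?thesis by simp
    qed
    show "(\<lambda>n. real (n - K) / real n) \<longlonglongrightarrow> 1" by real_asymp
  qed auto
  then have l: "((\<lambda>n. Re (sqrt (real n) * FI (\<lambda>t. (of_real (sqrt (real n)) * ghat t * cis t) * psi t ^ (n - K)))) \<longlongrightarrow> 0) gseq"
    using tendsto_Re[OF tendsto_mono[OF gseq_le]] by fastforce
  have "((\<lambda>n. Re (sqrt (real n) * FI (\<lambda>t. (of_real (sqrt (real n)) * ghat t * cis t) * psi t ^ (n - K))) / (sqrt (real n) * PS n (n - 1))) \<longlongrightarrow> 0 / \<kappa>) gseq"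
    using \<kappa>_pos by (intro tendsto_divide l PS_tendsto) auto
  then have "((\<lambda>n. Re (sqrt (real n) * FI (\<lambda>t. (of_real (sqrt (real n)) * ghat t * cis t) * psi t ^ (n - K))) / (sqrt (real n) * PS n (n - 1))) \<longlongrightarrow> 0) gseq"
    by simp
  then show ?thesis
  proof (rule Lim_transform_eventually)
    show "\<forall>\<^sub>F n in gseq. Re (sqrt (real n) * FI (\<lambda>t. (of_real (sqrt (real n)) * ghat t * cis t) * psi t ^ (n - K))) / (sqrt (real n) * PS n (n - 1))
        = CE n (\<lambda>w. \<Sum>i<n. g (rotate i w)) / (sqrt (real n) * PS n (n - 1))"
      using eventually_large[of K]
    proof eventually_elim
      case (elim n)
      define m where "m = n - K"
      have n: "n = K + m" using elim by (simp add: m_def)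
      let ?g = "\<lambda>w. complex_of_real (g w)"
      have ig: "integrable_W K ?g" using g_integrable by (rule integrable_of_real)
      have "CE n (\<lambda>w. \<Sum>i<n. g (rotate i w)) = (\<Sum>i<n. CE n g)"
        unfolding CE_sum by (intro sum.cong refl CE_rotate) auto
      then have "complex_of_real (CE n (\<lambda>w. \<Sum>i<n. g (rotate i w))) = of_real (real n) * CEc n ?g"
        by (simp add: CEc_of_real)
      also have "CEc n ?g = CEc n (\<lambda>w. ?g (take K w))" by (rule CEc_cong) (use n in \<open>simp add: dep_take\<close>)
      also have "\<dots> = FI (\<lambda>t. EW n (\<lambda>w. ?g (take K w) * cis (t * (real (sum_list w) - real n))) * cis t)"
        using expectation_replicate_take[OF ig, of m] elim by (intro CEc_FI) (auto simp: n)
      also have "\<dots> = FI (\<lambda>t. ghat t * cis t * psi t ^ m)"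
        unfolding n cis_split_take[OF ig] by (simp add: ghat_def mult_ac)
      also have "of_real (real n) * FI (\<lambda>t. ghat t * cis t * psi t ^ m)
          = sqrt (real n) * (sqrt (real n) * FI (\<lambda>t. ghat t * cis t * psi t ^ m))"
        by (simp only: mult.assoc[symmetric] of_real_mult[symmetric] real_sqrt_mult_self) simp
      also have "sqrt (real n) * FI (\<lambda>t. ghat t * cis t * psi t ^ m) = FI (\<lambda>t. (of_real (sqrt (real n)) * ghat t * cis t) * psi t ^ (n - K))"
        unfolding FI_def mult.assoc m_def by (simp only: set_integral_mult_right) (simp only: mult_ac)
      finally have "complex_of_real (CE n (\<lambda>w. \<Sum>i<n. g (rotate i w)))
          = sqrt (real n) * FI (\<lambda>t. (of_real (sqrt (real n)) * ghat t * cis t) * psi t ^ (n - K))" .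
      from arg_cong[OF this, of Re] show ?case by (simp only: Re_complex_of_real)
    qed
  qed
qed

end

lemma norm_cis_diff_le: "norm (cis x - cis y) \<le> \<bar>x - y\<bar>"
proof -
  have "cis x - cis y = cis y * (cis (x - y) - 1)" by (simp add: right_diff_distrib cis_mult)
  then have "norm (cis x - cis y) = norm (cis (x - y) - 1)" by (simp only: norm_mult norm_cis mult_1_left)
  also have "\<dots> \<le> \<bar>x - y\<bar>" using iexp_approx1[of "x - y" 0] by (simp add: cis_conv_exp)
  finally show ?thesis .
qed

lemma floor_ratio_tendsto:
  assumes "0 \<le> a"
  shows "(\<lambda>n. real (nat \<lfloor>a * real n\<rfloor>) / real n) \<longlonglongrightarrow> a"
proof (rule tendsto_sandwich)
  have fl: "real (nat \<lfloor>a * real n\<rfloor>) = of_int \<lfloor>a * real n\<rfloor>" for n using assms by simp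
  show "\<forall>\<^sub>F n in sequentially. a - 1 / real n \<le> real (nat \<lfloor>a * real n\<rfloor>) / real n"
  proof (rule eventually_sequentiallyI[of 1])
    fix n :: nat assume n: "1 \<le> n"
    have "a * real n - 1 \<le> real (nat \<lfloor>a * real n\<rfloor>)" unfolding fl by linarith
    then have "(a * real n - 1) / real n \<le> real (nat \<lfloor>a * real n\<rfloor>) / real n" by (rule divide_right_mono) simp
    then show "a - 1 / real n \<le> real (nat \<lfloor>a * real n\<rfloor>) / real n" using n by (simp add: diff_divide_distrib)
  qed
  show "\<forall>\<^sub>F n in sequentially. real (nat \<lfloor>a * real n\<rfloor>) / real n \<le> a"
  proof (rule eventually_sequentiallyI[of 1])
    fix n :: nat assume n: "1 \<le> n"
    have "real (nat \<lfloor>a * real n\<rfloor>) \<le> a * real n" unfolding fl by linarith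
    then show "real (nat \<lfloor>a * real n\<rfloor>) / real n \<le> a" using n by (simp add: pos_divide_le_eq)
  qed
  show "(\<lambda>n. a - 1 / real n) \<longlonglongrightarrow> a" by real_asymp
qed simp

context window
begin

text \<open>Only the windows that fit inside a block of length \<open>B\<close> are summed, which
  makes disjoint blocks independent.\<close>

definition U :: "nat \<Rightarrow> nat list \<Rightarrow> real" where "U B x = (\<Sum>r<B + 1 - K. g (drop r x))"

definition blocks :: "nat \<Rightarrow> nat \<Rightarrow> nat list \<Rightarrow> real" where
  "blocks B N w = (\<Sum>b<N. U B (take B (drop (b * B) w)))"

section \<open>Independent blocks of the word\<close>

lemma U_square: "(U B x)\<^sup>2 = (\<Sum>i<B + 1 - K. \<Sum>j<B + 1 - K. g (drop i x) * g (drop j x))"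
  by (simp add: U_def power2_eq_square sum_product)

lemma U_square_integrable: "integrable_W B (\<lambda>x. (U B x)\<^sup>2)"
  unfolding U_square by (intro Bochner_Integration.integrable_sum gg_integrable) auto

lemma g_drop_integrable: "i + K \<le> n \<Longrightarrow> integrable_W n (\<lambda>w. g (drop i w))"
  by (rule measure_pmf.square_integrable_imp_integrable[OF _ g_square_integrable]) simp

lemma U_integrable: "integrable_W B (U B)"
  by (rule measure_pmf.square_integrable_imp_integrable[OF _ U_square_integrable]) simp

lemma U_expectation: "EW B (U B) = 0"
  unfolding U_def by (subst Bochner_Integration.integral_sum) (auto intro!: g_drop_integrable sum.neutral g_expectation)

definition covsum :: "nat \<Rightarrow> real" where "covsum m = (\<Sum>i<m. \<Sum>j<m. cov (nd i j))"

lemma U_variance: "EW B (\<lambda>x. (U B x)\<^sup>2) = covsum (B + 1 - K)"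
proof -
  have "EW B (\<lambda>x. (U B x)\<^sup>2) = (\<Sum>i<B + 1 - K. \<Sum>j<B + 1 - K. EW B (\<lambda>x. g (drop i x) * g (drop j x)))"
  proof -
    have ii: "integrable_W B (\<lambda>x. g (drop i x) * g (drop j x))" if "i < B + 1 - K" "j < B + 1 - K" for i j
      using that by (intro gg_integrable) auto
    have "EW B (\<lambda>x. (U B x)\<^sup>2) = (\<Sum>i<B + 1 - K. EW B (\<lambda>x. \<Sum>j<B + 1 - K. g (drop i x) * g (drop j x)))"
      unfolding U_square by (intro Bochner_Integration.integral_sum Bochner_Integration.integrable_sum ii) auto
    also have "\<dots> = (\<Sum>i<B + 1 - K. \<Sum>j<B + 1 - K. EW B (\<lambda>x. g (drop i x) * g (drop j x)))"
      by (intro sum.cong refl Bochner_Integration.integral_sum ii) auto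
    finally show ?thesis .
  qed
  also have "\<dots> = covsum (B + 1 - K)" unfolding covsum_def
  proof (intro sum.cong refl)
    fix i j assume "i \<in> {..<B + 1 - K}" "j \<in> {..<B + 1 - K}"
    then have ij: "i + K \<le> B" "j + K \<le> B" by auto
    show "EW B (\<lambda>x. g (drop i x) * g (drop j x)) = cov (nd i j)"
    proof (cases "i \<le> j")
      case True then show ?thesis using cov_shift[OF True ij(2)] by (simp add: nd_def)
    next
      case False
      then have "EW B (\<lambda>x. g (drop j x) * g (drop i x)) = cov (i - j)" using ij by (intro cov_shift) auto
      moreover have "EW B (\<lambda>x. g (drop i x) * g (drop j x)) = EW B (\<lambda>x. g (drop j x) * g (drop i x))"
        by (rule Bochner_Integration.integral_cong[OF refl]) (rule mult.commute)
      ultimately show ?thesis using False by (simp add: nd_def)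
    qed
  qed
  finally show ?thesis .
qed

text \<open>Once K - 1 predecessors are present, a new position meets all its nonzero covariances,
  so \<open>covsum\<close> grows by a constant.\<close>

lemma covsum_Suc: "K \<le> Suc m \<Longrightarrow> covsum (Suc m) = covsum m + \<gamma>"
proof -
  assume m: "K \<le> Suc m"
  have "covsum (Suc m) = covsum m + (\<Sum>i<m. cov (nd i m)) + (\<Sum>j<m. cov (nd m j)) + cov (nd m m)"
    by (simp add: covsum_def sum.distrib)
  also have "(\<Sum>i<m. cov (nd i m)) = (\<Sum>D\<in>{1..m}. cov D)"
    by (rule sum.reindex_bij_witness[of _ "\<lambda>D. m - D" "\<lambda>i. m - i"]) (auto simp: nd_def)
  also have "(\<Sum>j<m. cov (nd m j)) = (\<Sum>D\<in>{1..m}. cov D)"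
    by (rule sum.reindex_bij_witness[of _ "\<lambda>D. m - D" "\<lambda>i. m - i"]) (auto simp: nd_def)
  also have "(\<Sum>D\<in>{1..m}. cov D) = (\<Sum>D\<in>{1..<K}. cov D)"
    using m by (intro sum.mono_neutral_right) (auto simp: cov_far)
  finally show ?thesis by (simp add: \<gamma>_def nd_def)
qed

lemma covsum_linear: "covsum (K + k) = covsum K + real k * \<gamma>"
  by (induction k) (simp_all add: covsum_Suc algebra_simps)

lemma U_variance_limit: "(\<lambda>B. EW B (\<lambda>x. (U B x)\<^sup>2) / real B) \<longlonglongrightarrow> \<gamma>"
proof -
  have "(\<lambda>B. (covsum K + (real B + 1 - 2 * real K) * \<gamma>) / real B) \<longlonglongrightarrow> \<gamma>"
  proof -
    have "(\<lambda>B. covsum K / real B + (real B + 1 - 2 * real K) / real B * \<gamma>) \<longlonglongrightarrow> 0 + 1 * \<gamma>"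
    proof (intro tendsto_add tendsto_mult tendsto_const)
      show "(\<lambda>B. covsum K / real B) \<longlonglongrightarrow> 0" by (rule lim_const_over_n)
      show "(\<lambda>B. (real B + 1 - 2 * real K) / real B) \<longlonglongrightarrow> 1" by real_asymp
    qed
    then show ?thesis by (simp add: add_divide_distrib)
  qed
  then show ?thesis
  proof (rule Lim_transform_eventually, intro eventually_sequentiallyI[of "2 * K"])
    fix B assume B: "2 * K \<le> B"
    then have "B + 1 - K = K + (B + 1 - 2 * K)" by simp
    then have "covsum (B + 1 - K) = covsum K + real (B + 1 - 2 * K) * \<gamma>" by (simp only: covsum_linear)
    then show "(covsum K + (real B + 1 - 2 * real K) * \<gamma>) / real B = EW B (\<lambda>x. (U B x)\<^sup>2) / real B"
      using B by (simp add: U_variance of_nat_diff)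
  qed
qed

text \<open>Makes the limit covariance of block sums and letter sum diagonal, so that fixing the
  letter sum does not change the limit of the block sums.\<close>

lemma U_uncorrelated: "EW B (\<lambda>x. U B x * (real (sum_list x) - real B)) = 0"
proof -
  have 1: "EW B (\<lambda>x. g (drop r x) * (real (sum_list x) - real B)) = 0"
    and 2: "integrable_W B (\<lambda>x. g (drop r x) * (real (sum_list x) - real B))" if r: "r < B + 1 - K" for r
  proof -
    show "integrable_W B (\<lambda>x. g (drop r x) * (real (sum_list x) - real B))"
      using r by (intro integrable_mult_squares g_square_integrable word_sum_square_integrable) simp
    define q where "q = B - r - K"
    have B: "B = r + (K + q)" using r by (simp add: q_def)
    let ?z = "\<lambda>n w. real (sum_list w) - real n"
    have zsplit: "?z (a + b) w = ?z a (take a w) + ?z b (drop a w)" for a b w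
    proof -
      have "sum_list w = sum_list (take a w) + sum_list (drop a w)" by (metis append_take_drop_id sum_list_append)
      then show ?thesis by simp
    qed
    have ig: "integrable_W (K + q) g" by (rule g_integrable') simp
    have igz: "integrable_W (K + q) (\<lambda>w. g w * ?z (K + q) w)"
      using integrable_mult_squares[OF g_square_integrable[of 0 "K + q"] word_sum_square_integrable] by simp
    have A: "EW (K + q) (\<lambda>w. g w * ?z (K + q) w) = 0"
    proof -
      note gz = expectation_replicate_take[OF gz_integrable, of q]
      note gm = integrable_replicate_mult[OF g_integrable word_sum_integrable[of q]]
        expectation_replicate_mult[OF g_integrable word_sum_integrable[of q]]
      have ae: "AE w in measure_pmf (W (K + q)). g w * ?z (K + q) w = g (take K w) * ?z K (take K w) + g (take K w) * ?z q (drop K w)"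
        by (intro AE_pmfI, subst zsplit) (auto simp: dep_take distrib_left dest!: length_replicate_pmf)
      have "EW (K + q) (\<lambda>w. g w * ?z (K + q) w) = EW (K + q) (\<lambda>w. g (take K w) * ?z K (take K w) + g (take K w) * ?z q (drop K w))"
        by (rule integral_cong_AE[OF _ _ ae]) auto
      also have "\<dots> = EW K (\<lambda>w. g w * ?z K w) + EW K g * EW q (?z q)"
        using gz gm by (subst Bochner_Integration.integral_add) auto
      finally show ?thesis by (simp add: m0 m1)
    qed
    have Bs: "EW (r + (K + q)) (\<lambda>x. ?z r (take r x) * g (drop r x)) = 0"
      using expectation_replicate_mult[OF word_sum_integrable[of r] ig] word_sum_moments(1)[of r] by simp
    have "EW (r + (K + q)) (\<lambda>x. g (drop r x) * ?z (r + (K + q)) x)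
        = EW (r + (K + q)) (\<lambda>x. ?z r (take r x) * g (drop r x) + g (drop r x) * ?z (K + q) (drop r x))"
      by (rule Bochner_Integration.integral_cong[OF refl], subst zsplit) (simp add: distrib_left mult.commute)
    also have "\<dots> = EW (r + (K + q)) (\<lambda>x. ?z r (take r x) * g (drop r x)) + EW (r + (K + q)) (\<lambda>x. g (drop r x) * ?z (K + q) (drop r x))"
      using integrable_replicate_mult[OF word_sum_integrable[of r] ig] expectation_replicate_drop[OF igz, of r]
      by (intro Bochner_Integration.integral_add) auto
    also have "\<dots> = 0" using Bs A expectation_replicate_drop[OF igz, of r] by simp
    finally show "EW B (\<lambda>x. g (drop r x) * (real (sum_list x) - real B)) = 0" unfolding B .
  qed
  have "EW B (\<lambda>x. U B x * (real (sum_list x) - real B)) = (\<Sum>r<B + 1 - K. EW B (\<lambda>x. g (drop r x) * (real (sum_list x) - real B)))"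
    unfolding U_def sum_distrib_right by (rule Bochner_Integration.integral_sum) (use 2 in auto)
  then show ?thesis using 1 by simp
qed

lemma blocks_char:
  "EW (N * B + l) (\<lambda>w. cis (u * blocks B N w) * cis (t * (real (sum_list w) - real (N * B + l))))
    = EW B (\<lambda>x. cis (u * U B x) * cis (t * (real (sum_list x) - real B))) ^ N * psi t ^ l"
proof (induction N)
  case 0
  show ?case by (simp add: blocks_def expectation_cis_word)
next
  case (Suc N)
  have ii: "integrable_W a (\<lambda>w. cis (h w))" for a h
    by (rule measure_pmf.integrable_const_bound[of _ 1]) auto
  have bs: "blocks B (Suc N) w = U B (take B w) + blocks B N (drop B w)" for w
    unfolding blocks_def sum.lessThan_Suc_shift by (simp add: add.commute)
  have "EW (B + (N * B + l)) (\<lambda>w. cis (u * U B (take B w)) * cis (u * blocks B N (drop B w)) * cis (t * (real (sum_list w) - real (B + (N * B + l)))))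
      = EW B (\<lambda>x. cis (u * U B x) * cis (t * (real (sum_list x) - real B)))
        * EW (N * B + l) (\<lambda>w. cis (u * blocks B N w) * cis (t * (real (sum_list w) - real (N * B + l))))"
    by (rule cis_mult_split[OF ii ii])
  moreover have "cis (u * blocks B (Suc N) w) = cis (u * U B (take B w)) * cis (u * blocks B N (drop B w))" for w
    by (simp add: bs cis_mult distrib_left)
  moreover have "Suc N * B + l = B + (N * B + l)" by simp
  ultimately show ?case by (simp only: Suc power_Suc mult.assoc)
qed

text \<open>The blocks cover only a fraction \<alpha> < 1 of the word, since the other letters have
  to supply the power of \<open>psi\<close> in \<open>FI_limit\<close>. Block sums and letter sum
  become independent Gaussians, and the factor of the letter sum cancels against P(S_n = n -
  1).\<close>

lemma blocks_limit:
  assumes B: "1 \<le> B" and \<alpha>: "0 \<le> \<alpha>" "\<alpha> < 1"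
  defines "N \<equiv> \<lambda>n. nat \<lfloor>\<alpha> / real B * real n\<rfloor>"
  shows "((\<lambda>n. CEc n (\<lambda>w. cis (u * blocks B (N n) w / sqrt (real n))) / of_real (PS n (n - 1)))
    \<longlongrightarrow> of_real (exp (- \<alpha> * u\<^sup>2 * (EW B (\<lambda>x. (U B x)\<^sup>2) / real B) / 2))) gseq"
proof -
  define v where "v = EW B (\<lambda>x. (U B x)\<^sup>2)"
  define c where "c = exp (- \<alpha> * u\<^sup>2 * (v / real B) / 2)"
  have Nl: "(\<lambda>n. real (N n) / real n) \<longlonglongrightarrow> \<alpha> / real B" unfolding N_def using \<alpha> by (intro floor_ratio_tendsto) simp
  have NB: "N n * B \<le> n" for n
  proof -
    have "real (N n) \<le> \<alpha> / real B * real n" unfolding N_def using \<alpha> by simp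
    then have "real (N n) * real B \<le> \<alpha> * real n" using B by (simp add: field_simps)
    also have "\<dots> \<le> 1 * real n" using \<alpha> by (intro mult_right_mono) auto
    finally have "real (N n * B) \<le> real n" by simp
    then show ?thesis by (simp only: of_nat_le_iff)
  qed
  define X where "X n x = cis (u / sqrt (real n) * U B x)" for n x
  define \<Phi> where "\<Phi> n t = EW B (\<lambda>x. X n x * cis (t * (real (sum_list x) - real B)))" for n t
  define A where "A n t = \<Phi> n t ^ N n * cis t" for n t
  have m\<Phi>: "\<Phi> n \<in> borel_measurable borel" for n
    using measurable_expectation_cis[of "W B" "X n" "\<lambda>x. real (sum_list x) - real B"] by (simp add: \<Phi>_def[abs_def])
  define A' where "A' s = complex_of_real (exp (- (\<alpha> / real B) * (u\<^sup>2 * v + s\<^sup>2 * (real B * s2)) / 2))" for s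
  have "(\<lambda>n. sqrt (real n) * FI (\<lambda>t. A n t * psi t ^ (n - N n * B))) \<longlonglongrightarrow>
     of_real (real span / (2 * pi)) * (LINT s|lborel. A' s * complex_of_real (exp (- (1 - \<alpha>) * s2 * s\<^sup>2 / 2)))"
  proof (rule FI_limit)
    show "A n \<in> borel_measurable borel" for n unfolding A_def[abs_def] using m\<Phi>[of n] by measurable
    show "A' \<in> borel_measurable borel" unfolding A'_def[abs_def] by measurable
    show "norm (A n t) \<le> 1 * (1 + real n * t\<^sup>2)" for n t
    proof -
      have "norm (\<Phi> n t) \<le> 1" unfolding \<Phi>_def X_def cis_mult by (rule norm_expectation_cis_le)
      then have "norm (A n t) \<le> 1" by (simp add: A_def norm_mult norm_power power_le_one)
      also have "\<dots> \<le> 1 * (1 + real n * t\<^sup>2)" by simp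
      finally show ?thesis .
    qed
    show "(\<lambda>n. A n (s / sqrt (real n))) \<longlonglongrightarrow> A' s" for s
    proof -
      \<comment> \<open>A linear combination of block sum and letter sum; by
        \<open>U_uncorrelated\<close> its variance has no mixed term.\<close>
      define h where "h x = u * U B x + s * (real (sum_list x) - real B)" for x
      have ih: "integrable_W B (\<lambda>x. u * U B x)" "integrable_W B (\<lambda>x. s * (real (sum_list x) - real B))"
        by (intro integrable_mult_right U_integrable word_sum_integrable)+
      have Eh: "EW B h = 0"
      proof -
        have "EW B h = EW B (\<lambda>x. u * U B x) + EW B (\<lambda>x. s * (real (sum_list x) - real B))"
          unfolding h_def by (rule Bochner_Integration.integral_add[OF ih])
        also have "\<dots> = u * EW B (U B) + s * EW B (\<lambda>x. real (sum_list x) - real B)"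
          by (simp only: integral_mult_right_zero)
        finally show ?thesis by (simp only: U_expectation word_sum_moments(1) mult_zero_right add_0_right)
      qed
      have h2: "(h x)\<^sup>2 = u\<^sup>2 * (U B x)\<^sup>2 + 2 * u * s * (U B x * (real (sum_list x) - real B)) + s\<^sup>2 * (real (sum_list x) - real B)\<^sup>2" for x
        unfolding h_def by (simp add: power2_eq_square algebra_simps)
      have i3: "integrable_W B (\<lambda>x. u\<^sup>2 * (U B x)\<^sup>2)"
        "integrable_W B (\<lambda>x. 2 * u * s * (U B x * (real (sum_list x) - real B)))"
        "integrable_W B (\<lambda>x. s\<^sup>2 * (real (sum_list x) - real B)\<^sup>2)"
        by (intro integrable_mult_right U_square_integrable word_sum_square_integrable integrable_mult_squares)+
      have ih2: "integrable_W B (\<lambda>x. (h x)\<^sup>2)"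
        unfolding h2 by (intro Bochner_Integration.integrable_add i3)
      have Eh2: "EW B (\<lambda>x. (h x)\<^sup>2) = u\<^sup>2 * v + s\<^sup>2 * (real B * s2)"
        unfolding h2 v_def
        by (subst Bochner_Integration.integral_add[OF Bochner_Integration.integrable_add[OF i3(1,2)] i3(3)],
            subst Bochner_Integration.integral_add[OF i3(1,2)])
          (simp only: integral_mult_right_zero U_uncorrelated word_sum_moments mult_zero_right add_0_right)
      have "(\<lambda>n. EW B (\<lambda>x. cis (h x / sqrt (real n))) ^ N n) \<longlonglongrightarrow> A' s"
        using char_power_tendsto[OF ih2 Eh Nl] unfolding Eh2 A'_def .
      moreover have "EW B (\<lambda>x. cis (h x / sqrt (real n))) = \<Phi> n (s / sqrt (real n))" for n
        unfolding \<Phi>_def X_def cis_mult h_def by (simp add: add_divide_distrib)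
      moreover have "(\<lambda>n. cis (s / sqrt (real n))) \<longlonglongrightarrow> cis 0"
      proof -
        have "(\<lambda>n. s / sqrt (real n)) \<longlonglongrightarrow> 0" by real_asymp
        then show ?thesis by (intro tendsto_intros)
      qed
      ultimately have "(\<lambda>n. \<Phi> n (s / sqrt (real n)) ^ N n * cis (s / sqrt (real n))) \<longlonglongrightarrow> A' s * cis 0"
        by (intro tendsto_mult) simp_all
      then show ?thesis by (simp add: A_def)
    qed
    show "(\<lambda>n. real (n - N n * B) / real n) \<longlonglongrightarrow> 1 - \<alpha>"
    proof -
      have "(\<lambda>n. 1 - real (N n) / real n * real B) \<longlonglongrightarrow> 1 - \<alpha> / real B * real B" by (intro tendsto_intros Nl)
      then have "(\<lambda>n. 1 - real (N n) / real n * real B) \<longlonglongrightarrow> 1 - \<alpha>" using B by simp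
      then show ?thesis
      proof (rule Lim_transform_eventually, intro eventually_sequentiallyI[of 1])
        fix n :: nat assume "1 \<le> n"
        then show "1 - real (N n) / real n * real B = real (n - N n * B) / real n"
          using NB[of n] by (simp add: of_nat_diff diff_divide_distrib)
      qed
    qed
    show "0 < 1 - \<alpha>" using \<alpha> by simp
  qed
  \<comment> \<open>The letter sum takes the share \<alpha> of its variance from the blocks and the
    share 1 - \<alpha> from the rest, so its exponent is free of \<alpha>.\<close>
  moreover have "A' s * complex_of_real (exp (- (1 - \<alpha>) * s2 * s\<^sup>2 / 2)) = complex_of_real c * complex_of_real (exp (- 1 * s2 * s\<^sup>2 / 2))" for s
  proof -
    have "- (\<alpha> / real B) * (u\<^sup>2 * v + s\<^sup>2 * (real B * s2)) / 2 + - (1 - \<alpha>) * s2 * s\<^sup>2 / 2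
        = - \<alpha> * u\<^sup>2 * (v / real B) / 2 + - 1 * s2 * s\<^sup>2 / 2"
      using B by (simp add: field_simps)
    then have "exp (- (\<alpha> / real B) * (u\<^sup>2 * v + s\<^sup>2 * (real B * s2)) / 2) * exp (- (1 - \<alpha>) * s2 * s\<^sup>2 / 2)
        = c * exp (- 1 * s2 * s\<^sup>2 / 2)" unfolding c_def exp_add[symmetric] by (simp only:)
    then show ?thesis unfolding A'_def of_real_mult[symmetric] by (simp only:)
  qed
  ultimately have "((\<lambda>n. sqrt (real n) * FI (\<lambda>t. A n t * psi t ^ (n - N n * B))) \<longlongrightarrow> of_real (c * \<kappa>)) gseq"
    using tendsto_mono[OF gseq_le] by (simp only: gauss_complex of_real_mult)
  moreover have "((\<lambda>n. complex_of_real (sqrt (real n) * PS n (n - 1))) \<longlongrightarrow> of_real \<kappa>) gseq"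
    by (rule tendsto_of_real[OF PS_tendsto])
  ultimately have "((\<lambda>n. sqrt (real n) * FI (\<lambda>t. A n t * psi t ^ (n - N n * B)) / complex_of_real (sqrt (real n) * PS n (n - 1)))
      \<longlongrightarrow> of_real (c * \<kappa>) / of_real \<kappa>) gseq"
    using \<kappa>_pos by (intro tendsto_divide) auto
  then have "((\<lambda>n. sqrt (real n) * FI (\<lambda>t. A n t * psi t ^ (n - N n * B)) / complex_of_real (sqrt (real n) * PS n (n - 1))) \<longlongrightarrow> of_real c) gseq"
    using \<kappa>_pos by simp
  then have "((\<lambda>n. CEc n (\<lambda>w. cis (u * blocks B (N n) w / sqrt (real n))) / of_real (PS n (n - 1))) \<longlongrightarrow> of_real c) gseq"
  proof (rule Lim_transform_eventually)
    show "\<forall>\<^sub>F n in gseq. sqrt (real n) * FI (\<lambda>t. A n t * psi t ^ (n - N n * B)) / complex_of_real (sqrt (real n) * PS n (n - 1))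
        = CEc n (\<lambda>w. cis (u * blocks B (N n) w / sqrt (real n))) / of_real (PS n (n - 1))"
      using eventually_large[of 1]
    proof eventually_elim
      case (elim n)
      define l where "l = n - N n * B"
      have n: "n = N n * B + l" using NB[of n] by (simp add: l_def)
      have "CEc n (\<lambda>w. cis (u * blocks B (N n) w / sqrt (real n)))
          = FI (\<lambda>t. EW n (\<lambda>w. cis (u * blocks B (N n) w / sqrt (real n)) * cis (t * (real (sum_list w) - real n))) * cis t)"
        using elim by (intro CEc_FI measure_pmf.integrable_const_bound[of _ 1]) auto
      also have "\<dots> = FI (\<lambda>t. A n t * psi t ^ l)"
      proof -
        have "EW n (\<lambda>w. cis (u * blocks B (N n) w / sqrt (real n)) * cis (t * (real (sum_list w) - real n))) * cis t = A n t * psi t ^ l" for t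
          using blocks_char[of "N n" B l "u / sqrt (real n)" t] unfolding n[symmetric]
          by (simp add: A_def \<Phi>_def X_def)
        then show ?thesis by simp
      qed
      finally show ?case using elim by (simp add: l_def)
    qed
  qed
  then show ?thesis by (simp only: c_def v_def)
qed

text \<open>The set \<open>I\<close> holds the positions left over: windows that cross the end of a
  block or begin behind the last block.\<close>

lemma blocks_rotate:
  assumes w: "length w = n" and NB: "N * B \<le> n" and B: "K \<le> B"
  shows "\<exists>I\<subseteq>{..<n}. card I = n - N * (B + 1 - K) \<and>
    (\<forall>w. length w = n \<longrightarrow> (\<Sum>i<n. g (rotate i w)) - blocks B N w = (\<Sum>i\<in>I. g (rotate i w)))"
proof -
  let ?P = "{..<N} \<times> {..<B + 1 - K}"
  define J where "J = (\<lambda>(b, r). b * B + r) ` ?P"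
  have inj: "inj_on (\<lambda>(b, r). b * B + r) ?P"
  proof (rule inj_onI)
    fix x y assume xy: "x \<in> ?P" "y \<in> ?P" "(\<lambda>(b, r). b * B + r) x = (\<lambda>(b, r). b * B + r) y"
    obtain b r b' r' where x: "x = (b, r)" and y: "y = (b', r')" by (cases x, cases y) auto
    have a: "r < B + 1 - K" "r' < B + 1 - K" "b * B + r = b' * B + r'" using xy by (auto simp: x y)
    then have rB: "r < B" "r' < B" using K1 by auto
    have "b = (b * B + r) div B" "r = (b * B + r) mod B" using rB by auto
    moreover have "b' = (b' * B + r') div B" "r' = (b' * B + r') mod B" using rB by auto
    ultimately show "x = y" using a(3) by (metis x y)
  qed
  have lt: "b * B + r + K \<le> n" if "b < N" "r < B + 1 - K" for b r
  proof -
    have "Suc b * B \<le> N * B" using that by (intro mult_le_mono1) simp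
    then show ?thesis using that NB B by simp
  qed
  have J: "J \<subseteq> {..<n}" using lt K1 by (force simp: J_def)
  have cJ: "card J = N * (B + 1 - K)" unfolding J_def using card_image[OF inj] by simp
  show ?thesis
  proof (intro exI[of _ "{..<n} - J"] conjI allI impI)
    show "card ({..<n} - J) = n - N * (B + 1 - K)" using J cJ by (simp add: card_Diff_subset finite_subset)
    fix w :: "nat list" assume w: "length w = n"
    have "blocks B N w = (\<Sum>b<N. \<Sum>r<B + 1 - K. g (rotate (b * B + r) w))"
      unfolding blocks_def U_def
    proof (intro sum.cong refl)
      fix b r assume "b \<in> {..<N}" "r \<in> {..<B + 1 - K}"
      then have br: "b < N" "r < B + 1 - K" by auto
      have "g (drop r (take B (drop (b * B) w))) = g (take (B - r) (drop (b * B + r) w))"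
        by (simp add: drop_take add.commute)
      also have "\<dots> = g (drop (b * B + r) w)" using br lt[OF br] w B by (intro dep_take) auto
      also have "\<dots> = g (rotate (b * B + r) w)" using lt[OF br] w by (intro g_rotate[symmetric]) simp
      finally show "g (drop r (take B (drop (b * B) w))) = g (rotate (b * B + r) w)" .
    qed
    also have "\<dots> = (\<Sum>i\<in>J. g (rotate i w))"
      unfolding J_def by (subst sum.reindex[OF inj]) (simp add: sum.cartesian_product case_prod_unfold o_def)
    finally have "blocks B N w = (\<Sum>i\<in>J. g (rotate i w))" .
    then show "(\<Sum>i<n. g (rotate i w)) - blocks B N w = (\<Sum>i\<in>{..<n} - J. g (rotate i w))"
      using J by (simp add: sum_diff)
  qed auto
qed

text \<open>Cauchy-Schwarz in the form 2 \<eta> |z| \<le> \<eta>^2 + z^2, with \<eta> left free for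
  balancing.\<close>

lemma CE_abs_le:
  assumes "0 < \<eta>"
  shows "CE n (\<lambda>w. \<bar>Z w\<bar>) \<le> (\<eta> * PS n (n - 1) + CE n (\<lambda>w. (Z w)\<^sup>2) / \<eta>) / 2"
proof -
  have "\<bar>z\<bar> \<le> \<eta> / 2 * 1 + 1 / (2 * \<eta>) * z\<^sup>2" for z
  proof -
    have "2 * \<eta> * \<bar>z\<bar> \<le> \<eta>\<^sup>2 + z\<^sup>2" using zero_le_power2[of "\<eta> - \<bar>z\<bar>"] by (simp add: power2_diff)
    then have "2 * \<eta> * \<bar>z\<bar> / (2 * \<eta>) \<le> (\<eta>\<^sup>2 + z\<^sup>2) / (2 * \<eta>)" using assms by (intro divide_right_mono) auto
    then show ?thesis using assms by (simp add: add_divide_distrib power2_eq_square)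
  qed
  then have "CE n (\<lambda>w. \<bar>Z w\<bar>) \<le> CE n (\<lambda>w. \<eta> / 2 * 1 + 1 / (2 * \<eta>) * (Z w)\<^sup>2)" by (intro CE_mono)
  also have "\<dots> = \<eta> / 2 * PS n (n - 1) + 1 / (2 * \<eta>) * CE n (\<lambda>w. (Z w)\<^sup>2)" by (simp only: CE_add CE_cmult CE_one)
  finally show ?thesis by (simp add: add_divide_distrib)
qed

lemma CEc_cis_diff: "norm (CEc n (\<lambda>w. cis (a w)) - CEc n (\<lambda>w. cis (b w))) \<le> CE n (\<lambda>w. \<bar>a w - b w\<bar>)"
proof -
  have "CEc n (\<lambda>w. cis (a w)) - CEc n (\<lambda>w. cis (b w)) = (\<Sum>w\<in>words n (n - 1). of_real (pmf (W n) w) * (cis (a w) - cis (b w)))"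
    by (simp add: CEc_def sum_subtractf right_diff_distrib)
  also have "norm \<dots> \<le> CE n (\<lambda>w. \<bar>a w - b w\<bar>)" unfolding CE_def
    by (rule order_trans[OF norm_sum]) (auto simp: norm_mult intro!: sum_mono mult_left_mono norm_cis_diff_le)
  finally show ?thesis .
qed

text \<open>The block length B is fixed while n grows, and grows afterwards. The positions outside
  the blocks form a fraction of order 1 / B, so by \<open>CE_square_le\<close> they change the
  characteristic function by O(B^(-1/2)) for all large n.\<close>

theorem window_clt:
  "((\<lambda>n. CEc n (\<lambda>w. cis (u * (\<Sum>i<n. g (rotate i w)) / sqrt (real n))) / of_real (PS n (n - 1)))
    \<longlongrightarrow> of_real (exp (- u\<^sup>2 * \<gamma> / 2))) gseq"
proof -
  obtain C where C: "0 < C" "\<forall>\<^sub>F n in gseq. \<forall>I\<subseteq>{..<n}. CE n (\<lambda>w. (\<Sum>i\<in>I. g (rotate i w))\<^sup>2) \<le> C * real (card I) * PS n (n - 1)"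
    using CE_square_le by blast
  obtain c where c: "0 < c" "\<forall>\<^sub>F n in gseq. c / sqrt (real n) \<le> PS n (n - 1)" using PS_good_lower by blast
  define \<alpha> where "\<alpha> B = 1 - 1 / real B" for B :: nat
  define N where "N B n = nat \<lfloor>\<alpha> B / real B * real n\<rfloor>" for B n
  \<comment> \<open>Bound for the fraction of leftover positions. Of the K + 1 units, one stands for
    the uncovered end, K - 1 for windows across block ends, and one for rounding; the last uses n
    \<ge> B^2.\<close>
  define \<theta> where "\<theta> B = (real K + 1) / real B" for B :: nat
  have \<alpha>: "0 \<le> \<alpha> B" "\<alpha> B < 1" if "1 \<le> B" for B using that by (auto simp: \<alpha>_def)
  show ?thesis
  proof (rule tendsto_approx_family[where ?B0.0 = K and e = "\<lambda>B. \<bar>u\<bar> * (sqrt (\<theta> B) * (1 + C)) / 2"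
        and b = "\<lambda>B n. CEc n (\<lambda>w. cis (u * blocks B (N B n) w / sqrt (real n))) / of_real (PS n (n - 1))"
        and l = "\<lambda>B. of_real (exp (- \<alpha> B * u\<^sup>2 * (EW B (\<lambda>x. (U B x)\<^sup>2) / real B) / 2))"])
    fix B assume B: "K \<le> B"
    then have B1: "1 \<le> B" using K1 by simp
    show "((\<lambda>n. CEc n (\<lambda>w. cis (u * blocks B (N B n) w / sqrt (real n))) / of_real (PS n (n - 1)))
        \<longlongrightarrow> of_real (exp (- \<alpha> B * u\<^sup>2 * (EW B (\<lambda>x. (U B x)\<^sup>2) / real B) / 2))) gseq"
      unfolding N_def by (rule blocks_limit[OF B1 \<alpha>[OF B1]])
    have \<theta>: "0 < \<theta> B" using B1 by (simp add: \<theta>_def)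
    show "\<forall>\<^sub>F n in gseq. norm (CEc n (\<lambda>w. cis (u * (\<Sum>i<n. g (rotate i w)) / sqrt (real n))) / of_real (PS n (n - 1))
        - CEc n (\<lambda>w. cis (u * blocks B (N B n) w / sqrt (real n))) / of_real (PS n (n - 1))) \<le> \<bar>u\<bar> * (sqrt (\<theta> B) * (1 + C)) / 2"
      using C(2) c(2) eventually_large[of "B * B"]
    proof eventually_elim
      case (elim n)
      have n1: "1 \<le> n" using elim(3) B1 by (metis le_trans mult_le_mono nat_mult_1)
      then have sn: "0 < sqrt (real n)" by simp
      have PSp: "0 < PS n (n - 1)" using elim(2) c(1) sn by (meson divide_pos_pos less_le_trans)
      have Nle: "real (N B n) \<le> \<alpha> B / real B * real n" unfolding N_def using \<alpha>[OF B1] by simp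
      have Nge: "\<alpha> B / real B * real n - 1 \<le> real (N B n)" unfolding N_def by linarith
      have NB: "N B n * B \<le> n"
      proof -
        have "real (N B n) * real B \<le> \<alpha> B * real n" using Nle B1 by (simp add: field_simps)
        also have "\<dots> \<le> 1 * real n" using \<alpha>[OF B1] by (intro mult_right_mono) auto
        finally have "real (N B n * B) \<le> real n" by simp
        then show ?thesis by (simp only: of_nat_le_iff)
      qed
      obtain I where I: "I \<subseteq> {..<n}" "card I = n - N B n * (B + 1 - K)"
        "\<And>w. length w = n \<Longrightarrow> (\<Sum>i<n. g (rotate i w)) - blocks B (N B n) w = (\<Sum>i\<in>I. g (rotate i w))"
        using blocks_rotate[of "replicate n 0" n "N B n" B, OF _ NB B] by auto
      have cI: "real (card I) \<le> \<theta> B * real n"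
      proof -
        define k where "k = real (B + 1 - K)"
        have k: "k = real B + 1 - real K" "0 \<le> k" "k \<le> real B" using B K1 by (auto simp: k_def of_nat_diff)
        have "N B n * (B + 1 - K) \<le> N B n * B" using K1 by (intro mult_le_mono2) simp
        with NB have "N B n * (B + 1 - K) \<le> n" by linarith
        then have "real (card I) = real n - real (N B n) * k" unfolding I(2) k_def by (simp only: of_nat_diff of_nat_mult)
        also have "\<dots> \<le> real n - (\<alpha> B / real B * real n - 1) * k" using Nge k(2) by (intro diff_left_mono mult_right_mono)
        also have "\<dots> = real n * (1 - \<alpha> B * (k / real B)) + k" by (simp add: algebra_simps)
        also have "\<dots> \<le> real n * (real K / real B) + real B"
        proof (intro add_mono mult_left_mono k(3))
          have "k / real B = 1 - (real K - 1) / real B" using k(1) B1 by (simp add: field_simps)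
          moreover have "0 \<le> 1 / real B * ((real K - 1) / real B)" using K1 by (intro mult_nonneg_nonneg) auto
          ultimately have "1 - 1 / real B - (real K - 1) / real B \<le> \<alpha> B * (k / real B)"
          proof -
            assume x: "k / real B = 1 - (real K - 1) / real B" "0 \<le> 1 / real B * ((real K - 1) / real B)"
            have "(1 - y) * (1 - z) = 1 - y - z + y * z" for y z :: real by algebra
            then show ?thesis using x by (simp only: \<alpha>_def)
          qed
          then show "1 - \<alpha> B * (k / real B) \<le> real K / real B" by (simp add: diff_divide_distrib)
        qed simp
        also have "\<dots> \<le> real n * (real K / real B) + real n * (1 / real B)"
        proof (rule add_left_mono)
          have "real B * real B \<le> real n" using elim(3) by (metis of_nat_le_iff of_nat_mult)
          then show "real B \<le> real n * (1 / real B)" using B1 by (simp add: pos_le_divide_eq)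
        qed
        also have "\<dots> = \<theta> B * real n" unfolding \<theta>_def by (simp add: add_divide_distrib distrib_left distrib_right mult.commute)
        finally show ?thesis .
      qed
      let ?Y = "\<lambda>w. \<Sum>i<n. g (rotate i w)"
      \<comment> \<open>This value balances the two terms of \<open>CE_abs_le\<close>.\<close>
      define \<eta> where "\<eta> = sqrt (real n) * sqrt (\<theta> B)"
      have \<eta>: "0 < \<eta>" using sn \<theta> by (simp add: \<eta>_def)
      have "norm (CEc n (\<lambda>w. cis (u * ?Y w / sqrt (real n))) - CEc n (\<lambda>w. cis (u * blocks B (N B n) w / sqrt (real n))))
          \<le> CE n (\<lambda>w. \<bar>u * ?Y w / sqrt (real n) - u * blocks B (N B n) w / sqrt (real n)\<bar>)"
        by (rule CEc_cis_diff)
      also have "\<dots> = CE n (\<lambda>w. \<bar>u\<bar> / sqrt (real n) * \<bar>\<Sum>i\<in>I. g (rotate i w)\<bar>)"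
      proof (rule CE_cong)
        fix w :: "nat list" assume "length w = n"
        have "u * ?Y w / sqrt (real n) - u * blocks B (N B n) w / sqrt (real n) = u / sqrt (real n) * (?Y w - blocks B (N B n) w)"
          by (simp add: right_diff_distrib)
        then show "\<bar>u * ?Y w / sqrt (real n) - u * blocks B (N B n) w / sqrt (real n)\<bar> = \<bar>u\<bar> / sqrt (real n) * \<bar>\<Sum>i\<in>I. g (rotate i w)\<bar>"
          using I(3)[OF \<open>length w = n\<close>] sn by (simp add: abs_mult)
      qed
      also have "\<dots> = \<bar>u\<bar> / sqrt (real n) * CE n (\<lambda>w. \<bar>\<Sum>i\<in>I. g (rotate i w)\<bar>)" by (rule CE_cmult)
      also have "\<dots> \<le> \<bar>u\<bar> / sqrt (real n) * ((\<eta> * PS n (n - 1) + CE n (\<lambda>w. (\<Sum>i\<in>I. g (rotate i w))\<^sup>2) / \<eta>) / 2)"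
        by (intro mult_left_mono CE_abs_le \<eta>) auto
      also have "\<dots> \<le> \<bar>u\<bar> / sqrt (real n) * ((\<eta> * PS n (n - 1) + C * (\<theta> B * real n) * PS n (n - 1) / \<eta>) / 2)"
      proof -
        have "CE n (\<lambda>w. (\<Sum>i\<in>I. g (rotate i w))\<^sup>2) \<le> C * real (card I) * PS n (n - 1)" using elim(1) I(1) by blast
        also have "\<dots> \<le> C * (\<theta> B * real n) * PS n (n - 1)" using cI C(1) PSp by (intro mult_right_mono mult_left_mono) auto
        finally show ?thesis using \<eta> by (intro mult_left_mono divide_right_mono add_left_mono) auto
      qed
      also have "\<dots> = \<bar>u\<bar> * (sqrt (\<theta> B) * (1 + C)) / 2 * PS n (n - 1)"
      proof -
        have "a / r * ((r * q * P + C * (q * q * (r * r)) * P / (r * q)) / 2) = a * (q * (1 + C)) / 2 * P"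
          if "0 < r" "0 < q" for a r q P :: real using that by (simp add: field_simps)
        from this[of "sqrt (real n)" "sqrt (\<theta> B)" "\<bar>u\<bar>" "PS n (n - 1)"] sn \<theta> show ?thesis
          unfolding \<eta>_def by (simp add: mult_ac)
      qed
      finally show ?case using PSp
        by (simp only: diff_divide_distrib[symmetric] norm_divide norm_of_real abs_of_pos pos_divide_le_eq)
    qed
  next
    have "(\<lambda>B. \<theta> B) \<longlonglongrightarrow> 0" unfolding \<theta>_def by real_asymp
    then have "(\<lambda>B. \<bar>u\<bar> * (sqrt (\<theta> B) * (1 + C)) / 2) \<longlonglongrightarrow> \<bar>u\<bar> * (sqrt 0 * (1 + C)) / 2" by (intro tendsto_intros) auto
    then show "(\<lambda>B. \<bar>u\<bar> * (sqrt (\<theta> B) * (1 + C)) / 2) \<longlonglongrightarrow> 0" by simp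
    have "(\<lambda>B. \<alpha> B) \<longlonglongrightarrow> 1" unfolding \<alpha>_def by real_asymp
    then have "(\<lambda>B. complex_of_real (exp (- \<alpha> B * u\<^sup>2 * (EW B (\<lambda>x. (U B x)\<^sup>2) / real B) / 2))) \<longlonglongrightarrow> of_real (exp (- 1 * u\<^sup>2 * \<gamma> / 2))"
      by (intro tendsto_intros U_variance_limit) auto
    then show "(\<lambda>B. complex_of_real (exp (- \<alpha> B * u\<^sup>2 * (EW B (\<lambda>x. (U B x)\<^sup>2) / real B) / 2))) \<longlonglongrightarrow> of_real (exp (- u\<^sup>2 * \<gamma> / 2))"
      by simp
  qed
qed

end

section \<open>The cycle lemma\<close>

text \<open>The walk with 1 subtracted from each letter stays nonnegative until the last letter. The
  induction needs the strict form for a list of r subtrees, where the walk stays above -r before the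
  end.\<close>

lemma code_proper_prefix: "code T = a @ b \<Longrightarrow> b \<noteq> [] \<Longrightarrow> length a \<le> sum_list a"
proof (induction T arbitrary: a b)
  case (Node ts)
  have forest: "length a < sum_list a + length us"
    if "concat (map code us) = a @ b" "b \<noteq> []" "set us \<subseteq> set ts" for us a b
    using that
  proof (induction us arbitrary: a)
    case Nil
    then show ?case by simp
  next
    case (Cons t us)
    have len: "length (code t) = Suc (sum_list (code t))" by (simp add: length_code sum_code)
    have "code t @ concat (map code us) = a @ b" using Cons.prems(1) by simp
    then consider c where "a = code t @ c" "concat (map code us) = c @ b"
      | c where "code t = a @ c" "c @ concat (map code us) = b" "c \<noteq> []"
      unfolding append_eq_append_conv2 by (metis append_Nil append_Nil2)
    then show ?case
    proof cases
      case 1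
      then show ?thesis using Cons.IH[of c] Cons.prems len by simp
    next
      case 2
      then show ?thesis using Node.IH[of t a c] Cons.prems by simp
    qed
  qed
  show ?case
  proof (cases a)
    case (Cons d a')
    then have "d = length ts" "concat (map code ts) = a' @ b" using Node.prems(1) by auto
    then show ?thesis using forest[of ts a' b] Node.prems(2) Cons by simp
  qed simp
qed

text \<open>If a code a b and its nontrivial rotation b a were both codes, then a and b would both
  be proper prefixes of codes, and neither would have more letters than its sum. But the whole code
  has one letter more than its sum.\<close>

lemma rotate_code_inj:
  assumes "i < n" "j < n" "T \<in> trees n" "T' \<in> trees n" "rotate i (code T) = rotate j (code T')"
  shows "i = j \<and> T = T'"
proof -
  have main: "i = j \<and> T = T'" if ij: "i \<le> j" "j < n" and T: "T \<in> trees n" "T' \<in> trees n"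
    and eq: "rotate i (code T) = rotate j (code T')" for i j T T'
  proof -
    have l: "length (code T) = n" "length (code T') = n" using T by (simp_all add: length_code trees_def)
    have "rotate (n - i) (rotate i (code T)) = rotate (n - i) (rotate j (code T'))" using eq by simp
    then have "rotate n (code T) = rotate (n + (j - i)) (code T')" using ij by (simp add: rotate_rotate)
    then have r: "code T = rotate (j - i) (code T')"
      using l by (metis rotate_id mod_self rotate_rotate add.commute)
    have "j - i = 0"
    proof (rule ccontr)
      assume k: "j - i \<noteq> 0"
      define a b where "a = take (j - i) (code T')" and "b = drop (j - i) (code T')"
      have ab: "code T' = a @ b" "a \<noteq> []" "b \<noteq> []" using k ij l by (auto simp: a_def b_def)
      have "code T = b @ a" unfolding r rotate_drop_take a_def b_def using ij l by simp
      from code_proper_prefix[OF this ab(2)] code_proper_prefix[OF ab(1,3)]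
      have "length (code T') \<le> sum_list (code T')" by (simp add: ab(1))
      then show False using sum_code[of T'] by (simp add: length_code)
    qed
    then show ?thesis using r ij inj_code by (auto dest: injD)
  qed
  show ?thesis
  proof (cases "i \<le> j")
    case True
    then show ?thesis by (rule main[OF _ assms(2-5)])
  next
    case False
    then have "j \<le> i" by simp
    from main[OF this assms(1) assms(4,3) assms(5)[symmetric]] show ?thesis by simp
  qed
qed

lemma pmf_replicate: "length w = n \<Longrightarrow> pmf (replicate_pmf n q) w = (\<Prod>x\<leftarrow>w. pmf q x)"
proof (induction n arbitrary: w)
  case (Suc n)
  then obtain x v where w: "w = x # v" "length v = n" by (cases w) auto
  have "replicate_pmf (Suc n) q = map_pmf (\<lambda>(x, v). x # v) (pair_pmf q (replicate_pmf n q))"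
    by (simp add: pair_pmf_def map_bind_pmf)
  moreover have "inj_on (\<lambda>(x, v). x # v) UNIV" by (auto intro: inj_onI)
  ultimately have "pmf (replicate_pmf (Suc n) q) w = pmf (pair_pmf q (replicate_pmf n q)) (x, v)"
    using pmf_map_inj'[of "\<lambda>(x, v). x # v" "pair_pmf q (replicate_pmf n q)" "(x, v)"] by (simp add: w)
  then show ?case using Suc.IH[OF w(2)] by (simp add: w pmf_pair)
qed simp

section \<open>Sums over the rotations of a code\<close>

lemma sum_lessThan_add: "(\<Sum>i<a + b. h i) = (\<Sum>i<a. h i) + (\<Sum>i<b. h (a + i))" for h :: "nat \<Rightarrow> 'b :: comm_monoid_add"
  by (induction b) (simp_all add: add.assoc)

text \<open>The suffix of a code that starts at a node begins with the code of the fringe subtree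
  there, which is all that \<open>\<Phi>\<close> reads. The tails \<open>y i\<close> are arbitrary
  and may vary with i; they later hold the part wrapped around by a rotation.\<close>

lemma sum_drop_code:
  fixes f :: "ptree \<Rightarrow> real"
  assumes \<Phi>: "\<And>T z. \<Phi> (code T @ z) = f T"
  shows "(\<Sum>i<tree_order T. \<Phi> (drop i (code T) @ y i)) = additive_functional f T"
proof (induction T arbitrary: y)
  case (Node ts)
  let ?C = "\<lambda>us. concat (map code us)"
  have forest: "(\<Sum>i<length (?C us). \<Phi> (drop i (?C us) @ y i)) = (\<Sum>t\<leftarrow>us. additive_functional f t)"
    if "set us \<subseteq> set ts" for us y
    using that
  proof (induction us arbitrary: y)
    case (Cons t us)
    let ?n = "length (code t)"
    have "(\<Sum>i<length (?C (t # us)). \<Phi> (drop i (?C (t # us)) @ y i))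
        = (\<Sum>i<?n. \<Phi> (drop i (?C (t # us)) @ y i)) + (\<Sum>i<length (?C us). \<Phi> (drop (?n + i) (?C (t # us)) @ y (?n + i)))"
      by (simp only: list.map concat.simps length_append sum_lessThan_add)
    also have "(\<Sum>i<?n. \<Phi> (drop i (?C (t # us)) @ y i)) = (\<Sum>i<tree_order t. \<Phi> (drop i (code t) @ (?C us @ y i)))"
      unfolding length_code[symmetric] by (intro sum.cong) auto
    also have "\<dots> = additive_functional f t" using Cons.prems by (intro Node.IH) simp
    also have "(\<Sum>i<length (?C us). \<Phi> (drop (?n + i) (?C (t # us)) @ y (?n + i))) = (\<Sum>t\<leftarrow>us. additive_functional f t)"
      using Cons.IH[of "\<lambda>i. y (?n + i)"] Cons.prems by simp
    finally show ?case by simp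
  qed simp
  have "tree_order (Node ts) = Suc (length (?C ts))" using length_code[of "Node ts"] by simp
  then have "(\<Sum>i<tree_order (Node ts). \<Phi> (drop i (code (Node ts)) @ y i))
      = \<Phi> (code (Node ts) @ y 0) + (\<Sum>i<length (?C ts). \<Phi> (drop i (?C ts) @ y (Suc i)))"
    by (simp only: sum.lessThan_Suc_shift) simp
  also have "\<dots> = f (Node ts) + (\<Sum>t\<leftarrow>ts. additive_functional f t)"
    using forest[of ts "\<lambda>i. y (Suc i)"] by (simp only: \<Phi>)
  finally show ?case by (simp add: additive_functional_Node)
qed

lemma sum_rotate_code:
  fixes f :: "ptree \<Rightarrow> real"
  assumes "\<And>T z. \<Phi> (code T @ z) = f T"
  shows "(\<Sum>i<tree_order T. \<Phi> (rotate i (code T))) = additive_functional f T"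
proof -
  have "(\<Sum>i<tree_order T. \<Phi> (rotate i (code T))) = (\<Sum>i<tree_order T. \<Phi> (drop i (code T) @ take i (code T)))"
    by (intro sum.cong refl) (simp add: rotate_drop_take length_code)
  also have "\<dots> = additive_functional f T" by (rule sum_drop_code) (rule assms)
  finally show ?thesis .
qed

lemma additive_functional_add:
  "additive_functional (\<lambda>T. f T + h T) T = additive_functional f T + additive_functional h T"
  by (simp add: additive_functional_def sum.distrib)

lemma additive_functional_cmult: "additive_functional (\<lambda>T. c * f T) T = c * additive_functional f T"
  by (simp add: additive_functional_def sum_distrib_left)

lemma additive_functional_const: "additive_functional (\<lambda>_. c) T = c * real (tree_order T)"
  by (simp add: additive_functional_def tree_order_def)

text \<open>The number of edges minus the number of nodes.\<close>

lemma additive_functional_outdegree: "additive_functional (\<lambda>T. real (length (children T)) - 1) T = - 1"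
proof (induction T)
  case (Node ts)
  then have "(\<Sum>t\<leftarrow>ts. additive_functional (\<lambda>T. real (length (children T)) - 1) t) = (\<Sum>t\<leftarrow>ts. - 1)"
    by (intro arg_cong[of _ _ sum_list] map_cong) auto
  also have "\<dots> = - real (length ts)" by (simp add: sum_list_triv)
  finally show ?case by (simp add: additive_functional_Node)
qed

context critical_offspring
begin

lemma pmf_code: "tree_order T = n \<Longrightarrow> pmf (W n) (code T) = wt T"
proof -
  have "(\<Prod>x\<leftarrow>code T. p x) = wt T"
  proof (induction T)
    case (Node ts)
    then have 1: "map (\<lambda>t. \<Prod>x\<leftarrow>code t. p x) ts = map wt ts" by (intro map_cong) auto
    have 2: "(\<Prod>x\<leftarrow>concat (map code us). p x) = prod_list (map (\<lambda>t. \<Prod>x\<leftarrow>code t. p x) us)" for us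
      by (induction us) simp_all
    show ?case by (simp only: code.simps wt.simps list.map prod_list.Cons 2 1)
  qed
  then show "tree_order T = n \<Longrightarrow> pmf (W n) (code T) = wt T" by (simp add: pmf_replicate length_code)
qed

lemma pmf_rotate: "length w = n \<Longrightarrow> pmf (W n) (rotate i w) = pmf (W n) w"
proof -
  have "(\<Prod>x\<leftarrow>v. p x) = prod_mset (image_mset p (mset v))" for v by (metis mset_map prod_mset_prod_list)
  moreover have "mset (rotate i w) = mset w"
    unfolding rotate_drop_take mset_append by (metis add.commute append_take_drop_id mset_append)
  ultimately show "length w = n \<Longrightarrow> pmf (W n) (rotate i w) = pmf (W n) w" by (simp add: pmf_replicate)
qed

text \<open>Rotations of codes of trees are pairwise distinct, and by \<open>kemperman\<close> they carry the full weight
  of the words of length \<open>n\<close> and sum \<open>n - 1\<close>; so the other such words have weight \<open>0\<close>.\<close>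

lemma CE_cyclic:
  assumes n: "1 \<le> n" and H: "\<And>i w. length w = n \<Longrightarrow> H (rotate i w) = H w"
  shows "CE n H = real n * treesum (\<lambda>T. H (code T)) n"
proof -
  let ?S = "(\<lambda>(i, T). rotate i (code T)) ` ({..<n} \<times> trees n)"
  have inj: "inj_on (\<lambda>(i, T). rotate i (code T)) ({..<n} \<times> trees n)"
    using rotate_code_inj by (intro inj_onI) (auto; blast)
  have sub: "?S \<subseteq> words n (n - 1)"
    using code_trees by (auto simp: words_def sum_list_rotate)
  have S: "(\<Sum>w\<in>?S. pmf (W n) w * h w) = real n * treesum (\<lambda>T. h (code T)) n"
    if h: "\<And>i w. length w = n \<Longrightarrow> h (rotate i w) = h w" for h
  proof -
    have "(\<Sum>w\<in>?S. pmf (W n) w * h w) = (\<Sum>(i, T)\<in>{..<n} \<times> trees n. wt T * h (code T))"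
      unfolding sum.reindex[OF inj]
      by (intro sum.cong refl) (auto simp: pmf_rotate h trees_def length_code pmf_code)
    also have "\<dots> = (\<Sum>i<n. \<Sum>T\<in>trees n. wt T * h (code T))" by (rule sum.cartesian_product[symmetric])
    finally show ?thesis by (simp add: treesum_def)
  qed
  have "(\<Sum>w\<in>?S. pmf (W n) w) = real n * mass n" using S[of "\<lambda>_. 1"] by simp
  also have "\<dots> = (\<Sum>w\<in>words n (n - 1). pmf (W n) w)" using treesum_one[OF n] n CE_one[of n] by (simp add: CE_def)
  finally have "(\<Sum>w\<in>words n (n - 1) - ?S. pmf (W n) w) = 0" using sub by (simp add: sum_diff)
  then have z: "pmf (W n) w = 0" if "w \<in> words n (n - 1) - ?S" for w
    using that by (subst (asm) sum_nonneg_eq_0_iff) auto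
  have "CE n H = (\<Sum>w\<in>?S. pmf (W n) w * H w)"
    unfolding CE_def using z by (intro sum.mono_neutral_right sub) auto
  then show ?thesis using S[of H] H by simp
qed

text \<open>The letters behind the first m are independent of them and centred, so they add nothing
  to the correlation.\<close>

lemma expectation_take_sum:
  assumes v: "integrable_W m v" and vz: "integrable_W m (\<lambda>w. v w * (real (sum_list w) - real m))"
  shows "integrable_W (m + q) (\<lambda>w. v (take m w) * (real (sum_list w) - real (m + q))) \<and>
    EW (m + q) (\<lambda>w. v (take m w) * (real (sum_list w) - real (m + q)))
    = EW m (\<lambda>w. v w * (real (sum_list w) - real m))"
proof -
  let ?z = "\<lambda>n w. real (sum_list w) - real n"
  have zsplit: "v (take m w) * ?z (m + q) w = v (take m w) * ?z m (take m w) + v (take m w) * ?z q (drop m w)" for w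
  proof -
    have "sum_list w = sum_list (take m w) + sum_list (drop m w)" by (metis append_take_drop_id sum_list_append)
    then have "?z (m + q) w = ?z m (take m w) + ?z q (drop m w)" by simp
    then show ?thesis by (simp only: distrib_left)
  qed
  note gz = expectation_replicate_take[OF vz, of q]
  note gm = integrable_replicate_mult[OF v word_sum_integrable[of q]]
    expectation_replicate_mult[OF v word_sum_integrable[of q]]
  show ?thesis unfolding zsplit using gz gm
    by (auto simp: Bochner_Integration.integral_add word_sum_moments)
qed

end

context critical_offspring
begin

text \<open>By \<open>code_prefix_free\<close> at most one term is nonzero: the value at the tree
  whose code begins the word, or 0 if no tree of order up to K does.\<close>

definition prefix_functional :: "nat \<Rightarrow> (ptree \<Rightarrow> real) \<Rightarrow> nat list \<Rightarrow> real" where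
  "prefix_functional K f w = (\<Sum>T\<in>(\<Union>k\<le>K. trees k). f T * of_bool (take (tree_order T) w = code T))"

lemma mem_trees_upto: "T \<in> (\<Union>k\<le>K. trees k) \<longleftrightarrow> tree_order T \<le> K"
  by (auto simp: trees_def)

lemma finite_trees_upto: "finite (\<Union>k\<le>K. trees k)" by auto

lemma prefix_functional_code:
  assumes "\<And>T. K < tree_order T \<Longrightarrow> f T = 0"
  shows "prefix_functional K f (code T @ z) = f T"
proof -
  have iff: "take (tree_order T') (code T @ z) = code T' \<longleftrightarrow> T' = T" for T'
  proof
    assume "take (tree_order T') (code T @ z) = code T'"
    then have "code T @ z = code T' @ drop (tree_order T') (code T @ z)" by (metis append_take_drop_id)
    then show "T' = T" using code_prefix_free by blast
  qed (simp add: length_code[symmetric])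
  have "prefix_functional K f (code T @ z) = (\<Sum>T'\<in>(\<Union>k\<le>K. trees k). if T' = T then f T else 0)"
    unfolding prefix_functional_def iff by (intro sum.cong refl) auto
  also have "\<dots> = (if T \<in> (\<Union>k\<le>K. trees k) then f T else 0)"
    by (rule sum.delta[OF finite_trees_upto])
  also have "\<dots> = f T" unfolding mem_trees_upto using assms[of T] by (auto simp: not_le)
  finally show ?thesis .
qed

lemma prefix_functional_take: "prefix_functional K f (take K w) = prefix_functional K f w"
  unfolding prefix_functional_def
proof (intro sum.cong refl)
  fix T assume "T \<in> (\<Union>k\<le>K. trees k)"
  then have "tree_order T \<le> K" by (simp only: mem_trees_upto)
  then show "f T * of_bool (take (tree_order T) (take K w) = code T) = f T * of_bool (take (tree_order T) w = code T)"
    by (simp add: min_def)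
qed

lemma prefix_functional_bounded: "\<bar>prefix_functional K f w\<bar> \<le> (\<Sum>T\<in>(\<Union>k\<le>K. trees k). \<bar>f T\<bar>)"
  unfolding prefix_functional_def by (rule order_trans[OF sum_abs sum_mono]) (simp add: abs_mult)

lemma integrable_bounded_word: "(\<And>w. \<bar>v w\<bar> \<le> B) \<Longrightarrow> integrable_W n (v :: nat list \<Rightarrow> real)"
  by (rule measure_pmf.integrable_const_bound[of _ B]) auto

text \<open>A code has a letter sum one less than its length, and later letters are centred. So a
  tree that contributes its weight to the mean contributes minus its weight to the correlation, and
  one hypothesis settles both.\<close>

lemma prefix_functional_moments:
  assumes "(\<Sum>k\<le>K. treesum f k) = 0"
  shows "EW K (prefix_functional K f) = 0" (is ?A)
    and "EW K (\<lambda>w. prefix_functional K f w * (real (sum_list w) - real K)) = 0" (is ?B)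
proof -
  let ?b = "\<lambda>T w. of_bool (w = code T) :: real"
  let ?U = "\<Union>k\<le>K. trees k"
  have one: "EW n (\<lambda>w. ?b T w * c w) = wt T * c (code T)" if "tree_order T = n" for T n c
  proof -
    have "EW n (\<lambda>w. ?b T w * c w) = (\<Sum>w\<in>{code T}. pmf (W n) w *\<^sub>R (?b T w * c w))"
      by (rule integral_measure_pmf) (auto split: if_splits)
    then show ?thesis using that by (simp add: pmf_code)
  qed
  have sm: "sum_list (code T) = tree_order T - 1" for T using sum_code[of T] by simp
  have single: "EW K (\<lambda>w. ?b T (take (tree_order T) w)) = wt T"
    "integrable_W K (\<lambda>w. ?b T (take (tree_order T) w) * (real (sum_list w) - real K))"
    "EW K (\<lambda>w. ?b T (take (tree_order T) w) * (real (sum_list w) - real K)) = - wt T"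
    if "T \<in> ?U" for T
  proof -
    define m where "m = tree_order T"
    define q where "q = K - m"
    have K: "K = m + q" using that unfolding mem_trees_upto by (simp add: m_def q_def)
    have ib: "integrable_W m (?b T)" by (rule integrable_bounded_word[of _ 1]) simp
    have iz: "integrable_W m (\<lambda>w. ?b T w * (real (sum_list w) - real m))"
    proof (rule integrable_bounded_word[of _ "\<bar>real (sum_list (code T)) - real m\<bar>"])
    qed auto
    show "EW K (\<lambda>w. ?b T (take (tree_order T) w)) = wt T"
      using expectation_replicate_take[OF ib, of q] one[of T m "\<lambda>_. 1"] by (simp add: K m_def[symmetric])
    have "wt T * (real (sum_list (code T)) - real m) = - wt T"
      using tree_order_pos[of T] by (simp add: m_def sm of_nat_diff)
    then show "integrable_W K (\<lambda>w. ?b T (take (tree_order T) w) * (real (sum_list w) - real K))"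
      "EW K (\<lambda>w. ?b T (take (tree_order T) w) * (real (sum_list w) - real K)) = - wt T"
      using expectation_take_sum[OF ib iz, of q] one[of T m "\<lambda>w. real (sum_list w) - real m"]
      by (simp_all only: K m_def[symmetric])
  qed
  have tot: "(\<Sum>T\<in>?U. f T * wt T) = 0"
  proof -
    have "(\<Sum>T\<in>?U. f T * wt T) = (\<Sum>k\<le>K. \<Sum>T\<in>trees k. f T * wt T)"
      by (rule sum.UNION_disjoint) (auto simp: trees_def, simp add: trees_def[symmetric])
    also have "\<dots> = (\<Sum>k\<le>K. treesum f k)" by (simp add: treesum_def mult.commute)
    finally show ?thesis using assms by simp
  qed
  have "EW K (prefix_functional K f)
      = (\<Sum>T\<in>?U. EW K (\<lambda>w. f T * ?b T (take (tree_order T) w)))"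
    unfolding prefix_functional_def
    by (intro Bochner_Integration.integral_sum integrable_mult_right integrable_bounded_word[of _ 1]) simp
  also have "\<dots> = (\<Sum>T\<in>?U. f T * wt T)" by (intro sum.cong refl) (simp only: integral_mult_right_zero single)
  finally show ?A using tot by simp
  have "EW K (\<lambda>w. prefix_functional K f w * (real (sum_list w) - real K))
      = (\<Sum>T\<in>?U. EW K (\<lambda>w. f T * (?b T (take (tree_order T) w) * (real (sum_list w) - real K))))"
    unfolding prefix_functional_def sum_distrib_right mult.assoc
    by (intro Bochner_Integration.integral_sum integrable_mult_right single)
  also have "\<dots> = (\<Sum>T\<in>?U. f T * - wt T)" by (intro sum.cong refl) (simp only: integral_mult_right_zero single)
  finally show ?B using tot by (simp add: sum_negf)
qed

text \<open>\<open>\<omega>\<close> is centred and uncorrelated with \<open>\<xi>\<close>, while its sum over the outdegrees of a tree is the number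
  of leaves divided by \<open>\<xi>\<close>'s mass at \<open>0\<close>, minus the number of nodes, up to a constant.\<close>

definition \<omega> :: "nat \<Rightarrow> real" where "\<omega> d = of_bool (d = 0) / p 0 - 1 + (real d - 1) / s2"

text \<open>The correlation with d - 1 is -1 for the leaf term, by the division by
  \<open>p 0\<close>, and s2 / s2 = 1 for the linear term.\<close>

lemma \<omega>_moments:
  shows "integrable (measure_pmf \<xi>) (\<lambda>d. (\<omega> d)\<^sup>2)" "E \<omega> = 0" "E (\<lambda>d. \<omega> d * (real d - 1)) = 0"
proof -
  have p0: "0 < p 0" by (rule zero_in_support)
  let ?z = "\<lambda>d. of_bool (d = 0) / p 0 - 1 :: real" and ?l = "\<lambda>d. (real d - 1) / s2"
  have bd: "\<bar>?z d\<bar> \<le> 1 / p 0 + 1" for d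
    using p0 by (intro order_trans[OF abs_triangle_ineq4]) simp
  have iz: "integrable (measure_pmf \<xi>) ?z"
  proof (rule measure_pmf.integrable_const_bound)
    show "AE d in measure_pmf \<xi>. norm (?z d) \<le> 1 / p 0 + 1" by (intro AE_pmfI) (simp only: real_norm_def bd)
  qed simp
  have iz2: "integrable (measure_pmf \<xi>) (\<lambda>d. (?z d)\<^sup>2)"
  proof (rule measure_pmf.integrable_const_bound)
    show "AE d in measure_pmf \<xi>. norm ((?z d)\<^sup>2) \<le> (1 / p 0 + 1)\<^sup>2"
      by (intro AE_pmfI) (simp only: real_norm_def power_abs power_mono[OF bd abs_ge_zero])
  qed simp
  have il: "integrable (measure_pmf \<xi>) ?l" using int_centred by (intro integrable_divide)
  have il2: "integrable (measure_pmf \<xi>) (\<lambda>d. (?l d)\<^sup>2)"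
    unfolding power_divide using int_centred_square by (intro integrable_divide)
  have dl: "E (\<lambda>d. of_bool (d = 0) * c d) = p 0 * c 0" for c :: "nat \<Rightarrow> real"
  proof -
    have "E (\<lambda>d. of_bool (d = 0) * c d) = (\<Sum>d\<in>{0}. p d *\<^sub>R (of_bool (d = 0) * c d))"
      by (rule integral_measure_pmf) auto
    then show ?thesis by simp
  qed
  have ib: "integrable (measure_pmf \<xi>) (\<lambda>d. of_bool (d = 0) :: real)"
    by (rule measure_pmf.integrable_const_bound[of _ 1]) auto
  have ibc: "integrable (measure_pmf \<xi>) (\<lambda>d. of_bool (d = 0) * (real d - 1))"
    by (rule measure_pmf.integrable_const_bound[of _ 1]) auto
  show "integrable (measure_pmf \<xi>) (\<lambda>d. (\<omega> d)\<^sup>2)"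
  proof -
    have "(\<omega> d)\<^sup>2 = (?z d)\<^sup>2 + 2 * (?z d * ?l d) + (?l d)\<^sup>2" for d
      unfolding \<omega>_def by (simp add: power2_sum)
    then show ?thesis
      by (simp only:) (intro Bochner_Integration.integrable_add integrable_mult_right iz2 il2 integrable_mult_squares)
  qed
  have "E \<omega> = E ?z + E ?l" unfolding \<omega>_def by (rule Bochner_Integration.integral_add[OF iz il])
  moreover have "E ?l = 0" using int_centred by (simp only: integral_divide_zero div_0)
  moreover have "E ?z = E (\<lambda>d. of_bool (d = 0) / p 0) - E (\<lambda>_. 1)"
    using ib by (intro Bochner_Integration.integral_diff integrable_divide) auto
  moreover have "E (\<lambda>d. of_bool (d = 0) / p 0) = 1" using dl[of "\<lambda>_. 1 / p 0"] p0 by simp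
  ultimately show "E \<omega> = 0" by (simp add: measure_pmf.prob_space)
  have "(b / q - 1 + x / s) * x = b * x * (1 / q) - x + x\<^sup>2 * (1 / s)" for b q x s :: real
    by (simp add: power2_eq_square distrib_right left_diff_distrib)
  then have "\<omega> d * (real d - 1) = of_bool (d = 0) * (real d - 1) * (1 / p 0) - (real d - 1) + (real d - 1)\<^sup>2 * (1 / s2)" for d
    by (simp only: \<omega>_def)
  then have "E (\<lambda>d. \<omega> d * (real d - 1)) = E (\<lambda>d. of_bool (d = 0) * (real d - 1) * (1 / p 0) - (real d - 1)) + E (\<lambda>d. (real d - 1)\<^sup>2 * (1 / s2))"
    by (simp only:) (intro Bochner_Integration.integral_add Bochner_Integration.integrable_diff integrable_mult_left
      ibc int_centred(1) int_centred_square)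
  also have "E (\<lambda>d. of_bool (d = 0) * (real d - 1) * (1 / p 0) - (real d - 1)) = E (\<lambda>d. of_bool (d = 0) * (real d - 1) * (1 / p 0)) - E (\<lambda>d. real d - 1)"
    by (intro Bochner_Integration.integral_diff integrable_mult_left ibc int_centred(1))
  also have "E (\<lambda>d. of_bool (d = 0) * (real d - 1) * (1 / p 0)) = - 1"
    using dl[of "\<lambda>d. (real d - 1) * (1 / p 0)"] p0 by (simp add: mult.assoc)
  also have "E (\<lambda>d. (real d - 1)\<^sup>2 * (1 / s2)) = 1" using s2_pos by (simp only: integral_mult_left_zero s2_eq[symmetric]) simp
  finally show "E (\<lambda>d. \<omega> d * (real d - 1)) = 0" using int_centred by simp
qed

lemma additive_functional_\<omega>:
  "additive_functional (\<lambda>T. \<omega> (length (children T))) T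
    = additive_functional (\<lambda>T. of_bool (tree_order T = 1)) T / p 0 - real (tree_order T) - 1 / s2"
proof -
  have leaf: "tree_order T = 1 \<longleftrightarrow> length (children T) = 0" for T unfolding trees_1 by (cases T) simp
  have "\<omega> (length (children T)) = (1 / p 0 * of_bool (tree_order T = 1) + - 1) + 1 / s2 * (real (length (children T)) - 1)" for T
    unfolding leaf by (simp add: \<omega>_def)
  then show ?thesis
    by (simp only: additive_functional_add additive_functional_cmult additive_functional_const additive_functional_outdegree) simp
qed

lemma window_prefix_functional:
  assumes K: "1 \<le> K" and m: "(\<Sum>k\<le>K. treesum f k) = 0"
  shows "window \<xi> K (\<lambda>w. prefix_functional K f w + \<mu> * \<omega> (hd w))"
proof -
  obtain q where Kq: "K = 1 + q" using K le_iff_add by blast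
  have W1: "W 1 = map_pmf (\<lambda>x. [x]) \<xi>" by (rule replicate_pmf_1)
  let ?z = "\<lambda>n w. real (sum_list w) - real n"
  have i1: "integrable_W 1 (\<lambda>w. \<omega> (hd w))"
    unfolding W1 using measure_pmf.square_integrable_imp_integrable[OF _ \<omega>_moments(1)] by simp
  have i2: "integrable_W 1 (\<lambda>w. (\<omega> (hd w))\<^sup>2)" unfolding W1 using \<omega>_moments(1) by simp
  have i3: "integrable_W 1 (\<lambda>w. \<omega> (hd w) * ?z 1 w)"
    unfolding W1 using integrable_mult_squares[OF \<omega>_moments(1) int_centred_square] by simp
  have e: "EW 1 (\<lambda>w. \<omega> (hd w)) = 0" "EW 1 (\<lambda>w. \<omega> (hd w) * ?z 1 w) = 0"
    unfolding W1 using \<omega>_moments(2,3) by simp_all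
  have ae: "AE w in measure_pmf (W K). c (\<omega> (hd w)) w = c (\<omega> (hd (take 1 w))) w" for c :: "real \<Rightarrow> nat list \<Rightarrow> real"
    by (rule AE_pmfI) (auto dest!: length_replicate_pmf simp: Kq)
  note aei = integrable_cong_AE[OF _ _ ae] integral_cong_AE[OF _ _ ae]
  have j1: "integrable_W K (\<lambda>w. \<omega> (hd w))" "EW K (\<lambda>w. \<omega> (hd w)) = 0"
    using aei[of "\<lambda>a b. a"] expectation_replicate_take[OF i1, of q] e by (auto simp: Kq)
  have j2: "integrable_W K (\<lambda>w. (\<omega> (hd w))\<^sup>2)"
    using aei[of "\<lambda>a b. a\<^sup>2"] expectation_replicate_take[OF i2, of q] by (auto simp: Kq)
  have j3: "integrable_W K (\<lambda>w. \<omega> (hd w) * ?z K w)" "EW K (\<lambda>w. \<omega> (hd w) * ?z K w) = 0"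
    using aei[of "\<lambda>a b. a * ?z K b"] expectation_take_sum[OF i1 i3, of q] e by (auto simp: Kq)
  let ?P = "prefix_functional K f"
  have k1: "integrable_W K ?P" using prefix_functional_bounded by (rule integrable_bounded_word)
  have k2: "integrable_W K (\<lambda>w. (?P w)\<^sup>2)"
  proof (rule integrable_bounded_word)
    fix w show "\<bar>(?P w)\<^sup>2\<bar> \<le> (\<Sum>T\<in>(\<Union>k\<le>K. trees k). \<bar>f T\<bar>)\<^sup>2"
      using prefix_functional_bounded[of K f w] power_mono[of "\<bar>?P w\<bar>" _ 2] by fastforce
  qed
  have k3: "integrable_W K (\<lambda>w. ?P w * ?z K w)"
    by (rule integrable_mult_squares[OF k2 word_sum_square_integrable])
  show ?thesis
  proof
    show "1 \<le> K" by (rule K)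
    show "?P w + \<mu> * \<omega> (hd w) = ?P (take K w) + \<mu> * \<omega> (hd (take K w))" if "K \<le> length w" for w
      using K that by (simp add: prefix_functional_take hd_take)
    have "(?P w + \<mu> * \<omega> (hd w))\<^sup>2 = (?P w)\<^sup>2 + 2 * \<mu> * (?P w * \<omega> (hd w)) + \<mu>\<^sup>2 * (\<omega> (hd w))\<^sup>2" for w
      by (simp add: power2_eq_square algebra_simps)
    then show "integrable_W K (\<lambda>w. (?P w + \<mu> * \<omega> (hd w))\<^sup>2)"
      by (simp only:) (intro Bochner_Integration.integrable_add integrable_mult_right k2 j2 integrable_mult_squares)
    have "EW K (\<lambda>w. ?P w + \<mu> * \<omega> (hd w)) = EW K ?P + EW K (\<lambda>w. \<mu> * \<omega> (hd w))"
      by (intro Bochner_Integration.integral_add integrable_mult_right k1 j1)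
    then show "EW K (\<lambda>w. ?P w + \<mu> * \<omega> (hd w)) = 0"
      by (simp only: integral_mult_right_zero j1 prefix_functional_moments(1)[OF m])
    have "EW K (\<lambda>w. (?P w + \<mu> * \<omega> (hd w)) * ?z K w)
        = EW K (\<lambda>w. ?P w * ?z K w + \<mu> * (\<omega> (hd w) * ?z K w))"
      by (simp add: distrib_right mult.assoc)
    also have "\<dots> = EW K (\<lambda>w. ?P w * ?z K w) + EW K (\<lambda>w. \<mu> * (\<omega> (hd w) * ?z K w))"
      by (intro Bochner_Integration.integral_add integrable_mult_right k3 j3)
    finally show "EW K (\<lambda>w. (?P w + \<mu> * \<omega> (hd w)) * ?z K w) = 0"
      by (simp only: integral_mult_right_zero j3 prefix_functional_moments(2)[OF m])
  qed
qed

end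

lemma sum_rotations:
  fixes g :: "'a list \<Rightarrow> 'b :: ab_group_add"
  assumes "length w = n"
  shows "(\<Sum>i<n. g (rotate i (rotate j w))) = (\<Sum>i<n. g (rotate i w))"
proof (induction j)
  case (Suc j)
  let ?v = "rotate j w"
  have "(\<Sum>i<n. g (rotate i (rotate1 ?v))) = (\<Sum>i<n. g (rotate (Suc i) ?v))"
    by (simp add: rotate1_rotate_swap)
  also have "\<dots> = (\<Sum>i<Suc n. g (rotate i ?v)) - g ?v" by (subst sum.lessThan_Suc_shift) simp
  also have "\<dots> = (\<Sum>i<n. g (rotate i ?v))" using assms by simp
  finally show ?case using Suc by simp
qed simp

context critical_offspring
begin

text \<open>The sum of the window functional over all rotations is invariant under rotation, and on
  a code it is an additive functional of the tree. So \<open>CE_cyclic\<close> carries the window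
  limits over to conditioned trees.\<close>

theorem truncated_limits:
  fixes \<mu> :: real
  assumes K: "1 \<le> K" and f: "\<And>T. K < tree_order T \<Longrightarrow> f T = 0" and m: "(\<Sum>k\<le>K. treesum f k) = 0"
  defines "Y \<equiv> additive_functional (\<lambda>T. f T + \<mu> * \<omega> (length (children T)))"
  shows "\<exists>v. ((\<lambda>n. treesum (\<lambda>T. (Y T)\<^sup>2) n / mass n / real n) \<longlongrightarrow> v) gseq \<and>
    ((\<lambda>n. treesum Y n / mass n / sqrt (real n)) \<longlongrightarrow> 0) gseq \<and>
    (\<forall>u. ((\<lambda>n. treesum (\<lambda>T. cos (u * Y T / sqrt (real n))) n / mass n) \<longlongrightarrow> exp (- u\<^sup>2 * v / 2)) gseq \<and>
      ((\<lambda>n. treesum (\<lambda>T. sin (u * Y T / sqrt (real n))) n / mass n) \<longlongrightarrow> 0) gseq)"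
proof -
  define g where "g w = prefix_functional K f w + \<mu> * \<omega> (hd w)" for w
  interpret window \<xi> K g unfolding g_def[abs_def] by (rule window_prefix_functional[OF K m])
  have gT: "g (code T @ z) = f T + \<mu> * \<omega> (length (children T))" for T z
    by (cases T) (simp add: g_def prefix_functional_code[OF f] del: append_Cons code.simps, simp)
  define S where "S n w = (\<Sum>i<n. g (rotate i w))" for n w
  have SY: "S (tree_order T) (code T) = Y T" for T unfolding S_def Y_def by (rule sum_rotate_code) (rule gT)
  have CE: "CE n (\<lambda>w. \<phi> (S n w)) / PS n (n - 1) = treesum (\<lambda>T. \<phi> (Y T)) n / mass n" if n: "1 \<le> n" for n \<phi>
  proof -
    have "CE n (\<lambda>w. \<phi> (S n w)) = real n * treesum (\<lambda>T. \<phi> (S n (code T))) n"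
      by (rule CE_cyclic[OF n]) (simp add: S_def sum_rotations)
    also have "treesum (\<lambda>T. \<phi> (S n (code T))) n = treesum (\<lambda>T. \<phi> (Y T)) n"
      by (rule treesum_cong) (use SY in auto)
    finally show ?thesis using n by (simp add: treesum_one)
  qed
  have ev: "\<forall>\<^sub>F n in gseq. 1 \<le> n" unfolding eventually_gseq by auto
  have "((\<lambda>n. treesum (\<lambda>T. (Y T)\<^sup>2) n / mass n / real n) \<longlongrightarrow> \<gamma>) gseq"
    using second_moment_limit
  proof (rule Lim_transform_eventually)
    show "\<forall>\<^sub>F n in gseq. CE n (\<lambda>w. (\<Sum>i<n. g (rotate i w))\<^sup>2) / (real n * PS n (n - 1)) = treesum (\<lambda>T. (Y T)\<^sup>2) n / mass n / real n"
      using ev by eventually_elim (simp only: CE[of _ "\<lambda>x. x\<^sup>2", symmetric] S_def divide_divide_eq_left mult.commute)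
  qed
  moreover have "((\<lambda>n. treesum Y n / mass n / sqrt (real n)) \<longlongrightarrow> 0) gseq"
    using first_moment_limit
  proof (rule Lim_transform_eventually)
    show "\<forall>\<^sub>F n in gseq. CE n (\<lambda>w. \<Sum>i<n. g (rotate i w)) / (sqrt (real n) * PS n (n - 1)) = treesum Y n / mass n / sqrt (real n)"
      using ev by eventually_elim (simp only: CE[of _ "\<lambda>x. x", symmetric] S_def divide_divide_eq_left mult.commute)
  qed
  moreover have "((\<lambda>n. treesum (\<lambda>T. cos (u * Y T / sqrt (real n))) n / mass n) \<longlongrightarrow> exp (- u\<^sup>2 * \<gamma> / 2)) gseq \<and>
      ((\<lambda>n. treesum (\<lambda>T. sin (u * Y T / sqrt (real n))) n / mass n) \<longlongrightarrow> 0) gseq" for u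
  proof -
    let ?Z = "\<lambda>n. CEc n (\<lambda>w. cis (u * (\<Sum>i<n. g (rotate i w)) / sqrt (real n))) / of_real (PS n (n - 1))"
    have re: "Re (CEc n (\<lambda>w. cis (h w)) / of_real c) = CE n (\<lambda>w. cos (h w)) / c"
      and im: "Im (CEc n (\<lambda>w. cis (h w)) / of_real c) = CE n (\<lambda>w. sin (h w)) / c" for n h c
      by (simp_all add: CEc_def CE_def Re_divide_of_real Im_divide_of_real)
    have "\<forall>\<^sub>F n in gseq. Re (?Z n) = treesum (\<lambda>T. cos (u * Y T / sqrt (real n))) n / mass n"
      using ev
    proof eventually_elim
      case (elim n)
      then show ?case using CE[of n "\<lambda>x. cos (u * x / sqrt (real n))"] by (simp only: re S_def)
    qed
    moreover have "\<forall>\<^sub>F n in gseq. Im (?Z n) = treesum (\<lambda>T. sin (u * Y T / sqrt (real n))) n / mass n"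
      using ev
    proof eventually_elim
      case (elim n)
      then show ?case using CE[of n "\<lambda>x. sin (u * x / sqrt (real n))"] by (simp only: im S_def)
    qed
    ultimately show ?thesis
      using Lim_transform_eventually[OF tendsto_Re[OF window_clt[of u]]] Lim_transform_eventually[OF tendsto_Im[OF window_clt[of u]]]
      by simp
  qed
  ultimately show ?thesis by blast
qed

end

section \<open>The law of the Galton--Watson tree\<close>

lemma prod_nodes_Node:
  fixes h :: "nat list \<Rightarrow> 'b :: comm_monoid_mult"
  shows "(\<Prod>v\<in>nodes (Node ts). h v) = h [] * (\<Prod>i<length ts. \<Prod>v\<in>nodes (ts ! i). h (i # v))"
proof -
  have "(\<Prod>v\<in>nodes (Node ts). h v) = h [] * (\<Prod>v\<in>(\<Union>i<length ts. (#) i ` nodes (ts ! i)). h v)"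
    unfolding nodes_Node by (subst prod.insert) auto
  also have "(\<Prod>v\<in>(\<Union>i<length ts. (#) i ` nodes (ts ! i)). h v) = (\<Prod>i<length ts. \<Prod>v\<in>(#) i ` nodes (ts ! i). h v)"
    by (rule prod.UNION_disjoint) auto
  also have "\<dots> = (\<Prod>i<length ts. \<Prod>v\<in>nodes (ts ! i). h (i # v))"
    by (simp add: prod.reindex)
  finally show ?thesis .
qed

lemma expectation_finite_support:
  fixes \<phi> :: "ptree \<Rightarrow> 'b :: {banach, second_countable_topology}"
  assumes "prob_space Q" "sets Q = UNIV" "finite A"
  shows "(\<integral>T. indicator A T *\<^sub>R \<phi> T \<partial>Q) = (\<Sum>T\<in>A. measure Q {T} *\<^sub>R \<phi> T)"
proof -
  interpret Q: prob_space Q by (rule assms)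
  have "indicator A T *\<^sub>R \<phi> T = (\<Sum>S\<in>A. indicator {S} T *\<^sub>R \<phi> S)" for T
  proof -
    have "(\<Sum>S\<in>A. indicator {S} T *\<^sub>R \<phi> S) = (\<Sum>S\<in>A. if S = T then \<phi> T else 0)"
      by (intro sum.cong) (auto split: split_indicator)
    also have "\<dots> = (if T \<in> A then \<phi> T else 0)" by (rule sum.delta[OF assms(3)])
    finally show ?thesis by simp
  qed
  then have "(\<integral>T. indicator A T *\<^sub>R \<phi> T \<partial>Q) = (\<Sum>S\<in>A. \<integral>T. indicator {S} T *\<^sub>R \<phi> S \<partial>Q)"
    using assms(2) by (simp only:) (intro Bochner_Integration.integral_sum integrable_scaleR_left integrable_real_indicator; simp add: Q.emeasure_eq_measure)
  also have "\<dots> = (\<Sum>T\<in>A. measure Q {T} *\<^sub>R \<phi> T)"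
    using sets_eq_imp_space_eq[of Q "count_space UNIV"] assms(2)
    by (intro sum.cong refl, subst integral_scaleR_left) (auto intro!: integrable_real_indicator simp: Q.emeasure_eq_measure)
  finally show ?thesis .
qed

lemma sets_GW: "sets (GW \<xi>) = UNIV" "space (GW \<xi>) = UNIV"
  by (simp_all add: GW_def)

context critical_offspring
begin

lemma partial_expectation_tendsto:
  assumes "integrable (measure_pmf \<xi>) h"
  shows "(\<lambda>N. \<Sum>d\<le>N. h d * p d) \<longlonglongrightarrow> E h"
proof -
  have "(\<Sum>d\<le>N. h d * p d) = E (\<lambda>k. h k * of_bool (k \<le> N))" for N
    by (subst integral_measure_pmf[of "{..N}"]) (auto simp: mult.commute intro!: sum.cong)
  moreover have "(\<lambda>N. E (\<lambda>k. h k * of_bool (k \<le> N))) \<longlonglongrightarrow> E h"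
  proof (rule integral_dominated_convergence[where w = "\<lambda>k. \<bar>h k\<bar>"])
    show "AE k in measure_pmf \<xi>. (\<lambda>N. h k * of_bool (k \<le> N)) \<longlonglongrightarrow> h k"
    proof (intro AE_pmfI tendsto_eventually eventually_sequentiallyI)
      fix k N :: nat assume "k \<le> N" then show "h k * of_bool (k \<le> N) = h k" by simp
    qed
  qed (use assms in auto)
  ultimately show ?thesis by simp
qed

lemma summable_TT: "summable (\<lambda>n. fps_nth TT n)"
proof (rule summableI_nonneg_bounded)
  show nn: "0 \<le> fps_nth TT n" for n by (simp add: treesum_one_nonneg)
  show "(\<Sum>k<n. fps_nth TT k) \<le> 1" for n
  proof (rule order_trans[OF _ TT_partial_sum])
    show "(\<Sum>k<n. fps_nth TT k) \<le> (\<Sum>k\<le>n. fps_nth TT k)" using nn by (intro sum_mono2) auto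
  qed
qed

lemma TT_power_sums: "(\<lambda>m. fps_nth (TT ^ d) m) sums (\<Sum>n. fps_nth TT n) ^ d"
proof (induction d)
  case 0
  have "(\<lambda>m. fps_nth (TT ^ 0) m) = (\<lambda>m. if m = 0 then 1 else 0)" by auto
  then show ?case using sums_single[of 0 "\<lambda>_. 1 :: real"] by simp
next
  case (Suc d)
  have n: "norm (fps_nth (TT ^ r) m) = fps_nth (TT ^ r) m" for r m using TT_power_nonneg by simp
  have "(\<lambda>m. \<Sum>i\<le>m. fps_nth TT i * fps_nth (TT ^ d) (m - i)) sums ((\<Sum>n. fps_nth TT n) * (\<Sum>n. fps_nth (TT ^ d) n))"
    using summable_TT sums_summable[OF Suc] n[of 1] n[of d] by (intro Cauchy_product_sums) simp_all
  then show ?case using sums_unique[OF Suc] by (simp add: fps_mult_nth atLeast0AtMost)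
qed

text \<open>Criticality gives extinction. With G the offspring generating function, the total mass q
  satisfies G(q) \<le> q by the recursion, while q^d \<ge> 1 - d (1 - q) by Bernoulli, with mean q
  on the right. For q < 1 the inequality is strict at some d \<ge> 2 of positive
  probability.\<close>

lemma TT_sums_1: "(\<lambda>n. mass n) sums 1"
proof -
  define q where "q = (\<Sum>n. fps_nth TT n)"
  have qs: "(\<lambda>n. fps_nth TT n) sums q" unfolding q_def by (rule summable_sums[OF summable_TT])
  have q0: "0 \<le> q" unfolding q_def by (intro suminf_nonneg summable_TT) (simp add: treesum_one_nonneg)
  have psum: "(\<lambda>n. \<Sum>k\<le>n. fps_nth TT k) \<longlonglongrightarrow> q" using qs by (simp add: sums_def_le)
  have q1: "q \<le> 1" by (rule LIMSEQ_le_const2[OF psum]) (use TT_partial_sum in blast)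
  \<comment> \<open>With the degrees cut at a fixed \<open>D\<close> the limit in n can be taken
    term by term.\<close>
  have fin: "(\<Sum>d\<le>D. q ^ d * p d) \<le> q" for D
  proof -
    have "(\<lambda>n. \<Sum>d\<le>D. p d * (\<Sum>m\<le>n. fps_nth (TT ^ d) m)) \<longlonglongrightarrow> (\<Sum>d\<le>D. p d * q ^ d)"
      using TT_power_sums by (intro tendsto_sum tendsto_mult tendsto_const) (simp add: sums_def_le q_def)
    moreover have "(\<lambda>n. \<Sum>k\<le>Suc n. fps_nth TT k) \<longlonglongrightarrow> q" by (rule LIMSEQ_Suc[OF psum])
    moreover have "\<exists>N. \<forall>n\<ge>N. (\<Sum>d\<le>D. p d * (\<Sum>m\<le>n. fps_nth (TT ^ d) m)) \<le> (\<Sum>k\<le>Suc n. fps_nth TT k)"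
    proof (intro exI[of _ D] allI impI)
      fix n assume "D \<le> n"
      have "(\<Sum>k\<le>Suc n. fps_nth TT k) = (\<Sum>m\<le>n. \<Sum>d\<le>n. p d * fps_nth (TT ^ d) m)"
        by (subst sum.atMost_Suc_shift) (simp add: treesum_Suc[of _ n] fsum_one)
      also have "\<dots> = (\<Sum>d\<le>n. p d * (\<Sum>m\<le>n. fps_nth (TT ^ d) m))"
        unfolding sum_distrib_left by (rule sum.swap)
      also have "\<dots> \<ge> (\<Sum>d\<le>D. p d * (\<Sum>m\<le>n. fps_nth (TT ^ d) m))"
        using \<open>D \<le> n\<close> by (intro sum_mono2) (auto intro!: mult_nonneg_nonneg sum_nonneg TT_power_nonneg)
      finally show "(\<Sum>d\<le>D. p d * (\<Sum>m\<le>n. fps_nth (TT ^ d) m)) \<le> (\<Sum>k\<le>Suc n. fps_nth TT k)" .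
    qed
    ultimately have "(\<Sum>d\<le>D. p d * q ^ d) \<le> q" by (rule LIMSEQ_le)
    then show ?thesis by (simp add: mult.commute)
  qed
  have iq: "integrable (measure_pmf \<xi>) (\<lambda>d. q ^ d)"
    using q0 q1 by (intro measure_pmf.integrable_const_bound[of _ 1]) (auto intro: power_le_one)
  have Eq: "E (\<lambda>d. q ^ d) \<le> q"
    by (rule LIMSEQ_le_const2[OF partial_expectation_tendsto[OF iq]]) (use fin in blast)
  have "q = 1"
  proof (rule ccontr)
    assume "q \<noteq> 1"
    define x where "x = 1 - q"
    have x: "0 < x" "q = 1 - x" "x \<le> 1" using \<open>q \<noteq> 1\<close> q0 q1 by (auto simp: x_def)
    define h where "h d = q ^ d - (1 - real d * x)" for d
    have h0: "0 \<le> h d" for d using Bernoulli_inequality[of "- x" d] x by (simp add: h_def)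
    have ih: "integrable (measure_pmf \<xi>) h"
      unfolding h_def[abs_def] using int1 iq by simp
    have "E h = E (\<lambda>d. q ^ d) - E (\<lambda>d. 1 - real d * x)"
      unfolding h_def using int1 iq by (intro Bochner_Integration.integral_diff) auto
    also have "E (\<lambda>d. 1 - real d * x) = 1 - x"
      using int1 mean1 by (simp add: measure_pmf.prob_space)
    finally have Eh: "E h \<le> 0" using Eq x by simp
    obtain k where k: "2 \<le> k" "0 < p k" using large_in_support by blast
    have "h k * p k \<le> (\<Sum>d\<le>k. h d * p d)" using h0 by (intro member_le_sum) auto
    also have "\<dots> \<le> E h" by (rule partial_expectation_le[OF ih h0])
    finally have "h k * p k \<le> 0" using Eh by simp
    then have "h k \<le> 0" using k(2) by (simp add: mult_le_0_iff)
    \<comment> \<open>One further factor q in the Bernoulli inequality leaves the positive surplus m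
      x^2.\<close>
    moreover have "0 < h k"
    proof -
      obtain m where m: "k = Suc m" "1 \<le> m" using k(1) by (cases k) auto
      have "q * (1 - real m * x) \<le> q * q ^ m"
        using h0[of m] q0 by (intro mult_left_mono) (simp_all add: h_def)
      moreover have "q * (1 - real m * x) = 1 - real k * x + real m * x\<^sup>2"
        unfolding m x(2) by (simp add: power2_eq_square algebra_simps)
      moreover have "0 < real m * x\<^sup>2" using m x by simp
      ultimately show ?thesis by (simp add: h_def m)
    qed
    ultimately show False by simp
  qed
  then show ?thesis using qs by simp
qed

lemma wt_eq_prod_nodes: "wt T = (\<Prod>v\<in>nodes T. p (outdeg T v))"
proof (induction T)
  case (Node ts)
  have "(\<Prod>v\<in>nodes (Node ts). p (outdeg (Node ts) v)) = p (length ts) * (\<Prod>i<length ts. \<Prod>v\<in>nodes (ts ! i). p (outdeg (ts ! i) v))"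
    unfolding prod_nodes_Node by (simp add: outdeg_def)
  also have "\<dots> = p (length ts) * (\<Prod>i<length ts. wt (ts ! i))" using Node by simp
  also have "(\<Prod>i<length ts. wt (ts ! i)) = prod_list (map wt ts)"
    by (simp add: prod.list_conv_set_nth atLeast0LessThan)
  finally show ?case by simp
qed

text \<open>At first only an inequality, because \<open>tree_of\<close> may take the value
  \<open>T\<close> also where no finite tree is compatible.\<close>

lemma measure_GW_ge: "wt T \<le> measure (GW \<xi>) {T}"
proof -
  interpret P: product_prob_space "\<lambda>_. measure_pmf \<xi>" "UNIV :: nat list set" ..
  interpret G: prob_space "GW \<xi>" by (rule prob_space_GW)
  let ?P = "\<Pi>\<^sub>M v\<in>(UNIV :: nat list set). measure_pmf \<xi>"
  let ?A = "{c \<in> space ?P. \<forall>v\<in>nodes T. c v \<in> {outdeg T v}}"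
  have "emeasure ?P ?A = (\<Prod>v\<in>nodes T. emeasure (measure_pmf \<xi>) {outdeg T v})"
    by (rule P.emeasure_PiM_Collect) auto
  also have "\<dots> = ennreal (wt T)"
    unfolding wt_eq_prod_nodes by (simp add: emeasure_pmf_single prod_ennreal)
  finally have A: "emeasure ?P ?A = ennreal (wt T)" .
  have "?A \<subseteq> tree_of -` {T} \<inter> space ?P"
    using tree_of_eq[of T] by (auto simp: has_offspring_def)
  then have "emeasure ?P ?A \<le> emeasure ?P (tree_of -` {T} \<inter> space ?P)"
    by (rule emeasure_mono) (rule measurable_sets[OF measurable_tree_of], simp)
  also have "\<dots> = emeasure (GW \<xi>) {T}"
    unfolding GW_def by (rule emeasure_distr[OF measurable_tree_of, symmetric]) simp
  finally have "ennreal (wt T) \<le> emeasure (GW \<xi>) {T}" unfolding A .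
  then show ?thesis by (simp add: G.emeasure_eq_measure)
qed

text \<open>The lower bounds add up to 1 by \<open>TT_sums_1\<close>, so no singleton can exceed its
  own; in particular the default value of \<open>tree_of\<close> gains no mass.\<close>

lemma measure_GW: "measure (GW \<xi>) {T} = wt T"
proof (rule antisym[OF _ measure_GW_ge], rule ccontr)
  interpret G: prob_space "GW \<xi>" by (rule prob_space_GW)
  assume "\<not> measure (GW \<xi>) {T} \<le> wt T"
  then have \<delta>: "0 < measure (GW \<xi>) {T} - wt T" by simp
  have "(\<lambda>N. \<Sum>n\<le>N. mass n) \<longlonglongrightarrow> 1" using TT_sums_1 by (simp add: sums_def_le)
  then have "\<forall>\<^sub>F N in sequentially. 1 - (measure (GW \<xi>) {T} - wt T) < (\<Sum>n\<le>N. mass n)"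
    using \<delta> by (intro order_tendstoD(1)) auto
  moreover have "\<forall>\<^sub>F N in sequentially. tree_order T \<le> N" by (rule eventually_ge_at_top)
  ultimately have "\<forall>\<^sub>F N in sequentially. 1 - (measure (GW \<xi>) {T} - wt T) < (\<Sum>n\<le>N. mass n) \<and> tree_order T \<le> N"
    by (rule eventually_conj)
  then obtain N where N: "1 - (measure (GW \<xi>) {T} - wt T) < (\<Sum>n\<le>N. mass n)" "tree_order T \<le> N"
    using eventually_happens'[OF sequentially_bot] by blast
  let ?U = "\<Union>k\<le>N. trees k"
  have TU: "T \<in> ?U" using N(2) by (simp only: mem_trees_upto)
  have "(\<Sum>n\<le>N. mass n) = (\<Sum>S\<in>?U. wt S)"
    unfolding treesum_def mult_1_right
    by (rule sum.UNION_disjoint[symmetric]) (auto simp: trees_def, simp add: trees_def[symmetric])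
  also have "\<dots> = wt T + (\<Sum>S\<in>?U - {T}. wt S)" by (rule sum.remove[OF finite_trees_upto TU])
  also have "\<dots> \<le> wt T + (\<Sum>S\<in>?U - {T}. measure (GW \<xi>) {S})" by (intro add_left_mono sum_mono measure_GW_ge)
  also have "\<dots> = wt T - measure (GW \<xi>) {T} + (\<Sum>S\<in>?U. measure (GW \<xi>) {S})"
    by (simp only: sum.remove[OF finite_trees_upto TU])
  also have "(\<Sum>S\<in>?U. measure (GW \<xi>) {S}) = measure (GW \<xi>) ?U"
    by (rule G.finite_measure_eq_sum_singleton[OF finite_trees_upto, symmetric]) (simp add: sets_GW)
  also have "\<dots> \<le> 1" by (rule G.prob_le_1)
  finally show False using N(1) by simp
qed

lemma expectation_GW:
  assumes "bounded (range f)"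
  shows "(\<lambda>n. treesum f n) sums prob_space.expectation (GW \<xi>) f"
proof -
  interpret G: prob_space "GW \<xi>" by (rule prob_space_GW)
  obtain B where B: "\<And>T. \<bar>f T\<bar> \<le> B" using assms by (auto simp: bounded_iff)
  let ?U = "\<lambda>N. \<Union>k\<le>N. trees k"
  have m: "h \<in> borel_measurable (GW \<xi>)" for h :: "ptree \<Rightarrow> real"
    using measurable_cong_sets[of "GW \<xi>" "count_space UNIV" borel borel] sets_GW by auto
  have "(\<Sum>n\<le>N. treesum f n) = (\<integral>T. indicator (?U N) T *\<^sub>R f T \<partial>GW \<xi>)" for N
  proof -
    have "(\<Sum>n\<le>N. treesum f n) = (\<Sum>S\<in>?U N. wt S * f S)"
      unfolding treesum_def by (rule sum.UNION_disjoint[symmetric]) (auto simp: trees_def, simp add: trees_def[symmetric])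
    also have "\<dots> = (\<integral>T. indicator (?U N) T *\<^sub>R f T \<partial>GW \<xi>)"
      by (subst expectation_finite_support[OF prob_space_GW sets_GW(1) finite_trees_upto]) (simp add: measure_GW)
    finally show ?thesis .
  qed
  moreover have "(\<lambda>N. \<integral>T. indicator (?U N) T *\<^sub>R f T \<partial>GW \<xi>) \<longlonglongrightarrow> (\<integral>T. f T \<partial>GW \<xi>)"
  proof (rule integral_dominated_convergence[where w = "\<lambda>_. B"])
    show "AE T in GW \<xi>. (\<lambda>N. indicator (?U N) T *\<^sub>R f T) \<longlonglongrightarrow> f T"
    proof (intro AE_I2 tendsto_eventually eventually_sequentiallyI)
      fix T N assume "tree_order T \<le> N"
      then have "T \<in> ?U N" by (simp only: mem_trees_upto)
      then show "indicator (?U N) T *\<^sub>R f T = f T" by (simp only: indicator_simps) simp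
    qed
    show "AE T in GW \<xi>. norm (indicator (?U N) T *\<^sub>R f T) \<le> B" for N
    proof (intro AE_I2)
      fix T show "norm (indicator (?U N) T *\<^sub>R f T) \<le> B"
        using B[of T] abs_ge_zero[of "f T"] by (simp only: indicator_def split: if_split) auto
    qed
  qed (auto intro: m)
  ultimately show ?thesis by (simp add: sums_def_le)
qed

lemma measure_GW_order: "measure (GW \<xi>) {T. tree_order T = n} = mass n"
proof -
  interpret G: prob_space "GW \<xi>" by (rule prob_space_GW)
  have "measure (GW \<xi>) (trees n) = (\<Sum>T\<in>trees n. measure (GW \<xi>) {T})"
    by (rule G.finite_measure_eq_sum_singleton) (simp_all add: sets_GW)
  then show ?thesis by (simp add: measure_GW treesum_def trees_def)
qed

lemma admissible_iff: "n \<in> admissible \<xi> \<longleftrightarrow> 0 < mass n"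
  by (simp add: admissible_def measure_GW_order)

lemma admissible_good: "n \<in> admissible \<xi> \<Longrightarrow> n \<in> good"
  using treesum_span[of "\<lambda>_. 1" n] by (auto simp only: admissible_iff good_def mem_Collect_eq)

lemma adm_seq_le: "adm_seq \<xi> \<le> gseq"
proof -
  have "admissible \<xi> \<subseteq> good" using admissible_good by blast
  then show ?thesis unfolding adm_seq_def gseq_def by (intro inf_mono order_refl) (simp only: principal_le_iff)
qed

lemma integral_cond_GW:
  fixes \<phi> :: "ptree \<Rightarrow> 'b :: {banach, second_countable_topology}"
  assumes n: "n \<in> admissible \<xi>"
  shows "(\<integral>T. \<phi> T \<partial>cond_GW \<xi> n) = (\<Sum>T\<in>trees n. (wt T / mass n) *\<^sub>R \<phi> T)"
proof -
  interpret G: prob_space "GW \<xi>" by (rule prob_space_GW)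
  interpret Q: prob_space "cond_GW \<xi> n" by (rule prob_space_cond_GW[OF n])
  have s: "sets (cond_GW \<xi> n) = UNIV" by (simp add: cond_GW_def sets_GW)
  have pos: "0 < mass n" using n by (simp add: admissible_iff)
  have em: "emeasure (GW \<xi>) {T. tree_order T = n} \<noteq> 0"
    using pos by (simp add: G.emeasure_eq_measure measure_GW_order)
  have ae: "AE T in cond_GW \<xi> n. T \<in> trees n"
    unfolding cond_GW_def by (rule AE_uniform_measureI) (auto simp: sets_GW trees_def)
  have m: "h \<in> borel_measurable (cond_GW \<xi> n)" for h :: "ptree \<Rightarrow> 'b"
    using measurable_cong_sets[of "cond_GW \<xi> n" "count_space UNIV" borel borel] s by auto
  have "(\<integral>T. \<phi> T \<partial>cond_GW \<xi> n) = (\<integral>T. indicator (trees n) T *\<^sub>R \<phi> T \<partial>cond_GW \<xi> n)"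
    by (rule integral_cong_AE[OF m m]) (use ae in eventually_elim, simp)
  also have "\<dots> = (\<Sum>T\<in>trees n. measure (cond_GW \<xi> n) {T} *\<^sub>R \<phi> T)"
    by (rule expectation_finite_support[OF Q.prob_space_axioms s finite_trees])
  also have "\<dots> = (\<Sum>T\<in>trees n. (wt T / mass n) *\<^sub>R \<phi> T)"
  proof (intro sum.cong refl)
    fix T assume "T \<in> trees n"
    then have "{T. tree_order T = n} \<inter> {T} = {T}" by (auto simp: trees_def)
    then have "measure (cond_GW \<xi> n) {T} = wt T / mass n"
      unfolding cond_GW_def using em
      by (subst measure_uniform_measure) (simp_all add: sets_GW measure_GW measure_GW_order)
    then show "measure (cond_GW \<xi> n) {T} *\<^sub>R \<phi> T = (wt T / mass n) *\<^sub>R \<phi> T" by simp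
  qed
  finally show ?thesis .
qed

lemma expectation_cond_GW:
  "n \<in> admissible \<xi> \<Longrightarrow> prob_space.expectation (cond_GW \<xi> n) \<phi> = treesum \<phi> n / mass n"
  by (simp add: integral_cond_GW treesum_def[of \<phi>] sum_divide_distrib)

end

section \<open>Weak convergence along a filter\<close>

lemma char_normal_law:
  assumes "0 \<le> v"
  shows "real_distribution (normal_law 0 v)" "char (normal_law 0 v) t = of_real (exp (- t\<^sup>2 * v / 2))"
proof -
  have "real_distribution (normal_law 0 v) \<and> char (normal_law 0 v) t = of_real (exp (- t\<^sup>2 * v / 2))"
  proof (cases "v = 0")
    case True
    interpret prob_space "return borel (0 :: real)" by (rule prob_space_return) simp
    have "real_distribution (return borel (0 :: real))" by unfold_locales auto
    then show ?thesis using True by (simp add: normal_law_def char_def integral_return)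
  next
    case False
    then have v: "0 < v" using assms by simp
    interpret N: real_distribution std_normal_distribution by (rule real_dist_normal_dist)
    let ?N = "std_normal_distribution"
    have "distributed ?N lborel (\<lambda>x. x) (normal_density 0 1)"
      using distr_id2[of lborel ?N] by (simp add: distributed_def)
    from N.normal_density_affine[OF this, of "sqrt v" 0] v
    have d: "distr ?N lborel (\<lambda>x. sqrt v * x) = density lborel (\<lambda>x. ennreal (normal_density 0 (sqrt v) x))"
      by (simp add: distributed_def)
    have "distr ?N lborel (\<lambda>x. sqrt v * x) = distr ?N borel (\<lambda>x. sqrt v * x)" by (rule distr_cong) simp_all
    then have nl: "normal_law 0 v = distr ?N borel (\<lambda>x. sqrt v * x)" using d v by (simp add: normal_law_def)
    have "real_distribution (normal_law 0 v)" unfolding nl by (rule N.real_distribution_distr) simp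
    moreover have "char (normal_law 0 v) t = char ?N (t * sqrt v)"
      unfolding nl char_def by (subst integral_distr) (simp_all add: mult_ac)
    moreover have "char ?N (t * sqrt v) = of_real (exp (- t\<^sup>2 * v / 2))"
      unfolding char_std_normal_distribution using v by (simp add: power_mult_distrib)
    ultimately show ?thesis by simp
  qed
  then show "real_distribution (normal_law 0 v)" "char (normal_law 0 v) t = of_real (exp (- t\<^sup>2 * v / 2))" by auto
qed

text \<open>For infinite \<open>A\<close> the increasing enumeration reduces the claim to sequences;
  for finite \<open>A\<close> the filter is trivial and every limit statement holds.\<close>

lemma levy_continuity_along:
  fixes \<mu>s :: "nat \<Rightarrow> real measure"
  assumes rd: "\<And>n. n \<in> A \<Longrightarrow> real_distribution (\<mu>s n)" and \<mu>: "real_distribution \<mu>"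
    and ch: "\<And>t. ((\<lambda>n. char (\<mu>s n) t) \<longlongrightarrow> char \<mu> t) (inf sequentially (principal A))"
  shows "weak_conv_m_along (inf sequentially (principal A)) \<mu>s \<mu>"
proof (cases "finite A")
  case True
  then obtain N where "\<forall>n\<in>A. n < N" using finite_nat_set_iff_bounded by blast
  then have "eventually P (inf sequentially (principal A))" for P
    unfolding eventually_inf_principal eventually_sequentially by (intro exI[of _ N]) auto
  then show ?thesis unfolding weak_conv_m_along_def tendsto_def by simp
next
  case False
  define e where "e = enumerate A"
  have e: "strict_mono e" "range e = A" unfolding e_def
    using False by (simp_all add: strict_mono_enumerate range_enumerate)
  have fe: "filterlim e (inf sequentially (principal A)) sequentially"
    unfolding filterlim_inf filterlim_principal
    using filterlim_subseq[OF e(1)] e(2) by auto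
  have "weak_conv_m (\<lambda>k. \<mu>s (e k)) \<mu>"
  proof (rule levy_continuity[OF _ \<mu>])
    show "real_distribution (\<mu>s (e k))" for k using rd e(2) by blast
    show "(\<lambda>k. char (\<mu>s (e k)) t) \<longlonglongrightarrow> char \<mu> t" for t by (rule filterlim_compose[OF ch fe])
  qed
  then have lim: "(\<lambda>k. cdf (\<mu>s (e k)) x) \<longlonglongrightarrow> cdf \<mu> x" if "isCont (cdf \<mu>) x" for x
    using that by (simp add: weak_conv_m_def weak_conv_def)
  have along: "eventually P (inf sequentially (principal A))" if "\<forall>\<^sub>F k in sequentially. P (e k)" for P
  proof -
    obtain K where K: "\<And>k. K \<le> k \<Longrightarrow> P (e k)" using \<open>\<forall>\<^sub>F k in sequentially. P (e k)\<close> by (auto simp: eventually_sequentially)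
    show ?thesis unfolding eventually_inf_principal eventually_sequentially
    proof (intro exI[of _ "e K"] allI impI)
      fix n assume "e K \<le> n" "n \<in> A"
      then obtain k where "n = e k" using e(2) by blast
      then show "P n" using \<open>e K \<le> n\<close> K strict_mono_less_eq[OF e(1)] by simp
    qed
  qed
  show ?thesis unfolding weak_conv_m_along_def
  proof (intro allI impI tendstoI along)
    fix x \<epsilon> :: real assume "isCont (cdf \<mu>) x" "0 < \<epsilon>"
    then show "\<forall>\<^sub>F k in sequentially. dist (cdf (\<mu>s (e k)) x) (cdf \<mu> x) < \<epsilon>" using tendstoD[OF lim] by blast
  qed
qed

section \<open>Approximation in mean square\<close>

text \<open>The limits \<open>l j\<close> form a Cauchy sequence because all \<open>b j\<close> are
  eventually close to the same \<open>a\<close>. So \<open>a\<close> converges although its limit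
  has not been identified.\<close>

lemma tendsto_family_exists:
  fixes a :: "'a \<Rightarrow> real"
  assumes F: "F \<noteq> bot" and b: "\<And>j. (b j \<longlongrightarrow> l j) F"
    and ab: "\<And>j. \<forall>\<^sub>F n in F. \<bar>a n - b j n\<bar> \<le> 1 / (real j + 1)"
  obtains L where "(a \<longlongrightarrow> L) F" "l \<longlonglongrightarrow> L"
proof -
  have ll: "\<bar>l i - l j\<bar> \<le> 1 / (real i + 1) + 1 / (real j + 1)" for i j
  proof (rule tendsto_upperbound[OF _ _ F])
    show "((\<lambda>n. \<bar>b i n - b j n\<bar>) \<longlongrightarrow> \<bar>l i - l j\<bar>) F" by (intro tendsto_intros b)
    show "\<forall>\<^sub>F n in F. \<bar>b i n - b j n\<bar> \<le> 1 / (real i + 1) + 1 / (real j + 1)"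
      using ab[of i] ab[of j] by eventually_elim linarith
  qed
  have "Cauchy l"
  proof (rule CauchyI)
    fix e :: real assume "0 < e"
    then obtain N where N: "inverse (real (Suc N)) < e / 2" using reals_Archimedean[of "e / 2"] by auto
    have lt: "1 / (real m + 1) < e / 2" if "N \<le> m" for m
    proof -
      have "1 / (real m + 1) \<le> 1 / (real N + 1)" using that by (intro divide_left_mono) auto
      then show ?thesis using N by (simp add: inverse_eq_divide add.commute)
    qed
    show "\<exists>M. \<forall>m\<ge>M. \<forall>n\<ge>M. norm (l m - l n) < e"
    proof (intro exI[of _ N] allI impI)
      fix m n assume "N \<le> m" "N \<le> n"
      then show "norm (l m - l n) < e" using ll[of m n] lt[of m] lt[of n] by simp
    qed
  qed
  then obtain L where L: "l \<longlonglongrightarrow> L" using Cauchy_convergent convergent_def by blast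
  have "(\<lambda>j. 1 / (real j + 1)) \<longlonglongrightarrow> 0" by real_asymp
  then have "(a \<longlongrightarrow> L) F"
    by (rule tendsto_approx_family[rotated 2, where b = b and l = l and ?B0.0 = 0]) (simp_all only: L b ab real_norm_def)
  then show thesis using L by (rule that)
qed

context critical_offspring
begin

section \<open>Means given the order\<close>

definition cmean :: "nat \<Rightarrow> (ptree \<Rightarrow> real) \<Rightarrow> real" where
  "cmean n \<phi> = treesum \<phi> n / mass n"

lemma cmean_add: "cmean n (\<lambda>T. \<phi> T + \<psi> T) = cmean n \<phi> + cmean n \<psi>"
  by (simp only: cmean_def treesum_add add_divide_distrib)

lemma cmean_diff: "cmean n (\<lambda>T. \<phi> T - \<psi> T) = cmean n \<phi> - cmean n \<psi>"
  by (simp only: cmean_def treesum_diff diff_divide_distrib)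

lemma cmean_cmult: "cmean n (\<lambda>T. c * \<phi> T) = c * cmean n \<phi>"
  by (simp only: cmean_def treesum_cmult times_divide_eq_right)

lemma cmean_mono: "(\<And>T. tree_order T = n \<Longrightarrow> \<phi> T \<le> \<psi> T) \<Longrightarrow> cmean n \<phi> \<le> cmean n \<psi>"
  unfolding cmean_def by (intro divide_right_mono treesum_mono treesum_one_nonneg)

lemma cmean_cong: "(\<And>T. tree_order T = n \<Longrightarrow> \<phi> T = \<psi> T) \<Longrightarrow> cmean n \<phi> = cmean n \<psi>"
  unfolding cmean_def by (intro arg_cong2[of _ _ _ _ "(/)"] treesum_cong refl)

lemma cmean_abs: "\<bar>cmean n \<phi>\<bar> \<le> cmean n (\<lambda>T. \<bar>\<phi> T\<bar>)"
  unfolding cmean_def abs_divide abs_of_nonneg[OF treesum_one_nonneg]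
  by (intro divide_right_mono abs_treesum_le treesum_one_nonneg)

lemma cmean_nonneg: "(\<And>T. 0 \<le> \<phi> T) \<Longrightarrow> 0 \<le> cmean n \<phi>"
  unfolding cmean_def by (intro divide_nonneg_nonneg treesum_nonneg treesum_one_nonneg) auto

lemma cmean_const_le: "0 \<le> c \<Longrightarrow> cmean n (\<lambda>_. c) \<le> c"
  using treesum_cmult[of c "\<lambda>_. 1" n] by (simp add: cmean_def)

text \<open>Writes the conditional second moment as a weighted Euclidean norm, so that Minkowski and
  Cauchy-Schwarz come from \<open>L2_set\<close>.\<close>

lemma cmean_L2: "sqrt (cmean n (\<lambda>T. (\<phi> T)\<^sup>2)) = L2_set (\<lambda>T. sqrt (wt T / mass n) * \<phi> T) (trees n)"
proof -
  have "0 \<le> wt T / mass n" for T by (simp add: treesum_one_nonneg)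
  then show ?thesis
    by (simp add: L2_set_def cmean_def treesum_def[of "\<lambda>T. (\<phi> T)\<^sup>2"] sum_divide_distrib power_mult_distrib real_sqrt_pow2)
qed

lemma cmean_minkowski: "\<bar>sqrt (cmean n (\<lambda>T. (\<phi> T)\<^sup>2)) - sqrt (cmean n (\<lambda>T. (\<psi> T)\<^sup>2))\<bar> \<le> sqrt (cmean n (\<lambda>T. (\<phi> T - \<psi> T)\<^sup>2))"
proof -
  let ?w = "\<lambda>T. sqrt (wt T / mass n)"
  have tri: "sqrt (cmean n (\<lambda>T. (\<phi> T)\<^sup>2)) \<le> sqrt (cmean n (\<lambda>T. (\<psi> T)\<^sup>2)) + sqrt (cmean n (\<lambda>T. (\<phi> T - \<psi> T)\<^sup>2))" for \<phi> \<psi>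
  proof -
    have "L2_set (\<lambda>T. ?w T * \<psi> T + ?w T * (\<phi> T - \<psi> T)) (trees n) \<le> L2_set (\<lambda>T. ?w T * \<psi> T) (trees n) + L2_set (\<lambda>T. ?w T * (\<phi> T - \<psi> T)) (trees n)"
      by (rule L2_set_triangle_ineq)
    moreover have "?w T * \<psi> T + ?w T * (\<phi> T - \<psi> T) = ?w T * \<phi> T" for T by (simp add: right_diff_distrib)
    ultimately show ?thesis by (simp only: cmean_L2)
  qed
  have "(\<psi> T - \<phi> T)\<^sup>2 = (\<phi> T - \<psi> T)\<^sup>2" for T by (rule power2_commute)
  then show ?thesis using tri[of \<phi> \<psi>] tri[of \<psi> \<phi>] by (simp only: abs_le_iff) linarith
qed

lemma cmean_abs_le_L2: "cmean n (\<lambda>T. \<bar>\<phi> T\<bar>) \<le> sqrt (cmean n (\<lambda>T. (\<phi> T)\<^sup>2))"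
proof -
  let ?w = "\<lambda>T. sqrt (wt T / mass n)"
  have w: "0 \<le> wt T / mass n" for T by (simp add: treesum_one_nonneg)
  have "cmean n (\<lambda>T. \<bar>\<phi> T\<bar>) = (\<Sum>T\<in>trees n. \<bar>?w T * \<phi> T\<bar> * \<bar>?w T * 1\<bar>)"
    unfolding cmean_def treesum_def[of "\<lambda>T. \<bar>\<phi> T\<bar>"] sum_divide_distrib
  proof (intro sum.cong refl)
    fix T
    have sq: "\<bar>a * x\<bar> * \<bar>a * 1\<bar> = a * a * \<bar>x\<bar>" if "0 \<le> a" for a x :: real using that by (simp add: abs_mult)
    have "\<bar>?w T * \<phi> T\<bar> * \<bar>?w T * 1\<bar> = (?w T * ?w T) * \<bar>\<phi> T\<bar>" using w[of T] by (intro sq) simp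
    also have "?w T * ?w T = wt T / mass n" by (simp only: real_sqrt_mult_self abs_of_nonneg[OF w])
    finally show "wt T * \<bar>\<phi> T\<bar> / mass n = \<bar>?w T * \<phi> T\<bar> * \<bar>?w T * 1\<bar>" by simp
  qed
  also have "\<dots> \<le> sqrt (cmean n (\<lambda>T. (\<phi> T)\<^sup>2)) * sqrt (cmean n (\<lambda>T. 1\<^sup>2))"
    unfolding cmean_L2 by (rule L2_set_mult_ineq)
  also have "\<dots> \<le> sqrt (cmean n (\<lambda>T. (\<phi> T)\<^sup>2)) * 1"
    using cmean_const_le[of 1 n] by (intro mult_left_mono) (auto intro: cmean_nonneg)
  finally show ?thesis by simp
qed

text \<open>The scaled L2 norms of the \<open>Y j\<close> approximate that of \<open>X\<close>, so
  the square roots of the \<open>v j\<close> converge and define the limit variance. Mean and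
  characteristic function follow from the L1 bound, as sine and cosine are Lipschitz.\<close>

lemma L2_limit:
  fixes X Y
  assumes F: "F \<noteq> bot" "F \<le> sequentially"
    and Y2: "\<And>j. ((\<lambda>n. cmean n (\<lambda>T. (Y j T)\<^sup>2) / real n) \<longlongrightarrow> v j) F"
    and Y1: "\<And>j. ((\<lambda>n. cmean n (Y j) / sqrt (real n)) \<longlongrightarrow> 0) F"
    and Yc: "\<And>j u. ((\<lambda>n. cmean n (\<lambda>T. cos (u * Y j T / sqrt (real n)))) \<longlongrightarrow> exp (- u\<^sup>2 * v j / 2)) F"
    and Ys: "\<And>j u. ((\<lambda>n. cmean n (\<lambda>T. sin (u * Y j T / sqrt (real n)))) \<longlongrightarrow> 0) F"
    and XY: "\<And>j. \<forall>\<^sub>F n in F. cmean n (\<lambda>T. (X n T - Y j T)\<^sup>2) \<le> (1 / (real j + 1))\<^sup>2 * real n"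
  obtains \<gamma>2 where "0 \<le> \<gamma>2" "((\<lambda>n. cmean n (\<lambda>T. (X n T)\<^sup>2) / real n) \<longlongrightarrow> \<gamma>2) F"
    "((\<lambda>n. cmean n (X n) / sqrt (real n)) \<longlongrightarrow> 0) F"
    "\<And>u. ((\<lambda>n. cmean n (\<lambda>T. cos (u * X n T / sqrt (real n)))) \<longlongrightarrow> exp (- u\<^sup>2 * \<gamma>2 / 2)) F"
    "\<And>u. ((\<lambda>n. cmean n (\<lambda>T. sin (u * X n T / sqrt (real n)))) \<longlongrightarrow> 0) F"
proof -
  define e where "e j = 1 / (real j + 1)" for j
  have e0: "0 \<le> e j" for j by (simp add: e_def)
  have el: "e \<longlonglongrightarrow> 0" unfolding e_def by real_asymp
  have n1: "\<forall>\<^sub>F n in F. 1 \<le> n" using F(2) by (rule filter_leD) (rule eventually_ge_at_top)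
  have d: "\<forall>\<^sub>F n in F. 1 \<le> n \<and> sqrt (cmean n (\<lambda>T. (X n T - Y j T)\<^sup>2)) \<le> e j * sqrt (real n)" for j
    using XY[of j] n1
  proof eventually_elim
    case (elim n)
    have "sqrt (cmean n (\<lambda>T. (X n T - Y j T)\<^sup>2)) \<le> sqrt ((e j)\<^sup>2 * real n)"
      using elim(1) unfolding e_def by (rule real_sqrt_le_mono)
    then show ?case using elim(2) e0[of j] by (simp add: real_sqrt_mult)
  qed
  have d1: "\<forall>\<^sub>F n in F. 1 \<le> n \<and> cmean n (\<lambda>T. \<bar>X n T - Y j T\<bar>) \<le> e j * sqrt (real n)" for j
    using d[of j]
  proof eventually_elim
    case (elim n)
    then show ?case using cmean_abs_le_L2[of n "\<lambda>T. X n T - Y j T"] by linarith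
  qed
  have sv: "((\<lambda>n. sqrt (cmean n (\<lambda>T. (Y j T)\<^sup>2) / real n)) \<longlongrightarrow> sqrt (v j)) F" for j
    by (rule tendsto_real_sqrt[OF Y2])
  have ap: "\<forall>\<^sub>F n in F. \<bar>sqrt (cmean n (\<lambda>T. (X n T)\<^sup>2) / real n) - sqrt (cmean n (\<lambda>T. (Y j T)\<^sup>2) / real n)\<bar> \<le> 1 / (real j + 1)" for j
    using d[of j]
  proof eventually_elim
    case (elim n)
    have "\<bar>sqrt (cmean n (\<lambda>T. (X n T)\<^sup>2)) - sqrt (cmean n (\<lambda>T. (Y j T)\<^sup>2))\<bar> \<le> e j * sqrt (real n)"
      using cmean_minkowski[of n "X n" "Y j"] elim by linarith
    then have "\<bar>sqrt (cmean n (\<lambda>T. (X n T)\<^sup>2)) - sqrt (cmean n (\<lambda>T. (Y j T)\<^sup>2))\<bar> / sqrt (real n) \<le> e j"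
      using elim by (simp add: pos_divide_le_eq)
    then show ?case by (simp add: e_def real_sqrt_divide diff_divide_distrib[symmetric])
  qed
  obtain s where s: "((\<lambda>n. sqrt (cmean n (\<lambda>T. (X n T)\<^sup>2) / real n)) \<longlongrightarrow> s) F" "(\<lambda>j. sqrt (v j)) \<longlonglongrightarrow> s"
    using tendsto_family_exists[OF F(1) sv ap] by blast
  have v0: "0 \<le> v j" for j
    by (rule tendsto_lowerbound[OF Y2 _ F(1)]) (auto intro!: always_eventually divide_nonneg_nonneg cmean_nonneg)
  have vs: "v \<longlonglongrightarrow> s\<^sup>2" using tendsto_power[OF s(2), of 2] v0 by (simp add: real_sqrt_pow2)
  have "((\<lambda>n. cmean n (\<lambda>T. (X n T)\<^sup>2) / real n) \<longlongrightarrow> s\<^sup>2) F"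
    using tendsto_power[OF s(1), of 2] by (simp add: real_sqrt_pow2 cmean_nonneg)
  moreover have "((\<lambda>n. cmean n (X n) / sqrt (real n)) \<longlongrightarrow> 0) F"
  proof (rule tendsto_approx_family[OF _ Y1 el tendsto_const])
    fix j
    show "\<forall>\<^sub>F n in F. norm (cmean n (X n) / sqrt (real n) - cmean n (Y j) / sqrt (real n)) \<le> e j"
      using d1[of j]
    proof eventually_elim
      case (elim n)
      have "\<bar>cmean n (X n) - cmean n (Y j)\<bar> \<le> e j * sqrt (real n)"
        using cmean_abs[of n "\<lambda>T. X n T - Y j T"] elim by (simp add: cmean_diff)
      then show ?case using elim by (simp add: diff_divide_distrib[symmetric] pos_divide_le_eq)
    qed
  qed
  moreover have cs: "\<forall>\<^sub>F n in F. norm (cmean n (\<lambda>T. h (u * X n T / sqrt (real n))) - cmean n (\<lambda>T. h (u * Y j T / sqrt (real n)))) \<le> \<bar>u\<bar> * e j"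
    if h: "\<And>x y. \<bar>h x - h y\<bar> \<le> \<bar>x - y\<bar>" for h :: "real \<Rightarrow> real" and u j
    using d1[of j]
  proof eventually_elim
    case (elim n)
    have "\<bar>cmean n (\<lambda>T. h (u * X n T / sqrt (real n))) - cmean n (\<lambda>T. h (u * Y j T / sqrt (real n)))\<bar>
        \<le> cmean n (\<lambda>T. \<bar>h (u * X n T / sqrt (real n)) - h (u * Y j T / sqrt (real n))\<bar>)"
      unfolding cmean_diff[symmetric] by (rule cmean_abs)
    also have "\<dots> \<le> cmean n (\<lambda>T. \<bar>u\<bar> / sqrt (real n) * \<bar>X n T - Y j T\<bar>)"
    proof (rule cmean_mono)
      fix T
      have "u * X n T / sqrt (real n) - u * Y j T / sqrt (real n) = u / sqrt (real n) * (X n T - Y j T)"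
        by (simp add: right_diff_distrib)
      then show "\<bar>h (u * X n T / sqrt (real n)) - h (u * Y j T / sqrt (real n))\<bar> \<le> \<bar>u\<bar> / sqrt (real n) * \<bar>X n T - Y j T\<bar>"
        using h[of "u * X n T / sqrt (real n)" "u * Y j T / sqrt (real n)"] by (simp add: abs_mult)
    qed
    also have "\<dots> = \<bar>u\<bar> / sqrt (real n) * cmean n (\<lambda>T. \<bar>X n T - Y j T\<bar>)" by (rule cmean_cmult)
    also have "\<dots> \<le> \<bar>u\<bar> / sqrt (real n) * (e j * sqrt (real n))" using elim by (intro mult_left_mono) auto
    also have "\<dots> = \<bar>u\<bar> * e j" using elim by simp
    finally show ?case by simp
  qed
  have lip: "\<bar>cos x - cos y\<bar> \<le> \<bar>x - y\<bar>" "\<bar>sin x - sin y\<bar> \<le> \<bar>x - y\<bar>" for x y :: real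
    using norm_cis_diff_le[of x y] abs_Re_le_cmod[of "cis x - cis y"] abs_Im_le_cmod[of "cis x - cis y"] by auto
  have ue: "(\<lambda>j. \<bar>u\<bar> * e j) \<longlonglongrightarrow> 0" for u using tendsto_mult_right_zero[OF el] .
  have "((\<lambda>n. cmean n (\<lambda>T. cos (u * X n T / sqrt (real n)))) \<longlongrightarrow> exp (- u\<^sup>2 * s\<^sup>2 / 2)) F" for u
    by (rule tendsto_approx_family[OF cs[OF lip(1)] Yc ue]) (intro tendsto_intros vs; simp)
  moreover have "((\<lambda>n. cmean n (\<lambda>T. sin (u * X n T / sqrt (real n)))) \<longlongrightarrow> 0) F" for u
    by (rule tendsto_approx_family[OF cs[OF lip(2)] Ys ue tendsto_const])
  ultimately show thesis using that[of "s\<^sup>2"] by simp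
qed

lemma gseq_nontrivial: "gseq \<noteq> bot"
proof -
  have "\<exists>n\<ge>N. n \<in> good" for N
  proof (intro exI[of _ "1 + span * N"] conjI)
    have "1 * N \<le> span * N" using span_pos by (intro mult_le_mono1) simp
    then show "N \<le> 1 + span * N" by linarith
  qed (simp add: good_def)
  then show ?thesis unfolding trivial_limit_def eventually_gseq by blast
qed

lemma treesum_one_lower: "\<exists>c>0. \<forall>\<^sub>F n in gseq. c \<le> real n * sqrt (real n) * mass n"
proof -
  obtain c where c: "0 < c" "\<forall>\<^sub>F n in gseq. c / sqrt (real n) \<le> PS n (n - 1)" using PS_good_lower by blast
  have ev: "\<forall>\<^sub>F n in gseq. 1 \<le> n" unfolding eventually_gseq by auto
  have "\<forall>\<^sub>F n in gseq. c \<le> real n * sqrt (real n) * mass n"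
    using c(2) ev
  proof eventually_elim
    case (elim n)
    then have "c \<le> PS n (n - 1) * sqrt (real n)" by (simp add: pos_divide_le_eq)
    then show ?case using elim(2) by (simp add: treesum_one mult_ac)
  qed
  then show ?thesis using c(1) by blast
qed

lemma treesum_leaf: "treesum (\<lambda>T. of_bool (tree_order T = 1)) n = (if n = 1 then p 0 else 0)"
proof (cases "n = 1")
  case True
  then show ?thesis using trees_1[of "Node []"] treesum_1[of "\<lambda>T. of_bool (tree_order T = 1)"] by simp
next
  case False
  then have "treesum (\<lambda>T. of_bool (tree_order T = 1)) n = treesum (\<lambda>T. 0 * 1) n" by (intro treesum_cong) auto
  then show ?thesis using False by (simp only: treesum_cmult) simp
qed

end

section \<open>Limits for functionals of small mean on large trees\<close>

context critical_offspring
begin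

theorem weakly_local_limits:
  assumes B: "\<And>T. \<bar>f T\<bar> \<le> B" and wl: "weakly_local_at M f"
    and sm: "summable (\<lambda>n. sqrt (real n + 1) * \<bar>treesum f n\<bar>)"
    and sup: "(\<lambda>n. w3 n * \<bar>treesum f n\<bar>) \<longlonglongrightarrow> 0"
    and \<mu>: "treesum f sums \<mu>"
  defines "X \<equiv> \<lambda>n T. additive_functional f T - real n * \<mu>"
  obtains \<gamma>2 where "0 \<le> \<gamma>2" "((\<lambda>n. cmean n (\<lambda>T. (X n T)\<^sup>2) / real n) \<longlongrightarrow> \<gamma>2) gseq"
    "((\<lambda>n. cmean n (X n) / sqrt (real n)) \<longlongrightarrow> 0) gseq"
    "\<And>u. ((\<lambda>n. cmean n (\<lambda>T. cos (u * X n T / sqrt (real n)))) \<longlongrightarrow> exp (- u\<^sup>2 * \<gamma>2 / 2)) gseq"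
    "\<And>u. ((\<lambda>n. cmean n (\<lambda>T. sin (u * X n T / sqrt (real n)))) \<longlongrightarrow> 0) gseq"
proof -
  define lf where "lf T = (of_bool (tree_order T = 1) :: real)" for T
  \<comment> \<open>The mean is removed on the leaf alone. All orders above 1 keep their values, so
    the decay hypotheses survive.\<close>
  define f' where "f' T = f T - \<mu> / p 0 * lf T" for T
  have p0: "0 < p 0" by (rule zero_in_support)
  have B0: "0 \<le> B" using B[of "Node []"] by linarith
  have lfN: "lf (Node []) = 1" using trees_1[of "Node []"] by (simp add: lf_def)
  have lf01: "\<bar>lf T\<bar> \<le> 1" for T by (simp add: lf_def)
  have tlf: "treesum lf n = (if n = 1 then p 0 else 0)" for n unfolding lf_def[abs_def] by (rule treesum_leaf)
  have tf': "treesum f' n = treesum f n - (if n = 1 then \<mu> else 0)" for n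
    unfolding f'_def[abs_def] treesum_diff treesum_cmult tlf using p0 by simp
  have sums1: "(\<lambda>n. if n = 1 then a else 0) sums a" for a :: real using sums_single[of 1 "\<lambda>_. a"] by simp
  have f'0: "treesum f' sums 0"
    using sums_diff[OF \<mu> sums1[of \<mu>]] by (simp add: tf'[abs_def])
  have evf': "\<forall>\<^sub>F n in sequentially. treesum f' n = treesum f n"
    using eventually_ge_at_top[of 2] by eventually_elim (simp add: tf')
  define B1 where "B1 = B + \<bar>\<mu> / p 0\<bar>"
  have f'B: "\<bar>f' T\<bar> \<le> B1" for T
  proof -
    have "\<bar>f' T\<bar> \<le> \<bar>f T\<bar> + \<bar>\<mu> / p 0\<bar> * \<bar>lf T\<bar>" unfolding f'_def abs_mult[symmetric] by (rule abs_triangle_ineq4)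
    also have "\<dots> \<le> B + \<bar>\<mu> / p 0\<bar> * 1" by (intro add_mono B mult_left_mono lf01) simp
    finally show ?thesis by (simp add: B1_def)
  qed
  define S where "S n = sqrt (real n + 1) * \<bar>treesum f' n\<bar>" for n
  have S0: "0 \<le> S n" for n by (simp add: S_def)
  have sS: "summable S"
  proof -
    have "\<forall>\<^sub>F n in sequentially. S n = sqrt (real n + 1) * \<bar>treesum f n\<bar>"
      using evf' by eventually_elim (simp add: S_def)
    from summable_cong[OF this] sm show ?thesis by simp
  qed
  define D where "D n = w3 n * \<bar>treesum f' n\<bar>" for n
  have Dl: "D \<longlonglongrightarrow> 0"
    using sup by (rule Lim_transform_eventually) (use evf' in eventually_elim, simp add: D_def)
  \<comment> \<open>Minus the mass of \<open>f'\<close> up to order K, hence the mass beyond K.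
    Moved to the leaf, it gives both parts mean zero, and it tends to 0.\<close>
  define c where "c K = - (\<Sum>k\<le>K. treesum f' k)" for K
  have cl: "c \<longlonglongrightarrow> 0"
  proof -
    have "(\<lambda>K. \<Sum>k\<le>K. treesum f' k) \<longlonglongrightarrow> 0" using f'0 by (simp add: sums_def_le)
    from tendsto_minus[OF this] show ?thesis by (simp add: c_def[abs_def])
  qed
  define t where "t K = suminf S - (\<Sum>k\<le>K. S k)" for K
  have tl: "t \<longlonglongrightarrow> 0"
    using tendsto_diff[OF tendsto_const[of "suminf S"], of "\<lambda>K. \<Sum>k\<le>K. S k" "suminf S"] summable_sums[OF sS]
    by (simp add: sums_def_le t_def[abs_def])
  define g where "g K T = (if tree_order T \<le> K then 0 else f' T) - c K / p 0 * lf T" for K T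
  have cut: "(\<lambda>n. if n \<le> K then 0 else a n) sums (L - (\<Sum>k\<le>K. a k))" if "a sums L" for a :: "nat \<Rightarrow> real" and L K
  proof -
    have "(\<lambda>n. a n - (if n \<in> {..K} then a n else 0)) sums (L - (\<Sum>k\<le>K. a k))"
      by (rule sums_diff[OF that sums_If_finite_set]) simp
    moreover have "(\<lambda>n. a n - (if n \<in> {..K} then a n else 0)) = (\<lambda>n. if n \<le> K then 0 else a n)" by auto
    ultimately show ?thesis by simp
  qed
  have tg: "treesum (g K) n = (if n \<le> K then 0 else treesum f' n) - (if n = 1 then c K else 0)" for K n
  proof -
    have "treesum (\<lambda>T. if tree_order T \<le> K then 0 else f' T) n = (if n \<le> K then 0 else treesum f' n)"
    proof (cases "n \<le> K")
      case True
      then have "treesum (\<lambda>T. if tree_order T \<le> K then 0 else f' T) n = treesum (\<lambda>T. 0 * 1) n" by (intro treesum_cong) simp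
      then show ?thesis using True by (simp only: treesum_cmult) simp
    next
      case False
      then have "treesum (\<lambda>T. if tree_order T \<le> K then 0 else f' T) n = treesum f' n" by (intro treesum_cong) simp
      then show ?thesis using False by simp
    qed
    then show ?thesis unfolding g_def[abs_def] treesum_diff treesum_cmult tlf using p0 by simp
  qed
  have g0: "treesum (g K) sums 0" for K
    using sums_diff[OF cut[OF f'0, of K] sums1[of "c K"]] by (simp add: tg[abs_def] c_def)
  \<comment> \<open>The extra unit is room for the leaf correction, which is at most \<epsilon>
    \<le> 1.\<close>
  define B2 where "B2 = B1 + 1"
  have B2: "0 \<le> B2" using f'B[of "Node []"] by (simp add: B2_def)
  obtain C where C: "0 < C" and CC: "\<And>g K \<epsilon>. (\<forall>T. \<bar>g T\<bar> \<le> B2) \<Longrightarrow> weakly_local_at M g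
    \<Longrightarrow> (\<forall>T. tree_order T \<noteq> 1 \<longrightarrow> tree_order T \<le> K \<longrightarrow> g T = 0)
    \<Longrightarrow> (\<Sum>n. treesum g n) = 0 \<Longrightarrow> summable (\<lambda>n. sqrt (real n + 1) * \<bar>treesum g n\<bar>)
    \<Longrightarrow> (\<Sum>n. sqrt (real n + 1) * \<bar>treesum g n\<bar>) \<le> \<epsilon> \<Longrightarrow> (\<forall>n. w3 n * \<bar>treesum g n\<bar> \<le> \<epsilon>)
    \<Longrightarrow> \<bar>g (Node [])\<bar> \<le> \<epsilon> \<Longrightarrow> \<epsilon> \<le> 1
    \<Longrightarrow> (\<forall>n. \<bar>treesum (\<lambda>T. (additive_functional g T)\<^sup>2) n\<bar> \<le> C * (\<epsilon> + 1 / sqrt (real K + 1)) / sqrt (real n + 1))"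
    using additive_functional_second_moment[OF B2, of M] by blast
  have rem: "\<forall>\<^sub>F K in sequentially. \<forall>n. \<bar>treesum (\<lambda>T. (additive_functional (g K) T)\<^sup>2) n\<bar>
      \<le> C * (\<epsilon> + 1 / sqrt (real K + 1)) / sqrt (real n + 1)" if \<epsilon>: "0 < \<epsilon>" "\<epsilon> \<le> 1" for \<epsilon>
  proof -
    have e1: "\<forall>\<^sub>F K in sequentially. t K + sqrt 2 * \<bar>c K\<bar> < \<epsilon>"
    proof (rule order_tendstoD(2)[OF _ \<epsilon>(1)])
      show "(\<lambda>K. t K + sqrt 2 * \<bar>c K\<bar>) \<longlonglongrightarrow> 0"
        using tendsto_add[OF tl tendsto_mult_right_zero[OF tendsto_rabs_zero[OF cl]]] by simp
    qed
    have e2: "\<forall>\<^sub>F K in sequentially. w3 1 * \<bar>c K\<bar> < \<epsilon>"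
      by (rule order_tendstoD(2)[OF tendsto_mult_right_zero[OF tendsto_rabs_zero[OF cl]] \<epsilon>(1)])
    have e3: "\<forall>\<^sub>F K in sequentially. 1 / p 0 * \<bar>c K\<bar> < \<epsilon>"
      by (rule order_tendstoD(2)[OF tendsto_mult_right_zero[OF tendsto_rabs_zero[OF cl]] \<epsilon>(1)])
    have e4: "\<forall>\<^sub>F K in sequentially. \<forall>n\<ge>K. D n < \<epsilon>"
      using order_tendstoD(2)[OF Dl \<epsilon>(1)] by (rule eventually_all_ge_at_top)
    show ?thesis using e1 e2 e3 e4 eventually_ge_at_top[of 1]
    proof eventually_elim
      case (elim K)
      have ck: "\<bar>c K / p 0\<bar> \<le> \<epsilon>" using elim(3) p0 by simp
      show ?case
      proof (rule CC)
        show "\<forall>T. \<bar>g K T\<bar> \<le> B2"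
        proof
          fix T
          have "\<bar>g K T\<bar> \<le> \<bar>if tree_order T \<le> K then 0 else f' T\<bar> + \<bar>c K / p 0\<bar> * \<bar>lf T\<bar>"
            unfolding g_def abs_mult[symmetric] by (rule abs_triangle_ineq4)
          also have "\<dots> \<le> B1 + 1 * 1"
            using f'B[of T] ck \<epsilon> by (intro add_mono mult_mono lf01) auto
          finally show "\<bar>g K T\<bar> \<le> B2" by (simp add: B2_def)
        qed
        show "weakly_local_at M (g K)" unfolding weakly_local_at_def
        proof (intro allI impI)
          fix T T' assume a: "tree_order T = tree_order T' \<and> truncate M T = truncate M T'"
          then have "f T = f T'" using wl unfolding weakly_local_at_def by blast
          then show "g K T = g K T'" using a by (simp add: g_def f'_def lf_def)
        qed
        show "\<forall>T. tree_order T \<noteq> 1 \<longrightarrow> tree_order T \<le> K \<longrightarrow> g K T = 0" by (simp add: g_def lf_def)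
        show "(\<Sum>n. treesum (g K) n) = 0" using sums_unique[OF g0[of K]] by simp
        have le: "sqrt (real n + 1) * \<bar>treesum (g K) n\<bar> \<le> (if n \<le> K then 0 else S n) + (if n = 1 then sqrt 2 * \<bar>c K\<bar> else 0)" for n
          using elim(5) by (simp add: tg S_def)
        have su: "(\<lambda>n. (if n \<le> K then 0 else S n) + (if n = 1 then sqrt 2 * \<bar>c K\<bar> else 0)) sums (t K + sqrt 2 * \<bar>c K\<bar>)"
          unfolding t_def by (intro sums_add cut summable_sums sS sums1)
        show sg: "summable (\<lambda>n. sqrt (real n + 1) * \<bar>treesum (g K) n\<bar>)"
          by (rule summable_comparison_test'[OF sums_summable[OF su], of 0]) (use le in simp)
        have "(\<Sum>n. sqrt (real n + 1) * \<bar>treesum (g K) n\<bar>) \<le> t K + sqrt 2 * \<bar>c K\<bar>"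
          by (rule sums_le[OF le summable_sums[OF sg] su])
        then show "(\<Sum>n. sqrt (real n + 1) * \<bar>treesum (g K) n\<bar>) \<le> \<epsilon>" using elim(1) by linarith
        show "\<forall>n. w3 n * \<bar>treesum (g K) n\<bar> \<le> \<epsilon>"
        proof
          fix n
          consider "n = 1" | "n \<noteq> 1" "n \<le> K" | "K < n" "n \<noteq> 1" by linarith
          then show "w3 n * \<bar>treesum (g K) n\<bar> \<le> \<epsilon>"
          proof cases
            case 1 then show ?thesis using elim(2,5) by (simp add: tg)
          next
            case 2 then show ?thesis using \<epsilon> by (simp add: tg)
          next
            case 3 then show ?thesis using elim(4) by (simp add: tg D_def less_imp_le)
          qed
        qed
        show "\<bar>g K (Node [])\<bar> \<le> \<epsilon>"
          using elim(5) ck trees_1[of "Node []"] by (simp add: g_def lfN)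
        show "\<epsilon> \<le> 1" by (rule \<epsilon>)
      qed
    qed
  qed
  obtain q where q: "0 < q" "\<forall>\<^sub>F n in gseq. q \<le> real n * sqrt (real n) * mass n"
    using treesum_one_lower by blast
  have app: "\<exists>K\<ge>1. \<forall>\<^sub>F n in gseq. cmean n (\<lambda>T. (additive_functional (g K) T + \<mu> / s2)\<^sup>2) \<le> \<delta> * real n" if \<delta>: "0 < \<delta>" for \<delta>
  proof -
    \<comment> \<open>Two terms of at most r each, and the factor 2 from (x + y)^2 \<le> 2 x^2 + 2
      y^2, yield \<delta> / 2 for the functional and leave \<delta> / 2 for the constant \<mu> /
      s2.\<close>
    define r where "r = \<delta> * q / (8 * C)"
    have r: "0 < r" using \<delta> q(1) C by (simp add: r_def)
    have "(\<lambda>K. 1 / sqrt (real K + 1)) \<longlonglongrightarrow> 0" by real_asymp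
    then have "\<forall>\<^sub>F K in sequentially. 1 / sqrt (real K + 1) < r" using r by (intro order_tendstoD(2)) auto
    moreover have "\<forall>\<^sub>F K in sequentially. \<forall>n. \<bar>treesum (\<lambda>T. (additive_functional (g K) T)\<^sup>2) n\<bar>
        \<le> C * (min 1 r + 1 / sqrt (real K + 1)) / sqrt (real n + 1)" using r by (intro rem) auto
    ultimately have "\<forall>\<^sub>F K in sequentially. 1 \<le> K \<and> 1 / sqrt (real K + 1) < r \<and> (\<forall>n. \<bar>treesum (\<lambda>T. (additive_functional (g K) T)\<^sup>2) n\<bar>
        \<le> C * (min 1 r + 1 / sqrt (real K + 1)) / sqrt (real n + 1))"
      using eventually_ge_at_top[of 1] by eventually_elim blast
    then obtain K where K: "1 \<le> K" "1 / sqrt (real K + 1) < r"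
      "\<And>n. \<bar>treesum (\<lambda>T. (additive_functional (g K) T)\<^sup>2) n\<bar> \<le> C * (min 1 r + 1 / sqrt (real K + 1)) / sqrt (real n + 1)"
      using eventually_happens'[OF sequentially_bot] by blast
    obtain N where N: "4 * (\<mu> / s2)\<^sup>2 / \<delta> \<le> real N" using real_arch_simple by blast
    have evN: "\<forall>\<^sub>F n in gseq. N \<le> n \<and> 1 \<le> n" unfolding eventually_gseq by (intro exI[of _ "max N 1"]) auto
    have "\<forall>\<^sub>F n in gseq. cmean n (\<lambda>T. (additive_functional (g K) T + \<mu> / s2)\<^sup>2) \<le> \<delta> * real n"
      using q(2) evN
    proof eventually_elim
      case (elim n)
      let ?G = "\<lambda>T. (additive_functional (g K) T)\<^sup>2"
      define z where "z = mass n"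
      have nz: "0 < real n * sqrt (real n)" using elim(2) by simp
      then have z: "0 < z" using elim(1) q(1) unfolding z_def by (metis less_le_trans zero_less_mult_pos)
      have "cmean n (\<lambda>T. (additive_functional (g K) T + \<mu> / s2)\<^sup>2) \<le> cmean n (\<lambda>T. 2 * ?G T + 2 * (\<mu> / s2)\<^sup>2)"
      proof (rule cmean_mono)
        fix T show "(additive_functional (g K) T + \<mu> / s2)\<^sup>2 \<le> 2 * ?G T + 2 * (\<mu> / s2)\<^sup>2"
          using zero_le_power2[of "additive_functional (g K) T - \<mu> / s2"] unfolding power2_sum power2_diff by linarith
      qed
      also have "\<dots> = 2 * cmean n ?G + cmean n (\<lambda>_. 2 * (\<mu> / s2)\<^sup>2)" by (simp only: cmean_add cmean_cmult[of n 2 ?G])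
      also have "\<dots> \<le> 2 * (\<delta> / 4 * real n) + 2 * (\<mu> / s2)\<^sup>2"
      proof (intro add_mono mult_left_mono cmean_const_le)
        have "treesum ?G n \<le> C * (r + r) / sqrt (real n)"
        proof -
          have "treesum ?G n \<le> C * (min 1 r + 1 / sqrt (real K + 1)) / sqrt (real n + 1)" using K(3)[of n] by linarith
          also have "\<dots> \<le> C * (r + r) / sqrt (real n)"
            using C r K(2) elim(2) by (intro frac_le mult_left_mono add_mono mult_nonneg_nonneg) auto
          finally show ?thesis .
        qed
        also have "\<dots> = \<delta> / 4 * (q / sqrt (real n))" using C by (simp add: r_def)
        also have "\<dots> \<le> \<delta> / 4 * (real n * z)"
        proof (intro mult_left_mono)
          have "q \<le> real n * z * sqrt (real n)" using elim(1) by (simp add: z_def mult_ac)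
          then show "q / sqrt (real n) \<le> real n * z" using elim(2) by (simp add: pos_divide_le_eq)
        qed (use \<delta> in simp)
        finally have "treesum ?G n \<le> \<delta> / 4 * real n * z" by (simp add: mult.assoc)
        then show "cmean n ?G \<le> \<delta> / 4 * real n" unfolding cmean_def z_def[symmetric] using z by (simp only: pos_divide_le_eq)
      qed auto
      also have "2 * (\<mu> / s2)\<^sup>2 \<le> \<delta> / 2 * real n"
      proof -
        have "4 * (\<mu> / s2)\<^sup>2 / \<delta> \<le> real n" using N elim(2) by linarith
        then have "4 * (\<mu> / s2)\<^sup>2 \<le> real n * \<delta>" using \<delta> by (simp only: pos_divide_le_eq)
        then show ?thesis by (simp add: mult.commute)
      qed
      finally show ?case by simp
    qed
    then show ?thesis using K(1) by blast
  qed
  have "\<exists>K\<ge>1. \<forall>\<^sub>F n in gseq. cmean n (\<lambda>T. (additive_functional (g K) T + \<mu> / s2)\<^sup>2) \<le> (1 / (real j + 1))\<^sup>2 * real n" for j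
    by (rule app) simp
  then obtain K where K: "\<And>j. 1 \<le> K j"
    "\<And>j. \<forall>\<^sub>F n in gseq. cmean n (\<lambda>T. (additive_functional (g (K j)) T + \<mu> / s2)\<^sup>2) \<le> (1 / (real j + 1))\<^sup>2 * real n"
    by metis
  define h where "h j T = (if tree_order T \<le> K j then f' T else 0) + c (K j) / p 0 * lf T" for j T
  define Y where "Y j = additive_functional (\<lambda>T. h j T + \<mu> * \<omega> (length (children T)))" for j
  have th: "(\<Sum>k\<le>K j. treesum (h j) k) = 0" for j
  proof -
    have "treesum (h j) k = treesum f' k + (if k = 1 then c (K j) else 0)" if "k \<le> K j" for k
    proof -
      have "treesum (\<lambda>T. if tree_order T \<le> K j then f' T else 0) k = treesum f' k"
        using that by (intro treesum_cong) simp
      then show ?thesis unfolding h_def[abs_def] treesum_add treesum_cmult tlf using p0 by simp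
    qed
    then have "(\<Sum>k\<le>K j. treesum (h j) k) = (\<Sum>k\<le>K j. treesum f' k) + (\<Sum>k\<le>K j. if k = 1 then c (K j) else 0)"
      by (simp add: sum.distrib)
    also have "(\<Sum>k\<le>K j. if k = 1 then c (K j) else 0) = c (K j)" using K(1)[of j] by (simp add: sum.delta)
    finally show ?thesis by (simp add: c_def)
  qed
  have hz: "h j T = 0" if "K j < tree_order T" for j T using that K(1)[of j] by (simp add: h_def lf_def)
  define Q where "Q j v \<longleftrightarrow> ((\<lambda>n. cmean n (\<lambda>T. (Y j T)\<^sup>2) / real n) \<longlongrightarrow> v) gseq \<and>
    ((\<lambda>n. cmean n (Y j) / sqrt (real n)) \<longlongrightarrow> 0) gseq \<and>
    (\<forall>u. ((\<lambda>n. cmean n (\<lambda>T. cos (u * Y j T / sqrt (real n)))) \<longlongrightarrow> exp (- u\<^sup>2 * v / 2)) gseq \<and>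
      ((\<lambda>n. cmean n (\<lambda>T. sin (u * Y j T / sqrt (real n)))) \<longlongrightarrow> 0) gseq)" for j v
  have "\<exists>v. Q j v" for j
    unfolding Q_def cmean_def Y_def by (rule truncated_limits[OF K(1) hz th])
  then have "\<forall>j. \<exists>v. Q j v" by blast
  from choice[OF this] obtain v where Q: "\<And>j. Q j (v j)" by blast
  have v: "((\<lambda>n. cmean n (\<lambda>T. (Y j T)\<^sup>2) / real n) \<longlongrightarrow> v j) gseq"
    "((\<lambda>n. cmean n (Y j) / sqrt (real n)) \<longlongrightarrow> 0) gseq"
    "((\<lambda>n. cmean n (\<lambda>T. cos (u * Y j T / sqrt (real n)))) \<longlongrightarrow> exp (- u\<^sup>2 * v j / 2)) gseq"
    "((\<lambda>n. cmean n (\<lambda>T. sin (u * Y j T / sqrt (real n)))) \<longlongrightarrow> 0) gseq" for j u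
    using Q[of j] unfolding Q_def by blast+
  \<comment> \<open>An exact identity: the leaf terms of \<open>f\<close> and of
    \<open>\<omega>\<close> cancel, the order in \<open>\<omega>\<close> accounts for n \<mu>, and
    its constant leaves \<mu> / s2.\<close>
  have XY: "X n T - Y j T = additive_functional (g (K j)) T + \<mu> / s2" if "tree_order T = n" for n T j
  proof -
    have "f = (\<lambda>T. (h j T + g (K j) T) + \<mu> / p 0 * lf T)" by (rule ext) (simp add: h_def g_def f'_def)
    then have "additive_functional f T = additive_functional (\<lambda>T. (h j T + g (K j) T) + \<mu> / p 0 * lf T) T" by (rule arg_cong2[OF _ refl])
    then have f: "additive_functional f T = additive_functional (h j) T + additive_functional (g (K j)) T + \<mu> / p 0 * additive_functional lf T"
      by (simp only: additive_functional_add additive_functional_cmult)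
    have "Y j T = additive_functional (h j) T + \<mu> * (additive_functional lf T / p 0 - real n - 1 / s2)"
      unfolding Y_def additive_functional_add additive_functional_cmult additive_functional_\<omega> lf_def[abs_def] that ..
    then show ?thesis unfolding X_def f by (simp add: algebra_simps)
  qed
  have XYE: "\<forall>\<^sub>F n in gseq. cmean n (\<lambda>T. (X n T - Y j T)\<^sup>2) \<le> (1 / (real j + 1))\<^sup>2 * real n" for j
    using K(2)[of j]
  proof eventually_elim
    case (elim n)
    have "cmean n (\<lambda>T. (X n T - Y j T)\<^sup>2) = cmean n (\<lambda>T. (additive_functional (g (K j)) T + \<mu> / s2)\<^sup>2)"
      by (rule cmean_cong) (simp only: XY)
    then show ?case using elim by simp
  qed
  show thesis
    by (rule L2_limit[OF gseq_nontrivial gseq_le v XYE]) (rule that)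
qed

end

context critical_offspring
begin

end

context critical_offspring
begin

lemma cmean_const: "n \<in> admissible \<xi> \<Longrightarrow> cmean n (\<lambda>_. c) = c"
  using treesum_cmult[of c "\<lambda>_. 1" n] by (simp add: cmean_def admissible_iff)

lemma cmean_eq: "cmean n \<phi> = (\<Sum>T\<in>trees n. wt T / mass n * \<phi> T)"
  by (simp add: cmean_def treesum_def[of \<phi>] sum_divide_distrib)

lemma limit_laws:
  assumes \<gamma>2: "0 \<le> \<gamma>2"
    and X: "\<And>T. X (tree_order T) T = additive_functional f T - real (tree_order T) * \<mu>"
    and X2: "((\<lambda>n. cmean n (\<lambda>T. (X n T)\<^sup>2) / real n) \<longlongrightarrow> \<gamma>2) gseq"
    and X1: "((\<lambda>n. cmean n (X n) / sqrt (real n)) \<longlongrightarrow> 0) gseq"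
    and Xc: "\<And>u. ((\<lambda>n. cmean n (\<lambda>T. cos (u * X n T / sqrt (real n)))) \<longlongrightarrow> exp (- u\<^sup>2 * \<gamma>2 / 2)) gseq"
    and Xs: "\<And>u. ((\<lambda>n. cmean n (\<lambda>T. sin (u * X n T / sqrt (real n)))) \<longlongrightarrow> 0) gseq"
  shows "(\<lambda>n. prob_space.expectation (cond_GW \<xi> n) (additive_functional f) - real n * \<mu>)
      \<in> o[adm_seq \<xi>](\<lambda>n. sqrt (real n))"
    and "(\<lambda>n. prob_space.variance (cond_GW \<xi> n) (additive_functional f) - real n * \<gamma>2)
      \<in> o[adm_seq \<xi>](\<lambda>n. real n)"
    and "weak_conv_m_along (adm_seq \<xi>)
      (\<lambda>n. distr (cond_GW \<xi> n) borel (\<lambda>T. (additive_functional f T - real n * \<mu>) / sqrt (real n)))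
      (normal_law 0 \<gamma>2)"
proof -
  note lim = tendsto_mono[OF adm_seq_le]
  have ev: "\<forall>\<^sub>F n in adm_seq \<xi>. n \<in> admissible \<xi> \<and> 1 \<le> n"
    unfolding adm_seq_def eventually_inf_principal by (rule eventually_sequentiallyI[of 1]) simp
  have mean: "prob_space.expectation (cond_GW \<xi> n) (additive_functional f) = cmean n (X n) + real n * \<mu>"
    if n: "n \<in> admissible \<xi>" for n
  proof -
    have "prob_space.expectation (cond_GW \<xi> n) (additive_functional f) = cmean n (additive_functional f)"
      using n by (simp add: expectation_cond_GW cmean_def)
    also have "\<dots> = cmean n (\<lambda>T. X n T + real n * \<mu>)" by (rule cmean_cong) (use X in auto)
    finally show ?thesis by (simp only: cmean_add cmean_const[OF n])
  qed
  have var: "prob_space.variance (cond_GW \<xi> n) (additive_functional f) = cmean n (\<lambda>T. (X n T)\<^sup>2) - (cmean n (X n))\<^sup>2"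
    if n: "n \<in> admissible \<xi>" for n
  proof -
    have "prob_space.variance (cond_GW \<xi> n) (additive_functional f) = cmean n (\<lambda>T. (additive_functional f T - (cmean n (X n) + real n * \<mu>))\<^sup>2)"
      unfolding mean[OF n] using n by (simp add: expectation_cond_GW cmean_def)
    also have "\<dots> = cmean n (\<lambda>T. ((X n T)\<^sup>2 - (2 * cmean n (X n)) * X n T) + (cmean n (X n))\<^sup>2)"
    proof (rule cmean_cong)
      fix T assume "tree_order T = n"
      then have e: "additive_functional f T - (cmean n (X n) + real n * \<mu>) = X n T - cmean n (X n)" using X[of T] by simp
      show "(additive_functional f T - (cmean n (X n) + real n * \<mu>))\<^sup>2 = ((X n T)\<^sup>2 - (2 * cmean n (X n)) * X n T) + (cmean n (X n))\<^sup>2"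
        unfolding e by (simp add: power2_diff)
    qed
    also have "\<dots> = cmean n (\<lambda>T. (X n T)\<^sup>2) - (2 * cmean n (X n)) * cmean n (X n) + (cmean n (X n))\<^sup>2"
      by (simp only: cmean_add cmean_diff cmean_cmult cmean_const[OF n])
    finally show ?thesis by (simp add: power2_eq_square)
  qed
  have nz: "\<forall>\<^sub>F n in adm_seq \<xi>. sqrt (real n) \<noteq> 0" "\<forall>\<^sub>F n in adm_seq \<xi>. real n \<noteq> 0"
    using ev by (eventually_elim, simp)+
  show "(\<lambda>n. prob_space.expectation (cond_GW \<xi> n) (additive_functional f) - real n * \<mu>) \<in> o[adm_seq \<xi>](\<lambda>n. sqrt (real n))"
  proof (rule smalloI_tendsto[OF _ nz(1)])
    show "((\<lambda>n. (prob_space.expectation (cond_GW \<xi> n) (additive_functional f) - real n * \<mu>) / sqrt (real n)) \<longlongrightarrow> 0) (adm_seq \<xi>)"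
      using lim[OF X1]
    proof (rule Lim_transform_eventually)
      show "\<forall>\<^sub>F n in adm_seq \<xi>. cmean n (X n) / sqrt (real n) = (prob_space.expectation (cond_GW \<xi> n) (additive_functional f) - real n * \<mu>) / sqrt (real n)"
        using ev by eventually_elim (simp add: mean)
    qed
  qed
  show "(\<lambda>n. prob_space.variance (cond_GW \<xi> n) (additive_functional f) - real n * \<gamma>2) \<in> o[adm_seq \<xi>](\<lambda>n. real n)"
  proof (rule smalloI_tendsto[OF _ nz(2)])
    have "((\<lambda>n. cmean n (\<lambda>T. (X n T)\<^sup>2) / real n - (cmean n (X n) / sqrt (real n))\<^sup>2 - \<gamma>2) \<longlongrightarrow> \<gamma>2 - 0\<^sup>2 - \<gamma>2) (adm_seq \<xi>)"
      by (intro tendsto_intros lim[OF X1] lim[OF X2])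
    then have "((\<lambda>n. cmean n (\<lambda>T. (X n T)\<^sup>2) / real n - (cmean n (X n) / sqrt (real n))\<^sup>2 - \<gamma>2) \<longlongrightarrow> 0) (adm_seq \<xi>)" by simp
    then show "((\<lambda>n. (prob_space.variance (cond_GW \<xi> n) (additive_functional f) - real n * \<gamma>2) / real n) \<longlongrightarrow> 0) (adm_seq \<xi>)"
    proof (rule Lim_transform_eventually)
      show "\<forall>\<^sub>F n in adm_seq \<xi>. cmean n (\<lambda>T. (X n T)\<^sup>2) / real n - (cmean n (X n) / sqrt (real n))\<^sup>2 - \<gamma>2
          = (prob_space.variance (cond_GW \<xi> n) (additive_functional f) - real n * \<gamma>2) / real n"
        using ev
      proof eventually_elim
        case (elim n)
        then show ?case unfolding var[OF conjunct1[OF elim]] by (simp add: power_divide diff_divide_distrib)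
      qed
    qed
  qed
  show "weak_conv_m_along (adm_seq \<xi>)
      (\<lambda>n. distr (cond_GW \<xi> n) borel (\<lambda>T. (additive_functional f T - real n * \<mu>) / sqrt (real n))) (normal_law 0 \<gamma>2)"
    unfolding adm_seq_def
  proof (rule levy_continuity_along)
    have m: "h \<in> borel_measurable (cond_GW \<xi> n)" for h :: "ptree \<Rightarrow> real" and n
    proof -
      have "sets (cond_GW \<xi> n) = UNIV" by (simp add: cond_GW_def sets_GW)
      then show ?thesis using measurable_cong_sets[of "cond_GW \<xi> n" "count_space UNIV" borel borel] by auto
    qed
    show "real_distribution (distr (cond_GW \<xi> n) borel (\<lambda>T. (additive_functional f T - real n * \<mu>) / sqrt (real n)))"
      if n: "n \<in> admissible \<xi>" for n
    proof -
      interpret prob_space "cond_GW \<xi> n" by (rule prob_space_cond_GW[OF n])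
      show ?thesis by (rule real_distribution_distr[OF m])
    qed
    show "real_distribution (normal_law 0 \<gamma>2)" by (rule char_normal_law[OF \<gamma>2])
    fix u
    have "((\<lambda>n. Complex (cmean n (\<lambda>T. cos (u * X n T / sqrt (real n)))) (cmean n (\<lambda>T. sin (u * X n T / sqrt (real n)))))
        \<longlongrightarrow> Complex (exp (- u\<^sup>2 * \<gamma>2 / 2)) 0) (adm_seq \<xi>)"
      by (intro tendsto_Complex lim Xc Xs)
    then have "((\<lambda>n. Complex (cmean n (\<lambda>T. cos (u * X n T / sqrt (real n)))) (cmean n (\<lambda>T. sin (u * X n T / sqrt (real n)))))
        \<longlongrightarrow> char (normal_law 0 \<gamma>2) u) (adm_seq \<xi>)"
      by (simp only: char_normal_law[OF \<gamma>2] complex_of_real_def)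
    then show "((\<lambda>n. char (distr (cond_GW \<xi> n) borel (\<lambda>T. (additive_functional f T - real n * \<mu>) / sqrt (real n))) u)
        \<longlongrightarrow> char (normal_law 0 \<gamma>2) u) (inf sequentially (principal (admissible \<xi>)))"
      unfolding adm_seq_def[symmetric]
    proof (rule Lim_transform_eventually)
      show "\<forall>\<^sub>F n in adm_seq \<xi>. Complex (cmean n (\<lambda>T. cos (u * X n T / sqrt (real n)))) (cmean n (\<lambda>T. sin (u * X n T / sqrt (real n))))
          = char (distr (cond_GW \<xi> n) borel (\<lambda>T. (additive_functional f T - real n * \<mu>) / sqrt (real n))) u"
        using ev
      proof eventually_elim
        case (elim n)
        let ?h = "\<lambda>T. (additive_functional f T - real n * \<mu>) / sqrt (real n)"
        let ?w = "\<lambda>T. wt T / mass n"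
        have "char (distr (cond_GW \<xi> n) borel ?h) u = (\<integral>T. cis (u * ?h T) \<partial>cond_GW \<xi> n)"
          unfolding char_def by (subst integral_distr[OF m]) (simp_all add: cis_conv_exp)
        also have "\<dots> = (\<Sum>T\<in>trees n. ?w T *\<^sub>R cis (u * ?h T))" using elim by (intro integral_cond_GW) simp
        also have "\<dots> = (\<Sum>T\<in>trees n. ?w T *\<^sub>R cis (u * X n T / sqrt (real n)))"
          by (intro sum.cong refl) (use X in \<open>auto simp: trees_def\<close>)
        also have "\<dots> = Complex (\<Sum>T\<in>trees n. ?w T * cos (u * X n T / sqrt (real n))) (\<Sum>T\<in>trees n. ?w T * sin (u * X n T / sqrt (real n)))"
          by (rule complex_eqI) simp_all
        finally show ?case by (simp only: cmean_eq)
      qed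
    qed
  qed
qed

text \<open>Subtracting L turns the rate of \<open>local_functional_rate\<close> into the decay that
  \<open>weakly_local_limits\<close> requires. The additive functional and n \<mu> change by the
  same amount L n, so their difference is unaffected.\<close>

lemma local_functional_limits:
  assumes M: "\<And>T. f T = f (truncate M T)" and B: "\<And>T. \<bar>f T\<bar> \<le> B" and \<mu>: "treesum f sums \<mu>"
  obtains X \<gamma>2 where "0 \<le> \<gamma>2" "\<And>T. X (tree_order T) T = additive_functional f T - real (tree_order T) * \<mu>"
    "((\<lambda>n. cmean n (\<lambda>T. (X n T)\<^sup>2) / real n) \<longlongrightarrow> \<gamma>2) gseq"
    "((\<lambda>n. cmean n (X n) / sqrt (real n)) \<longlongrightarrow> 0) gseq"
    "\<And>u. ((\<lambda>n. cmean n (\<lambda>T. cos (u * X n T / sqrt (real n)))) \<longlongrightarrow> exp (- u\<^sup>2 * \<gamma>2 / 2)) gseq"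
    "\<And>u. ((\<lambda>n. cmean n (\<lambda>T. sin (u * X n T / sqrt (real n)))) \<longlongrightarrow> 0) gseq"
proof -
  obtain L C where LC: "\<And>n. real n * \<bar>treesum f n - L * mass n\<bar> \<le> C / (real n + 1)"
    using local_functional_rate[of f M B, OF M B] by blast
  define h where "h T = f T - L * 1" for T
  have th: "treesum h n = treesum f n - L * mass n" for n
    unfolding h_def[abs_def] treesum_diff treesum_cmult ..
  have C: "0 \<le> C" using LC[of 0] by simp
  have hle: "w3 n * \<bar>treesum h n\<bar> \<le> 2 * C / sqrt (real n + 1)" for n
  proof (cases n)
    case 0
    then show ?thesis using C by simp
  next
    case (Suc m)
    have "(real n + 1) * \<bar>treesum h n\<bar> \<le> 2 * (real n * \<bar>treesum h n\<bar>)"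
      unfolding mult.assoc[symmetric] using Suc by (intro mult_right_mono) auto
    also have "\<dots> \<le> 2 * (C / (real n + 1))" using LC[of n] by (simp add: th)
    finally have "sqrt (real n + 1) * ((real n + 1) * \<bar>treesum h n\<bar>) \<le> sqrt (real n + 1) * (2 * (C / (real n + 1)))"
      by (rule mult_left_mono) simp
    also have "\<dots> = 2 * C / sqrt (real n + 1)"
    proof -
      have "s * (2 * (C / (s * s))) = 2 * C / s" if "0 < s" for s using that by simp
      from this[of "sqrt (real n + 1)"] show ?thesis by simp
    qed
    finally show ?thesis by (simp add: w3_def mult_ac)
  qed
  have sup: "(\<lambda>n. w3 n * \<bar>treesum h n\<bar>) \<longlonglongrightarrow> 0"
  proof (rule Lim_null_comparison[OF always_eventually])
    show "(\<lambda>n. 2 * C * (1 / sqrt (real n + 1))) \<longlonglongrightarrow> 0" by (rule tendsto_mult_right_zero) real_asymp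
    show "\<forall>n. norm (w3 n * \<bar>treesum h n\<bar>) \<le> 2 * C * (1 / sqrt (real n + 1))"
      using hle w3_pos by (simp add: abs_mult less_imp_le)
  qed
  have sm: "summable (\<lambda>n. sqrt (real n + 1) * \<bar>treesum h n\<bar>)"
  proof (rule summable_comparison_test'[OF summable_mult[OF summable_inverse_w3, of "2 * C"], of 0])
    fix n
    have "w3 n * \<bar>treesum h n\<bar> / (real n + 1) \<le> 2 * C / sqrt (real n + 1) / (real n + 1)"
      using hle by (rule divide_right_mono) simp
    then show "norm (sqrt (real n + 1) * \<bar>treesum h n\<bar>) \<le> 2 * C * (1 / w3 n)"
      by (simp add: w3_def mult.commute)
  qed
  have hB: "\<bar>h T\<bar> \<le> B + \<bar>L\<bar>" for T using B[of T] by (simp add: h_def)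
  have wl: "weakly_local_at M h" unfolding weakly_local_at_def
  proof (intro allI impI)
    fix T T' assume "tree_order T = tree_order T' \<and> truncate M T = truncate M T'"
    then have "f T = f T'" using M[of T] M[of T'] by simp
    then show "h T = h T'" by (simp add: h_def)
  qed
  have h\<mu>: "treesum h sums (\<mu> - L)"
    using sums_diff[OF \<mu> sums_mult[OF TT_sums_1, of L]] by (simp add: th[abs_def])
  have X: "additive_functional h T - real (tree_order T) * (\<mu> - L) = additive_functional f T - real (tree_order T) * \<mu>" for T
  proof -
    have "additive_functional h T = additive_functional f T - L * real (tree_order T)"
      by (simp add: h_def additive_functional_def sum_subtractf tree_order_def)
    then show ?thesis by (simp add: algebra_simps)
  qed
  define Y where "Y n T = additive_functional h T - real n * (\<mu> - L)" for n T
  have Y: "Y (tree_order T) T = additive_functional f T - real (tree_order T) * \<mu>" for T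
    unfolding Y_def by (rule X)
  show thesis
    by (rule weakly_local_limits[OF hB wl sm sup h\<mu>, folded Y_def]) (rule that[of _ Y, OF _ Y])
qed

text \<open>As \<open>mass n\<close> is at most of order n^(-3/2), the decay of the conditional
  means and the summability of their quotients by n become the two weighted conditions on
  \<open>treesum f\<close>.\<close>

lemma weakly_local_mean_bounds:
  assumes zero: "((\<lambda>n. prob_space.expectation (cond_GW \<xi> n) f) \<longlongrightarrow> 0) (adm_seq \<xi>)"
    and sm: "(\<lambda>n. \<bar>prob_space.expectation (cond_GW \<xi> n) f\<bar> / real n) summable_on admissible \<xi>"
  shows "summable (\<lambda>n. sqrt (real n + 1) * \<bar>treesum f n\<bar>)" "(\<lambda>n. w3 n * \<bar>treesum f n\<bar>) \<longlonglongrightarrow> 0"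
proof -
  define a where "a n = (if n \<in> admissible \<xi> then \<bar>prob_space.expectation (cond_GW \<xi> n) f\<bar> else 0)" for n
  obtain C where C: "controlled w3 TT C" using TT_controlled ..
  have le: "w3 n * \<bar>treesum f n\<bar> \<le> C * a n" for n
  proof (cases "n \<in> admissible \<xi>")
    case True
    then have "\<bar>treesum f n\<bar> = a n * mass n"
      by (simp add: a_def expectation_cond_GW admissible_iff abs_divide)
    then have "w3 n * \<bar>treesum f n\<bar> = (w3 n * mass n) * a n" by simp
    also have "\<dots> \<le> C * a n"
      using C treesum_one_nonneg[of n] by (intro mult_right_mono) (auto simp: controlled_def a_def)
    finally show ?thesis .
  next
    case False
    then have "mass n = 0" using treesum_one_nonneg[of n] by (simp add: admissible_iff)
    then show ?thesis using False treesum_eq_0 by (simp add: a_def)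
  qed
  have a0: "0 \<le> a n" for n by (simp add: a_def)
  have al: "a \<longlonglongrightarrow> 0"
  proof (rule tendstoI)
    fix e :: real assume "0 < e"
    from tendstoD[OF zero this] show "\<forall>\<^sub>F n in sequentially. dist (a n) 0 < e"
      unfolding adm_seq_def eventually_inf_principal by eventually_elim (use \<open>0 < e\<close> in \<open>simp add: a_def\<close>)
  qed
  show "(\<lambda>n. w3 n * \<bar>treesum f n\<bar>) \<longlonglongrightarrow> 0"
  proof (rule Lim_null_comparison[OF always_eventually])
    show "(\<lambda>n. C * a n) \<longlonglongrightarrow> 0" by (rule tendsto_mult_right_zero[OF al])
    show "\<forall>n. norm (w3 n * \<bar>treesum f n\<bar>) \<le> C * a n"
      using le w3_pos by (simp add: abs_mult less_imp_le)
  qed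
  have "(\<lambda>n. \<bar>prob_space.expectation (cond_GW \<xi> n) f\<bar> / real n) summable_on admissible \<xi> \<longleftrightarrow> (\<lambda>n. a n / real n) summable_on UNIV"
    by (rule summable_on_cong_neutral) (auto simp: a_def)
  with sm have "(\<lambda>n. a n / real n) summable_on UNIV" by blast
  then have "summable (\<lambda>n. a n / real n)" by (subst (asm) summable_on_UNIV_nonneg_real_iff) (auto simp: a0)
  then have "summable (\<lambda>n. C * (a n / real n))" by (rule summable_mult)
  then show "summable (\<lambda>n. sqrt (real n + 1) * \<bar>treesum f n\<bar>)"
  proof (rule summable_comparison_test'[of _ 1])
    fix n :: nat assume n: "1 \<le> n"
    have Ca: "0 \<le> C * a n" using le[of n] w3_pos[of n] by (meson abs_ge_zero less_imp_le mult_nonneg_nonneg order_trans)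
    have "w3 n * \<bar>treesum f n\<bar> / (real n + 1) \<le> C * a n / real n"
      using le[of n] n Ca by (intro frac_le) auto
    then show "norm (sqrt (real n + 1) * \<bar>treesum f n\<bar>) \<le> C * (a n / real n)"
      by (simp add: w3_def)
  qed
qed

end

theorem theorem1p13:
  fixes \<xi> :: "nat pmf" and f :: "ptree \<Rightarrow> real" and \<mu> :: real
  assumes mean: "integrable (measure_pmf \<xi>) real" "measure_pmf.expectation \<xi> real = 1"
    and var_finite: "integrable (measure_pmf \<xi>) (\<lambda>k. (real k)\<^sup>2)"
    and var_pos: "0 < measure_pmf.variance \<xi> real"
    and f_bounded: "bounded (range f)"
    and f_local: "local_functional f \<or>
          (weakly_local_functional f \<and>
           ((\<lambda>n. prob_space.expectation (cond_GW \<xi> n) f) \<longlongrightarrow> 0) (adm_seq \<xi>) \<and>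
           (\<lambda>n. \<bar>prob_space.expectation (cond_GW \<xi> n) f\<bar> / real n) summable_on admissible \<xi>)"
    and \<mu>: "\<mu> = prob_space.expectation (GW \<xi>) f"
  shows "\<exists>\<gamma>2::real. \<gamma>2 \<ge> 0 \<and>
    (\<lambda>n. prob_space.expectation (cond_GW \<xi> n) (additive_functional f) - real n * \<mu>)
      \<in> o[adm_seq \<xi>](\<lambda>n. sqrt (real n)) \<and>
    (\<lambda>n. prob_space.variance (cond_GW \<xi> n) (additive_functional f) - real n * \<gamma>2)
      \<in> o[adm_seq \<xi>](\<lambda>n. real n) \<and>
    weak_conv_m_along (adm_seq \<xi>)
      (\<lambda>n. distr (cond_GW \<xi> n) borel (\<lambda>T. (additive_functional f T - real n * \<mu>) / sqrt (real n)))
      (normal_law 0 \<gamma>2)"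
proof -
  interpret critical_offspring \<xi>
    using mean var_finite var_pos by unfold_locales
  obtain B where B: "\<And>T. \<bar>f T\<bar> \<le> B" using f_bounded by (auto simp: bounded_iff)
  have \<mu>': "treesum f sums \<mu>" unfolding \<mu> by (rule expectation_GW[OF f_bounded])
  from f_local show ?thesis
  proof
    assume "local_functional f"
    then obtain M where M: "\<And>T. f T = f (truncate M T)" unfolding local_functional_def by blast
    show ?thesis
    proof (rule local_functional_limits[OF M B \<mu>'])
      fix X \<gamma>2
      assume *: "0 \<le> \<gamma>2" "\<And>T. X (tree_order T) T = additive_functional f T - real (tree_order T) * \<mu>"
        "((\<lambda>n. cmean n (\<lambda>T. (X n T)\<^sup>2) / real n) \<longlongrightarrow> \<gamma>2) gseq"
        "((\<lambda>n. cmean n (X n) / sqrt (real n)) \<longlongrightarrow> 0) gseq"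
        "\<And>u. ((\<lambda>n. cmean n (\<lambda>T. cos (u * X n T / sqrt (real n)))) \<longlongrightarrow> exp (- u\<^sup>2 * \<gamma>2 / 2)) gseq"
        "\<And>u. ((\<lambda>n. cmean n (\<lambda>T. sin (u * X n T / sqrt (real n)))) \<longlongrightarrow> 0) gseq"
      from *(1) limit_laws[OF *] show ?thesis by blast
    qed
  next
    assume w: "weakly_local_functional f \<and>
      ((\<lambda>n. prob_space.expectation (cond_GW \<xi> n) f) \<longlongrightarrow> 0) (adm_seq \<xi>) \<and>
      (\<lambda>n. \<bar>prob_space.expectation (cond_GW \<xi> n) f\<bar> / real n) summable_on admissible \<xi>"
    then obtain M where M: "weakly_local_at M f"
      unfolding weakly_local_functional_def weakly_local_at_def by blast
    note lim = weakly_local_mean_bounds[OF conjunct1[OF conjunct2[OF w]] conjunct2[OF conjunct2[OF w]]]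
    show ?thesis
    proof (rule weakly_local_limits[OF B M lim \<mu>'])
      fix \<gamma>2
      let ?X = "\<lambda>n T. additive_functional f T - real n * \<mu>"
      assume *: "0 \<le> \<gamma>2" "((\<lambda>n. cmean n (\<lambda>T. (?X n T)\<^sup>2) / real n) \<longlongrightarrow> \<gamma>2) gseq"
        "((\<lambda>n. cmean n (?X n) / sqrt (real n)) \<longlongrightarrow> 0) gseq"
        "\<And>u. ((\<lambda>n. cmean n (\<lambda>T. cos (u * ?X n T / sqrt (real n)))) \<longlongrightarrow> exp (- u\<^sup>2 * \<gamma>2 / 2)) gseq"
        "\<And>u. ((\<lambda>n. cmean n (\<lambda>T. sin (u * ?X n T / sqrt (real n)))) \<longlongrightarrow> 0) gseq"
      from *(1) limit_laws[of \<gamma>2 ?X f \<mu>, OF *(1) refl *(2-5)] show ?thesis by blast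
    qed
  qed
qed

end
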